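(* Let $\mathcal{E}$ be a category with pullbacks and finite products. The category $\mathcal{E}$ is extensive if and only if the $2$-category $\mathbf{Cat}(\mathcal{E})$ is extensive, in which case the coproducts in $\mathbf{Cat}(\mathcal{E})$ are computed in the functor category $[\Delta_{\leq 3}^{\mathrm{op}},\mathcal{E}]$.
   Context: $\mathbf{Cat}(\mathcal{E})$ is the $2$-category of categories, functors and natural transformations internal to $\mathcal{E}$. $\Delta_{\leq 3}$ is the full subcategory of the simplex category on $[0],[1],[2],[3]$; the underlying category of $\mathbf{Cat}(\mathcal{E})$ is regarded as a full subcategory of $[\Delta_{\leq 3}^{\mathrm{op}},\mathcal{E}]$ via the truncated nerve (sending $\mathbb{A}$ to its objects of objects $A_0$, arrows $A_1$, composable pairs $A_2$ and composable triples $A_3$). A category with pullbacks is extensive if it has finite coproducts and for all $A,B$ the functor $\mathcal{E}/A\times\mathcal{E}/B\to\mathcal{E}/(A+B)$ taking coproducts is an equivalence of categories. A $2$-category with pullbacks $\mathcal{K}$ is extensive if it has finite ($\mathbf{Cat}$-enriched) coproducts and the similarly defined $2$-functor $\mathcal{K}/A\times\mathcal{K}/B\to\mathcal{K}/(A+B)$ between strict slice $2$-categories is a $2$-equivalence (equivalence of $\mathbf{Cat}$-enriched categories) for all $A,B$. *)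

theory Defs
  imports Main "HOL-Library.FuncSet"
begin

section \<open>Categories, functors, equivalences\<close>

text \<open>\<open>g \<cdot> f\<close> is the composite ``first \<open>f\<close>, then \<open>g\<close>''; it is only meaningful when the
  codomain of \<open>f\<close> is the domain of \<open>g\<close>.\<close>

record ('o, 'm) cat =
  Obj :: "'o set"
  Arr :: "'m set"
  Dom :: "'m \<Rightarrow> 'o"
  Cod :: "'m \<Rightarrow> 'o"
  Idn :: "'o \<Rightarrow> 'm"
  Cmp :: "'m \<Rightarrow> 'm \<Rightarrow> 'm" (infixr "\<cdot>\<index>" 70)

definition hom :: "('o, 'm, 'z) cat_scheme \<Rightarrow> 'o \<Rightarrow> 'o \<Rightarrow> 'm set" where
  "hom C a b = {f \<in> Arr C. Dom C f = a \<and> Cod C f = b}"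

locale category =
  fixes C :: "('o, 'm, 'z) cat_scheme" (structure)
  assumes Dom_in: "f \<in> Arr C \<Longrightarrow> Dom C f \<in> Obj C"
    and Cod_in: "f \<in> Arr C \<Longrightarrow> Cod C f \<in> Obj C"
    and Idn_in: "a \<in> Obj C \<Longrightarrow> Idn C a \<in> hom C a a"
    and Cmp_in: "f \<in> hom C a b \<Longrightarrow> g \<in> hom C b c \<Longrightarrow> g \<cdot> f \<in> hom C a c"
    and Cmp_Idn: "f \<in> hom C a b \<Longrightarrow> f \<cdot> Idn C a = f"
    and Idn_Cmp: "f \<in> hom C a b \<Longrightarrow> Idn C b \<cdot> f = f"
    and Cmp_assoc: "f \<in> hom C a b \<Longrightarrow> g \<in> hom C b c \<Longrightarrow> h \<in> hom C c d \<Longrightarrow>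
                      (h \<cdot> g) \<cdot> f = h \<cdot> (g \<cdot> f)"

definition is_iso :: "('o, 'm, 'z) cat_scheme \<Rightarrow> 'm \<Rightarrow> bool" where
  "is_iso C f \<longleftrightarrow> f \<in> Arr C \<and>
     (\<exists>g \<in> hom C (Cod C f) (Dom C f).
        g \<cdot>\<^bsub>C\<^esub> f = Idn C (Dom C f) \<and> f \<cdot>\<^bsub>C\<^esub> g = Idn C (Cod C f))"

definition opp :: "('o, 'm, 'z) cat_scheme \<Rightarrow> ('o, 'm) cat" where
  "opp C = \<lparr>Obj = Obj C, Arr = Arr C, Dom = Cod C, Cod = Dom C, Idn = Idn C,
            Cmp = (\<lambda>g f. f \<cdot>\<^bsub>C\<^esub> g)\<rparr>"

definition prod_cat :: "('o, 'm, 'z) cat_scheme \<Rightarrow> ('p, 'n, 'y) cat_scheme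
    \<Rightarrow> ('o \<times> 'p, 'm \<times> 'n) cat" where
  "prod_cat C D =
     \<lparr>Obj = Obj C \<times> Obj D, Arr = Arr C \<times> Arr D,
      Dom = (\<lambda>(f, g). (Dom C f, Dom D g)), Cod = (\<lambda>(f, g). (Cod C f, Cod D g)),
      Idn = (\<lambda>(a, b). (Idn C a, Idn D b)),
      Cmp = (\<lambda>(f', g') (f, g). (f' \<cdot>\<^bsub>C\<^esub> f, g' \<cdot>\<^bsub>D\<^esub> g))\<rparr>"

text \<open>An arrow \<open>(f, g, h)\<close> of the slice is the commuting triangle \<open>h : f \<rightarrow> g\<close>.\<close>

definition slice :: "('o, 'm, 'z) cat_scheme \<Rightarrow> 'o \<Rightarrow> ('m, 'm \<times> 'm \<times> 'm) cat" where
  "slice C A =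
     \<lparr>Obj = {f \<in> Arr C. Cod C f = A},
      Arr = {(f, g, h). f \<in> Arr C \<and> Cod C f = A \<and> g \<in> Arr C \<and> Cod C g = A \<and>
                        h \<in> hom C (Dom C f) (Dom C g) \<and> g \<cdot>\<^bsub>C\<^esub> h = f},
      Dom = (\<lambda>(f, g, h). f), Cod = (\<lambda>(f, g, h). g),
      Idn = (\<lambda>f. (f, f, Idn C (Dom C f))),
      Cmp = (\<lambda>(_, g', h') (f, _, h). (f, g', h' \<cdot>\<^bsub>C\<^esub> h))\<rparr>"

record ('o, 'm, 'p, 'n) func =
  OMap :: "'o \<Rightarrow> 'p"
  AMap :: "'m \<Rightarrow> 'n"

definition is_functor :: "('o, 'm, 'z) cat_scheme \<Rightarrow> ('p, 'n, 'y) cat_scheme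
    \<Rightarrow> ('o, 'm, 'p, 'n, 'x) func_scheme \<Rightarrow> bool" where
  "is_functor C D F \<longleftrightarrow>
     (\<forall>a \<in> Obj C. OMap F a \<in> Obj D) \<and>
     (\<forall>f \<in> Arr C. AMap F f \<in> hom D (OMap F (Dom C f)) (OMap F (Cod C f))) \<and>
     (\<forall>a \<in> Obj C. AMap F (Idn C a) = Idn D (OMap F a)) \<and>
     (\<forall>f \<in> Arr C. \<forall>g \<in> Arr C. Cod C f = Dom C g \<longrightarrow>
        AMap F (g \<cdot>\<^bsub>C\<^esub> f) = AMap F g \<cdot>\<^bsub>D\<^esub> AMap F f)"

definition id_func :: "('o, 'm, 'o, 'm) func" where
  "id_func = \<lparr>OMap = (\<lambda>a. a), AMap = (\<lambda>f. f)\<rparr>"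

definition comp_func :: "('p, 'n, 'q, 'l, 'x) func_scheme \<Rightarrow> ('o, 'm, 'p, 'n, 'y) func_scheme
    \<Rightarrow> ('o, 'm, 'q, 'l) func" where
  "comp_func G F = \<lparr>OMap = (\<lambda>a. OMap G (OMap F a)), AMap = (\<lambda>f. AMap G (AMap F f))\<rparr>"

definition is_nat :: "('o, 'm, 'z) cat_scheme \<Rightarrow> ('p, 'n, 'y) cat_scheme
    \<Rightarrow> ('o, 'm, 'p, 'n, 'x) func_scheme \<Rightarrow> ('o, 'm, 'p, 'n, 'w) func_scheme
    \<Rightarrow> ('o \<Rightarrow> 'n) \<Rightarrow> bool" where
  "is_nat C D F G \<tau> \<longleftrightarrow>
     (\<forall>a \<in> Obj C. \<tau> a \<in> hom D (OMap F a) (OMap G a)) \<and>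
     (\<forall>f \<in> Arr C. AMap G f \<cdot>\<^bsub>D\<^esub> \<tau> (Dom C f) = \<tau> (Cod C f) \<cdot>\<^bsub>D\<^esub> AMap F f)"

definition is_nat_iso :: "('o, 'm, 'z) cat_scheme \<Rightarrow> ('p, 'n, 'y) cat_scheme
    \<Rightarrow> ('o, 'm, 'p, 'n, 'x) func_scheme \<Rightarrow> ('o, 'm, 'p, 'n, 'w) func_scheme
    \<Rightarrow> ('o \<Rightarrow> 'n) \<Rightarrow> bool" where
  "is_nat_iso C D F G \<tau> \<longleftrightarrow> is_nat C D F G \<tau> \<and> (\<forall>a \<in> Obj C. is_iso D (\<tau> a))"

definition is_equivalence :: "('o, 'm, 'z) cat_scheme \<Rightarrow> ('p, 'n, 'y) cat_scheme
    \<Rightarrow> ('o, 'm, 'p, 'n) func \<Rightarrow> bool" where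
  "is_equivalence C D F \<longleftrightarrow> is_functor C D F \<and>
     (\<exists>G :: ('p, 'n, 'o, 'm) func. is_functor D C G \<and>
        (\<exists>\<eta>. is_nat_iso C C id_func (comp_func G F) \<eta>) \<and>
        (\<exists>\<epsilon>. is_nat_iso D D (comp_func F G) id_func \<epsilon>))"

text \<open>Functors that are objects of a functor category, and the components of its arrows, are
  \<open>undefined\<close> outside the source category, so that equality is extensional.
  An arrow is a triple (source, target, components).\<close>

definition fun_cat :: "('o, 'm, 'z) cat_scheme \<Rightarrow> ('p, 'n, 'y) cat_scheme
    \<Rightarrow> (('o, 'm, 'p, 'n) func,
        ('o, 'm, 'p, 'n) func \<times> ('o, 'm, 'p, 'n) func \<times> ('o \<Rightarrow> 'n)) cat" where
  "fun_cat C D =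
     (let Fs = {F. is_functor C D F \<and> OMap F \<in> extensional (Obj C) \<and> AMap F \<in> extensional (Arr C)}
      in \<lparr>Obj = Fs,
          Arr = {(F, G, \<tau>). F \<in> Fs \<and> G \<in> Fs \<and> is_nat C D F G \<tau> \<and> \<tau> \<in> extensional (Obj C)},
          Dom = (\<lambda>(F, G, \<tau>). F), Cod = (\<lambda>(F, G, \<tau>). G),
          Idn = (\<lambda>F. (F, F, \<lambda>a \<in> Obj C. Idn D (OMap F a))),
          Cmp = (\<lambda>(_, H, \<sigma>) (F, _, \<tau>). (F, H, \<lambda>a \<in> Obj C. \<sigma> a \<cdot>\<^bsub>D\<^esub> \<tau> a))\<rparr>)"


section \<open>Limits, coproducts, extensive categories\<close>

definition is_pullback :: "('o, 'm, 'z) cat_scheme \<Rightarrow> 'm \<Rightarrow> 'm \<Rightarrow> 'o \<Rightarrow> 'm \<Rightarrow> 'm \<Rightarrow> bool" where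
  "is_pullback C f g P p q \<longleftrightarrow>
     f \<in> Arr C \<and> g \<in> Arr C \<and> Cod C f = Cod C g \<and>
     p \<in> hom C P (Dom C f) \<and> q \<in> hom C P (Dom C g) \<and> f \<cdot>\<^bsub>C\<^esub> p = g \<cdot>\<^bsub>C\<^esub> q \<and>
     (\<forall>X \<in> Obj C. \<forall>h \<in> hom C X (Dom C f). \<forall>k \<in> hom C X (Dom C g).
        f \<cdot>\<^bsub>C\<^esub> h = g \<cdot>\<^bsub>C\<^esub> k \<longrightarrow>
        (\<exists>!u. u \<in> hom C X P \<and> p \<cdot>\<^bsub>C\<^esub> u = h \<and> q \<cdot>\<^bsub>C\<^esub> u = k))"

definition has_pullbacks :: "('o, 'm, 'z) cat_scheme \<Rightarrow> bool" where
  "has_pullbacks C \<longleftrightarrow>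
     (\<forall>f \<in> Arr C. \<forall>g \<in> Arr C. Cod C f = Cod C g \<longrightarrow> (\<exists>P p q. is_pullback C f g P p q))"

definition is_terminal :: "('o, 'm, 'z) cat_scheme \<Rightarrow> 'o \<Rightarrow> bool" where
  "is_terminal C T \<longleftrightarrow> T \<in> Obj C \<and> (\<forall>X \<in> Obj C. \<exists>!u. u \<in> hom C X T)"

definition is_product :: "('o, 'm, 'z) cat_scheme \<Rightarrow> 'o \<Rightarrow> 'o \<Rightarrow> 'o \<Rightarrow> 'm \<Rightarrow> 'm \<Rightarrow> bool" where
  "is_product C A B P p q \<longleftrightarrow>
     A \<in> Obj C \<and> B \<in> Obj C \<and> P \<in> Obj C \<and> p \<in> hom C P A \<and> q \<in> hom C P B \<and>
     (\<forall>X \<in> Obj C. \<forall>h \<in> hom C X A. \<forall>k \<in> hom C X B.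
        \<exists>!u. u \<in> hom C X P \<and> p \<cdot>\<^bsub>C\<^esub> u = h \<and> q \<cdot>\<^bsub>C\<^esub> u = k)"

definition has_finite_products :: "('o, 'm, 'z) cat_scheme \<Rightarrow> bool" where
  "has_finite_products C \<longleftrightarrow>
     (\<exists>T. is_terminal C T) \<and>
     (\<forall>A \<in> Obj C. \<forall>B \<in> Obj C. \<exists>P p q. is_product C A B P p q)"

definition is_initial :: "('o, 'm, 'z) cat_scheme \<Rightarrow> 'o \<Rightarrow> bool" where
  "is_initial C Z \<longleftrightarrow> Z \<in> Obj C \<and> (\<forall>X \<in> Obj C. \<exists>!u. u \<in> hom C Z X)"

definition is_coproduct :: "('o, 'm, 'z) cat_scheme \<Rightarrow> 'o \<Rightarrow> 'o \<Rightarrow> 'o \<Rightarrow> 'm \<Rightarrow> 'm \<Rightarrow> bool" where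
  "is_coproduct C A B Q i j \<longleftrightarrow>
     A \<in> Obj C \<and> B \<in> Obj C \<and> Q \<in> Obj C \<and> i \<in> hom C A Q \<and> j \<in> hom C B Q \<and>
     (\<forall>X \<in> Obj C. \<forall>h \<in> hom C A X. \<forall>k \<in> hom C B X.
        \<exists>!u. u \<in> hom C Q X \<and> u \<cdot>\<^bsub>C\<^esub> i = h \<and> u \<cdot>\<^bsub>C\<^esub> j = k)"

definition has_finite_coproducts :: "('o, 'm, 'z) cat_scheme \<Rightarrow> bool" where
  "has_finite_coproducts C \<longleftrightarrow>
     (\<exists>Z. is_initial C Z) \<and>
     (\<forall>A \<in> Obj C. \<forall>B \<in> Obj C. \<exists>Q i j. is_coproduct C A B Q i j)"

text \<open>A choice \<open>S\<close> of binary coproducts assigns to \<open>A\<close>, \<open>B\<close> the triple of the coproduct object and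
  its two injections. \<open>sum_arr C S f g\<close> is \<open>f + g\<close> with respect to \<open>S\<close>.\<close>

type_synonym ('o, 'm) coprods = "'o \<Rightarrow> 'o \<Rightarrow> 'o \<times> 'm \<times> 'm"

abbreviation cp_obj :: "('o, 'm) coprods \<Rightarrow> 'o \<Rightarrow> 'o \<Rightarrow> 'o" where
  "cp_obj S A B \<equiv> fst (S A B)"

abbreviation cp_inl :: "('o, 'm) coprods \<Rightarrow> 'o \<Rightarrow> 'o \<Rightarrow> 'm" where
  "cp_inl S A B \<equiv> fst (snd (S A B))"

abbreviation cp_inr :: "('o, 'm) coprods \<Rightarrow> 'o \<Rightarrow> 'o \<Rightarrow> 'm" where
  "cp_inr S A B \<equiv> snd (snd (S A B))"

definition the_coprods :: "('o, 'm, 'z) cat_scheme \<Rightarrow> ('o, 'm) coprods" where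
  "the_coprods C A B = (SOME (Q, i, j). is_coproduct C A B Q i j)"

definition sum_arr :: "('o, 'm, 'z) cat_scheme \<Rightarrow> ('o, 'm) coprods \<Rightarrow> 'm \<Rightarrow> 'm \<Rightarrow> 'm" where
  "sum_arr C S f g =
     (THE u. u \<in> hom C (cp_obj S (Dom C f) (Dom C g)) (cp_obj S (Cod C f) (Cod C g)) \<and>
        u \<cdot>\<^bsub>C\<^esub> cp_inl S (Dom C f) (Dom C g) = cp_inl S (Cod C f) (Cod C g) \<cdot>\<^bsub>C\<^esub> f \<and>
        u \<cdot>\<^bsub>C\<^esub> cp_inr S (Dom C f) (Dom C g) = cp_inr S (Cod C f) (Cod C g) \<cdot>\<^bsub>C\<^esub> g)"

definition coprod_func :: "('o, 'm, 'z) cat_scheme \<Rightarrow> ('o, 'm) coprods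
    \<Rightarrow> ('m \<times> 'm, ('m \<times> 'm \<times> 'm) \<times> ('m \<times> 'm \<times> 'm), 'm, 'm \<times> 'm \<times> 'm) func" where
  "coprod_func C S =
     \<lparr>OMap = (\<lambda>(f, g). sum_arr C S f g),
      AMap = (\<lambda>((f, f', h), (g, g', k)). (sum_arr C S f g, sum_arr C S f' g', sum_arr C S h k))\<rparr>"

definition extensive :: "('o, 'm, 'z) cat_scheme \<Rightarrow> bool" where
  "extensive C \<longleftrightarrow>
     category C \<and> has_pullbacks C \<and> has_finite_coproducts C \<and>
     (\<forall>A \<in> Obj C. \<forall>B \<in> Obj C.
        is_equivalence (prod_cat (slice C A) (slice C B))
          (slice C (cp_obj (the_coprods C) A B)) (coprod_func C (the_coprods C)))"


section \<open>2-categories, 2-functors, 2-equivalences\<close>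

text \<open>A 2-category extends its underlying category by 2-cells: \<open>Vc \<beta> \<alpha>\<close> is the vertical composite
  ``first \<open>\<alpha>\<close>, then \<open>\<beta>\<close>'', and \<open>Hc \<beta> \<alpha>\<close> is the horizontal composite of \<open>\<alpha> : f \<Rightarrow> f' : A \<rightarrow> B\<close> with
  \<open>\<beta> : g \<Rightarrow> g' : B \<rightarrow> C\<close>.\<close>

record ('o, 'm, 'c) two_cat = "('o, 'm) cat" +
  Cell :: "'c set"
  Src :: "'c \<Rightarrow> 'm"
  Trg :: "'c \<Rightarrow> 'm"
  Idc :: "'m \<Rightarrow> 'c"
  Vc :: "'c \<Rightarrow> 'c \<Rightarrow> 'c"
  Hc :: "'c \<Rightarrow> 'c \<Rightarrow> 'c"

definition cells :: "('o, 'm, 'c, 'z) two_cat_scheme \<Rightarrow> 'm \<Rightarrow> 'm \<Rightarrow> 'c set" where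
  "cells K f g = {\<theta> \<in> Cell K. Src K \<theta> = f \<and> Trg K \<theta> = g}"

locale two_category = category K
  for K :: "('o, 'm, 'c, 'z) two_cat_scheme" (structure) +
  assumes Src_in: "\<theta> \<in> Cell K \<Longrightarrow> Src K \<theta> \<in> Arr K"
    and Trg_in: "\<theta> \<in> Cell K \<Longrightarrow> Trg K \<theta> \<in> Arr K"
    and Dom_Src_Trg: "\<theta> \<in> Cell K \<Longrightarrow> Dom K (Src K \<theta>) = Dom K (Trg K \<theta>)"
    and Cod_Src_Trg: "\<theta> \<in> Cell K \<Longrightarrow> Cod K (Src K \<theta>) = Cod K (Trg K \<theta>)"
    and Idc_in: "f \<in> Arr K \<Longrightarrow> Idc K f \<in> cells K f f"
    and Vc_in: "\<alpha> \<in> cells K f g \<Longrightarrow> \<beta> \<in> cells K g h \<Longrightarrow> Vc K \<beta> \<alpha> \<in> cells K f h"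
    and Vc_Idc: "\<alpha> \<in> cells K f g \<Longrightarrow> Vc K \<alpha> (Idc K f) = \<alpha>"
    and Idc_Vc: "\<alpha> \<in> cells K f g \<Longrightarrow> Vc K (Idc K g) \<alpha> = \<alpha>"
    and Vc_assoc: "\<alpha> \<in> cells K f g \<Longrightarrow> \<beta> \<in> cells K g h \<Longrightarrow> \<gamma> \<in> cells K h k \<Longrightarrow>
                     Vc K (Vc K \<gamma> \<beta>) \<alpha> = Vc K \<gamma> (Vc K \<beta> \<alpha>)"
    and Hc_in: "\<alpha> \<in> cells K f f' \<Longrightarrow> \<beta> \<in> cells K g g' \<Longrightarrow> Cod K f = Dom K g \<Longrightarrow>
                  Hc K \<beta> \<alpha> \<in> cells K (g \<cdot> f) (g' \<cdot> f')"
    and Hc_Idc_Idn: "\<alpha> \<in> cells K f f' \<Longrightarrow> Hc K \<alpha> (Idc K (Idn K (Dom K f))) = \<alpha>"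
    and Idc_Idn_Hc: "\<alpha> \<in> cells K f f' \<Longrightarrow> Hc K (Idc K (Idn K (Cod K f))) \<alpha> = \<alpha>"
    and Hc_assoc: "\<alpha> \<in> cells K f f' \<Longrightarrow> \<beta> \<in> cells K g g' \<Longrightarrow> \<gamma> \<in> cells K h h' \<Longrightarrow>
                     Cod K f = Dom K g \<Longrightarrow> Cod K g = Dom K h \<Longrightarrow>
                     Hc K (Hc K \<gamma> \<beta>) \<alpha> = Hc K \<gamma> (Hc K \<beta> \<alpha>)"
    and Hc_Idc_Idc: "f \<in> hom K a b \<Longrightarrow> g \<in> hom K b c \<Longrightarrow> Hc K (Idc K g) (Idc K f) = Idc K (g \<cdot> f)"
    and interchange: "\<alpha> \<in> cells K f f' \<Longrightarrow> \<alpha>' \<in> cells K f' f'' \<Longrightarrow>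
                      \<beta> \<in> cells K g g' \<Longrightarrow> \<beta>' \<in> cells K g' g'' \<Longrightarrow> Cod K f = Dom K g \<Longrightarrow>
                      Hc K (Vc K \<beta>' \<beta>) (Vc K \<alpha>' \<alpha>) = Vc K (Hc K \<beta>' \<alpha>') (Hc K \<beta> \<alpha>)"

definition lwhisk :: "('o, 'm, 'c, 'z) two_cat_scheme \<Rightarrow> 'm \<Rightarrow> 'c \<Rightarrow> 'c" where
  "lwhisk K g \<theta> = Hc K (Idc K g) \<theta>"

definition rwhisk :: "('o, 'm, 'c, 'z) two_cat_scheme \<Rightarrow> 'c \<Rightarrow> 'm \<Rightarrow> 'c" where
  "rwhisk K \<theta> f = Hc K \<theta> (Idc K f)"

definition prod_two_cat :: "('o, 'm, 'c, 'z) two_cat_scheme \<Rightarrow> ('p, 'n, 'd, 'y) two_cat_scheme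
    \<Rightarrow> ('o \<times> 'p, 'm \<times> 'n, 'c \<times> 'd) two_cat" where
  "prod_two_cat K L =
     \<lparr>Obj = Obj (prod_cat K L), Arr = Arr (prod_cat K L),
      Dom = Dom (prod_cat K L), Cod = Cod (prod_cat K L),
      Idn = Idn (prod_cat K L), Cmp = Cmp (prod_cat K L),
      Cell = Cell K \<times> Cell L,
      Src = (\<lambda>(\<alpha>, \<beta>). (Src K \<alpha>, Src L \<beta>)), Trg = (\<lambda>(\<alpha>, \<beta>). (Trg K \<alpha>, Trg L \<beta>)),
      Idc = (\<lambda>(f, g). (Idc K f, Idc L g)),
      Vc = (\<lambda>(\<alpha>', \<beta>') (\<alpha>, \<beta>). (Vc K \<alpha>' \<alpha>, Vc L \<beta>' \<beta>)),
      Hc = (\<lambda>(\<alpha>', \<beta>') (\<alpha>, \<beta>). (Hc K \<alpha>' \<alpha>, Hc L \<beta>' \<beta>))\<rparr>"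

text \<open>The strict slice: a 2-cell \<open>(f, g, \<theta>)\<close> between arrows \<open>h, h' : f \<rightarrow> g\<close> over \<open>A\<close> is a 2-cell
  \<open>\<theta> : h \<Rightarrow> h'\<close> whose whiskering with \<open>g\<close> is the identity of \<open>f\<close>.\<close>

definition slice_two_cat :: "('o, 'm, 'c, 'z) two_cat_scheme \<Rightarrow> 'o
    \<Rightarrow> ('m, 'm \<times> 'm \<times> 'm, 'm \<times> 'm \<times> 'c) two_cat" where
  "slice_two_cat K A =
     \<lparr>Obj = Obj (slice K A), Arr = Arr (slice K A),
      Dom = Dom (slice K A), Cod = Cod (slice K A),
      Idn = Idn (slice K A), Cmp = Cmp (slice K A),
      Cell = {(f, g, \<theta>). \<theta> \<in> Cell K \<and> (f, g, Src K \<theta>) \<in> Arr (slice K A) \<and>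
                (f, g, Trg K \<theta>) \<in> Arr (slice K A) \<and> lwhisk K g \<theta> = Idc K f},
      Src = (\<lambda>(f, g, \<theta>). (f, g, Src K \<theta>)), Trg = (\<lambda>(f, g, \<theta>). (f, g, Trg K \<theta>)),
      Idc = (\<lambda>(f, g, h). (f, g, Idc K h)),
      Vc = (\<lambda>(_, _, \<theta>') (f, g, \<theta>). (f, g, Vc K \<theta>' \<theta>)),
      Hc = (\<lambda>(_, g', \<theta>') (f, _, \<theta>). (f, g', Hc K \<theta>' \<theta>))\<rparr>"

record ('o, 'm, 'c, 'p, 'n, 'd) two_func = "('o, 'm, 'p, 'n) func" +
  CMap :: "'c \<Rightarrow> 'd"

definition is_two_functor :: "('o, 'm, 'c, 'z) two_cat_scheme \<Rightarrow> ('p, 'n, 'd, 'y) two_cat_scheme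
    \<Rightarrow> ('o, 'm, 'c, 'p, 'n, 'd) two_func \<Rightarrow> bool" where
  "is_two_functor K L F \<longleftrightarrow>
     is_functor K L F \<and>
     (\<forall>\<theta> \<in> Cell K. CMap F \<theta> \<in> cells L (AMap F (Src K \<theta>)) (AMap F (Trg K \<theta>))) \<and>
     (\<forall>f \<in> Arr K. CMap F (Idc K f) = Idc L (AMap F f)) \<and>
     (\<forall>\<alpha> \<in> Cell K. \<forall>\<beta> \<in> Cell K. Trg K \<alpha> = Src K \<beta> \<longrightarrow>
        CMap F (Vc K \<beta> \<alpha>) = Vc L (CMap F \<beta>) (CMap F \<alpha>)) \<and>
     (\<forall>\<alpha> \<in> Cell K. \<forall>\<beta> \<in> Cell K. Cod K (Src K \<alpha>) = Dom K (Src K \<beta>) \<longrightarrow>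
        CMap F (Hc K \<beta> \<alpha>) = Hc L (CMap F \<beta>) (CMap F \<alpha>))"

definition id_two_func :: "('o, 'm, 'c, 'o, 'm, 'c) two_func" where
  "id_two_func = \<lparr>OMap = (\<lambda>a. a), AMap = (\<lambda>f. f), CMap = (\<lambda>\<theta>. \<theta>)\<rparr>"

definition comp_two_func :: "('p, 'n, 'd, 'q, 'l, 'e) two_func \<Rightarrow> ('o, 'm, 'c, 'p, 'n, 'd) two_func
    \<Rightarrow> ('o, 'm, 'c, 'q, 'l, 'e) two_func" where
  "comp_two_func G F =
     \<lparr>OMap = (\<lambda>a. OMap G (OMap F a)), AMap = (\<lambda>f. AMap G (AMap F f)),
      CMap = (\<lambda>\<theta>. CMap G (CMap F \<theta>))\<rparr>"

definition is_two_nat :: "('o, 'm, 'c, 'z) two_cat_scheme \<Rightarrow> ('p, 'n, 'd, 'y) two_cat_scheme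
    \<Rightarrow> ('o, 'm, 'c, 'p, 'n, 'd) two_func \<Rightarrow> ('o, 'm, 'c, 'p, 'n, 'd) two_func
    \<Rightarrow> ('o \<Rightarrow> 'n) \<Rightarrow> bool" where
  "is_two_nat K L F G \<tau> \<longleftrightarrow> is_nat K L F G \<tau> \<and>
     (\<forall>\<theta> \<in> Cell K. rwhisk L (CMap G \<theta>) (\<tau> (Dom K (Src K \<theta>)))
                   = lwhisk L (\<tau> (Cod K (Src K \<theta>))) (CMap F \<theta>))"

text \<open>The inverses of the components of a 2-natural transformation with invertible components are
  automatically 2-natural.\<close>

definition is_two_nat_iso :: "('o, 'm, 'c, 'z) two_cat_scheme \<Rightarrow> ('p, 'n, 'd, 'y) two_cat_scheme
    \<Rightarrow> ('o, 'm, 'c, 'p, 'n, 'd) two_func \<Rightarrow> ('o, 'm, 'c, 'p, 'n, 'd) two_func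
    \<Rightarrow> ('o \<Rightarrow> 'n) \<Rightarrow> bool" where
  "is_two_nat_iso K L F G \<tau> \<longleftrightarrow> is_two_nat K L F G \<tau> \<and> (\<forall>a \<in> Obj K. is_iso L (\<tau> a))"

definition is_two_equivalence :: "('o, 'm, 'c, 'z) two_cat_scheme
    \<Rightarrow> ('p, 'n, 'd, 'y) two_cat_scheme \<Rightarrow> ('o, 'm, 'c, 'p, 'n, 'd) two_func \<Rightarrow> bool" where
  "is_two_equivalence K L F \<longleftrightarrow> is_two_functor K L F \<and>
     (\<exists>G. is_two_functor L K G \<and>
        (\<exists>\<eta>. is_two_nat_iso K K id_two_func (comp_two_func G F) \<eta>) \<and>
        (\<exists>\<epsilon>. is_two_nat_iso L L (comp_two_func F G) id_two_func \<epsilon>))"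


section \<open>Extensive 2-categories\<close>

text \<open>The \<open>Cat\<close>-enriched universal properties: the evident comparison functor out of (for colimits)
  or into (for limits) each hom-category is an isomorphism of categories, i.e. bijective on arrows
  and on 2-cells.\<close>

definition is_pullback2 :: "('o, 'm, 'c, 'z) two_cat_scheme \<Rightarrow> 'm \<Rightarrow> 'm \<Rightarrow> 'o \<Rightarrow> 'm \<Rightarrow> 'm \<Rightarrow> bool" where
  "is_pullback2 K f g P p q \<longleftrightarrow> is_pullback K f g P p q \<and>
     (\<forall>X \<in> Obj K. \<forall>u \<in> hom K X P. \<forall>v \<in> hom K X P.
        \<forall>\<alpha> \<in> cells K (p \<cdot>\<^bsub>K\<^esub> u) (p \<cdot>\<^bsub>K\<^esub> v). \<forall>\<beta> \<in> cells K (q \<cdot>\<^bsub>K\<^esub> u) (q \<cdot>\<^bsub>K\<^esub> v).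
          lwhisk K f \<alpha> = lwhisk K g \<beta> \<longrightarrow>
          (\<exists>!\<theta>. \<theta> \<in> cells K u v \<and> lwhisk K p \<theta> = \<alpha> \<and> lwhisk K q \<theta> = \<beta>))"

definition has_pullbacks2 :: "('o, 'm, 'c, 'z) two_cat_scheme \<Rightarrow> bool" where
  "has_pullbacks2 K \<longleftrightarrow>
     (\<forall>f \<in> Arr K. \<forall>g \<in> Arr K. Cod K f = Cod K g \<longrightarrow> (\<exists>P p q. is_pullback2 K f g P p q))"

definition is_initial2 :: "('o, 'm, 'c, 'z) two_cat_scheme \<Rightarrow> 'o \<Rightarrow> bool" where
  "is_initial2 K Z \<longleftrightarrow> is_initial K Z \<and>
     (\<forall>X \<in> Obj K. \<forall>u \<in> hom K Z X. \<forall>v \<in> hom K Z X. \<exists>!\<theta>. \<theta> \<in> cells K u v)"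

definition is_coproduct2 :: "('o, 'm, 'c, 'z) two_cat_scheme \<Rightarrow> 'o \<Rightarrow> 'o \<Rightarrow> 'o \<Rightarrow> 'm \<Rightarrow> 'm \<Rightarrow> bool" where
  "is_coproduct2 K A B Q i j \<longleftrightarrow> is_coproduct K A B Q i j \<and>
     (\<forall>X \<in> Obj K. \<forall>u \<in> hom K Q X. \<forall>v \<in> hom K Q X.
        \<forall>\<alpha> \<in> cells K (u \<cdot>\<^bsub>K\<^esub> i) (v \<cdot>\<^bsub>K\<^esub> i). \<forall>\<beta> \<in> cells K (u \<cdot>\<^bsub>K\<^esub> j) (v \<cdot>\<^bsub>K\<^esub> j).
          \<exists>!\<theta>. \<theta> \<in> cells K u v \<and> rwhisk K \<theta> i = \<alpha> \<and> rwhisk K \<theta> j = \<beta>)"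

definition has_finite_coproducts2 :: "('o, 'm, 'c, 'z) two_cat_scheme \<Rightarrow> bool" where
  "has_finite_coproducts2 K \<longleftrightarrow>
     (\<exists>Z. is_initial2 K Z) \<and>
     (\<forall>A \<in> Obj K. \<forall>B \<in> Obj K. \<exists>Q i j. is_coproduct2 K A B Q i j)"

definition the_coprods2 :: "('o, 'm, 'c, 'z) two_cat_scheme \<Rightarrow> ('o, 'm) coprods" where
  "the_coprods2 K A B = (SOME (Q, i, j). is_coproduct2 K A B Q i j)"

definition sum_cell :: "('o, 'm, 'c, 'z) two_cat_scheme \<Rightarrow> ('o, 'm) coprods \<Rightarrow> 'c \<Rightarrow> 'c \<Rightarrow> 'c" where
  "sum_cell K S \<alpha> \<beta> =
     (let A = Dom K (Src K \<alpha>); A' = Cod K (Src K \<alpha>); B = Dom K (Src K \<beta>); B' = Cod K (Src K \<beta>)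
      in THE \<theta>. \<theta> \<in> cells K (sum_arr K S (Src K \<alpha>) (Src K \<beta>)) (sum_arr K S (Trg K \<alpha>) (Trg K \<beta>)) \<and>
           rwhisk K \<theta> (cp_inl S A B) = lwhisk K (cp_inl S A' B') \<alpha> \<and>
           rwhisk K \<theta> (cp_inr S A B) = lwhisk K (cp_inr S A' B') \<beta>)"

definition coprod_two_func :: "('o, 'm, 'c, 'z) two_cat_scheme \<Rightarrow> ('o, 'm) coprods
    \<Rightarrow> ('m \<times> 'm, ('m \<times> 'm \<times> 'm) \<times> ('m \<times> 'm \<times> 'm), ('m \<times> 'm \<times> 'c) \<times> ('m \<times> 'm \<times> 'c),
        'm, 'm \<times> 'm \<times> 'm, 'm \<times> 'm \<times> 'c) two_func" where
  "coprod_two_func K S =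
     \<lparr>OMap = OMap (coprod_func K S), AMap = AMap (coprod_func K S),
      CMap = (\<lambda>((f, f', \<alpha>), (g, g', \<beta>)). (sum_arr K S f g, sum_arr K S f' g', sum_cell K S \<alpha> \<beta>))\<rparr>"

definition extensive2 :: "('o, 'm, 'c, 'z) two_cat_scheme \<Rightarrow> bool" where
  "extensive2 K \<longleftrightarrow>
     two_category K \<and> has_pullbacks2 K \<and> has_finite_coproducts2 K \<and>
     (\<forall>A \<in> Obj K. \<forall>B \<in> Obj K.
        is_two_equivalence (prod_two_cat (slice_two_cat K A) (slice_two_cat K B))
          (slice_two_cat K (cp_obj (the_coprods2 K) A B)) (coprod_two_func K (the_coprods2 K)))"


section \<open>The 2-category of internal categories\<close>

text \<open>An internal category comes with specified pullbacks \<open>ic2\<close> of composable pairs and \<open>ic3\<close> of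
  composable triples. Functors and transformations do not refer to this choice, so any two choices
  give isomorphic internal categories (by an isomorphism that is the identity on objects and
  arrows). Pairs and triples are in diagrammatic order: \<open>(x, y)\<close> in \<open>ic2\<close> satisfies
  \<open>tgt x = src y\<close>, and \<open>mul (x, y)\<close> is ``first \<open>x\<close>, then \<open>y\<close>''. The object of triples is the pullback
  of \<open>snd2\<close> and \<open>fst2\<close>, with \<open>fst3 (x, y, z) = (x, y)\<close> and \<open>snd3 (x, y, z) = (y, z)\<close>.\<close>

record ('o, 'm) icat =
  ic0 :: 'o
  ic1 :: 'o
  ic2 :: 'o
  ic3 :: 'o
  src :: 'm
  tgt :: 'm
  unt :: 'm
  fst2 :: 'm
  snd2 :: 'm
  mul :: 'm
  fst3 :: 'm
  snd3 :: 'm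

definition pair2 :: "('o, 'm, 'z) cat_scheme \<Rightarrow> ('o, 'm) icat \<Rightarrow> 'm \<Rightarrow> 'm \<Rightarrow> 'm" where
  "pair2 E A x y =
     (THE u. u \<in> hom E (Dom E x) (ic2 A) \<and> fst2 A \<cdot>\<^bsub>E\<^esub> u = x \<and> snd2 A \<cdot>\<^bsub>E\<^esub> u = y)"

text \<open>The composite in \<open>A\<close> of generalised arrows \<open>x, y : X \<rightarrow> ic1 A\<close>.\<close>

definition icomp :: "('o, 'm, 'z) cat_scheme \<Rightarrow> ('o, 'm) icat \<Rightarrow> 'm \<Rightarrow> 'm \<Rightarrow> 'm" where
  "icomp E A x y = mul A \<cdot>\<^bsub>E\<^esub> pair2 E A x y"

definition is_icat :: "('o, 'm, 'z) cat_scheme \<Rightarrow> ('o, 'm) icat \<Rightarrow> bool" where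
  "is_icat E A \<longleftrightarrow>
     ic0 A \<in> Obj E \<and> ic1 A \<in> Obj E \<and> ic2 A \<in> Obj E \<and> ic3 A \<in> Obj E \<and>
     src A \<in> hom E (ic1 A) (ic0 A) \<and> tgt A \<in> hom E (ic1 A) (ic0 A) \<and>
     unt A \<in> hom E (ic0 A) (ic1 A) \<and> mul A \<in> hom E (ic2 A) (ic1 A) \<and>
     is_pullback E (tgt A) (src A) (ic2 A) (fst2 A) (snd2 A) \<and>
     is_pullback E (snd2 A) (fst2 A) (ic3 A) (fst3 A) (snd3 A) \<and>
     src A \<cdot>\<^bsub>E\<^esub> unt A = Idn E (ic0 A) \<and> tgt A \<cdot>\<^bsub>E\<^esub> unt A = Idn E (ic0 A) \<and>
     src A \<cdot>\<^bsub>E\<^esub> mul A = src A \<cdot>\<^bsub>E\<^esub> fst2 A \<and> tgt A \<cdot>\<^bsub>E\<^esub> mul A = tgt A \<cdot>\<^bsub>E\<^esub> snd2 A \<and>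
     icomp E A (unt A \<cdot>\<^bsub>E\<^esub> src A) (Idn E (ic1 A)) = Idn E (ic1 A) \<and>
     icomp E A (Idn E (ic1 A)) (unt A \<cdot>\<^bsub>E\<^esub> tgt A) = Idn E (ic1 A) \<and>
     icomp E A (mul A \<cdot>\<^bsub>E\<^esub> fst3 A) (snd2 A \<cdot>\<^bsub>E\<^esub> snd3 A)
       = icomp E A (fst2 A \<cdot>\<^bsub>E\<^esub> fst3 A) (mul A \<cdot>\<^bsub>E\<^esub> snd3 A)"

record ('o, 'm) ifun =
  ifdom :: "('o, 'm) icat"
  ifcod :: "('o, 'm) icat"
  if0 :: 'm
  if1 :: 'm

definition is_ifun :: "('o, 'm, 'z) cat_scheme \<Rightarrow> ('o, 'm) ifun \<Rightarrow> bool" where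
  "is_ifun E F \<longleftrightarrow>
     (let A = ifdom F; B = ifcod F in
        is_icat E A \<and> is_icat E B \<and>
        if0 F \<in> hom E (ic0 A) (ic0 B) \<and> if1 F \<in> hom E (ic1 A) (ic1 B) \<and>
        src B \<cdot>\<^bsub>E\<^esub> if1 F = if0 F \<cdot>\<^bsub>E\<^esub> src A \<and> tgt B \<cdot>\<^bsub>E\<^esub> if1 F = if0 F \<cdot>\<^bsub>E\<^esub> tgt A \<and>
        if1 F \<cdot>\<^bsub>E\<^esub> unt A = unt B \<cdot>\<^bsub>E\<^esub> if0 F \<and>
        if1 F \<cdot>\<^bsub>E\<^esub> mul A = icomp E B (if1 F \<cdot>\<^bsub>E\<^esub> fst2 A) (if1 F \<cdot>\<^bsub>E\<^esub> snd2 A))"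

definition id_ifun :: "('o, 'm, 'z) cat_scheme \<Rightarrow> ('o, 'm) icat \<Rightarrow> ('o, 'm) ifun" where
  "id_ifun E A = \<lparr>ifdom = A, ifcod = A, if0 = Idn E (ic0 A), if1 = Idn E (ic1 A)\<rparr>"

definition comp_ifun :: "('o, 'm, 'z) cat_scheme \<Rightarrow> ('o, 'm) ifun \<Rightarrow> ('o, 'm) ifun
    \<Rightarrow> ('o, 'm) ifun" where
  "comp_ifun E G F =
     \<lparr>ifdom = ifdom F, ifcod = ifcod G, if0 = if0 G \<cdot>\<^bsub>E\<^esub> if0 F, if1 = if1 G \<cdot>\<^bsub>E\<^esub> if1 F\<rparr>"

record ('o, 'm) itrans =
  itsrc :: "('o, 'm) ifun"
  ittrg :: "('o, 'm) ifun"
  itc :: 'm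

definition is_itrans :: "('o, 'm, 'z) cat_scheme \<Rightarrow> ('o, 'm) itrans \<Rightarrow> bool" where
  "is_itrans E \<alpha> \<longleftrightarrow>
     (let F = itsrc \<alpha>; G = ittrg \<alpha>; A = ifdom F; B = ifcod F in
        is_ifun E F \<and> is_ifun E G \<and> ifdom G = A \<and> ifcod G = B \<and>
        itc \<alpha> \<in> hom E (ic0 A) (ic1 B) \<and>
        src B \<cdot>\<^bsub>E\<^esub> itc \<alpha> = if0 F \<and> tgt B \<cdot>\<^bsub>E\<^esub> itc \<alpha> = if0 G \<and>
        icomp E B (if1 F) (itc \<alpha> \<cdot>\<^bsub>E\<^esub> tgt A) = icomp E B (itc \<alpha> \<cdot>\<^bsub>E\<^esub> src A) (if1 G))"

definition id_itrans :: "('o, 'm, 'z) cat_scheme \<Rightarrow> ('o, 'm) ifun \<Rightarrow> ('o, 'm) itrans" where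
  "id_itrans E F = \<lparr>itsrc = F, ittrg = F, itc = unt (ifcod F) \<cdot>\<^bsub>E\<^esub> if0 F\<rparr>"

definition vcomp_itrans :: "('o, 'm, 'z) cat_scheme \<Rightarrow> ('o, 'm) itrans \<Rightarrow> ('o, 'm) itrans
    \<Rightarrow> ('o, 'm) itrans" where
  "vcomp_itrans E \<beta> \<alpha> =
     \<lparr>itsrc = itsrc \<alpha>, ittrg = ittrg \<beta>, itc = icomp E (ifcod (itsrc \<alpha>)) (itc \<alpha>) (itc \<beta>)\<rparr>"

text \<open>At an object \<open>a\<close>, the horizontal composite of \<open>\<alpha> : F \<Rightarrow> F'\<close> and \<open>\<beta> : G \<Rightarrow> G'\<close> is \<open>G (\<alpha> a)\<close>
  followed by \<open>\<beta> (F' a)\<close>.\<close>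

definition hcomp_itrans :: "('o, 'm, 'z) cat_scheme \<Rightarrow> ('o, 'm) itrans \<Rightarrow> ('o, 'm) itrans
    \<Rightarrow> ('o, 'm) itrans" where
  "hcomp_itrans E \<beta> \<alpha> =
     \<lparr>itsrc = comp_ifun E (itsrc \<beta>) (itsrc \<alpha>), ittrg = comp_ifun E (ittrg \<beta>) (ittrg \<alpha>),
      itc = icomp E (ifcod (itsrc \<beta>))
              (if1 (itsrc \<beta>) \<cdot>\<^bsub>E\<^esub> itc \<alpha>) (itc \<beta> \<cdot>\<^bsub>E\<^esub> if0 (ittrg \<alpha>))\<rparr>"

definition CatI :: "('o, 'm, 'z) cat_scheme
    \<Rightarrow> (('o, 'm) icat, ('o, 'm) ifun, ('o, 'm) itrans) two_cat" where
  "CatI E =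
     \<lparr>Obj = {A. is_icat E A}, Arr = {F. is_ifun E F}, Dom = ifdom, Cod = ifcod,
      Idn = id_ifun E, Cmp = comp_ifun E,
      Cell = {\<alpha>. is_itrans E \<alpha>}, Src = itsrc, Trg = ittrg,
      Idc = id_itrans E, Vc = vcomp_itrans E, Hc = hcomp_itrans E\<rparr>"


section \<open>The truncated nerve\<close>

text \<open>The full subcategory of the simplex category on \<open>[0], [1], [2], [3]\<close>; the triple \<open>(m, n, f)\<close>
  is the monotone map \<open>f : [m] \<rightarrow> [n]\<close>, where \<open>[n] = {..n}\<close>.\<close>

definition simplex3 :: "(nat, nat \<times> nat \<times> (nat \<Rightarrow> nat)) cat" where
  "simplex3 =
     \<lparr>Obj = {..3},
      Arr = {(m, n, f). m \<le> 3 \<and> n \<le> 3 \<and> f \<in> {..m} \<rightarrow>\<^sub>E {..n} \<and> mono_on {..m} f},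
      Dom = (\<lambda>(m, n, f). m), Cod = (\<lambda>(m, n, f). n),
      Idn = (\<lambda>n. (n, n, \<lambda>i \<in> {..n}. i)),
      Cmp = (\<lambda>(_, k, g) (m, _, f). (m, k, \<lambda>i \<in> {..m}. g (f i)))\<rparr>"

definition level :: "('o, 'm) icat \<Rightarrow> nat \<Rightarrow> 'o" where
  "level A n = (if n = 0 then ic0 A else if n = 1 then ic1 A else if n = 2 then ic2 A else ic3 A)"

text \<open>For a generalised chain \<open>a 0 \<rightarrow> \<dots> \<rightarrow> a n\<close> of \<open>n\<close> composable arrows, \<open>edge E A n i\<close> picks out the
  arrow \<open>a i \<rightarrow> a (i + 1)\<close>, \<open>vertex E A n i\<close> the object \<open>a i\<close>, and \<open>path E A n i k\<close> the composite
  \<open>a i \<rightarrow> a (i + k)\<close>.\<close>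

definition edge :: "('o, 'm, 'z) cat_scheme \<Rightarrow> ('o, 'm) icat \<Rightarrow> nat \<Rightarrow> nat \<Rightarrow> 'm" where
  "edge E A n i =
     (if n = 1 then Idn E (ic1 A)
      else if n = 2 then (if i = 0 then fst2 A else snd2 A)
      else (if i = 0 then fst2 A \<cdot>\<^bsub>E\<^esub> fst3 A
            else if i = 1 then snd2 A \<cdot>\<^bsub>E\<^esub> fst3 A
            else snd2 A \<cdot>\<^bsub>E\<^esub> snd3 A))"

definition vertex :: "('o, 'm, 'z) cat_scheme \<Rightarrow> ('o, 'm) icat \<Rightarrow> nat \<Rightarrow> nat \<Rightarrow> 'm" where
  "vertex E A n i =
     (if n = 0 then Idn E (ic0 A)
      else if i < n then src A \<cdot>\<^bsub>E\<^esub> edge E A n i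
      else tgt A \<cdot>\<^bsub>E\<^esub> edge E A n (n - 1))"

primrec path :: "('o, 'm, 'z) cat_scheme \<Rightarrow> ('o, 'm) icat \<Rightarrow> nat \<Rightarrow> nat \<Rightarrow> nat \<Rightarrow> 'm" where
  "path E A n i 0 = unt A \<cdot>\<^bsub>E\<^esub> vertex E A n i"
| "path E A n i (Suc k) = icomp E A (path E A n i k) (edge E A n (i + k))"

text \<open>A monotone map \<open>f : [m] \<rightarrow> [n]\<close> sends a chain \<open>a 0 \<rightarrow> \<dots> \<rightarrow> a n\<close> to the chain
  \<open>a (f 0) \<rightarrow> \<dots> \<rightarrow> a (f m)\<close> of composites.\<close>

definition nerve_obj :: "('o, 'm, 'z) cat_scheme \<Rightarrow> ('o, 'm) icat
    \<Rightarrow> (nat, nat \<times> nat \<times> (nat \<Rightarrow> nat), 'o, 'm) func" where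
  "nerve_obj E A =
     \<lparr>OMap = (\<lambda>n \<in> Obj simplex3. level A n),
      AMap = (\<lambda>(m, n, f) \<in> Arr simplex3.
                THE u. u \<in> hom E (level A n) (level A m) \<and>
                  (\<forall>i \<le> m. vertex E A m i \<cdot>\<^bsub>E\<^esub> u = vertex E A n (f i)) \<and>
                  (\<forall>i < m. edge E A m i \<cdot>\<^bsub>E\<^esub> u = path E A n (f i) (f (Suc i) - f i)))\<rparr>"

definition nerve_arr :: "('o, 'm, 'z) cat_scheme \<Rightarrow> ('o, 'm) ifun
    \<Rightarrow> (nat, nat \<times> nat \<times> (nat \<Rightarrow> nat), 'o, 'm) func \<times>
       (nat, nat \<times> nat \<times> (nat \<Rightarrow> nat), 'o, 'm) func \<times> (nat \<Rightarrow> 'm)" where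
  "nerve_arr E F =
     (let A = ifdom F; B = ifcod F in
       (nerve_obj E A, nerve_obj E B,
        \<lambda>n \<in> Obj simplex3.
          THE u. u \<in> hom E (level A n) (level B n) \<and>
            (\<forall>i \<le> n. vertex E B n i \<cdot>\<^bsub>E\<^esub> u = if0 F \<cdot>\<^bsub>E\<^esub> vertex E A n i) \<and>
            (\<forall>i < n. edge E B n i \<cdot>\<^bsub>E\<^esub> u = if1 F \<cdot>\<^bsub>E\<^esub> edge E A n i)))"

definition nerve :: "('o, 'm, 'z) cat_scheme
    \<Rightarrow> (('o, 'm) icat, ('o, 'm) ifun,
        (nat, nat \<times> nat \<times> (nat \<Rightarrow> nat), 'o, 'm) func,
        (nat, nat \<times> nat \<times> (nat \<Rightarrow> nat), 'o, 'm) func \<times>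
        (nat, nat \<times> nat \<times> (nat \<Rightarrow> nat), 'o, 'm) func \<times> (nat \<Rightarrow> 'm)) func" where
  "nerve E = \<lparr>OMap = nerve_obj E, AMap = nerve_arr E\<rparr>"

text \<open>The finite (\<open>Cat\<close>-enriched) coproducts of \<open>K\<close> are computed in \<open>D\<close>, along \<open>N\<close>: a cocone in \<open>K\<close> is
  a coproduct cocone exactly when its image in \<open>D\<close> is one.\<close>

definition coproducts_computed_in :: "('o, 'm, 'c, 'z) two_cat_scheme \<Rightarrow> ('p, 'n, 'y) cat_scheme
    \<Rightarrow> ('o, 'm, 'p, 'n) func \<Rightarrow> bool" where
  "coproducts_computed_in K D N \<longleftrightarrow>
     (\<forall>Z \<in> Obj K. is_initial2 K Z \<longleftrightarrow> is_initial D (OMap N Z)) \<and>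
     (\<forall>A \<in> Obj K. \<forall>B \<in> Obj K. \<forall>Q \<in> Obj K. \<forall>i \<in> hom K A Q. \<forall>j \<in> hom K B Q.
        is_coproduct2 K A B Q i j \<longleftrightarrow>
        is_coproduct D (OMap N A) (OMap N B) (OMap N Q) (AMap N i) (AMap N j))"

end

theory Submission
  imports Defs
begin

text \<open>
  A category with pullbacks and finite coproducts is extensive if and only if its coproducts are van Kampen:
  over \<open>A \<rightarrow> Q \<leftarrow> B\<close>, a row \<open>X \<rightarrow> Z \<leftarrow> Y\<close> is a coproduct exactly when both squares are pullbacks. In a 2-category
  whose pullbacks and coproducts are \<open>Cat\<close>-enriched, this property of the underlying category also makes the
  coproduct 2-functor between slices bijective on 2-cells.

  If \<open>E\<close> is extensive, a pullback of coproducts is the coproduct of the pullbacks. Coproducts of internal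
  categories can therefore be formed at the levels of objects and arrows, and are then automatically coproducts at
  the levels of composable pairs and triples, that is, coproducts of nerves. Since pullbacks are computed levelwise
  as well, the van Kampen property passes from \<open>E\<close> to \<open>Cat(E)\<close>.

  Conversely, the functor taking an internal category to its object of objects has the discrete categories as
  left adjoint and the codiscrete ones (this uses products) as right adjoint, so it preserves pullbacks and
  coproducts. An arrow \<open>Z \<rightarrow> Q\<^sub>0\<close> transposes to \<open>disc Z \<rightarrow> Q\<close>, whose decomposition in \<open>Cat(E)\<close> is sent to one in \<open>E\<close>.
\<close>

section \<open>Categories\<close>

text \<open>Full faithfulness of the sum functor speaks about pairs of arrows, a pullback square
  about one summand. The initial object bridges the gap: a test arrow into one summand is completed
  by an arrow out of the initial object into the other (\<open>van_kampen_if_equivalence\<close>).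

  Much of the data is chosen up to isomorphism: \<open>the_coprods\<close>,
  \<open>the_coprods2\<close>, and the pullbacks \<open>ic2\<close> and \<open>ic3\<close> inside an
  internal category. Hence properties are proved for one convenient coproduct or pullback and then
  carried along comparison isomorphisms.

  Extensivity enters already in the construction of coproducts in \<open>CatI C\<close>: composition
  is an arrow out of \<open>ic2\<close> and associativity an equation between arrows out of
  \<open>ic3\<close>, so neither can be treated on the summands before these pullbacks are known to
  be coproducts.

  Coproducts in the functor category are not shown to be pointwise in general. A cocone of nerves is
  compared with the nerve of a levelwise coproduct instead, and by uniqueness the comparison is
  itself the nerve of an internal functor.\<close>

context category
begin

declare Dom_in [simp] Cod_in [simp]

text \<open>Several axioms of \<open>category\<close> mention objects that do not occur in their
  conclusions, so the simplifier cannot discharge them. With \<open>Dom\<close> and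
  \<open>Cod\<close> in place of hom-sets every side condition is computed by rewriting.\<close>

lemma Idn_Arr [simp]: "a \<in> Obj C \<Longrightarrow> Idn C a \<in> Arr C"
  and Dom_Idn [simp]: "a \<in> Obj C \<Longrightarrow> Dom C (Idn C a) = a"
  and Cod_Idn [simp]: "a \<in> Obj C \<Longrightarrow> Cod C (Idn C a) = a"
  using Idn_in by (auto simp: hom_def)

lemma Cmp_Arr [simp]: "f \<in> Arr C \<Longrightarrow> g \<in> Arr C \<Longrightarrow> Cod C f = Dom C g \<Longrightarrow> g \<cdot> f \<in> Arr C"
  and Dom_Cmp [simp]: "f \<in> Arr C \<Longrightarrow> g \<in> Arr C \<Longrightarrow> Cod C f = Dom C g \<Longrightarrow> Dom C (g \<cdot> f) = Dom C f"
  and Cod_Cmp [simp]: "f \<in> Arr C \<Longrightarrow> g \<in> Arr C \<Longrightarrow> Cod C f = Dom C g \<Longrightarrow> Cod C (g \<cdot> f) = Cod C g"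
  using Cmp_in[of f "Dom C f" "Cod C f" g "Cod C g"] by (auto simp: hom_def)

lemma Cmp_Idn_eq [simp]: "f \<in> Arr C \<Longrightarrow> Dom C f = a \<Longrightarrow> f \<cdot> Idn C a = f"
  and Idn_Cmp_eq [simp]: "f \<in> Arr C \<Longrightarrow> Cod C f = b \<Longrightarrow> Idn C b \<cdot> f = f"
  using Cmp_Idn[of f a "Cod C f"] Idn_Cmp[of f "Dom C f" b] by (auto simp: hom_def)

lemma Cmp_assoc_eq [simp]:
  "f \<in> Arr C \<Longrightarrow> g \<in> Arr C \<Longrightarrow> h \<in> Arr C \<Longrightarrow> Cod C f = Dom C g \<Longrightarrow> Cod C g = Dom C h
    \<Longrightarrow> (h \<cdot> g) \<cdot> f = h \<cdot> g \<cdot> f"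
  using Cmp_assoc[of f "Dom C f" "Cod C f" g "Cod C g" h "Cod C h"] by (auto simp: hom_def)

text \<open>Composites are kept associated to the right; these rules rewrite inside one.\<close>

lemma Cmp_eq_Cmp:
  assumes "g \<cdot> f = k" "x \<in> Arr C" "f \<in> Arr C" "g \<in> Arr C" "Cod C x = Dom C f" "Cod C f = Dom C g"
  shows "g \<cdot> f \<cdot> x = k \<cdot> x"
  using assms Cmp_assoc_eq[of x f g] by simp

lemma square_Cmp:
  assumes "g \<cdot> f = k \<cdot> h" "x \<in> Arr C" "f \<in> Arr C" "g \<in> Arr C" "h \<in> Arr C" "k \<in> Arr C"
    "Cod C x = Dom C f" "Cod C f = Dom C g" "Cod C x = Dom C h" "Cod C h = Dom C k"
  shows "g \<cdot> f \<cdot> x = k \<cdot> h \<cdot> x"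
  using assms Cmp_assoc_eq[of x f g] Cmp_assoc_eq[of x h k] by simp

lemma is_isoI:
  "f \<in> Arr C \<Longrightarrow> g \<in> Arr C \<Longrightarrow> Dom C g = Cod C f \<Longrightarrow> Cod C g = Dom C f \<Longrightarrow>
    g \<cdot> f = Idn C (Dom C f) \<Longrightarrow> f \<cdot> g = Idn C (Cod C f) \<Longrightarrow> is_iso C f"
  by (auto simp: is_iso_def hom_def)

lemma is_isoE:
  assumes "is_iso C f"
  obtains g where "f \<in> Arr C" "g \<in> Arr C" "Dom C g = Cod C f" "Cod C g = Dom C f"
    "g \<cdot> f = Idn C (Dom C f)" "f \<cdot> g = Idn C (Cod C f)"
  using assms by (auto simp: is_iso_def hom_def)

lemma iso_cancel_left:
  assumes "is_iso C f" "f \<cdot> g = f \<cdot> h" "g \<in> Arr C" "h \<in> Arr C" "Cod C g = Dom C f" "Cod C h = Dom C f"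
  shows "g = h"
proof -
  from assms(1) obtain k where k: "f \<in> Arr C" "k \<in> Arr C" "Dom C k = Cod C f" "Cod C k = Dom C f"
    "k \<cdot> f = Idn C (Dom C f)" using is_isoE[OF assms(1)] by metis
  have "k \<cdot> f \<cdot> g = g" "k \<cdot> f \<cdot> h = h"
    using k assms(3-) by (simp_all add: Cmp_eq_Cmp[OF k(5)])
  then show ?thesis using assms(2) by metis
qed

lemma iso_cancel_right:
  assumes "is_iso C f" "g \<cdot> f = h \<cdot> f" "g \<in> Arr C" "h \<in> Arr C" "Dom C g = Cod C f" "Dom C h = Cod C f"
  shows "g = h"
proof -
  from assms(1) obtain k where k: "f \<in> Arr C" "k \<in> Arr C" "Dom C k = Cod C f" "Cod C k = Dom C f"
    "f \<cdot> k = Idn C (Cod C f)" using is_isoE[OF assms(1)] by metis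
  have "(g \<cdot> f) \<cdot> k = (h \<cdot> f) \<cdot> k" by (simp add: assms)
  then show ?thesis using k assms(3-) by simp
qed

end

section \<open>Vertical and horizontal composition of 2-cells in a form suited to rewriting\<close>

context two_category
begin

declare Src_in [simp] Trg_in [simp]

lemma Dom_Trg [simp]: "\<theta> \<in> Cell K \<Longrightarrow> Dom K (Trg K \<theta>) = Dom K (Src K \<theta>)"
  and Cod_Trg [simp]: "\<theta> \<in> Cell K \<Longrightarrow> Cod K (Trg K \<theta>) = Cod K (Src K \<theta>)"
  using Dom_Src_Trg Cod_Src_Trg by auto

lemma Idc_Cell [simp]: "f \<in> Arr K \<Longrightarrow> Idc K f \<in> Cell K"
  and Src_Idc [simp]: "f \<in> Arr K \<Longrightarrow> Src K (Idc K f) = f"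
  and Trg_Idc [simp]: "f \<in> Arr K \<Longrightarrow> Trg K (Idc K f) = f"
  using Idc_in by (auto simp: cells_def)

lemma Vc_Cell [simp]: "\<alpha> \<in> Cell K \<Longrightarrow> \<beta> \<in> Cell K \<Longrightarrow> Trg K \<alpha> = Src K \<beta> \<Longrightarrow> Vc K \<beta> \<alpha> \<in> Cell K"
  and Src_Vc [simp]: "\<alpha> \<in> Cell K \<Longrightarrow> \<beta> \<in> Cell K \<Longrightarrow> Trg K \<alpha> = Src K \<beta> \<Longrightarrow> Src K (Vc K \<beta> \<alpha>) = Src K \<alpha>"
  and Trg_Vc [simp]: "\<alpha> \<in> Cell K \<Longrightarrow> \<beta> \<in> Cell K \<Longrightarrow> Trg K \<alpha> = Src K \<beta> \<Longrightarrow> Trg K (Vc K \<beta> \<alpha>) = Trg K \<beta>"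
  using Vc_in[of \<alpha> "Src K \<alpha>" "Trg K \<alpha>" \<beta> "Trg K \<beta>"] by (auto simp: cells_def)

lemma Hc_Cell [simp]: "\<alpha> \<in> Cell K \<Longrightarrow> \<beta> \<in> Cell K \<Longrightarrow> Cod K (Src K \<alpha>) = Dom K (Src K \<beta>)
      \<Longrightarrow> Hc K \<beta> \<alpha> \<in> Cell K"
  and Src_Hc [simp]: "\<alpha> \<in> Cell K \<Longrightarrow> \<beta> \<in> Cell K \<Longrightarrow> Cod K (Src K \<alpha>) = Dom K (Src K \<beta>)
      \<Longrightarrow> Src K (Hc K \<beta> \<alpha>) = Src K \<beta> \<cdot> Src K \<alpha>"
  and Trg_Hc [simp]: "\<alpha> \<in> Cell K \<Longrightarrow> \<beta> \<in> Cell K \<Longrightarrow> Cod K (Src K \<alpha>) = Dom K (Src K \<beta>)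
      \<Longrightarrow> Trg K (Hc K \<beta> \<alpha>) = Trg K \<beta> \<cdot> Trg K \<alpha>"
  using Hc_in[of \<alpha> "Src K \<alpha>" "Trg K \<alpha>" \<beta> "Src K \<beta>" "Trg K \<beta>"] by (auto simp: cells_def)

lemma Vc_Idc_eq [simp]: "\<alpha> \<in> Cell K \<Longrightarrow> Src K \<alpha> = f \<Longrightarrow> Vc K \<alpha> (Idc K f) = \<alpha>"
  and Idc_Vc_eq [simp]: "\<alpha> \<in> Cell K \<Longrightarrow> Trg K \<alpha> = f \<Longrightarrow> Vc K (Idc K f) \<alpha> = \<alpha>"
  using Vc_Idc[of \<alpha> f "Trg K \<alpha>"] Idc_Vc[of \<alpha> "Src K \<alpha>" f] by (auto simp: cells_def)

lemma Vc_assoc_eq [simp]: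
  "\<alpha> \<in> Cell K \<Longrightarrow> \<beta> \<in> Cell K \<Longrightarrow> \<gamma> \<in> Cell K \<Longrightarrow> Trg K \<alpha> = Src K \<beta> \<Longrightarrow> Trg K \<beta> = Src K \<gamma> \<Longrightarrow>
    Vc K (Vc K \<gamma> \<beta>) \<alpha> = Vc K \<gamma> (Vc K \<beta> \<alpha>)"
  using Vc_assoc[of \<alpha> "Src K \<alpha>" "Trg K \<alpha>" \<beta> "Trg K \<beta>" \<gamma> "Trg K \<gamma>"] by (auto simp: cells_def)

lemma Hc_assoc_eq [simp]:
  "\<alpha> \<in> Cell K \<Longrightarrow> \<beta> \<in> Cell K \<Longrightarrow> \<gamma> \<in> Cell K \<Longrightarrow> Cod K (Src K \<alpha>) = Dom K (Src K \<beta>) \<Longrightarrow>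
    Cod K (Src K \<beta>) = Dom K (Src K \<gamma>) \<Longrightarrow> Hc K (Hc K \<gamma> \<beta>) \<alpha> = Hc K \<gamma> (Hc K \<beta> \<alpha>)"
  using Hc_assoc[of \<alpha> "Src K \<alpha>" "Trg K \<alpha>" \<beta> "Src K \<beta>" "Trg K \<beta>" \<gamma> "Src K \<gamma>" "Trg K \<gamma>"]
  by (auto simp: cells_def)

lemma Hc_Idn_eq [simp]: "\<alpha> \<in> Cell K \<Longrightarrow> Dom K (Src K \<alpha>) = a \<Longrightarrow> Hc K \<alpha> (Idc K (Idn K a)) = \<alpha>"
  and Idn_Hc_eq [simp]: "\<alpha> \<in> Cell K \<Longrightarrow> Cod K (Src K \<alpha>) = a \<Longrightarrow> Hc K (Idc K (Idn K a)) \<alpha> = \<alpha>"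
  using Hc_Idc_Idn[of \<alpha> "Src K \<alpha>" "Trg K \<alpha>"] Idc_Idn_Hc[of \<alpha> "Src K \<alpha>" "Trg K \<alpha>"]
  by (auto simp: cells_def)

lemma Hc_Idc_Idc_eq [simp]:
  "f \<in> Arr K \<Longrightarrow> g \<in> Arr K \<Longrightarrow> Cod K f = Dom K g \<Longrightarrow> Hc K (Idc K g) (Idc K f) = Idc K (g \<cdot> f)"
  using Hc_Idc_Idc[of f "Dom K f" "Cod K f" g "Cod K g"] by (auto simp: hom_def)

text \<open>\<open>Hc_assoc_eq\<close> moves brackets to the right and thereby keeps two successive
  whiskerings apart; this rule merges them again.\<close>

lemma Hc_Idc_Hc [simp]:
  "f \<in> Arr K \<Longrightarrow> g \<in> Arr K \<Longrightarrow> Cod K f = Dom K g \<Longrightarrow> \<alpha> \<in> Cell K \<Longrightarrow> Cod K (Src K \<alpha>) = Dom K f \<Longrightarrow>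
    Hc K (Idc K g) (Hc K (Idc K f) \<alpha>) = Hc K (Idc K (g \<cdot> f)) \<alpha>"
  by (subst Hc_assoc_eq[symmetric]) auto

lemma interchange_eq:
  "\<alpha> \<in> Cell K \<Longrightarrow> \<alpha>' \<in> Cell K \<Longrightarrow> \<beta> \<in> Cell K \<Longrightarrow> \<beta>' \<in> Cell K \<Longrightarrow> Trg K \<alpha> = Src K \<alpha>' \<Longrightarrow>
    Trg K \<beta> = Src K \<beta>' \<Longrightarrow> Cod K (Src K \<alpha>) = Dom K (Src K \<beta>) \<Longrightarrow>
    Hc K (Vc K \<beta>' \<beta>) (Vc K \<alpha>' \<alpha>) = Vc K (Hc K \<beta>' \<alpha>') (Hc K \<beta> \<alpha>)"
  using interchange[of \<alpha> "Src K \<alpha>" "Trg K \<alpha>" \<alpha>' "Trg K \<alpha>'" \<beta> "Src K \<beta>" "Trg K \<beta>" \<beta>' "Trg K \<beta>'"]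
  by (auto simp: cells_def)

text \<open>Interchange against an identity 2-cell, written as the vertical composite of itself with
  itself.\<close>

lemma Idc_Hc_Vc:
  assumes "\<alpha> \<in> Cell K" "\<beta> \<in> Cell K" "Trg K \<alpha> = Src K \<beta>" "f \<in> Arr K" "Cod K (Src K \<alpha>) = Dom K f"
  shows "Hc K (Idc K f) (Vc K \<beta> \<alpha>) = Vc K (Hc K (Idc K f) \<beta>) (Hc K (Idc K f) \<alpha>)"
  using interchange_eq[of \<alpha> \<beta> "Idc K f" "Idc K f"] assms by simp

lemma Vc_Hc_Idc:
  assumes "\<alpha> \<in> Cell K" "\<beta> \<in> Cell K" "Trg K \<alpha> = Src K \<beta>" "f \<in> Arr K" "Cod K f = Dom K (Src K \<alpha>)"
  shows "Hc K (Vc K \<beta> \<alpha>) (Idc K f) = Vc K (Hc K \<beta> (Idc K f)) (Hc K \<alpha> (Idc K f))"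
  using interchange_eq[of "Idc K f" "Idc K f" \<alpha> \<beta>] assms by simp

end

section \<open>Fully faithful and essentially surjective functors\<close>

lemma is_functorD:
  assumes "is_functor C D F"
  shows "a \<in> Obj C \<Longrightarrow> OMap F a \<in> Obj D"
    and "f \<in> Arr C \<Longrightarrow> AMap F f \<in> Arr D"
    and "f \<in> Arr C \<Longrightarrow> Dom D (AMap F f) = OMap F (Dom C f)"
    and "f \<in> Arr C \<Longrightarrow> Cod D (AMap F f) = OMap F (Cod C f)"
    and "a \<in> Obj C \<Longrightarrow> AMap F (Idn C a) = Idn D (OMap F a)"
    and "f \<in> Arr C \<Longrightarrow> g \<in> Arr C \<Longrightarrow> Cod C f = Dom C g \<Longrightarrow>
      AMap F (g \<cdot>\<^bsub>C\<^esub> f) = AMap F g \<cdot>\<^bsub>D\<^esub> AMap F f"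
  using assms by (auto simp: is_functor_def hom_def)

definition fully_faithful where
  "fully_faithful C D F \<longleftrightarrow>
     (\<forall>a \<in> Obj C. \<forall>b \<in> Obj C. \<forall>h \<in> hom D (OMap F a) (OMap F b).
        \<exists>!u. u \<in> hom C a b \<and> AMap F u = h)"

definition ess_surjective where
  "ess_surjective C D F \<longleftrightarrow>
     (\<forall>d \<in> Obj D. \<exists>a \<in> Obj C. \<exists>e \<in> hom D (OMap F a) d. is_iso D e)"

text \<open>Essential surjectivity with preimages \<open>G0\<close> and isomorphisms
  \<open>e\<close> (inverse \<open>e'\<close>) chosen once and for all, so that the quasi-inverse
  becomes an explicit term and the laws become rewrite rules. The record scheme of \<open>F\<close>
  admits 2-functors as well, which is how \<open>two_equivalence_data\<close> reuses the
  construction.\<close>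

locale equivalence_data = C: category C + D: category D
  for C :: "('o, 'm, 'z) cat_scheme" and D :: "('p, 'n, 'y) cat_scheme" +
  fixes F :: "('o, 'm, 'p, 'n, 'x) func_scheme" and G0 :: "'p \<Rightarrow> 'o" and e e' :: "'p \<Rightarrow> 'n"
  assumes F_functor: "is_functor C D F"
    and ff: "fully_faithful C D F"
    and G0 [simp]: "d \<in> Obj D \<Longrightarrow> G0 d \<in> Obj C"
    and e [simp]: "d \<in> Obj D \<Longrightarrow> e d \<in> Arr D" "d \<in> Obj D \<Longrightarrow> Dom D (e d) = OMap F (G0 d)"
      "d \<in> Obj D \<Longrightarrow> Cod D (e d) = d"
    and e' [simp]: "d \<in> Obj D \<Longrightarrow> e' d \<in> Arr D" "d \<in> Obj D \<Longrightarrow> Cod D (e' d) = OMap F (G0 d)"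
      "d \<in> Obj D \<Longrightarrow> Dom D (e' d) = d"
    and ee' [simp]: "d \<in> Obj D \<Longrightarrow> e d \<cdot>\<^bsub>D\<^esub> e' d = Idn D d"
    and e'e [simp]: "d \<in> Obj D \<Longrightarrow> e' d \<cdot>\<^bsub>D\<^esub> e d = Idn D (OMap F (G0 d))"
begin

lemmas F [simp] = is_functorD[OF F_functor]

lemma e_e' [simp]: "d \<in> Obj D \<Longrightarrow> x \<in> Arr D \<Longrightarrow> Cod D x = d \<Longrightarrow> e d \<cdot>\<^bsub>D\<^esub> e' d \<cdot>\<^bsub>D\<^esub> x = x"
  and e'_e [simp]: "d \<in> Obj D \<Longrightarrow> x \<in> Arr D \<Longrightarrow> Cod D x = OMap F (G0 d) \<Longrightarrow>
    e' d \<cdot>\<^bsub>D\<^esub> e d \<cdot>\<^bsub>D\<^esub> x = x"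
  by (simp_all add: D.Cmp_eq_Cmp[OF ee'] D.Cmp_eq_Cmp[OF e'e])

definition lift :: "'o \<Rightarrow> 'o \<Rightarrow> 'n \<Rightarrow> 'm" where
  "lift a b h = (THE u. u \<in> hom C a b \<and> AMap F u = h)"

lemma lift [simp]:
  assumes "a \<in> Obj C" "b \<in> Obj C" "h \<in> Arr D" "Dom D h = OMap F a" "Cod D h = OMap F b"
  shows "lift a b h \<in> Arr C" "Dom C (lift a b h) = a" "Cod C (lift a b h) = b" "AMap F (lift a b h) = h"
proof -
  have "\<exists>!u. u \<in> hom C a b \<and> AMap F u = h"
    using ff assms by (simp add: fully_faithful_def hom_def)
  from theI'[OF this]
  show "lift a b h \<in> Arr C" "Dom C (lift a b h) = a" "Cod C (lift a b h) = b" "AMap F (lift a b h) = h"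
    by (auto simp: lift_def hom_def)
qed

lemma faithful:
  assumes "u \<in> Arr C" "v \<in> Arr C" "Dom C u = Dom C v" "Cod C u = Cod C v" "AMap F u = AMap F v"
  shows "u = v"
proof -
  have "\<exists>!w. w \<in> hom C (Dom C u) (Cod C u) \<and> AMap F w = AMap F u"
    using ff assms by (simp add: fully_faithful_def hom_def)
  then show ?thesis using assms by (auto simp: hom_def)
qed

text \<open>Conjugation by \<open>e\<close> is the only action on arrows for which \<open>e\<close>
  is natural.\<close>

definition G :: "('p, 'n, 'o, 'm) func" where
  "G = \<lparr>OMap = G0, AMap = (\<lambda>h. lift (G0 (Dom D h)) (G0 (Cod D h)) (e' (Cod D h) \<cdot>\<^bsub>D\<^esub> h \<cdot>\<^bsub>D\<^esub> e (Dom D h)))\<rparr>"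

text \<open>The component that a triangle identity forces: its image under \<open>F\<close> has to
  be inverse to \<open>e\<close> at \<open>OMap F a\<close>.\<close>

definition \<eta> :: "'o \<Rightarrow> 'm" where
  "\<eta> a = lift a (G0 (OMap F a)) (e' (OMap F a))"

lemma G_simps [simp]:
  "OMap G d = G0 d"
  "h \<in> Arr D \<Longrightarrow> AMap G h \<in> Arr C"
  "h \<in> Arr D \<Longrightarrow> Dom C (AMap G h) = G0 (Dom D h)"
  "h \<in> Arr D \<Longrightarrow> Cod C (AMap G h) = G0 (Cod D h)"
  "h \<in> Arr D \<Longrightarrow> AMap F (AMap G h) = e' (Cod D h) \<cdot>\<^bsub>D\<^esub> h \<cdot>\<^bsub>D\<^esub> e (Dom D h)"
  by (simp_all add: G_def)

lemma \<eta>_simps [simp]: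
  "a \<in> Obj C \<Longrightarrow> \<eta> a \<in> Arr C"
  "a \<in> Obj C \<Longrightarrow> Dom C (\<eta> a) = a"
  "a \<in> Obj C \<Longrightarrow> Cod C (\<eta> a) = G0 (OMap F a)"
  "a \<in> Obj C \<Longrightarrow> AMap F (\<eta> a) = e' (OMap F a)"
  by (simp_all add: \<eta>_def)

lemma functor_G: "is_functor D C G"
  by (auto simp: is_functor_def hom_def intro!: faithful)

lemma nat_iso_\<eta>: "is_nat_iso C C id_func (comp_func G F) \<eta>"
proof -
  have "is_iso C (\<eta> a)" if "a \<in> Obj C" for a
    by (rule C.is_isoI[where g = "lift (G0 (OMap F a)) a (e (OMap F a))"])
      (use that in \<open>auto intro!: faithful\<close>)
  then show ?thesis
    by (auto simp: is_nat_iso_def is_nat_def id_func_def comp_func_def hom_def intro!: faithful)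
qed

lemma iso_e: "d \<in> Obj D \<Longrightarrow> is_iso D (e d)"
  by (rule D.is_isoI[where g = "e' d"]) auto

lemma nat_iso_e: "is_nat_iso D D (comp_func F G) id_func e"
  by (auto simp: is_nat_iso_def is_nat_def id_func_def comp_func_def hom_def iso_e)

end

lemma equivalence_data_exists:
  assumes "category C" "category D" "is_functor C D F" "fully_faithful C D F" "ess_surjective C D F"
  shows "\<exists>G0 e e'. equivalence_data C D F G0 e e'"
proof -
  interpret C: category C by fact
  interpret D: category D by fact
  \<comment> \<open>The membership of \<open>d\<close> is moved inside the existential, so that the
    choice yields functions on the whole type.\<close>
  have "\<forall>d. \<exists>a f g. d \<in> Obj D \<longrightarrow> a \<in> Obj C \<and> f \<in> Arr D \<and> Dom D f = OMap F a \<and> Cod D f = d \<and>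
          g \<in> Arr D \<and> Dom D g = d \<and> Cod D g = OMap F a \<and>
          g \<cdot>\<^bsub>D\<^esub> f = Idn D (OMap F a) \<and> f \<cdot>\<^bsub>D\<^esub> g = Idn D d"
  proof
    fix d
    show "\<exists>a f g. d \<in> Obj D \<longrightarrow> a \<in> Obj C \<and> f \<in> Arr D \<and> Dom D f = OMap F a \<and> Cod D f = d \<and>
          g \<in> Arr D \<and> Dom D g = d \<and> Cod D g = OMap F a \<and>
          g \<cdot>\<^bsub>D\<^esub> f = Idn D (OMap F a) \<and> f \<cdot>\<^bsub>D\<^esub> g = Idn D d"
    proof (cases "d \<in> Obj D")
      case True
      then obtain a f where "a \<in> Obj C" "f \<in> hom D (OMap F a) d" "is_iso D f"
        using assms(5) unfolding ess_surjective_def by blast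
      moreover from \<open>is_iso D f\<close> obtain g where "f \<in> Arr D" "g \<in> Arr D" "Dom D g = Cod D f"
        "Cod D g = Dom D f" "g \<cdot>\<^bsub>D\<^esub> f = Idn D (Dom D f)" "f \<cdot>\<^bsub>D\<^esub> g = Idn D (Cod D f)"
        using D.is_isoE by metis
      ultimately show ?thesis by (auto simp: hom_def)
    qed auto
  qed
  then obtain G0 e e' where "\<forall>d \<in> Obj D. G0 d \<in> Obj C \<and> e d \<in> Arr D \<and> Dom D (e d) = OMap F (G0 d) \<and>
      Cod D (e d) = d \<and> e' d \<in> Arr D \<and> Dom D (e' d) = d \<and> Cod D (e' d) = OMap F (G0 d) \<and>
      e' d \<cdot>\<^bsub>D\<^esub> e d = Idn D (OMap F (G0 d)) \<and> e d \<cdot>\<^bsub>D\<^esub> e' d = Idn D d"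
    by metis
  then have "equivalence_data C D F G0 e e'"
    using assms by (unfold_locales) auto
  then show ?thesis by blast
qed

lemma is_equivalenceI:
  assumes "category C" "category D" "is_functor C D F" "fully_faithful C D F" "ess_surjective C D F"
  shows "is_equivalence C D F"
proof -
  from equivalence_data_exists[OF assms] obtain G0 e e' where *: "equivalence_data C D F G0 e e'"
    by blast
  interpret equivalence_data C D F G0 e e' by fact
  show ?thesis
    using F_functor functor_G nat_iso_\<eta> nat_iso_e unfolding is_equivalence_def by blast
qed

lemma is_equivalence_ess_surjective:
  fixes C :: "('o, 'm, 'z) cat_scheme" and D :: "('p, 'n, 'y) cat_scheme"
  assumes "is_equivalence C D F"
  shows "ess_surjective C D F"
proof -
  from assms obtain G :: "('p, 'n, 'o, 'm) func" and \<epsilon> where "is_functor D C G" "is_nat_iso D D (comp_func F G) id_func \<epsilon>"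
    unfolding is_equivalence_def by auto
  then show ?thesis
    unfolding ess_surjective_def is_nat_iso_def is_nat_def is_functor_def
    by (simp add: comp_func_def id_func_def) blast
qed

text \<open>Naturality expresses \<open>u\<close>, up to an invertible component, through
  \<open>AMap F u\<close>; cancelling that component recovers \<open>u\<close>. The disjunction
  covers a counit, where the component is cancelled on the right, and a unit, where it is cancelled
  on the left.\<close>

lemma faithful_of_nat_iso:
  assumes C: "category C" and "is_nat_iso C C F id_func \<epsilon> \<or> is_nat_iso C C id_func F \<epsilon>"
    "u \<in> Arr C" "v \<in> Arr C" "Dom C u = Dom C v" "Cod C u = Cod C v" "AMap F u = AMap F v"
  shows "u = v"
proof -
  interpret C: category C by fact
  from assms(2) show ?thesis
  proof
    assume *: "is_nat_iso C C F id_func \<epsilon>"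
    then have "u \<cdot>\<^bsub>C\<^esub> \<epsilon> (Dom C u) = v \<cdot>\<^bsub>C\<^esub> \<epsilon> (Dom C u)"
      using assms(3-) by (simp add: is_nat_iso_def is_nat_def id_func_def) metis
    then show ?thesis
      by (rule C.iso_cancel_right[rotated])
        (use * assms(3-) in \<open>auto simp: is_nat_iso_def is_nat_def id_func_def hom_def\<close>)
  next
    assume *: "is_nat_iso C C id_func F \<epsilon>"
    then have "\<epsilon> (Cod C u) \<cdot>\<^bsub>C\<^esub> u = \<epsilon> (Cod C u) \<cdot>\<^bsub>C\<^esub> v"
      using assms(3-) by (simp add: is_nat_iso_def is_nat_def id_func_def) metis
    then show ?thesis
      by (rule C.iso_cancel_left[rotated])
        (use * assms(3-) in \<open>auto simp: is_nat_iso_def is_nat_def id_func_def hom_def\<close>)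
  qed
qed

text \<open>Faithfulness of \<open>F\<close> comes from \<eta>. Fullness uses faithfulness of the
  quasi-inverse as well, which comes from \<epsilon>.\<close>

lemma is_equivalence_fully_faithful:
  fixes C :: "('o, 'm, 'z) cat_scheme" and D :: "('p, 'n, 'y) cat_scheme"
  assumes C: "category C" and D: "category D" and eq: "is_equivalence C D F"
  shows "fully_faithful C D F"
proof -
  interpret C: category C by fact
  interpret D: category D by fact
  from eq obtain G :: "('p, 'n, 'o, 'm) func" and \<eta> \<epsilon> where F: "is_functor C D F" and G: "is_functor D C G"
    and \<eta>: "is_nat_iso C C id_func (comp_func G F) \<eta>"
    and \<epsilon>: "is_nat_iso D D (comp_func F G) id_func \<epsilon>"
    unfolding is_equivalence_def by auto
  note [simp] = is_functorD[OF F] is_functorD[OF G]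
  have F_faithful: "u = v" if "u \<in> Arr C" "v \<in> Arr C" "Dom C u = Dom C v" "Cod C u = Cod C v"
    "AMap F u = AMap F v" for u v
    by (rule faithful_of_nat_iso[OF C disjI2[OF \<eta>]]) (use that in \<open>auto simp: comp_func_def\<close>)
  have G_faithful: "u = v" if "u \<in> Arr D" "v \<in> Arr D" "Dom D u = Dom D v" "Cod D u = Cod D v"
    "AMap G u = AMap G v" for u v
    by (rule faithful_of_nat_iso[OF D disjI1[OF \<epsilon>]]) (use that in \<open>auto simp: comp_func_def\<close>)
  have \<eta>_simps [simp]: "\<eta> a \<in> Arr C" "Dom C (\<eta> a) = a" "Cod C (\<eta> a) = OMap G (OMap F a)" "is_iso C (\<eta> a)"
    if "a \<in> Obj C" for a
    using \<eta> that by (auto simp: is_nat_iso_def is_nat_def id_func_def comp_func_def hom_def)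
  have \<eta>_nat: "AMap G (AMap F f) \<cdot>\<^bsub>C\<^esub> \<eta> (Dom C f) = \<eta> (Cod C f) \<cdot>\<^bsub>C\<^esub> f" if "f \<in> Arr C" for f
    using \<eta> that by (auto simp: is_nat_iso_def is_nat_def id_func_def comp_func_def)
  have "\<exists>!u. u \<in> hom C a b \<and> AMap F u = h"
    if ab: "a \<in> Obj C" "b \<in> Obj C" and h: "h \<in> hom D (OMap F a) (OMap F b)" for a b h
  proof -
    obtain k where k [simp]: "k \<in> Arr C" "Dom C k = OMap G (OMap F b)" "Cod C k = b"
      "k \<cdot>\<^bsub>C\<^esub> \<eta> b = Idn C b" "\<eta> b \<cdot>\<^bsub>C\<^esub> k = Idn C (OMap G (OMap F b))"
      using C.is_isoE[OF \<eta>_simps(4)[OF \<open>b \<in> Obj C\<close>]] ab by auto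
    \<comment> \<open>Naturality of \<eta> leaves no other candidate for a preimage of
      \<open>h\<close>; \<open>k\<close> is the inverse of \<open>\<eta> b\<close>.\<close>
    define u where "u = k \<cdot>\<^bsub>C\<^esub> AMap G h \<cdot>\<^bsub>C\<^esub> \<eta> a"
    have [simp]: "u \<in> Arr C" "Dom C u = a" "Cod C u = b" and h': "h \<in> Arr D" "Dom D h = OMap F a" "Cod D h = OMap F b"
      using ab h by (auto simp: u_def hom_def)
    have "AMap G (AMap F u) \<cdot>\<^bsub>C\<^esub> \<eta> a = AMap G h \<cdot>\<^bsub>C\<^esub> \<eta> a"
      using \<eta>_nat[of u] ab h' by (simp add: u_def C.Cmp_eq_Cmp[OF k(5)])
    then have "AMap G (AMap F u) = AMap G h"
      by (rule C.iso_cancel_right[rotated]) (use ab h' in auto)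
    then have "AMap F u = h"
      by (intro G_faithful) (use h' in auto)
    then show ?thesis
      by (intro ex1I[of _ u]) (auto simp: hom_def intro: F_faithful)
  qed
  then show ?thesis by (simp add: fully_faithful_def)
qed

section \<open>2-functors that are bijective on 2-cells, and 2-equivalences\<close>

definition cell_fully_faithful where
  "cell_fully_faithful K L F \<longleftrightarrow>
     (\<forall>u \<in> Arr K. \<forall>v \<in> Arr K. \<forall>\<theta> \<in> cells L (AMap F u) (AMap F v).
        Dom K u = Dom K v \<longrightarrow> Cod K u = Cod K v \<longrightarrow> (\<exists>!\<gamma>. \<gamma> \<in> cells K u v \<and> CMap F \<gamma> = \<theta>))"

lemma is_two_functorD:
  assumes "is_two_functor K L F"
  shows "is_functor K L F"
    and "\<theta> \<in> Cell K \<Longrightarrow> CMap F \<theta> \<in> Cell L"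
    and "\<theta> \<in> Cell K \<Longrightarrow> Src L (CMap F \<theta>) = AMap F (Src K \<theta>)"
    and "\<theta> \<in> Cell K \<Longrightarrow> Trg L (CMap F \<theta>) = AMap F (Trg K \<theta>)"
    and "f \<in> Arr K \<Longrightarrow> CMap F (Idc K f) = Idc L (AMap F f)"
    and "\<alpha> \<in> Cell K \<Longrightarrow> \<beta> \<in> Cell K \<Longrightarrow> Trg K \<alpha> = Src K \<beta> \<Longrightarrow>
      CMap F (Vc K \<beta> \<alpha>) = Vc L (CMap F \<beta>) (CMap F \<alpha>)"
    and "\<alpha> \<in> Cell K \<Longrightarrow> \<beta> \<in> Cell K \<Longrightarrow> Cod K (Src K \<alpha>) = Dom K (Src K \<beta>) \<Longrightarrow>
      CMap F (Hc K \<beta> \<alpha>) = Hc L (CMap F \<beta>) (CMap F \<alpha>)"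
  using assms by (auto simp: is_two_functor_def cells_def)

locale two_equivalence_data = equivalence_data K L F G0 e e' + K: two_category K + L: two_category L
  for K :: "('o, 'm, 'c, 'z) two_cat_scheme" and L :: "('p, 'n, 'd, 'y) two_cat_scheme"
    and F :: "('o, 'm, 'c, 'p, 'n, 'd) two_func" and G0 e e' +
  assumes two_functor: "is_two_functor K L F"
    and cff: "cell_fully_faithful K L F"
begin

lemmas F2 [simp] = is_two_functorD(2-)[OF two_functor]

definition clift :: "'m \<Rightarrow> 'm \<Rightarrow> 'd \<Rightarrow> 'c" where
  "clift u v \<theta> = (THE \<gamma>. \<gamma> \<in> cells K u v \<and> CMap F \<gamma> = \<theta>)"

lemma clift [simp]:
  assumes "u \<in> Arr K" "v \<in> Arr K" "\<theta> \<in> Cell L" "Src L \<theta> = AMap F u" "Trg L \<theta> = AMap F v"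
    "Dom K u = Dom K v" "Cod K u = Cod K v"
  shows "clift u v \<theta> \<in> Cell K" "Src K (clift u v \<theta>) = u" "Trg K (clift u v \<theta>) = v"
    "CMap F (clift u v \<theta>) = \<theta>"
proof -
  have "\<exists>!\<gamma>. \<gamma> \<in> cells K u v \<and> CMap F \<gamma> = \<theta>"
    using cff assms by (simp add: cell_fully_faithful_def cells_def)
  from theI'[OF this]
  show "clift u v \<theta> \<in> Cell K" "Src K (clift u v \<theta>) = u" "Trg K (clift u v \<theta>) = v"
    "CMap F (clift u v \<theta>) = \<theta>"
    by (auto simp: clift_def cells_def)
qed

lemma cfaithful:
  assumes "\<alpha> \<in> Cell K" "\<beta> \<in> Cell K" "Src K \<alpha> = Src K \<beta>" "Trg K \<alpha> = Trg K \<beta>" "CMap F \<alpha> = CMap F \<beta>"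
  shows "\<alpha> = \<beta>"
proof -
  have "\<exists>!\<gamma>. \<gamma> \<in> cells K (Src K \<alpha>) (Trg K \<alpha>) \<and> CMap F \<gamma> = CMap F \<alpha>"
    using cff assms unfolding cell_fully_faithful_def by (simp add: cells_def)
  then show ?thesis using assms by (auto simp: cells_def)
qed

text \<open>Conjugation by \<open>e\<close> on 2-cells. Its boundary consists of arrows of the form
  \<open>AMap F (AMap G h)\<close>, so it can be lifted through \<open>F\<close>.\<close>

definition conj :: "'d \<Rightarrow> 'd" where
  "conj \<theta> = Hc L (Idc L (e' (Cod L (Src L \<theta>)))) (Hc L \<theta> (Idc L (e (Dom L (Src L \<theta>)))))"

definition G2 :: "('p, 'n, 'd, 'o, 'm, 'c) two_func" where
  "G2 = \<lparr>OMap = OMap G, AMap = AMap G,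
         CMap = (\<lambda>\<theta>. clift (AMap G (Src L \<theta>)) (AMap G (Trg L \<theta>)) (conj \<theta>))\<rparr>"

lemma conj_simps [simp]:
  assumes "\<theta> \<in> Cell L"
  shows "conj \<theta> \<in> Cell L" "Src L (conj \<theta>) = AMap F (AMap G (Src L \<theta>))"
    "Trg L (conj \<theta>) = AMap F (AMap G (Trg L \<theta>))"
  using assms by (simp_all add: conj_def)

lemma G2_simps [simp]:
  "OMap G2 = OMap G" "AMap G2 = AMap G"
  "\<theta> \<in> Cell L \<Longrightarrow> CMap G2 \<theta> \<in> Cell K"
  "\<theta> \<in> Cell L \<Longrightarrow> Src K (CMap G2 \<theta>) = AMap G (Src L \<theta>)"
  "\<theta> \<in> Cell L \<Longrightarrow> Trg K (CMap G2 \<theta>) = AMap G (Trg L \<theta>)"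
  "\<theta> \<in> Cell L \<Longrightarrow> CMap F (CMap G2 \<theta>) = conj \<theta>"
  by (simp_all add: G2_def)

lemmas G_functor_simps [simp] = is_functorD(5,6)[OF functor_G]

lemma conj_Idc: "f \<in> Arr L \<Longrightarrow> conj (Idc L f) = Idc L (AMap F (AMap G f))"
  by (simp add: conj_def)

lemma conj_Vc:
  "\<alpha> \<in> Cell L \<Longrightarrow> \<beta> \<in> Cell L \<Longrightarrow> Trg L \<alpha> = Src L \<beta> \<Longrightarrow> conj (Vc L \<beta> \<alpha>) = Vc L (conj \<beta>) (conj \<alpha>)"
  using L.Dom_Trg[of \<alpha>] L.Cod_Trg[of \<alpha>] by (simp add: conj_def L.Idc_Hc_Vc L.Vc_Hc_Idc)

text \<open>The inner factors \<open>e\<close> and \<open>e'\<close> meet and cancel by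
  \<open>ee'\<close>.\<close>

lemma conj_Hc:
  assumes "\<alpha> \<in> Cell L" "\<beta> \<in> Cell L" "Cod L (Src L \<alpha>) = Dom L (Src L \<beta>)"
  shows "conj (Hc L \<beta> \<alpha>) = Hc L (conj \<beta>) (conj \<alpha>)"
  using assms by (simp add: conj_def)

lemma two_functor_G2: "is_two_functor L K G2"
proof -
  have "is_functor L K G2"
    using functor_G by (simp add: is_functor_def)
  moreover have "CMap G2 (Idc L f) = Idc K (AMap G2 f)" if "f \<in> Arr L" for f
    by (rule cfaithful) (use that in \<open>simp_all add: conj_Idc\<close>)
  moreover have "CMap G2 (Vc L \<beta> \<alpha>) = Vc K (CMap G2 \<beta>) (CMap G2 \<alpha>)"
    if "\<alpha> \<in> Cell L" "\<beta> \<in> Cell L" "Trg L \<alpha> = Src L \<beta>" for \<alpha> \<beta>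
    by (rule cfaithful) (use that in \<open>simp_all add: conj_Vc\<close>)
  moreover have "CMap G2 (Hc L \<beta> \<alpha>) = Hc K (CMap G2 \<beta>) (CMap G2 \<alpha>)"
    if "\<alpha> \<in> Cell L" "\<beta> \<in> Cell L" "Cod L (Src L \<alpha>) = Dom L (Src L \<beta>)" for \<alpha> \<beta>
    by (rule cfaithful) (use that in \<open>simp_all add: conj_Hc\<close>)
  ultimately show ?thesis
    by (simp add: is_two_functor_def cells_def)
qed

lemma two_nat_iso_\<eta>: "is_two_nat_iso K K id_two_func (comp_two_func G2 F) \<eta>"
proof -
  have "Hc K (CMap G2 (CMap F \<theta>)) (Idc K (\<eta> (Dom K (Src K \<theta>)))) = Hc K (Idc K (\<eta> (Cod K (Src K \<theta>)))) \<theta>"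
    if "\<theta> \<in> Cell K" for \<theta>
  proof -
    \<comment> \<open>Used for the source and the target of \<theta>: it makes the two sides
      parallel, as \<open>cfaithful\<close> demands.\<close>
    have nat: "AMap G (AMap F f) \<cdot>\<^bsub>K\<^esub> \<eta> (Dom K f) = \<eta> (Cod K f) \<cdot>\<^bsub>K\<^esub> f" if "f \<in> Arr K" for f
      using nat_iso_\<eta> that by (auto simp: is_nat_iso_def is_nat_def id_func_def comp_func_def)
    show ?thesis
      by (rule cfaithful) (use that nat[of "Src K \<theta>"] nat[of "Trg K \<theta>"] in \<open>simp_all add: conj_def\<close>)
  qed
  then show ?thesis
    using nat_iso_\<eta> by (simp add: is_two_nat_iso_def is_two_nat_def is_nat_iso_def is_nat_def
        id_two_func_def comp_two_func_def id_func_def comp_func_def rwhisk_def lwhisk_def)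
qed

lemma two_nat_iso_e: "is_two_nat_iso L L (comp_two_func F G2) id_two_func e"
  using nat_iso_e by (simp add: is_two_nat_iso_def is_two_nat_def is_nat_iso_def is_nat_def
      id_two_func_def comp_two_func_def id_func_def comp_func_def rwhisk_def lwhisk_def conj_def)

end

lemma is_two_equivalenceI:
  assumes "two_category K" "two_category L" "is_two_functor K L F" "fully_faithful K L F"
    "ess_surjective K L F" "cell_fully_faithful K L F"
  shows "is_two_equivalence K L F"
proof -
  interpret K: two_category K by fact
  interpret L: two_category L by fact
  from equivalence_data_exists[of K L F] obtain G0 e e' where *: "equivalence_data K L F G0 e e'"
    using assms K.category_axioms L.category_axioms is_two_functorD(1) by blast
  interpret two_equivalence_data K L F G0 e e'
    using * assms by (simp add: two_equivalence_data_def two_equivalence_data_axioms_def)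
  show ?thesis
    using two_functor two_functor_G2 two_nat_iso_\<eta> two_nat_iso_e unfolding is_two_equivalence_def by blast
qed

section \<open>Pullbacks and coproducts\<close>

context category
begin

lemma pullbackD:
  assumes "is_pullback C f g P p q"
  shows "f \<in> Arr C" "g \<in> Arr C" "Cod C g = Cod C f" "P \<in> Obj C" "p \<in> Arr C" "q \<in> Arr C"
    "Dom C p = P" "Dom C q = P" "Cod C p = Dom C f" "Cod C q = Dom C g" "f \<cdot> p = g \<cdot> q"
  using assms by (auto simp: is_pullback_def hom_def)

lemma pullback_lift:
  assumes "is_pullback C f g P p q" "h \<in> Arr C" "k \<in> Arr C" "Dom C k = Dom C h"
    "Cod C h = Dom C f" "Cod C k = Dom C g" "f \<cdot> h = g \<cdot> k"
  obtains u where "u \<in> Arr C" "Dom C u = Dom C h" "Cod C u = P" "p \<cdot> u = h" "q \<cdot> u = k"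
proof -
  have "h \<in> hom C (Dom C h) (Dom C f)" "k \<in> hom C (Dom C h) (Dom C g)" "Dom C h \<in> Obj C"
    using assms by (auto simp: hom_def)
  then obtain u where "u \<in> hom C (Dom C h) P" "p \<cdot> u = h" "q \<cdot> u = k"
    using assms(1,7) unfolding is_pullback_def by blast
  then show ?thesis using that by (auto simp: hom_def)
qed

lemma pullback_eqI:
  assumes "is_pullback C f g P p q" "u \<in> Arr C" "v \<in> Arr C" "Dom C v = Dom C u"
    "Cod C u = P" "Cod C v = P" "p \<cdot> u = p \<cdot> v" "q \<cdot> u = q \<cdot> v"
  shows "u = v"
proof -
  note [simp] = pullbackD[OF assms(1)]
  have "f \<cdot> p \<cdot> v = g \<cdot> q \<cdot> v"
    by (rule square_Cmp) (use assms(2-) in simp_all)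
  moreover have univ: "\<forall>X \<in> Obj C. \<forall>h \<in> hom C X (Dom C f). \<forall>k \<in> hom C X (Dom C g).
      f \<cdot> h = g \<cdot> k \<longrightarrow> (\<exists>!u. u \<in> hom C X P \<and> p \<cdot> u = h \<and> q \<cdot> u = k)"
    using assms(1) unfolding is_pullback_def by (elim conjE)
  ultimately have "\<exists>!w. w \<in> hom C (Dom C u) P \<and> p \<cdot> w = p \<cdot> u \<and> q \<cdot> w = q \<cdot> u"
    using assms(2-) by (intro univ[rule_format]) (simp_all add: hom_def)
  moreover have "u \<in> hom C (Dom C u) P" "v \<in> hom C (Dom C u) P" using assms by (auto simp: hom_def)
  ultimately show ?thesis using assms(7,8) by metis
qed

lemma pullbackI:
  assumes "f \<in> Arr C" "g \<in> Arr C" "Cod C g = Cod C f" "p \<in> Arr C" "q \<in> Arr C"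
    "Dom C p = P" "Dom C q = P" "Cod C p = Dom C f" "Cod C q = Dom C g" "f \<cdot> p = g \<cdot> q"
    and ex: "\<And>h k. h \<in> Arr C \<Longrightarrow> k \<in> Arr C \<Longrightarrow> Dom C k = Dom C h \<Longrightarrow> Cod C h = Dom C f \<Longrightarrow>
      Cod C k = Dom C g \<Longrightarrow> f \<cdot> h = g \<cdot> k \<Longrightarrow>
      \<exists>u. u \<in> Arr C \<and> Dom C u = Dom C h \<and> Cod C u = P \<and> p \<cdot> u = h \<and> q \<cdot> u = k"
    and eq: "\<And>u v. u \<in> Arr C \<Longrightarrow> v \<in> Arr C \<Longrightarrow> Dom C v = Dom C u \<Longrightarrow> Cod C u = P \<Longrightarrow> Cod C v = P \<Longrightarrow>
      p \<cdot> u = p \<cdot> v \<Longrightarrow> q \<cdot> u = q \<cdot> v \<Longrightarrow> u = v"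
  shows "is_pullback C f g P p q"
proof -
  have "\<exists>!u. u \<in> hom C X P \<and> p \<cdot> u = h \<and> q \<cdot> u = k"
    if "h \<in> hom C X (Dom C f)" "k \<in> hom C X (Dom C g)" "f \<cdot> h = g \<cdot> k" for X h k
  proof -
    obtain u where "u \<in> Arr C \<and> Dom C u = Dom C h \<and> Cod C u = P \<and> p \<cdot> u = h \<and> q \<cdot> u = k"
      using ex[of h k] \<open>h \<in> _\<close> \<open>k \<in> _\<close> \<open>f \<cdot> h = _\<close> by (auto simp: hom_def)
    then show ?thesis
      by (intro ex1I[of _ u]) (use that in \<open>auto simp: hom_def intro: eq\<close>)
  qed
  then show ?thesis using assms by (auto simp: is_pullback_def hom_def)
qed

lemma coproductD:
  assumes "is_coproduct C A B Q i j"
  shows "A \<in> Obj C" "B \<in> Obj C" "Q \<in> Obj C" "i \<in> Arr C" "j \<in> Arr C"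
    "Dom C i = A" "Dom C j = B" "Cod C i = Q" "Cod C j = Q"
  using assms by (auto simp: is_coproduct_def hom_def)

lemma copair:
  assumes "is_coproduct C A B Q i j" "h \<in> Arr C" "k \<in> Arr C" "Dom C h = A" "Dom C k = B"
    "Cod C k = Cod C h"
  obtains u where "u \<in> Arr C" "Dom C u = Q" "Cod C u = Cod C h" "u \<cdot> i = h" "u \<cdot> j = k"
proof -
  have "h \<in> hom C A (Cod C h)" "k \<in> hom C B (Cod C h)" "Cod C h \<in> Obj C"
    using assms by (auto simp: hom_def)
  then obtain u where "u \<in> hom C Q (Cod C h)" "u \<cdot> i = h" "u \<cdot> j = k"
    using assms(1) unfolding is_coproduct_def by blast
  then show ?thesis using that by (auto simp: hom_def)
qed

lemma coproduct_eqI: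
  assumes "is_coproduct C A B Q i j" "u \<in> Arr C" "v \<in> Arr C" "Dom C u = Q" "Dom C v = Q"
    "Cod C v = Cod C u" "u \<cdot> i = v \<cdot> i" "u \<cdot> j = v \<cdot> j"
  shows "u = v"
proof -
  note [simp] = coproductD[OF assms(1)]
  have univ: "\<forall>X \<in> Obj C. \<forall>h \<in> hom C A X. \<forall>k \<in> hom C B X.
      \<exists>!u. u \<in> hom C Q X \<and> u \<cdot> i = h \<and> u \<cdot> j = k"
    using assms(1) unfolding is_coproduct_def by (elim conjE)
  then have "\<exists>!w. w \<in> hom C Q (Cod C u) \<and> w \<cdot> i = u \<cdot> i \<and> w \<cdot> j = u \<cdot> j"
    using assms(2-) by (intro univ[rule_format]) (simp_all add: hom_def)
  moreover have "u \<in> hom C Q (Cod C u)" "v \<in> hom C Q (Cod C u)" using assms by (auto simp: hom_def)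
  ultimately show ?thesis using assms(7,8) by metis
qed

lemma coproductI:
  assumes "i \<in> Arr C" "j \<in> Arr C" "Dom C i = A" "Dom C j = B" "Cod C i = Q" "Cod C j = Q"
    and ex: "\<And>h k. h \<in> Arr C \<Longrightarrow> k \<in> Arr C \<Longrightarrow> Dom C h = A \<Longrightarrow> Dom C k = B \<Longrightarrow> Cod C k = Cod C h \<Longrightarrow>
      \<exists>u. u \<in> Arr C \<and> Dom C u = Q \<and> Cod C u = Cod C h \<and> u \<cdot> i = h \<and> u \<cdot> j = k"
    and eq: "\<And>u v. u \<in> Arr C \<Longrightarrow> v \<in> Arr C \<Longrightarrow> Dom C u = Q \<Longrightarrow> Dom C v = Q \<Longrightarrow> Cod C v = Cod C u \<Longrightarrow>
      u \<cdot> i = v \<cdot> i \<Longrightarrow> u \<cdot> j = v \<cdot> j \<Longrightarrow> u = v"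
  shows "is_coproduct C A B Q i j"
proof -
  have "\<exists>!u. u \<in> hom C Q X \<and> u \<cdot> i = h \<and> u \<cdot> j = k" if "h \<in> hom C A X" "k \<in> hom C B X" for X h k
  proof -
    obtain u where "u \<in> Arr C \<and> Dom C u = Q \<and> Cod C u = Cod C h \<and> u \<cdot> i = h \<and> u \<cdot> j = k"
      using ex[of h k] \<open>h \<in> _\<close> \<open>k \<in> _\<close> by (auto simp: hom_def)
    then show ?thesis
      by (intro ex1I[of _ u]) (use that in \<open>auto simp: hom_def intro: eq\<close>)
  qed
  then show ?thesis using assms by (auto simp: is_coproduct_def hom_def)
qed

lemma iso_inverse:
  assumes "is_iso C t" "Dom C t = a" "Cod C t = b"
  obtains t' where "t' \<in> Arr C" "Dom C t' = b" "Cod C t' = a" "t' \<cdot> t = Idn C a" "t \<cdot> t' = Idn C b"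
    "is_iso C t'" "\<And>x. x \<in> Arr C \<Longrightarrow> Cod C x = a \<Longrightarrow> t' \<cdot> t \<cdot> x = x"
    "\<And>x. x \<in> Arr C \<Longrightarrow> Cod C x = b \<Longrightarrow> t \<cdot> t' \<cdot> x = x"
proof -
  from assms(1) obtain t' where t': "t \<in> Arr C" "t' \<in> Arr C" "Dom C t' = b" "Cod C t' = a"
    "t' \<cdot> t = Idn C a" "t \<cdot> t' = Idn C b"
    using is_isoE[OF assms(1)] assms(2,3) by metis
  moreover have "is_iso C t'" by (rule is_isoI[of t' t]) (use t' assms in auto)
  moreover have "t' \<cdot> t \<cdot> x = x" if "x \<in> Arr C" "Cod C x = a" for x
    using that t' assms by (simp add: Cmp_eq_Cmp[OF t'(5)])
  moreover have "t \<cdot> t' \<cdot> x = x" if "x \<in> Arr C" "Cod C x = b" for x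
    using that t' assms by (simp add: Cmp_eq_Cmp[OF t'(6)])
  ultimately show ?thesis using that by blast
qed

lemma is_iso_Arr: "is_iso C t \<Longrightarrow> t \<in> Arr C"
  by (simp add: is_iso_def)

lemma coproduct_iso:
  assumes Q: "is_coproduct C A B Q i j" and t: "is_iso C t" "Dom C t = Q"
  shows "is_coproduct C A B (Cod C t) (t \<cdot> i) (t \<cdot> j)"
proof -
  note [simp] = coproductD[OF Q] t(2) is_iso_Arr[OF t(1)]
  from t obtain t' where t': "t' \<in> Arr C" "Dom C t' = Cod C t" "Cod C t' = Q" "t' \<cdot> t = Idn C Q"
    "t \<cdot> t' = Idn C (Cod C t)" "\<And>x. x \<in> Arr C \<Longrightarrow> Cod C x = Q \<Longrightarrow> t' \<cdot> t \<cdot> x = x"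
    using iso_inverse[OF t refl] by metis
  note [simp] = t'
  show ?thesis
  proof (rule coproductI)
    fix h k assume hk: "h \<in> Arr C" "k \<in> Arr C" "Dom C h = A" "Dom C k = B" "Cod C k = Cod C h"
    obtain u where "u \<in> Arr C" "Dom C u = Q" "Cod C u = Cod C h" "u \<cdot> i = h" "u \<cdot> j = k"
      by (rule copair[OF Q hk])
    then show "\<exists>u. u \<in> Arr C \<and> Dom C u = Cod C t \<and> Cod C u = Cod C h \<and> u \<cdot> t \<cdot> i = h \<and> u \<cdot> t \<cdot> j = k"
      by (intro exI[of _ "u \<cdot> t'"]) simp
  next
    fix u v assume uv: "u \<in> Arr C" "v \<in> Arr C" "Dom C u = Cod C t" "Dom C v = Cod C t"
      "Cod C v = Cod C u" "u \<cdot> t \<cdot> i = v \<cdot> t \<cdot> i" "u \<cdot> t \<cdot> j = v \<cdot> t \<cdot> j"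
    have "u \<cdot> t = v \<cdot> t" by (rule coproduct_eqI[OF Q]) (use uv in simp_all)
    then show "u = v" by (rule iso_cancel_right[OF t(1)]) (use uv in simp_all)
  qed simp_all
qed

lemma coproduct_comparison:
  assumes Q: "is_coproduct C A B Q i j" and Q': "is_coproduct C A B Q' i' j'"
  obtains t where "is_iso C t" "t \<in> Arr C" "Dom C t = Q" "Cod C t = Q'" "t \<cdot> i = i'" "t \<cdot> j = j'"
proof -
  note [simp] = coproductD[OF Q] coproductD[OF Q']
  obtain t where t: "t \<in> Arr C" "Dom C t = Q" "Cod C t = Q'" "t \<cdot> i = i'" "t \<cdot> j = j'"
    by (rule copair[OF Q, of i' j']) auto
  obtain s where s: "s \<in> Arr C" "Dom C s = Q'" "Cod C s = Q" "s \<cdot> i' = i" "s \<cdot> j' = j"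
    by (rule copair[OF Q', of i j]) auto
  have "s \<cdot> t = Idn C Q" by (rule coproduct_eqI[OF Q]) (use s t in simp_all)
  moreover have "t \<cdot> s = Idn C Q'" by (rule coproduct_eqI[OF Q']) (use s t in simp_all)
  ultimately have "is_iso C t" using s t by (intro is_isoI[of t s]) auto
  with t show ?thesis using that by blast
qed

lemma coproduct_iso_summands:
  assumes Z: "is_coproduct C X Y Z m n"
    and a: "is_iso C a" "Cod C a = X" and b: "is_iso C b" "Cod C b = Y"
  shows "is_coproduct C (Dom C a) (Dom C b) Z (m \<cdot> a) (n \<cdot> b)"
proof -
  note [simp] = coproductD[OF Z] a(2) is_iso_Arr[OF a(1)] b(2) is_iso_Arr[OF b(1)]
  obtain a' where [simp]: "a' \<in> Arr C" "Dom C a' = X" "Cod C a' = Dom C a" "a' \<cdot> a = Idn C (Dom C a)"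
    "a \<cdot> a' = Idn C X"
    using a iso_inverse by metis
  obtain b' where [simp]: "b' \<in> Arr C" "Dom C b' = Y" "Cod C b' = Dom C b" "b' \<cdot> b = Idn C (Dom C b)"
    "b \<cdot> b' = Idn C Y"
    using b iso_inverse by metis
  show ?thesis
  proof (rule coproductI)
    fix h k assume hk: "h \<in> Arr C" "k \<in> Arr C" "Dom C h = Dom C a" "Dom C k = Dom C b" "Cod C k = Cod C h"
    obtain u where u: "u \<in> Arr C" "Dom C u = Z" "Cod C u = Cod C h" "u \<cdot> m = h \<cdot> a'" "u \<cdot> n = k \<cdot> b'"
      by (rule copair[OF Z, of "h \<cdot> a'" "k \<cdot> b'"]) (use hk in simp_all)
    have "u \<cdot> m \<cdot> a = h" "u \<cdot> n \<cdot> b = k"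
      using u hk by (simp_all add: square_Cmp[OF u(4)] square_Cmp[OF u(5)])
    with u show "\<exists>u. u \<in> Arr C \<and> Dom C u = Z \<and> Cod C u = Cod C h \<and> u \<cdot> m \<cdot> a = h \<and> u \<cdot> n \<cdot> b = k"
      by blast
  next
    fix u v assume uv: "u \<in> Arr C" "v \<in> Arr C" "Dom C u = Z" "Dom C v = Z"
      "Cod C v = Cod C u" "u \<cdot> m \<cdot> a = v \<cdot> m \<cdot> a" "u \<cdot> n \<cdot> b = v \<cdot> n \<cdot> b"
    show "u = v"
    proof (rule coproduct_eqI[OF Z])
      show "u \<cdot> m = v \<cdot> m" by (rule iso_cancel_right[OF a(1)]) (use uv in simp_all)
      show "u \<cdot> n = v \<cdot> n" by (rule iso_cancel_right[OF b(1)]) (use uv in simp_all)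
    qed (use uv in simp_all)
  qed simp_all
qed

lemma pullback_comparison:
  assumes P: "is_pullback C f g P p q" and P': "is_pullback C f g P' p' q'"
  obtains a where "is_iso C a" "a \<in> Arr C" "Dom C a = P" "Cod C a = P'" "p' \<cdot> a = p" "q' \<cdot> a = q"
proof -
  note [simp] = pullbackD[OF P] pullbackD[OF P']
  obtain a where a: "a \<in> Arr C" "Dom C a = P" "Cod C a = P'" "p' \<cdot> a = p" "q' \<cdot> a = q"
    by (rule pullback_lift[OF P', of p q]) auto
  obtain b where b: "b \<in> Arr C" "Dom C b = P'" "Cod C b = P" "p \<cdot> b = p'" "q \<cdot> b = q'"
    by (rule pullback_lift[OF P, of p' q']) auto
  have "b \<cdot> a = Idn C P"
    by (rule pullback_eqI[OF P]) (use a b in \<open>simp_all add: Cmp_eq_Cmp[OF b(4)] Cmp_eq_Cmp[OF b(5)]\<close>)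
  moreover have "a \<cdot> b = Idn C P'"
    by (rule pullback_eqI[OF P']) (use a b in \<open>simp_all add: Cmp_eq_Cmp[OF a(4)] Cmp_eq_Cmp[OF a(5)]\<close>)
  ultimately have "is_iso C a" using a b by (intro is_isoI[of a b]) auto
  with a show ?thesis using that by blast
qed

text \<open>Exchanges the object over \<open>Cod C z\<close> for an isomorphic one;
  \<open>van_kampenI\<close> uses this to pass from one coproduct of two summands to
  another.\<close>

lemma pullback_iso_source:
  assumes P: "is_pullback C i z X x m" and t: "is_iso C t" "Dom C t = Dom C z"
    and z': "z' \<in> Arr C" "Dom C z' = Cod C t" "z' \<cdot> t = z"
  shows "is_pullback C i z' X x (t \<cdot> m)"
proof -
  note [simp] = pullbackD[OF P] is_iso_Arr[OF t(1)] t(2) z'(1,2)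
  have [simp]: "Cod C z' = Cod C i" using z' Cod_Cmp[of t z'] by simp
  obtain t' where t': "t' \<in> Arr C" "Dom C t' = Cod C t" "Cod C t' = Dom C z" "t' \<cdot> t = Idn C (Dom C z)"
    "t \<cdot> t' = Idn C (Cod C t)"
    using t iso_inverse by metis
  note [simp] = t'
  have zt': "z \<cdot> t' = z'"
  proof -
    have "(z' \<cdot> t) \<cdot> t' = z'" by simp
    then show ?thesis unfolding z'(3) .
  qed
  show ?thesis
  proof (rule pullbackI)
    show "i \<cdot> x = z' \<cdot> t \<cdot> m" by (simp add: Cmp_eq_Cmp[OF z'(3)])
  next
    fix h k assume hk: "h \<in> Arr C" "k \<in> Arr C" "Dom C k = Dom C h" "Cod C h = Dom C i"
      "Cod C k = Dom C z'" "i \<cdot> h = z' \<cdot> k"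
    obtain u where u: "u \<in> Arr C" "Dom C u = Dom C h" "Cod C u = X" "x \<cdot> u = h" "m \<cdot> u = t' \<cdot> k"
      by (rule pullback_lift[OF P, of h "t' \<cdot> k"]) (use hk in \<open>simp_all add: Cmp_eq_Cmp[OF zt']\<close>)
    then have "t \<cdot> m \<cdot> u = k" using hk by (simp add: Cmp_eq_Cmp[OF t'(5)])
    with u hk show "\<exists>u. u \<in> Arr C \<and> Dom C u = Dom C h \<and> Cod C u = X \<and> x \<cdot> u = h \<and> (t \<cdot> m) \<cdot> u = k"
      by (intro exI[of _ u]) simp
  next
    fix u v assume uv: "u \<in> Arr C" "v \<in> Arr C" "Dom C v = Dom C u" "Cod C u = X" "Cod C v = X"
      "x \<cdot> u = x \<cdot> v" "(t \<cdot> m) \<cdot> u = (t \<cdot> m) \<cdot> v"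
    have "m \<cdot> u = m \<cdot> v" by (rule iso_cancel_left[OF t(1)]) (use uv in simp_all)
    then show "u = v" by (intro pullback_eqI[OF P, of u v]) (use uv in simp_all)
  qed simp_all
qed

text \<open>An isomorphism can be cancelled, so both cospans have the same commuting
  squares.\<close>

lemma pullback_iso_target:
  assumes "is_iso C t" "f \<in> Arr C" "g \<in> Arr C" "Cod C f = Dom C t" "Cod C g = Dom C t"
  shows "is_pullback C (t \<cdot> f) (t \<cdot> g) P p q \<longleftrightarrow> is_pullback C f g P p q"
proof -
  note [simp] = is_iso_Arr[OF assms(1)] assms(2-)
  have eq: "(t \<cdot> f) \<cdot> h = (t \<cdot> g) \<cdot> k \<longleftrightarrow> f \<cdot> h = g \<cdot> k"
    if "h \<in> hom C X (Dom C f)" "k \<in> hom C X (Dom C g)" for X h k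
    using that iso_cancel_left[OF assms(1), of "f \<cdot> h" "g \<cdot> k"] by (auto simp: hom_def)
  then show ?thesis unfolding is_pullback_def by auto
qed

section \<open>Van Kampen coproducts\<close>

text \<open>From left to right, the summands of a coproduct over \<open>Q\<close> are recovered by
  pulling back along the injections; from right to left, pulling back the injections along an arrow
  into \<open>Q\<close> decomposes its domain. That \<open>Q\<close> is itself a coproduct is kept
  as a separate assumption of the lemmas.\<close>

definition van_kampen :: "'o \<Rightarrow> 'o \<Rightarrow> 'o \<Rightarrow> 'm \<Rightarrow> 'm \<Rightarrow> bool" where
  "van_kampen A B Q i j \<longleftrightarrow>
     (\<forall>X Y Z x y z m n. x \<in> hom C X A \<longrightarrow> y \<in> hom C Y B \<longrightarrow> z \<in> hom C Z Q \<longrightarrow>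
        m \<in> hom C X Z \<longrightarrow> n \<in> hom C Y Z \<longrightarrow> z \<cdot> m = i \<cdot> x \<longrightarrow> z \<cdot> n = j \<cdot> y \<longrightarrow>
        (is_coproduct C X Y Z m n \<longleftrightarrow> is_pullback C i z X x m \<and> is_pullback C j z Y y n))"

lemma van_kampen_iff:
  assumes "van_kampen A B Q i j" "x \<in> Arr C" "y \<in> Arr C" "z \<in> Arr C" "m \<in> Arr C" "n \<in> Arr C"
    "Cod C x = A" "Cod C y = B" "Cod C z = Q" "Dom C m = Dom C x" "Dom C n = Dom C y"
    "Cod C m = Dom C z" "Cod C n = Dom C z" "z \<cdot> m = i \<cdot> x" "z \<cdot> n = j \<cdot> y"
  shows "is_coproduct C (Dom C x) (Dom C y) (Dom C z) m n \<longleftrightarrow>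
    is_pullback C i z (Dom C x) x m \<and> is_pullback C j z (Dom C y) y n"
  using assms(1)[unfolded van_kampen_def hom_def, rule_format, of x "Dom C x" y "Dom C y" z "Dom C z" m n]
    assms(2-) by simp

lemma van_kampenD:
  assumes "van_kampen A B Q i j" "is_coproduct C X Y Z m n"
    "x \<in> Arr C" "y \<in> Arr C" "z \<in> Arr C" "Dom C x = X" "Cod C x = A" "Dom C y = Y" "Cod C y = B"
    "Dom C z = Z" "Cod C z = Q" "z \<cdot> m = i \<cdot> x" "z \<cdot> n = j \<cdot> y"
  shows "is_pullback C i z X x m" "is_pullback C j z Y y n"
proof -
  have "is_pullback C i z X x m \<and> is_pullback C j z Y y n"
    using assms unfolding van_kampen_def hom_def is_coproduct_def by blast
  then show "is_pullback C i z X x m" "is_pullback C j z Y y n" by auto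
qed

lemma van_kampen_coproduct:
  assumes "van_kampen A B Q i j" "is_coproduct C A B Q i j"
    "is_pullback C i z X x m" "is_pullback C j z Y y n"
  shows "is_coproduct C X Y (Dom C z) m n"
  using assms pullbackD[OF assms(3)] pullbackD[OF assms(4)] coproductD[OF assms(2)]
  unfolding van_kampen_def hom_def by (auto)

text \<open>Coproducts and pullbacks are unique up to isomorphism, so each implication has to be
  verified on one representative only: \<open>pb\<close> provides a coproduct of the given summands
  whose squares are pullbacks, and \<open>dec\<close> one decomposition of every arrow into
  \<open>Q\<close>.\<close>

lemma van_kampenI:
  assumes Q: "is_coproduct C A B Q i j"
    and pb: "\<And>x y. x \<in> Arr C \<Longrightarrow> y \<in> Arr C \<Longrightarrow> Cod C x = A \<Longrightarrow> Cod C y = B \<Longrightarrow>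
      \<exists>Z z m n. is_coproduct C (Dom C x) (Dom C y) Z m n \<and> z \<in> Arr C \<and> Dom C z = Z \<and>
        z \<cdot> m = i \<cdot> x \<and> z \<cdot> n = j \<cdot> y \<and> is_pullback C i z (Dom C x) x m \<and> is_pullback C j z (Dom C y) y n"
    and dec: "\<And>z. z \<in> Arr C \<Longrightarrow> Cod C z = Q \<Longrightarrow>
      \<exists>x y m n. x \<in> Arr C \<and> y \<in> Arr C \<and> Cod C x = A \<and> Cod C y = B \<and>
        is_coproduct C (Dom C x) (Dom C y) (Dom C z) m n \<and> z \<cdot> m = i \<cdot> x \<and> z \<cdot> n = j \<cdot> y"
  shows "van_kampen A B Q i j"
proof -
  note [simp] = coproductD[OF Q]
  have PB: "is_pullback C i z X x m \<and> is_pullback C j z Y y n"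
    if xyz [simp]: "x \<in> Arr C" "y \<in> Arr C" "z \<in> Arr C" "Dom C x = X" "Cod C x = A" "Dom C y = Y" "Cod C y = B"
      "Dom C z = Z" "Cod C z = Q" and eq: "z \<cdot> m = i \<cdot> x" "z \<cdot> n = j \<cdot> y"
      and Z: "is_coproduct C X Y Z m n" for X Y Z x y z m n
  proof -
    note [simp] = coproductD[OF Z]
    obtain Z1 z1 m1 n1 where Z1: "is_coproduct C X Y Z1 m1 n1" and z1: "z1 \<in> Arr C" "Dom C z1 = Z1"
      "z1 \<cdot> m1 = i \<cdot> x" "z1 \<cdot> n1 = j \<cdot> y" "is_pullback C i z1 X x m1" "is_pullback C j z1 Y y n1"
      using pb[of x y] by auto
    note [simp] = coproductD[OF Z1]
    obtain t where t: "is_iso C t" "t \<in> Arr C" "Dom C t = Z1" "Cod C t = Z" "t \<cdot> m1 = m" "t \<cdot> n1 = n"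
      by (rule coproduct_comparison[OF Z1 Z])
    have [simp]: "Cod C z1 = Q" using pullbackD(3)[OF z1(5)] by simp
    have "z \<cdot> t = z1"
      by (rule coproduct_eqI[OF Z1]) (use t z1 eq in simp_all)
    then show ?thesis
      using pullback_iso_source[OF z1(5) t(1), of z] pullback_iso_source[OF z1(6) t(1), of z] t z1 by simp
  qed
  have CP: "is_coproduct C X Y Z m n"
    if P: "is_pullback C i z X x m" "is_pullback C j z Y y n" and "Dom C z = Z" for X Y Z x y z m n
  proof -
    note [simp] = pullbackD[OF P(1)] pullbackD[OF P(2)] \<open>Dom C z = Z\<close>
    obtain x1 y1 m1 n1 where x1: "x1 \<in> Arr C" "y1 \<in> Arr C" "Cod C x1 = A" "Cod C y1 = B"
      "is_coproduct C (Dom C x1) (Dom C y1) Z m1 n1" "z \<cdot> m1 = i \<cdot> x1" "z \<cdot> n1 = j \<cdot> y1"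
      using dec[of z] by auto
    \<comment> \<open>The decomposition given by \<open>dec\<close> is a coproduct, so by
      \<open>PB\<close> its squares are pullbacks and can be compared with the given ones.\<close>
    from PB[OF x1(1,2) _ refl x1(3) refl x1(4) _ _ x1(6,7,5)]
    have P1: "is_pullback C i z (Dom C x1) x1 m1" "is_pullback C j z (Dom C y1) y1 n1" by auto
    obtain a where a: "is_iso C a" "Dom C a = X" "Cod C a = Dom C x1" "m1 \<cdot> a = m"
      using pullback_comparison[OF P(1) P1(1)] by metis
    obtain b where b: "is_iso C b" "Dom C b = Y" "Cod C b = Dom C y1" "n1 \<cdot> b = n"
      using pullback_comparison[OF P(2) P1(2)] by metis
    show ?thesis
      using coproduct_iso_summands[OF x1(5) a(1,3) b(1,3)] a b by simp
  qed
  show ?thesis unfolding van_kampen_def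
  proof (intro allI impI iffI)
    fix X Y Z x y z m n
    assume "x \<in> hom C X A" "y \<in> hom C Y B" "z \<in> hom C Z Q" "z \<cdot> m = i \<cdot> x" "z \<cdot> n = j \<cdot> y"
      "is_coproduct C X Y Z m n"
    then show "is_pullback C i z X x m \<and> is_pullback C j z Y y n"
      by (intro PB) (simp_all add: hom_def)
  next
    fix X Y Z x y z m n
    assume "z \<in> hom C Z Q" "is_pullback C i z X x m \<and> is_pullback C j z Y y n"
    then show "is_coproduct C X Y Z m n"
      by (intro CP[of z X x m Y y n]) (simp_all add: hom_def)
  qed
qed

text \<open>Only the target of the cospans changes, by an isomorphism. This makes the property
  independent of the choice hidden in \<open>the_coprods\<close>.\<close>

lemma van_kampen_iso:
  assumes vk: "van_kampen A B Q i j" and Q: "is_coproduct C A B Q i j" and Q': "is_coproduct C A B Q' i' j'"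
  shows "van_kampen A B Q' i' j'"
  unfolding van_kampen_def
proof (intro allI impI)
  fix X Y Z x y z m n
  assume "x \<in> hom C X A" "y \<in> hom C Y B" "z \<in> hom C Z Q'" "m \<in> hom C X Z" "n \<in> hom C Y Z"
  then have [simp]: "x \<in> Arr C" "y \<in> Arr C" "z \<in> Arr C" "m \<in> Arr C" "n \<in> Arr C"
    "Dom C x = X" "Dom C y = Y" "Dom C z = Z" "Dom C m = X" "Dom C n = Y"
    "Cod C x = A" "Cod C y = B" "Cod C z = Q'" "Cod C m = Z" "Cod C n = Z"
    by (auto simp: hom_def)
  assume eq: "z \<cdot> m = i' \<cdot> x" "z \<cdot> n = j' \<cdot> y"
  note [simp] = coproductD[OF Q] coproductD[OF Q']
  obtain t where t: "is_iso C t" "t \<in> Arr C" "Dom C t = Q'" "Cod C t = Q" "t \<cdot> i' = i" "t \<cdot> j' = j"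
    by (rule coproduct_comparison[OF Q' Q])
  have "(t \<cdot> z) \<cdot> m = i \<cdot> x" "(t \<cdot> z) \<cdot> n = j \<cdot> y"
    using t by (simp_all add: eq Cmp_eq_Cmp[OF t(5)] Cmp_eq_Cmp[OF t(6)])
  then have "is_coproduct C X Y Z m n \<longleftrightarrow> is_pullback C i (t \<cdot> z) X x m \<and> is_pullback C j (t \<cdot> z) Y y n"
    using van_kampen_iff[OF vk, of x y "t \<cdot> z" m n] t(1-4) by simp
  then show "is_coproduct C X Y Z m n \<longleftrightarrow> is_pullback C i' z X x m \<and> is_pullback C j' z Y y n"
    using pullback_iso_target[OF t(1), of i' z] pullback_iso_target[OF t(1), of j' z] t by simp
qed

end

section \<open>Slices and products\<close>

lemma slice_simps [simp]:
  "Dom (slice C A) (f, g, h) = f" "Cod (slice C A) (f, g, h) = g"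
  "Idn (slice C A) f = (f, f, Idn C (Dom C f))"
  "Cmp (slice C A) (f', g', h') (f, g, h) = (f, g', h' \<cdot>\<^bsub>C\<^esub> h)"
  "f \<in> Obj (slice C A) \<longleftrightarrow> f \<in> Arr C \<and> Cod C f = A"
  by (auto simp: slice_def)

lemma slice_Arr_iff:
  "(f, g, h) \<in> Arr (slice C A) \<longleftrightarrow> f \<in> Arr C \<and> Cod C f = A \<and> g \<in> Arr C \<and> Cod C g = A \<and>
     h \<in> Arr C \<and> Dom C h = Dom C f \<and> Cod C h = Dom C g \<and> g \<cdot>\<^bsub>C\<^esub> h = f"
  by (auto simp: slice_def hom_def)

lemma (in category) slice_Arr_Cmp:
  assumes "(f, g, h) \<in> Arr (slice C A)" "(g, k, h') \<in> Arr (slice C A)"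
  shows "(f, k, h' \<cdot> h) \<in> Arr (slice C A)"
proof -
  have f: "f \<in> Arr C" "Cod C f = A" "g \<in> Arr C" "Cod C g = A" "h \<in> Arr C" "Dom C h = Dom C f"
    "Cod C h = Dom C g" "g \<cdot> h = f" and k: "k \<in> Arr C" "Cod C k = A" "h' \<in> Arr C"
    "Dom C h' = Dom C g" "Cod C h' = Dom C k" "k \<cdot> h' = g"
    using assms by (auto simp: slice_def hom_def)
  have "k \<cdot> h' \<cdot> h = f" using f k by (simp add: Cmp_eq_Cmp[OF k(6)])
  then show ?thesis using f k by (simp add: slice_def hom_def)
qed

lemma (in category) category_slice:
  assumes "A \<in> Obj C"
  shows "category (slice C A)"
proof
  show "g' \<cdot>\<^bsub>slice C A\<^esub> f' \<in> hom (slice C A) a c"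
    if *: "f' \<in> hom (slice C A) a b" "g' \<in> hom (slice C A) b c" for f' g' a b c
  proof -
    obtain f g h k h' where "f' = (f, g, h)" "g' = (g, k, h')"
      using * by (cases f'; cases g') (auto simp: slice_def hom_def)
    then show ?thesis
      using * slice_Arr_Cmp[of f g h A k h'] by (simp add: hom_def) (auto simp: slice_def)
  qed
qed (simp_all add: hom_def split_paired_all slice_Arr_iff)

lemma category_prod:
  assumes "category C" "category D"
  shows "category (prod_cat C D)"
proof -
  interpret C: category C by fact
  interpret D: category D by fact
  show ?thesis
    by unfold_locales (clarsimp simp: prod_cat_def hom_def)+
qed

lemma (in two_category) slice_Cell_iff:
  "(f, g, \<theta>) \<in> Cell (slice_two_cat K A) \<longleftrightarrow> \<theta> \<in> Cell K \<and> f \<in> Arr K \<and> g \<in> Arr K \<and> Cod K f = A \<and> Cod K g = A \<and>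
     Dom K (Src K \<theta>) = Dom K f \<and> Cod K (Src K \<theta>) = Dom K g \<and> g \<cdot> Src K \<theta> = f \<and> g \<cdot> Trg K \<theta> = f \<and>
     Hc K (Idc K g) \<theta> = Idc K f"
  by (simp add: slice_two_cat_def slice_Arr_iff lwhisk_def) (rule iffI; elim conjE; intro conjI; simp)

lemma slice_two_cat_simps [simp]:
  "Obj (slice_two_cat K A) = Obj (slice K A)" "Arr (slice_two_cat K A) = Arr (slice K A)"
  "Dom (slice_two_cat K A) = Dom (slice K A)" "Cod (slice_two_cat K A) = Cod (slice K A)"
  "Idn (slice_two_cat K A) = Idn (slice K A)" "Cmp (slice_two_cat K A) = Cmp (slice K A)"
  "hom (slice_two_cat K A) = hom (slice K A)"
  "Src (slice_two_cat K A) (f, g, \<theta>) = (f, g, Src K \<theta>)"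
  "Trg (slice_two_cat K A) (f, g, \<theta>) = (f, g, Trg K \<theta>)"
  "Idc (slice_two_cat K A) (f, g, h) = (f, g, Idc K h)"
  "Vc (slice_two_cat K A) (f', g', \<theta>') (f, g, \<theta>) = (f, g, Vc K \<theta>' \<theta>)"
  "Hc (slice_two_cat K A) (f', g', \<theta>') (f, g, \<theta>) = (f, g', Hc K \<theta>' \<theta>)"
  by (auto simp: slice_two_cat_def hom_def fun_eq_iff)

lemma (in two_category) two_category_slice:
  assumes A: "A \<in> Obj K"
  shows "two_category (slice_two_cat K A)"
proof -
  let ?S = "slice_two_cat K A"
  interpret S: category "slice K A" by (rule category_slice[OF A])
  have "category ?S"
    using S.category_axioms by (simp add: category_def)
  moreover have "two_category_axioms ?S"
  proof
    fix \<alpha> \<beta> f g h assume *: "\<alpha> \<in> cells ?S f g" "\<beta> \<in> cells ?S g h"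
    obtain a b \<theta> \<theta>' where ab: "\<alpha> = (a, b, \<theta>)" "\<beta> = (a, b, \<theta>')" "Trg K \<theta> = Src K \<theta>'"
      using * by (cases \<alpha>; cases \<beta>) (auto simp: cells_def)
    show "Vc ?S \<beta> \<alpha> \<in> cells ?S f h"
      using * ab by (auto simp: cells_def slice_Cell_iff Idc_Hc_Vc)
  next
    fix \<alpha> \<beta> f f' g g'
    assume *: "\<alpha> \<in> cells ?S f f'" "\<beta> \<in> cells ?S g g'" "Cod ?S f = Dom ?S g"
    obtain a b c \<theta> \<theta>' where ab: "\<alpha> = (a, b, \<theta>)" "\<beta> = (b, c, \<theta>')"
      using * by (cases \<alpha>; cases \<beta>) (auto simp: cells_def)
    have c: "(a, b, \<theta>) \<in> Cell ?S" "(b, c, \<theta>') \<in> Cell ?S"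
      using * ab by (auto simp: cells_def)
    then have "(a, b, Src K \<theta>) \<in> Arr (slice K A)" "(b, c, Src K \<theta>') \<in> Arr (slice K A)"
      "(a, b, Trg K \<theta>) \<in> Arr (slice K A)" "(b, c, Trg K \<theta>') \<in> Arr (slice K A)"
      by (simp_all add: slice_Cell_iff slice_Arr_iff)
    then have "(a, c, Src K \<theta>' \<cdot> Src K \<theta>) \<in> Arr (slice K A)" "(a, c, Trg K \<theta>' \<cdot> Trg K \<theta>) \<in> Arr (slice K A)"
      by (blast intro: slice_Arr_Cmp)+
    \<comment> \<open>Whiskering \<theta>' by \<open>c\<close> gives the identity of
      \<open>b\<close>, and then whiskering \<theta> by \<open>b\<close> gives the identity of
      \<open>a\<close>; the bracketing of \<open>Hc_assoc_eq\<close> has to be undone for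
      this.\<close>
    moreover have "Hc K (Idc K c) (Hc K \<theta>' \<theta>) = Idc K a"
      using c by (subst Hc_assoc_eq[symmetric]) (auto simp: slice_Cell_iff)
    ultimately have "(a, c, Hc K \<theta>' \<theta>) \<in> Cell ?S"
      using c by (simp add: slice_Cell_iff slice_Arr_iff)
    moreover have "f = (a, b, Src K \<theta>)" "f' = (a, b, Trg K \<theta>)" "g = (b, c, Src K \<theta>')" "g' = (b, c, Trg K \<theta>')"
      using * ab by (simp_all add: cells_def)
    ultimately show "Hc ?S \<beta> \<alpha> \<in> cells ?S (g \<cdot>\<^bsub>?S\<^esub> f) (g' \<cdot>\<^bsub>?S\<^esub> f')"
      using c by (simp add: cells_def ab slice_Cell_iff)
  qed (auto simp: cells_def slice_Cell_iff slice_Arr_iff hom_def interchange_eq)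
  ultimately show ?thesis by (simp add: two_category_def)
qed

lemma two_category_prod:
  assumes "two_category K" "two_category L"
  shows "two_category (prod_two_cat K L)"
proof -
  interpret K: two_category K by fact
  interpret L: two_category L by fact
  have "category (prod_cat K L)" by (intro category_prod) unfold_locales
  then have "category (prod_two_cat K L)"
    by (simp add: category_def prod_two_cat_def hom_def)
  moreover have "two_category_axioms (prod_two_cat K L)"
    by unfold_locales
      (clarsimp simp: prod_two_cat_def prod_cat_def cells_def hom_def K.interchange_eq L.interchange_eq)+
  ultimately show ?thesis by (simp add: two_category_def)
qed

section \<open>The coproduct functor between slices\<close>

lemma prod_cat_simps [simp]:
  "Obj (prod_cat C D) = Obj C \<times> Obj D" "Arr (prod_cat C D) = Arr C \<times> Arr D"
  "Dom (prod_cat C D) (f, g) = (Dom C f, Dom D g)" "Cod (prod_cat C D) (f, g) = (Cod C f, Cod D g)"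
  "Idn (prod_cat C D) (a, b) = (Idn C a, Idn D b)"
  "Cmp (prod_cat C D) (f', g') (f, g) = (f' \<cdot>\<^bsub>C\<^esub> f, g' \<cdot>\<^bsub>D\<^esub> g)"
  by (simp_all add: prod_cat_def)

lemma coprod_func_simps [simp]:
  "OMap (coprod_func C S) (f, g) = sum_arr C S f g"
  "AMap (coprod_func C S) ((f, f', h), (g, g', k)) = (sum_arr C S f g, sum_arr C S f' g', sum_arr C S h k)"
  by (simp_all add: coprod_func_def)

context category
begin

lemma is_iso_slice:
  assumes "f \<in> Arr C" "Cod C f = A" "g \<in> Arr C" "Cod C g = A" "is_iso C t" "Dom C t = Dom C f" "Cod C t = Dom C g"
    "g \<cdot> t = f"
  shows "is_iso (slice C A) (f, g, t)"
proof -
  have [simp]: "t \<in> Arr C" using assms is_iso_Arr by blast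
  obtain t' where t': "t' \<in> Arr C" "Dom C t' = Dom C g" "Cod C t' = Dom C f" "t' \<cdot> t = Idn C (Dom C f)"
    "t \<cdot> t' = Idn C (Dom C g)"
    using iso_inverse[OF assms(5-7)] by metis
  have "f \<cdot> t' = (g \<cdot> t) \<cdot> t'" by (simp only: assms(8))
  also have "\<dots> = g" using t' assms(1-7) by simp
  finally have "(g, f, t') \<in> hom (slice C A) g f" using t' assms by (simp add: hom_def slice_Arr_iff)
  moreover have "(f, g, t) \<in> Arr (slice C A)" using assms by (simp add: slice_Arr_iff)
  ultimately show ?thesis
    unfolding is_iso_def using t' by (auto intro!: bexI[of _ "(g, f, t')"])
qed

lemma initialE:
  assumes "is_initial C Z" "X \<in> Obj C"
  obtains u where "u \<in> Arr C" "Dom C u = Z" "Cod C u = X"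
  using assms unfolding is_initial_def hom_def by auto

lemma initial_eqI:
  assumes "is_initial C Z" "u \<in> Arr C" "v \<in> Arr C" "Dom C u = Z" "Dom C v = Z" "Cod C u = Cod C v"
  shows "u = v"
proof -
  have "\<exists>!w. w \<in> hom C Z (Cod C u)"
    using assms(1) Cod_in[OF assms(2)] unfolding is_initial_def by blast
  moreover have "u \<in> hom C Z (Cod C u)" "v \<in> hom C Z (Cod C u)"
    using assms by (simp_all add: hom_def)
  ultimately show ?thesis by blast
qed

end

text \<open>An arbitrary choice of coproducts, so that the results serve \<open>the_coprods\<close>
  of a category and \<open>the_coprods2\<close> of a 2-category alike.\<close>

locale coprod_choice = category C for C :: "('o, 'm, 'z) cat_scheme" (structure) +
  fixes S :: "('o, 'm) coprods"
  assumes S: "A \<in> Obj C \<Longrightarrow> B \<in> Obj C \<Longrightarrow>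
    is_coproduct C A B (cp_obj S A B) (cp_inl S A B) (cp_inr S A B)"
begin

abbreviation "inl \<equiv> cp_inl S"
abbreviation "inr \<equiv> cp_inr S"

lemmas S_simps [simp] = coproductD(3-)[OF S]

lemma sum_arr_ex1:
  assumes "f \<in> Arr C" "g \<in> Arr C"
  shows "\<exists>!u. u \<in> hom C (cp_obj S (Dom C f) (Dom C g)) (cp_obj S (Cod C f) (Cod C g)) \<and>
        u \<cdot> inl (Dom C f) (Dom C g) = inl (Cod C f) (Cod C g) \<cdot> f \<and>
        u \<cdot> inr (Dom C f) (Dom C g) = inr (Cod C f) (Cod C g) \<cdot> g"
proof -
  note Q = S[OF Dom_in[OF assms(1)] Dom_in[OF assms(2)]]
  obtain u where "u \<in> Arr C" "Dom C u = cp_obj S (Dom C f) (Dom C g)"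
    "Cod C u = cp_obj S (Cod C f) (Cod C g)"
    "u \<cdot> inl (Dom C f) (Dom C g) = inl (Cod C f) (Cod C g) \<cdot> f"
    "u \<cdot> inr (Dom C f) (Dom C g) = inr (Cod C f) (Cod C g) \<cdot> g"
    by (rule copair[OF Q, of "inl (Cod C f) (Cod C g) \<cdot> f" "inr (Cod C f) (Cod C g) \<cdot> g"])
      (use assms in simp_all)
  then show ?thesis
    by (intro ex1I[of _ u]) (auto simp: hom_def intro: coproduct_eqI[OF Q])
qed

lemma sum_arr:
  assumes "f \<in> Arr C" "g \<in> Arr C"
  shows sum_arr_Arr [simp]: "sum_arr C S f g \<in> Arr C"
    and Dom_sum_arr [simp]: "Dom C (sum_arr C S f g) = cp_obj S (Dom C f) (Dom C g)"
    and Cod_sum_arr [simp]: "Cod C (sum_arr C S f g) = cp_obj S (Cod C f) (Cod C g)"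
    and "sum_arr C S f g \<cdot> inl (Dom C f) (Dom C g) = inl (Cod C f) (Cod C g) \<cdot> f"
    and "sum_arr C S f g \<cdot> inr (Dom C f) (Dom C g) = inr (Cod C f) (Cod C g) \<cdot> g"
  using theI'[OF sum_arr_ex1[OF assms]] by (simp_all add: sum_arr_def hom_def)

lemma sum_arr_inl [simp]:
  "f \<in> Arr C \<Longrightarrow> g \<in> Arr C \<Longrightarrow> Dom C f = A \<Longrightarrow> Dom C g = B \<Longrightarrow>
    sum_arr C S f g \<cdot> inl A B = inl (Cod C f) (Cod C g) \<cdot> f"
  and sum_arr_inr [simp]:
  "f \<in> Arr C \<Longrightarrow> g \<in> Arr C \<Longrightarrow> Dom C f = A \<Longrightarrow> Dom C g = B \<Longrightarrow>
    sum_arr C S f g \<cdot> inr A B = inr (Cod C f) (Cod C g) \<cdot> g"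
  using sum_arr(4,5) by blast+

lemma sum_arr_inl_Cmp [simp]:
  "f \<in> Arr C \<Longrightarrow> g \<in> Arr C \<Longrightarrow> Dom C f = A \<Longrightarrow> Dom C g = B \<Longrightarrow> x \<in> Arr C \<Longrightarrow> Cod C x = A \<Longrightarrow>
    sum_arr C S f g \<cdot> inl A B \<cdot> x = inl (Cod C f) (Cod C g) \<cdot> f \<cdot> x"
  by (rule square_Cmp) (auto simp del: Dom_in simp: Dom_in[of f] Dom_in[of g])

lemma sum_arr_inr_Cmp [simp]:
  "f \<in> Arr C \<Longrightarrow> g \<in> Arr C \<Longrightarrow> Dom C f = A \<Longrightarrow> Dom C g = B \<Longrightarrow> x \<in> Arr C \<Longrightarrow> Cod C x = B \<Longrightarrow>
    sum_arr C S f g \<cdot> inr A B \<cdot> x = inr (Cod C f) (Cod C g) \<cdot> g \<cdot> x"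
  by (rule square_Cmp) (auto simp del: Dom_in simp: Dom_in[of f] Dom_in[of g])

lemma sum_arr_eqI:
  assumes "f \<in> Arr C" "g \<in> Arr C" "u \<in> Arr C" "Dom C u = cp_obj S (Dom C f) (Dom C g)"
    "Cod C u = cp_obj S (Cod C f) (Cod C g)"
    "u \<cdot> inl (Dom C f) (Dom C g) = inl (Cod C f) (Cod C g) \<cdot> f"
    "u \<cdot> inr (Dom C f) (Dom C g) = inr (Cod C f) (Cod C g) \<cdot> g"
  shows "sum_arr C S f g = u"
  by (rule coproduct_eqI[OF S[of "Dom C f" "Dom C g"]]) (use assms in simp_all)

lemma sum_arr_Idn: "A \<in> Obj C \<Longrightarrow> B \<in> Obj C \<Longrightarrow> sum_arr C S (Idn C A) (Idn C B) = Idn C (cp_obj S A B)"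
  by (rule sum_arr_eqI) simp_all

lemma sum_arr_Cmp:
  "f \<in> Arr C \<Longrightarrow> g \<in> Arr C \<Longrightarrow> f' \<in> Arr C \<Longrightarrow> g' \<in> Arr C \<Longrightarrow> Cod C f = Dom C f' \<Longrightarrow> Cod C g = Dom C g' \<Longrightarrow>
    sum_arr C S (f' \<cdot> f) (g' \<cdot> g) = sum_arr C S f' g' \<cdot> sum_arr C S f g"
  by (rule sum_arr_eqI) simp_all

lemma sum_arr_triangle:
  assumes "(f, f', h) \<in> Arr (slice C A)" "(g, g', k) \<in> Arr (slice C B)"
  shows "(sum_arr C S f g, sum_arr C S f' g', sum_arr C S h k) \<in> Arr (slice C (cp_obj S A B))"
  using assms sum_arr_Cmp[of h k f' g'] by (simp add: slice_Arr_iff)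

lemma functor_coprod_func:
  assumes "A \<in> Obj C" "B \<in> Obj C"
  shows "is_functor (prod_cat (slice C A) (slice C B)) (slice C (cp_obj S A B)) (coprod_func C S)"
proof -
  let ?P = "prod_cat (slice C A) (slice C B)" and ?Q = "slice C (cp_obj S A B)"
  show ?thesis
    unfolding is_functor_def
  proof (intro conjI ballI impI)
    fix a assume "a \<in> Obj ?P"
    then show "OMap (coprod_func C S) a \<in> Obj ?Q"
      "AMap (coprod_func C S) (Idn ?P a) = Idn ?Q (OMap (coprod_func C S) a)"
      by (cases a; simp add: sum_arr_Idn)+
  next
    fix u assume "u \<in> Arr ?P"
    then show "AMap (coprod_func C S) u \<in> hom ?Q (OMap (coprod_func C S) (Dom ?P u)) (OMap (coprod_func C S) (Cod ?P u))"
      by (cases u) (simp add: hom_def sum_arr_triangle split_paired_all)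
  next
    fix u v assume uv: "u \<in> Arr ?P" "v \<in> Arr ?P" "Cod ?P u = Dom ?P v"
    then obtain f f' f'' h h' g g' g'' k k' where eq: "u = ((f, f', h), (g, g', k))" "v = ((f', f'', h'), (g', g'', k'))"
      by (cases u; cases v) (simp add: split_paired_all)
    then have "sum_arr C S (h' \<cdot> h) (k' \<cdot> k) = sum_arr C S h' k' \<cdot> sum_arr C S h k"
      using uv by (intro sum_arr_Cmp) (simp_all add: slice_Arr_iff)
    then show "AMap (coprod_func C S) (v \<cdot>\<^bsub>?P\<^esub> u) = AMap (coprod_func C S) v \<cdot>\<^bsub>?Q\<^esub> AMap (coprod_func C S) u"
      using eq by simp
  qed
qed

context
  fixes A B
  assumes A [simp]: "A \<in> Obj C" and B [simp]: "B \<in> Obj C"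
begin

text \<open>The injections into the target sum form pullback squares over those of \<open>A\<close>
  and \<open>B\<close>. Hence an arrow \<open>w\<close> between sums over the base, restricted to a
  summand of its source, factors uniquely through the corresponding summand of its target.\<close>

lemma fully_faithful_coprod_func:
  assumes vk: "van_kampen A B (cp_obj S A B) (inl A B) (inr A B)"
  shows "fully_faithful (prod_cat (slice C A) (slice C B)) (slice C (cp_obj S A B)) (coprod_func C S)"
  unfolding fully_faithful_def
proof (intro ballI)
  fix a b t
  assume "a \<in> Obj (prod_cat (slice C A) (slice C B))" "b \<in> Obj (prod_cat (slice C A) (slice C B))"
    and t: "t \<in> hom (slice C (cp_obj S A B)) (OMap (coprod_func C S) a) (OMap (coprod_func C S) b)"
  then obtain f g f' g' where ab: "a = (f, g)" "b = (f', g')"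
    and f [simp]: "f \<in> Arr C" "Cod C f = A" "g \<in> Arr C" "Cod C g = B"
      "f' \<in> Arr C" "Cod C f' = A" "g' \<in> Arr C" "Cod C g' = B"
    by (cases a; cases b) auto
  obtain w where w: "t = (sum_arr C S f g, sum_arr C S f' g', w)"
    "w \<in> Arr C" "Dom C w = cp_obj S (Dom C f) (Dom C g)" "Cod C w = cp_obj S (Dom C f') (Dom C g')"
    "sum_arr C S f' g' \<cdot> w = sum_arr C S f g"
    using t ab by (cases t) (simp add: hom_def slice_Arr_iff)
  note [simp] = w(2-4) and w5 = Cmp_eq_Cmp[OF w(5)]
  note Q = S[of "Dom C f'" "Dom C g'"]
  have P: "is_pullback C (inl A B) (sum_arr C S f' g') (Dom C f') f' (inl (Dom C f') (Dom C g'))"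
    "is_pullback C (inr A B) (sum_arr C S f' g') (Dom C g') g' (inr (Dom C f') (Dom C g'))"
    using van_kampenD[OF vk Q, of f' g' "sum_arr C S f' g'"] by simp_all
  obtain h where h: "h \<in> Arr C" "Dom C h = Dom C f" "Cod C h = Dom C f'" "f' \<cdot> h = f"
    "inl (Dom C f') (Dom C g') \<cdot> h = w \<cdot> inl (Dom C f) (Dom C g)"
    by (rule pullback_lift[OF P(1), of f "w \<cdot> inl (Dom C f) (Dom C g)"]) (simp_all add: w5)
  obtain k where k: "k \<in> Arr C" "Dom C k = Dom C g" "Cod C k = Dom C g'" "g' \<cdot> k = g"
    "inr (Dom C f') (Dom C g') \<cdot> k = w \<cdot> inr (Dom C f) (Dom C g)"
    by (rule pullback_lift[OF P(2), of g "w \<cdot> inr (Dom C f) (Dom C g)"]) (simp_all add: w5)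
  have hk: "sum_arr C S h k = w"
    by (rule sum_arr_eqI) (use h k in simp_all)
  show "\<exists>!u. u \<in> hom (prod_cat (slice C A) (slice C B)) a b \<and> AMap (coprod_func C S) u = t"
  proof (rule ex1I[of _ "((f, f', h), (g, g', k))"])
    show "((f, f', h), (g, g', k)) \<in> hom (prod_cat (slice C A) (slice C B)) a b \<and>
      AMap (coprod_func C S) ((f, f', h), (g, g', k)) = t"
      using h k ab w hk by (simp add: hom_def slice_Arr_iff)
  next
    fix u assume u: "u \<in> hom (prod_cat (slice C A) (slice C B)) a b \<and> AMap (coprod_func C S) u = t"
    then obtain h' k' where u': "u = ((f, f', h'), (g, g', k'))" "h' \<in> Arr C" "Dom C h' = Dom C f"
      "Cod C h' = Dom C f'" "f' \<cdot> h' = f" "k' \<in> Arr C" "Dom C k' = Dom C g" "Cod C k' = Dom C g'" "g' \<cdot> k' = g"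
      and w': "sum_arr C S h' k' = w"
      using ab w(1) by (cases u) (auto simp: hom_def slice_Arr_iff)
    have "inl (Dom C f') (Dom C g') \<cdot> h' = w \<cdot> inl (Dom C f) (Dom C g)"
      "inr (Dom C f') (Dom C g') \<cdot> k' = w \<cdot> inr (Dom C f) (Dom C g)"
      unfolding w'[symmetric] using u' by simp_all
    then have "h' = h" "k' = k"
      using h k u' pullback_eqI[OF P(1), of h' h] pullback_eqI[OF P(2), of k' k] by simp_all
    then show "u = ((f, f', h), (g, g', k))" using u' by simp
  qed
qed

end

text \<open>Pulling \<open>z\<close> back along both injections decomposes its domain.\<close>

lemma ess_surjective_coprod_func:
  assumes [simp]: "A \<in> Obj C" "B \<in> Obj C" and pb: "has_pullbacks C"
    and vk: "van_kampen A B (cp_obj S A B) (inl A B) (inr A B)"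
  shows "ess_surjective (prod_cat (slice C A) (slice C B)) (slice C (cp_obj S A B)) (coprod_func C S)"
  unfolding ess_surjective_def
proof
  fix z assume "z \<in> Obj (slice C (cp_obj S A B))"
  then have [simp]: "z \<in> Arr C" "Cod C z = cp_obj S A B" by simp_all
  obtain X x m where P: "is_pullback C (inl A B) z X x m"
    using pb unfolding has_pullbacks_def by (metis S_simps(2,6) \<open>z \<in> Arr C\<close> \<open>Cod C z = _\<close> assms(1,2))
  obtain Y y n where P': "is_pullback C (inr A B) z Y y n"
    using pb unfolding has_pullbacks_def by (metis S_simps(3,7) \<open>z \<in> Arr C\<close> \<open>Cod C z = _\<close> assms(1,2))
  note [simp] = pullbackD[OF P] pullbackD[OF P']
  obtain t where t: "is_iso C t" "t \<in> Arr C" "Dom C t = cp_obj S X Y" "Cod C t = Dom C z"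
    "t \<cdot> inl X Y = m" "t \<cdot> inr X Y = n"
    by (rule coproduct_comparison[OF S[of X Y] van_kampen_coproduct[OF vk S[of A B] P P']]) auto
  have zt: "sum_arr C S x y = z \<cdot> t"
    by (rule sum_arr_eqI) (use t in simp_all)
  have "is_iso (slice C (cp_obj S A B)) (sum_arr C S x y, z, t)"
    using t zt[symmetric] by (intro is_iso_slice) simp_all
  moreover have "(sum_arr C S x y, z, t) \<in> hom (slice C (cp_obj S A B)) (OMap (coprod_func C S) (x, y)) z"
    using t zt[symmetric] by (simp add: hom_def slice_Arr_iff)
  moreover have "(x, y) \<in> Obj (prod_cat (slice C A) (slice C B))"
    by simp
  ultimately show "\<exists>a \<in> Obj (prod_cat (slice C A) (slice C B)).
      \<exists>e \<in> hom (slice C (cp_obj S A B)) (OMap (coprod_func C S) a) z. is_iso (slice C (cp_obj S A B)) e"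
    by blast
qed

text \<open>The two conditions of \<open>van_kampenI\<close> match the two halves of an equivalence:
  the squares of a sum \<open>x + y\<close> are pullbacks by full faithfulness, and arrows into the
  coproduct decompose by essential surjectivity.\<close>

lemma van_kampen_if_equivalence:
  assumes A [simp]: "A \<in> Obj C" and B [simp]: "B \<in> Obj C" and Z: "is_initial C Z0"
    and eq: "is_equivalence (prod_cat (slice C A) (slice C B)) (slice C (cp_obj S A B)) (coprod_func C S)"
  shows "van_kampen A B (cp_obj S A B) (inl A B) (inr A B)"
proof -
  let ?P = "prod_cat (slice C A) (slice C B)" and ?Q = "slice C (cp_obj S A B)"
  have Z0 [simp]: "Z0 \<in> Obj C" using Z by (simp add: is_initial_def)
  have catP: "category ?P" and catQ: "category ?Q"
    using category_slice[OF A] category_slice[OF B] category_slice[of "cp_obj S A B"]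
    by (simp_all add: category_prod)
  have ff: "fully_faithful ?P ?Q (coprod_func C S)"
    by (rule is_equivalence_fully_faithful[OF catP catQ eq])
  \<comment> \<open>Full faithfulness spelled out in the category itself. The two components of a
    lift of \<open>w\<close> are packed into one pair \<open>p\<close>, so that their uniqueness is
    a single statement.\<close>
  have unique: "\<exists>!p. fst p \<in> Arr C \<and> Dom C (fst p) = Dom C f \<and> Cod C (fst p) = Dom C f' \<and> f' \<cdot> fst p = f \<and>
      snd p \<in> Arr C \<and> Dom C (snd p) = Dom C g \<and> Cod C (snd p) = Dom C g' \<and> g' \<cdot> snd p = g \<and>
      inl (Dom C f') (Dom C g') \<cdot> fst p = w \<cdot> inl (Dom C f) (Dom C g) \<and>
      inr (Dom C f') (Dom C g') \<cdot> snd p = w \<cdot> inr (Dom C f) (Dom C g)"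
    if [simp]: "f \<in> Arr C" "Cod C f = A" "g \<in> Arr C" "Cod C g = B" "f' \<in> Arr C" "Cod C f' = A" "g' \<in> Arr C"
      "Cod C g' = B" "w \<in> Arr C" "Dom C w = cp_obj S (Dom C f) (Dom C g)"
      "Cod C w = cp_obj S (Dom C f') (Dom C g')" and w: "sum_arr C S f' g' \<cdot> w = sum_arr C S f g" for f g f' g' w
  proof -
    have eqw: "sum_arr C S h k = w \<longleftrightarrow> inl (Dom C f') (Dom C g') \<cdot> h = w \<cdot> inl (Dom C f) (Dom C g) \<and>
        inr (Dom C f') (Dom C g') \<cdot> k = w \<cdot> inr (Dom C f) (Dom C g)"
      if hk: "h \<in> Arr C" "Dom C h = Dom C f" "Cod C h = Dom C f'" "k \<in> Arr C" "Dom C k = Dom C g"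
        "Cod C k = Dom C g'" for h k
    proof
      assume "sum_arr C S h k = w"
      then show "inl (Dom C f') (Dom C g') \<cdot> h = w \<cdot> inl (Dom C f) (Dom C g) \<and>
        inr (Dom C f') (Dom C g') \<cdot> k = w \<cdot> inr (Dom C f) (Dom C g)"
        using hk sum_arr_inl[of h k] sum_arr_inr[of h k] by metis
    qed (use hk in \<open>auto intro!: sum_arr_eqI\<close>)
    have "(f, g) \<in> Obj ?P" "(f', g') \<in> Obj ?P" and
      "(sum_arr C S f g, sum_arr C S f' g', w) \<in> hom ?Q (OMap (coprod_func C S) (f, g)) (OMap (coprod_func C S) (f', g'))"
      using w by (simp_all add: hom_def slice_Arr_iff)
    then have "\<exists>!u. u \<in> hom ?P (f, g) (f', g') \<and> AMap (coprod_func C S) u = (sum_arr C S f g, sum_arr C S f' g', w)"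
      using ff unfolding fully_faithful_def by blast
    then obtain u where u: "u \<in> hom ?P (f, g) (f', g')" "AMap (coprod_func C S) u = (sum_arr C S f g, sum_arr C S f' g', w)"
      and u': "\<And>v. v \<in> hom ?P (f, g) (f', g') \<Longrightarrow> AMap (coprod_func C S) v = (sum_arr C S f g, sum_arr C S f' g', w) \<Longrightarrow> v = u"
      by blast
    from u obtain h k where hk: "u = ((f, f', h), (g, g', k))" "h \<in> Arr C" "Dom C h = Dom C f" "Cod C h = Dom C f'"
      "f' \<cdot> h = f" "k \<in> Arr C" "Dom C k = Dom C g" "Cod C k = Dom C g'" "g' \<cdot> k = g" "sum_arr C S h k = w"
      by (cases u) (auto simp: hom_def slice_Arr_iff)
    have uniq: "p = (h, k)"
      if "fst p \<in> Arr C" "Dom C (fst p) = Dom C f" "Cod C (fst p) = Dom C f'" "f' \<cdot> fst p = f"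
        "snd p \<in> Arr C" "Dom C (snd p) = Dom C g" "Cod C (snd p) = Dom C g'" "g' \<cdot> snd p = g"
        "inl (Dom C f') (Dom C g') \<cdot> fst p = w \<cdot> inl (Dom C f) (Dom C g)"
        "inr (Dom C f') (Dom C g') \<cdot> snd p = w \<cdot> inr (Dom C f) (Dom C g)" for p
      using u'[of "((f, f', fst p), (g, g', snd p))"] that eqw[of "fst p" "snd p"] hk(1)
      by (simp add: hom_def slice_Arr_iff prod_eq_iff)
    show ?thesis
      by (rule ex1I[of _ "(h, k)"]) (use hk eqw[of h k] uniq in auto)
  qed
  have pb: "is_pullback C (inl A B) (sum_arr C S x y) (Dom C x) x (inl (Dom C x) (Dom C y))"
    and pb': "is_pullback C (inr A B) (sum_arr C S x y) (Dom C y) y (inr (Dom C x) (Dom C y))"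
    if [simp]: "x \<in> Arr C" "y \<in> Arr C" "Cod C x = A" "Cod C y = B" for x y
  proof -
    show "is_pullback C (inl A B) (sum_arr C S x y) (Dom C x) x (inl (Dom C x) (Dom C y))"
    proof (rule pullbackI)
      fix h k assume hk: "h \<in> Arr C" "k \<in> Arr C" "Dom C k = Dom C h" "Cod C h = Dom C (inl A B)"
        "Cod C k = Dom C (sum_arr C S x y)" "inl A B \<cdot> h = sum_arr C S x y \<cdot> k"
      \<comment> \<open>The pair \<open>h\<close>, \<open>k\<close> tests the left square only. The
        arrows \<open>b\<close> and \<open>d\<close> out of the initial object serve as right
        components, so that \<open>w\<close> becomes an arrow of the slice from \<open>h + b\<close>
        to \<open>x + y\<close>.\<close>
      obtain b where b [simp]: "b \<in> Arr C" "Dom C b = Z0" "Cod C b = B" using initialE[OF Z B] .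
      obtain d where d [simp]: "d \<in> Arr C" "Dom C d = Z0" "Cod C d = cp_obj S (Dom C x) (Dom C y)"
        using initialE[OF Z, of "cp_obj S (Dom C x) (Dom C y)"] by auto
      obtain w where w [simp]: "w \<in> Arr C" "Dom C w = cp_obj S (Dom C h) Z0" "Cod C w = cp_obj S (Dom C x) (Dom C y)"
        "w \<cdot> inl (Dom C h) Z0 = k" "w \<cdot> inr (Dom C h) Z0 = d"
        by (rule copair[OF S[of "Dom C h" Z0], of k d]) (use hk in simp_all)
      have "sum_arr C S x y \<cdot> w = sum_arr C S h b"
      proof (rule sym, rule sum_arr_eqI)
        show "(sum_arr C S x y \<cdot> w) \<cdot> inr (Dom C h) (Dom C b) = inr (Cod C h) (Cod C b) \<cdot> b"
          by (rule initial_eqI[OF Z]) (use hk in simp_all)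
      qed (use hk in simp_all)
      then show "\<exists>u. u \<in> Arr C \<and> Dom C u = Dom C h \<and> Cod C u = Dom C x \<and> x \<cdot> u = h \<and> inl (Dom C x) (Dom C y) \<cdot> u = k"
        using unique[of h b x y w] hk by auto
    next
      fix u v assume uv: "u \<in> Arr C" "v \<in> Arr C" "Dom C v = Dom C u" "Cod C u = Dom C x" "Cod C v = Dom C x"
        "x \<cdot> u = x \<cdot> v" "inl (Dom C x) (Dom C y) \<cdot> u = inl (Dom C x) (Dom C y) \<cdot> v"
      obtain d where d [simp]: "d \<in> Arr C" "Dom C d = Z0" "Cod C d = Dom C y"
        using initialE[OF Z, of "Dom C y"] by auto
      \<comment> \<open>Both \<open>(u, d)\<close> and \<open>(v, d)\<close> are lifts of the same
        arrow \<open>u + d\<close>.\<close>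
      have "\<exists>!p. fst p \<in> Arr C \<and> Dom C (fst p) = Dom C (x \<cdot> u) \<and> Cod C (fst p) = Dom C x \<and> x \<cdot> fst p = x \<cdot> u \<and>
        snd p \<in> Arr C \<and> Dom C (snd p) = Dom C (y \<cdot> d) \<and> Cod C (snd p) = Dom C y \<and> y \<cdot> snd p = y \<cdot> d \<and>
        inl (Dom C x) (Dom C y) \<cdot> fst p = sum_arr C S u d \<cdot> inl (Dom C (x \<cdot> u)) (Dom C (y \<cdot> d)) \<and>
        inr (Dom C x) (Dom C y) \<cdot> snd p = sum_arr C S u d \<cdot> inr (Dom C (x \<cdot> u)) (Dom C (y \<cdot> d))"
        by (rule unique) (use uv in \<open>simp_all add: sum_arr_Cmp[symmetric]\<close>)
      then have "(u, d) = (v, d)"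
        by (rule ex1E) (use uv in \<open>smt (verit) Dom_Cmp d(1-3) fst_conv snd_conv sum_arr_inl sum_arr_inr that(1-2)\<close>)
      then show "u = v" by simp
    qed simp_all
    show "is_pullback C (inr A B) (sum_arr C S x y) (Dom C y) y (inr (Dom C x) (Dom C y))"
    proof (rule pullbackI)
      fix h k assume hk: "h \<in> Arr C" "k \<in> Arr C" "Dom C k = Dom C h" "Cod C h = Dom C (inr A B)"
        "Cod C k = Dom C (sum_arr C S x y)" "inr A B \<cdot> h = sum_arr C S x y \<cdot> k"
      obtain b where b [simp]: "b \<in> Arr C" "Dom C b = Z0" "Cod C b = A" using initialE[OF Z A] .
      obtain d where d [simp]: "d \<in> Arr C" "Dom C d = Z0" "Cod C d = cp_obj S (Dom C x) (Dom C y)"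
        using initialE[OF Z, of "cp_obj S (Dom C x) (Dom C y)"] by auto
      obtain w where w [simp]: "w \<in> Arr C" "Dom C w = cp_obj S Z0 (Dom C h)" "Cod C w = cp_obj S (Dom C x) (Dom C y)"
        "w \<cdot> inl Z0 (Dom C h) = d" "w \<cdot> inr Z0 (Dom C h) = k"
        by (rule copair[OF S[of Z0 "Dom C h"], of d k]) (use hk in simp_all)
      have "sum_arr C S x y \<cdot> w = sum_arr C S b h"
      proof (rule sym, rule sum_arr_eqI)
        show "(sum_arr C S x y \<cdot> w) \<cdot> inl (Dom C b) (Dom C h) = inl (Cod C b) (Cod C h) \<cdot> b"
          by (rule initial_eqI[OF Z]) (use hk in simp_all)
      qed (use hk in simp_all)
      then show "\<exists>u. u \<in> Arr C \<and> Dom C u = Dom C h \<and> Cod C u = Dom C y \<and> y \<cdot> u = h \<and> inr (Dom C x) (Dom C y) \<cdot> u = k"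
        using unique[of b h x y w] hk by auto
    next
      fix u v assume uv: "u \<in> Arr C" "v \<in> Arr C" "Dom C v = Dom C u" "Cod C u = Dom C y" "Cod C v = Dom C y"
        "y \<cdot> u = y \<cdot> v" "inr (Dom C x) (Dom C y) \<cdot> u = inr (Dom C x) (Dom C y) \<cdot> v"
      obtain d where d [simp]: "d \<in> Arr C" "Dom C d = Z0" "Cod C d = Dom C x"
        using initialE[OF Z, of "Dom C x"] by auto
      have "\<exists>!p. fst p \<in> Arr C \<and> Dom C (fst p) = Dom C (x \<cdot> d) \<and> Cod C (fst p) = Dom C x \<and> x \<cdot> fst p = x \<cdot> d \<and>
        snd p \<in> Arr C \<and> Dom C (snd p) = Dom C (y \<cdot> u) \<and> Cod C (snd p) = Dom C y \<and> y \<cdot> snd p = y \<cdot> u \<and>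
        inl (Dom C x) (Dom C y) \<cdot> fst p = sum_arr C S d u \<cdot> inl (Dom C (x \<cdot> d)) (Dom C (y \<cdot> u)) \<and>
        inr (Dom C x) (Dom C y) \<cdot> snd p = sum_arr C S d u \<cdot> inr (Dom C (x \<cdot> d)) (Dom C (y \<cdot> u))"
        by (rule unique) (use uv in \<open>simp_all add: sum_arr_Cmp[symmetric]\<close>)
      then have "(d, u) = (d, v)"
        by (rule ex1E) (use uv in \<open>smt (verit) Dom_Cmp d(1-3) fst_conv snd_conv sum_arr_inl sum_arr_inr that(1-2)\<close>)
      then show "u = v" by simp
    qed simp_all
  qed
  show ?thesis
  proof (rule van_kampenI[OF S])
    fix x y assume [simp]: "x \<in> Arr C" "y \<in> Arr C" "Cod C x = A" "Cod C y = B"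
    show "\<exists>Z z m n. is_coproduct C (Dom C x) (Dom C y) Z m n \<and> z \<in> Arr C \<and> Dom C z = Z \<and>
        z \<cdot> m = inl A B \<cdot> x \<and> z \<cdot> n = inr A B \<cdot> y \<and> is_pullback C (inl A B) z (Dom C x) x m \<and>
        is_pullback C (inr A B) z (Dom C y) y n"
      using S[of "Dom C x" "Dom C y"] pb[of x y] pb'[of x y]
      by (intro exI[of _ "cp_obj S (Dom C x) (Dom C y)"] exI[of _ "sum_arr C S x y"]
        exI[of _ "inl (Dom C x) (Dom C y)"] exI[of _ "inr (Dom C x) (Dom C y)"]) simp
  next
    fix z assume z [simp]: "z \<in> Arr C" "Cod C z = cp_obj S A B"
    then have "z \<in> Obj ?Q" by simp
    then obtain a e where "a \<in> Obj ?P" "e \<in> hom ?Q (OMap (coprod_func C S) a) z" "is_iso ?Q e"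
      using is_equivalence_ess_surjective[OF eq] unfolding ess_surjective_def by blast
    then obtain x y where x [simp]: "x \<in> Arr C" "y \<in> Arr C" "Cod C x = A" "Cod C y = B" "a = (x, y)"
      and e: "e \<in> hom ?Q (sum_arr C S x y) z" "is_iso ?Q e"
      by (cases a) auto
    from e obtain t where iso: "is_iso ?Q (sum_arr C S x y, z, t)"
      and t: "(sum_arr C S x y, z, t) \<in> Arr ?Q"
      by (cases e) (simp add: hom_def)
    then have t: "t \<in> Arr C" "Dom C t = cp_obj S (Dom C x) (Dom C y)" "Cod C t = Dom C z" "z \<cdot> t = sum_arr C S x y"
      by (simp_all add: slice_Arr_iff)
    \<comment> \<open>An isomorphism of the slice has an invertible underlying arrow, along which
      the coproduct can be moved to the domain of \<open>z\<close>.\<close>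
    from iso obtain q where q: "q \<in> hom ?Q z (sum_arr C S x y)"
      "q \<cdot>\<^bsub>?Q\<^esub> (sum_arr C S x y, z, t) = Idn ?Q (sum_arr C S x y)"
      "(sum_arr C S x y, z, t) \<cdot>\<^bsub>?Q\<^esub> q = Idn ?Q z"
      unfolding is_iso_def by (simp only: slice_simps) blast
    then obtain t' where "q = (z, sum_arr C S x y, t')"
      by (cases q) (simp add: hom_def)
    with q t have "is_iso C t"
      by (intro is_isoI[of t t']) (simp_all add: hom_def slice_Arr_iff)
    then have "is_coproduct C (Dom C x) (Dom C y) (Dom C z) (t \<cdot> inl (Dom C x) (Dom C y)) (t \<cdot> inr (Dom C x) (Dom C y))"
      using coproduct_iso[OF S[of "Dom C x" "Dom C y"], of t] t by simp
    moreover have "z \<cdot> t \<cdot> inl (Dom C x) (Dom C y) = inl A B \<cdot> x" "z \<cdot> t \<cdot> inr (Dom C x) (Dom C y) = inr A B \<cdot> y"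
      using t by (simp_all add: Cmp_eq_Cmp[OF t(4)])
    ultimately show "\<exists>x y m n. x \<in> Arr C \<and> y \<in> Arr C \<and> Cod C x = A \<and> Cod C y = B \<and>
        is_coproduct C (Dom C x) (Dom C y) (Dom C z) m n \<and> z \<cdot> m = inl A B \<cdot> x \<and> z \<cdot> n = inr A B \<cdot> y"
      using x(1-4) by blast
  qed simp_all
qed

end

lemma (in category) coprod_choice_the_coprods:
  assumes "has_finite_coproducts C"
  shows "coprod_choice C (the_coprods C)"
proof
  fix A B assume "A \<in> Obj C" "B \<in> Obj C"
  then have "\<exists>p. case p of (Q, i, j) \<Rightarrow> is_coproduct C A B Q i j"
    using assms unfolding has_finite_coproducts_def by fastforce
  then have "case the_coprods C A B of (Q, i, j) \<Rightarrow> is_coproduct C A B Q i j"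
    unfolding the_coprods_def by (rule someI_ex)
  then show "is_coproduct C A B (cp_obj (the_coprods C) A B) (cp_inl (the_coprods C) A B) (cp_inr (the_coprods C) A B)"
    by (simp add: split_beta)
qed

text \<open>A single van Kampen coproduct for each pair is enough, since \<open>the_coprods\<close>
  picks an isomorphic one.\<close>

lemma extensiveI:
  assumes C: "category C" "has_pullbacks C" "has_finite_coproducts C"
    and vk: "\<And>A B. A \<in> Obj C \<Longrightarrow> B \<in> Obj C \<Longrightarrow>
      \<exists>Q i j. is_coproduct C A B Q i j \<and> category.van_kampen C A B Q i j"
  shows "extensive C"
proof -
  interpret category C by fact
  interpret coprod_choice C "the_coprods C" by (rule coprod_choice_the_coprods) fact
  have "is_equivalence (prod_cat (slice C A) (slice C B)) (slice C (cp_obj (the_coprods C) A B)) (coprod_func C (the_coprods C))"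
    if AB: "A \<in> Obj C" "B \<in> Obj C" for A B
  proof (rule is_equivalenceI)
    obtain Q i j where Q: "is_coproduct C A B Q i j" "van_kampen A B Q i j"
      using vk AB by blast
    have vk': "van_kampen A B (cp_obj (the_coprods C) A B) (inl A B) (inr A B)"
      by (rule van_kampen_iso[OF Q(2,1) S[OF AB]])
    show "fully_faithful (prod_cat (slice C A) (slice C B)) (slice C (cp_obj (the_coprods C) A B)) (coprod_func C (the_coprods C))"
      by (rule fully_faithful_coprod_func[OF AB vk'])
    show "ess_surjective (prod_cat (slice C A) (slice C B)) (slice C (cp_obj (the_coprods C) A B)) (coprod_func C (the_coprods C))"
      by (rule ess_surjective_coprod_func[OF AB C(2) vk'])
  qed (use AB in \<open>simp_all add: functor_coprod_func category_prod category_slice\<close>)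
  with C show ?thesis by (simp add: extensive_def)
qed

lemma extensive_van_kampen:
  assumes ext: "extensive C" and Q: "is_coproduct C A B Q i j"
  shows "category.van_kampen C A B Q i j"
proof -
  interpret category C using ext by (simp add: extensive_def)
  interpret coprod_choice C "the_coprods C"
    by (rule coprod_choice_the_coprods) (use ext in \<open>simp add: extensive_def\<close>)
  obtain Z0 where Z0: "is_initial C Z0"
    using ext unfolding extensive_def has_finite_coproducts_def by blast
  note AB = coproductD(1,2)[OF Q]
  have "van_kampen A B (cp_obj (the_coprods C) A B) (inl A B) (inr A B)"
    by (rule van_kampen_if_equivalence[OF AB Z0]) (use ext AB in \<open>simp add: extensive_def\<close>)
  then show ?thesis by (rule van_kampen_iso[OF _ S[OF AB] Q])
qed

section \<open>The coproduct 2-functor between slices\<close>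

context two_category
begin

lemma coproduct2_ex:
  assumes "is_coproduct2 K A B Q i j" "u \<in> Arr K" "v \<in> Arr K" "Dom K u = Q" "Dom K v = Q" "Cod K v = Cod K u"
    "\<alpha> \<in> Cell K" "Src K \<alpha> = u \<cdot> i" "Trg K \<alpha> = v \<cdot> i" "\<beta> \<in> Cell K" "Src K \<beta> = u \<cdot> j" "Trg K \<beta> = v \<cdot> j"
  obtains \<theta> where "\<theta> \<in> Cell K" "Src K \<theta> = u" "Trg K \<theta> = v" "Hc K \<theta> (Idc K i) = \<alpha>" "Hc K \<theta> (Idc K j) = \<beta>"
proof -
  have "u \<in> hom K Q (Cod K u)" "v \<in> hom K Q (Cod K u)" "\<alpha> \<in> cells K (u \<cdot> i) (v \<cdot> i)"
    "\<beta> \<in> cells K (u \<cdot> j) (v \<cdot> j)" "Cod K u \<in> Obj K"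
    using assms by (simp_all add: hom_def cells_def)
  then have "\<exists>!\<theta>. \<theta> \<in> cells K u v \<and> rwhisk K \<theta> i = \<alpha> \<and> rwhisk K \<theta> j = \<beta>"
    using assms(1) unfolding is_coproduct2_def by blast
  then show ?thesis using that by (auto simp: cells_def rwhisk_def)
qed

lemma coproduct2_eqI:
  assumes "is_coproduct2 K A B Q i j" "\<theta> \<in> Cell K" "\<theta>' \<in> Cell K" "Dom K (Src K \<theta>) = Q"
    "Src K \<theta>' = Src K \<theta>" "Trg K \<theta>' = Trg K \<theta>"
    "Hc K \<theta> (Idc K i) = Hc K \<theta>' (Idc K i)" "Hc K \<theta> (Idc K j) = Hc K \<theta>' (Idc K j)"
  shows "\<theta> = \<theta>'"
proof -
  let ?u = "Src K \<theta>" and ?v = "Trg K \<theta>"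
  have Q: "is_coproduct K A B Q i j" using assms(1) by (simp add: is_coproduct2_def)
  note [simp] = coproductD[OF Q]
  have "?u \<in> hom K Q (Cod K ?u)" "?v \<in> hom K Q (Cod K ?u)" "Hc K \<theta> (Idc K i) \<in> cells K (?u \<cdot> i) (?v \<cdot> i)"
    "Hc K \<theta> (Idc K j) \<in> cells K (?u \<cdot> j) (?v \<cdot> j)" "Cod K ?u \<in> Obj K"
    using assms(2-6) by (simp_all add: hom_def cells_def)
  then have "\<exists>!\<gamma>. \<gamma> \<in> cells K ?u ?v \<and> rwhisk K \<gamma> i = Hc K \<theta> (Idc K i) \<and> rwhisk K \<gamma> j = Hc K \<theta> (Idc K j)"
    using assms(1) unfolding is_coproduct2_def by blast
  then show ?thesis using assms by (auto simp: cells_def rwhisk_def)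
qed

lemma pullback2_ex1:
  assumes "is_pullback2 K f g P p q" "u \<in> Arr K" "v \<in> Arr K" "Cod K u = P" "Cod K v = P" "Dom K v = Dom K u"
    "\<alpha> \<in> Cell K" "Src K \<alpha> = p \<cdot> u" "Trg K \<alpha> = p \<cdot> v" "\<beta> \<in> Cell K" "Src K \<beta> = q \<cdot> u" "Trg K \<beta> = q \<cdot> v"
    "Hc K (Idc K f) \<alpha> = Hc K (Idc K g) \<beta>"
  shows "\<exists>!\<theta>. \<theta> \<in> Cell K \<and> Src K \<theta> = u \<and> Trg K \<theta> = v \<and> Hc K (Idc K p) \<theta> = \<alpha> \<and> Hc K (Idc K q) \<theta> = \<beta>"
proof -
  have "u \<in> hom K (Dom K u) P" "v \<in> hom K (Dom K u) P" "\<alpha> \<in> cells K (p \<cdot> u) (p \<cdot> v)"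
    "\<beta> \<in> cells K (q \<cdot> u) (q \<cdot> v)" "Dom K u \<in> Obj K"
    using assms by (simp_all add: hom_def cells_def)
  then have "\<exists>!\<theta>. \<theta> \<in> cells K u v \<and> lwhisk K p \<theta> = \<alpha> \<and> lwhisk K q \<theta> = \<beta>"
    using assms(1,13) unfolding is_pullback2_def lwhisk_def by blast
  then show ?thesis by (simp add: cells_def lwhisk_def conj_assoc)
qed

text \<open>A given pullback is isomorphic to one with the 2-dimensional property and inherits it by
  whiskering with the comparison. The van Kampen condition produces pullbacks of the underlying
  category only; this lemma upgrades them.\<close>

lemma pullback2_if_pullback:
  assumes pb: "has_pullbacks2 K" and P: "is_pullback K f g P p q"
  shows "is_pullback2 K f g P p q"
proof -
  note [simp] = pullbackD[OF P]
  obtain P' p' q' where P': "is_pullback2 K f g P' p' q'"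
    using pb unfolding has_pullbacks2_def by (metis pullbackD(1-3)[OF P])
  then have P'1: "is_pullback K f g P' p' q'" by (simp add: is_pullback2_def)
  note [simp] = pullbackD[OF P'1]
  obtain a where a: "is_iso K a" "a \<in> Arr K" "Dom K a = P" "Cod K a = P'" "p' \<cdot> a = p" "q' \<cdot> a = q"
    using pullback_comparison[OF P P'1] .
  obtain b where b: "b \<in> Arr K" "Dom K b = P'" "Cod K b = P" "b \<cdot> a = Idn K P" "a \<cdot> b = Idn K P'"
    using iso_inverse[OF a(1,3,4)] by metis
  note [simp] = a(2-4) b
  have pb': "p \<cdot> b = p'" "q \<cdot> b = q'"
    unfolding a(5,6)[symmetric] by simp_all
  have "\<exists>!\<theta>. \<theta> \<in> cells K u v \<and> lwhisk K p \<theta> = \<alpha> \<and> lwhisk K q \<theta> = \<beta>"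
    if "u \<in> hom K X P" "v \<in> hom K X P" "\<alpha> \<in> cells K (p \<cdot> u) (p \<cdot> v)" "\<beta> \<in> cells K (q \<cdot> u) (q \<cdot> v)"
      "lwhisk K f \<alpha> = lwhisk K g \<beta>" for X u v \<alpha> \<beta>
  proof -
    have uv: "u \<in> Arr K" "v \<in> Arr K" "Dom K u = X" "Dom K v = X" "Cod K u = P" "Cod K v = P"
      and \<alpha>: "\<alpha> \<in> Cell K" "Src K \<alpha> = p \<cdot> u" "Trg K \<alpha> = p \<cdot> v"
      and \<beta>: "\<beta> \<in> Cell K" "Src K \<beta> = q \<cdot> u" "Trg K \<beta> = q \<cdot> v"
      and eq: "Hc K (Idc K f) \<alpha> = Hc K (Idc K g) \<beta>"
      using that by (simp_all add: hom_def cells_def lwhisk_def)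
    note [simp] = uv \<alpha>(1) \<beta>(1)
    \<comment> \<open>The lifting problem is moved along \<open>a\<close> to \<open>P'\<close>,
      solved there, and the solution is brought back by whiskering with \<open>b\<close>.\<close>
    have "\<exists>!\<theta>. \<theta> \<in> Cell K \<and> Src K \<theta> = a \<cdot> u \<and> Trg K \<theta> = a \<cdot> v \<and> Hc K (Idc K p') \<theta> = \<alpha> \<and> Hc K (Idc K q') \<theta> = \<beta>"
      by (rule pullback2_ex1[OF P'])
        (use \<alpha> \<beta> eq in \<open>simp_all add: Cmp_eq_Cmp[OF a(5)] Cmp_eq_Cmp[OF a(6)]\<close>)
    then obtain \<theta> where \<theta>: "\<theta> \<in> Cell K" "Src K \<theta> = a \<cdot> u" "Trg K \<theta> = a \<cdot> v" "Hc K (Idc K p') \<theta> = \<alpha>"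
      "Hc K (Idc K q') \<theta> = \<beta>" and \<theta>_eq: "\<And>\<gamma>. \<gamma> \<in> Cell K \<Longrightarrow> Src K \<gamma> = a \<cdot> u \<Longrightarrow> Trg K \<gamma> = a \<cdot> v \<Longrightarrow>
        Hc K (Idc K p') \<gamma> = \<alpha> \<Longrightarrow> Hc K (Idc K q') \<gamma> = \<beta> \<Longrightarrow> \<gamma> = \<theta>"
      by blast
    show ?thesis
    proof (rule ex1I[of _ "Hc K (Idc K b) \<theta>"])
      show "Hc K (Idc K b) \<theta> \<in> cells K u v \<and> lwhisk K p (Hc K (Idc K b) \<theta>) = \<alpha> \<and> lwhisk K q (Hc K (Idc K b) \<theta>) = \<beta>"
        using \<theta> pb' by (simp add: cells_def lwhisk_def Cmp_eq_Cmp[OF b(4)])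
    next
      fix \<gamma> assume \<gamma>: "\<gamma> \<in> cells K u v \<and> lwhisk K p \<gamma> = \<alpha> \<and> lwhisk K q \<gamma> = \<beta>"
      then have "Hc K (Idc K a) \<gamma> = \<theta>"
        by (intro \<theta>_eq) (simp_all add: cells_def lwhisk_def a(5,6))
      from this[symmetric] show "\<gamma> = Hc K (Idc K b) \<theta>"
        using \<gamma> by (simp add: cells_def)
    qed
  qed
  then show ?thesis using P by (simp add: is_pullback2_def)
qed

end

section \<open>Sums of 2-cells along chosen coproducts\<close>

locale coprod2_choice = two_category K for K :: "('o, 'm, 'c, 'z) two_cat_scheme" (structure) +
  fixes S :: "('o, 'm) coprods"
  assumes S2: "A \<in> Obj K \<Longrightarrow> B \<in> Obj K \<Longrightarrow>
    is_coproduct2 K A B (cp_obj S A B) (cp_inl S A B) (cp_inr S A B)"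

sublocale coprod2_choice \<subseteq> coprod_choice K S
  by unfold_locales (use S2 in \<open>simp add: is_coproduct2_def\<close>)

context coprod2_choice
begin

lemma sum_cell:
  assumes \<alpha>: "\<alpha> \<in> Cell K" and \<beta>: "\<beta> \<in> Cell K"
  shows sum_cell_Cell [simp]: "sum_cell K S \<alpha> \<beta> \<in> Cell K"
    and Src_sum_cell [simp]: "Src K (sum_cell K S \<alpha> \<beta>) = sum_arr K S (Src K \<alpha>) (Src K \<beta>)"
    and Trg_sum_cell [simp]: "Trg K (sum_cell K S \<alpha> \<beta>) = sum_arr K S (Trg K \<alpha>) (Trg K \<beta>)"
    and "Hc K (sum_cell K S \<alpha> \<beta>) (Idc K (inl (Dom K (Src K \<alpha>)) (Dom K (Src K \<beta>)))) =
      Hc K (Idc K (inl (Cod K (Src K \<alpha>)) (Cod K (Src K \<beta>)))) \<alpha>"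
    and "Hc K (sum_cell K S \<alpha> \<beta>) (Idc K (inr (Dom K (Src K \<alpha>)) (Dom K (Src K \<beta>)))) =
      Hc K (Idc K (inr (Cod K (Src K \<alpha>)) (Cod K (Src K \<beta>)))) \<beta>"
proof -
  note [simp] = \<alpha> \<beta>
  let ?A = "Dom K (Src K \<alpha>)" and ?B = "Dom K (Src K \<beta>)" and ?A' = "Cod K (Src K \<alpha>)" and ?B' = "Cod K (Src K \<beta>)"
  let ?P = "\<lambda>\<theta>. \<theta> \<in> cells K (sum_arr K S (Src K \<alpha>) (Src K \<beta>)) (sum_arr K S (Trg K \<alpha>) (Trg K \<beta>)) \<and>
      rwhisk K \<theta> (inl ?A ?B) = lwhisk K (inl ?A' ?B') \<alpha> \<and> rwhisk K \<theta> (inr ?A ?B) = lwhisk K (inr ?A' ?B') \<beta>"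
  have Q: "is_coproduct2 K ?A ?B (cp_obj S ?A ?B) (inl ?A ?B) (inr ?A ?B)"
    by (rule S2) simp_all
  obtain \<theta> where "\<theta> \<in> Cell K" "Src K \<theta> = sum_arr K S (Src K \<alpha>) (Src K \<beta>)" "Trg K \<theta> = sum_arr K S (Trg K \<alpha>) (Trg K \<beta>)"
    "Hc K \<theta> (Idc K (inl ?A ?B)) = Hc K (Idc K (inl ?A' ?B')) \<alpha>"
    "Hc K \<theta> (Idc K (inr ?A ?B)) = Hc K (Idc K (inr ?A' ?B')) \<beta>"
    by (rule coproduct2_ex[OF Q, of "sum_arr K S (Src K \<alpha>) (Src K \<beta>)" "sum_arr K S (Trg K \<alpha>) (Trg K \<beta>)"
        "Hc K (Idc K (inl ?A' ?B')) \<alpha>" "Hc K (Idc K (inr ?A' ?B')) \<beta>"]) simp_all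
  then have "\<exists>!\<theta>. ?P \<theta>"
    by (intro ex1I[of _ \<theta>]) (auto simp: cells_def rwhisk_def lwhisk_def intro: coproduct2_eqI[OF Q])
  from theI'[OF this] have "?P (sum_cell K S \<alpha> \<beta>)"
    by (simp add: sum_cell_def Let_def)
  then show "sum_cell K S \<alpha> \<beta> \<in> Cell K" "Src K (sum_cell K S \<alpha> \<beta>) = sum_arr K S (Src K \<alpha>) (Src K \<beta>)"
    "Trg K (sum_cell K S \<alpha> \<beta>) = sum_arr K S (Trg K \<alpha>) (Trg K \<beta>)"
    "Hc K (sum_cell K S \<alpha> \<beta>) (Idc K (inl ?A ?B)) = Hc K (Idc K (inl ?A' ?B')) \<alpha>"
    "Hc K (sum_cell K S \<alpha> \<beta>) (Idc K (inr ?A ?B)) = Hc K (Idc K (inr ?A' ?B')) \<beta>"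
    by (simp_all add: cells_def rwhisk_def lwhisk_def)
qed

lemma sum_cell_inl [simp]:
  "\<alpha> \<in> Cell K \<Longrightarrow> \<beta> \<in> Cell K \<Longrightarrow> Dom K (Src K \<alpha>) = A \<Longrightarrow> Dom K (Src K \<beta>) = B \<Longrightarrow>
    Hc K (sum_cell K S \<alpha> \<beta>) (Idc K (inl A B)) = Hc K (Idc K (inl (Cod K (Src K \<alpha>)) (Cod K (Src K \<beta>)))) \<alpha>"
  and sum_cell_inr [simp]:
  "\<alpha> \<in> Cell K \<Longrightarrow> \<beta> \<in> Cell K \<Longrightarrow> Dom K (Src K \<alpha>) = A \<Longrightarrow> Dom K (Src K \<beta>) = B \<Longrightarrow>
    Hc K (sum_cell K S \<alpha> \<beta>) (Idc K (inr A B)) = Hc K (Idc K (inr (Cod K (Src K \<alpha>)) (Cod K (Src K \<beta>)))) \<beta>"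
  using sum_cell(4,5) by blast+

lemma sum_cell_eqI:
  assumes "\<alpha> \<in> Cell K" "\<beta> \<in> Cell K" "\<theta> \<in> Cell K" "Src K \<theta> = sum_arr K S (Src K \<alpha>) (Src K \<beta>)"
    "Trg K \<theta> = sum_arr K S (Trg K \<alpha>) (Trg K \<beta>)"
    "Hc K \<theta> (Idc K (inl (Dom K (Src K \<alpha>)) (Dom K (Src K \<beta>)))) =
      Hc K (Idc K (inl (Cod K (Src K \<alpha>)) (Cod K (Src K \<beta>)))) \<alpha>"
    "Hc K \<theta> (Idc K (inr (Dom K (Src K \<alpha>)) (Dom K (Src K \<beta>)))) =
      Hc K (Idc K (inr (Cod K (Src K \<alpha>)) (Cod K (Src K \<beta>)))) \<beta>"
  shows "sum_cell K S \<alpha> \<beta> = \<theta>"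
  by (rule coproduct2_eqI[OF S2[of "Dom K (Src K \<alpha>)" "Dom K (Src K \<beta>)"]]) (use assms in simp_all)

lemma sum_cell_Idc: "f \<in> Arr K \<Longrightarrow> g \<in> Arr K \<Longrightarrow> sum_cell K S (Idc K f) (Idc K g) = Idc K (sum_arr K S f g)"
  by (rule sum_cell_eqI) simp_all

lemma sum_cell_Vc:
  "\<alpha> \<in> Cell K \<Longrightarrow> \<beta> \<in> Cell K \<Longrightarrow> \<alpha>' \<in> Cell K \<Longrightarrow> \<beta>' \<in> Cell K \<Longrightarrow> Trg K \<alpha> = Src K \<alpha>' \<Longrightarrow> Trg K \<beta> = Src K \<beta>' \<Longrightarrow>
    sum_cell K S (Vc K \<alpha>' \<alpha>) (Vc K \<beta>' \<beta>) = Vc K (sum_cell K S \<alpha>' \<beta>') (sum_cell K S \<alpha> \<beta>)"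
  using Dom_Trg[of \<alpha>] Dom_Trg[of \<beta>] Cod_Trg[of \<alpha>] Cod_Trg[of \<beta>]
  by (intro sum_cell_eqI) (simp_all add: Vc_Hc_Idc Idc_Hc_Vc)

lemma sum_cell_Hc:
  assumes [simp]: "\<alpha> \<in> Cell K" "\<beta> \<in> Cell K" "\<alpha>' \<in> Cell K" "\<beta>' \<in> Cell K" "Cod K (Src K \<alpha>) = Dom K (Src K \<alpha>')"
    "Cod K (Src K \<beta>) = Dom K (Src K \<beta>')"
  shows "sum_cell K S (Hc K \<alpha>' \<alpha>) (Hc K \<beta>' \<beta>) = Hc K (sum_cell K S \<alpha>' \<beta>') (sum_cell K S \<alpha> \<beta>)"
proof -
  \<comment> \<open>The opposite of the simplifier's bracketing: once an injection has passed the
    inner sum, it has to be grouped with the outer one.\<close>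
  have assoc: "Hc K \<gamma> (Hc K (Idc K f) \<delta>) = Hc K (Hc K \<gamma> (Idc K f)) \<delta>"
    if "\<gamma> \<in> Cell K" "\<delta> \<in> Cell K" "f \<in> Arr K" "Cod K f = Dom K (Src K \<gamma>)" "Cod K (Src K \<delta>) = Dom K f" for \<gamma> \<delta> f
    using that by simp
  show ?thesis
    by (rule sum_cell_eqI) (simp_all add: sum_arr_Cmp, simp_all add: assoc del: Hc_assoc_eq, simp_all)
qed

lemma sum_cell_triangle:
  assumes "(f, f', \<alpha>) \<in> Cell (slice_two_cat K A)" "(g, g', \<beta>) \<in> Cell (slice_two_cat K B)"
  shows "(sum_arr K S f g, sum_arr K S f' g', sum_cell K S \<alpha> \<beta>) \<in> Cell (slice_two_cat K (cp_obj S A B))"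
proof -
  have f: "\<alpha> \<in> Cell K" "f \<in> Arr K" "f' \<in> Arr K" "Cod K f = A" "Cod K f' = A" "Dom K (Src K \<alpha>) = Dom K f"
    "Cod K (Src K \<alpha>) = Dom K f'" "f' \<cdot> Src K \<alpha> = f" "f' \<cdot> Trg K \<alpha> = f" "Hc K (Idc K f') \<alpha> = Idc K f"
    and g: "\<beta> \<in> Cell K" "g \<in> Arr K" "g' \<in> Arr K" "Cod K g = B" "Cod K g' = B" "Dom K (Src K \<beta>) = Dom K g"
    "Cod K (Src K \<beta>) = Dom K g'" "g' \<cdot> Src K \<beta> = g" "g' \<cdot> Trg K \<beta> = g" "Hc K (Idc K g') \<beta> = Idc K g"
    using assms by (simp_all add: slice_Cell_iff)
  \<comment> \<open>Sums commute with whiskering, so the two slice conditions add up to the slice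
    condition for the sum.\<close>
  have "sum_cell K S (Hc K (Idc K f') \<alpha>) (Hc K (Idc K g') \<beta>) = Hc K (Idc K (sum_arr K S f' g')) (sum_cell K S \<alpha> \<beta>)"
    using f(1-7) g(1-7) by (simp add: sum_cell_Hc sum_cell_Idc)
  then have "Hc K (Idc K (sum_arr K S f' g')) (sum_cell K S \<alpha> \<beta>) = Idc K (sum_arr K S f g)"
    using f(2,10) g(2,10) by (simp add: sum_cell_Idc)
  then show ?thesis
    using f g sum_arr_Cmp[of "Src K \<alpha>" "Src K \<beta>" f' g'] sum_arr_Cmp[of "Trg K \<alpha>" "Trg K \<beta>" f' g']
    by (simp add: slice_Cell_iff)
qed

end

lemma prod_two_cat_simps [simp]:
  "Obj (prod_two_cat C D) = Obj (prod_cat C D)" "Arr (prod_two_cat C D) = Arr (prod_cat C D)"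
  "Dom (prod_two_cat C D) = Dom (prod_cat C D)" "Cod (prod_two_cat C D) = Cod (prod_cat C D)"
  "Idn (prod_two_cat C D) = Idn (prod_cat C D)" "Cmp (prod_two_cat C D) = Cmp (prod_cat C D)"
  "hom (prod_two_cat C D) = hom (prod_cat C D)"
  "Cell (prod_two_cat C D) = Cell C \<times> Cell D"
  "Src (prod_two_cat C D) (\<alpha>, \<beta>) = (Src C \<alpha>, Src D \<beta>)"
  "Trg (prod_two_cat C D) (\<alpha>, \<beta>) = (Trg C \<alpha>, Trg D \<beta>)"
  "Idc (prod_two_cat C D) (f, g) = (Idc C f, Idc D g)"
  "Vc (prod_two_cat C D) (\<alpha>', \<beta>') (\<alpha>, \<beta>) = (Vc C \<alpha>' \<alpha>, Vc D \<beta>' \<beta>)"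
  "Hc (prod_two_cat C D) (\<alpha>', \<beta>') (\<alpha>, \<beta>) = (Hc C \<alpha>' \<alpha>, Hc D \<beta>' \<beta>)"
  by (simp_all add: prod_two_cat_def hom_def fun_eq_iff)

lemma coprod_two_func_simps [simp]:
  "OMap (coprod_two_func K S) = OMap (coprod_func K S)"
  "AMap (coprod_two_func K S) = AMap (coprod_func K S)"
  "CMap (coprod_two_func K S) ((f, f', \<alpha>), (g, g', \<beta>)) = (sum_arr K S f g, sum_arr K S f' g', sum_cell K S \<alpha> \<beta>)"
  by (simp_all add: coprod_two_func_def)

lemma prod_cat_slice_two_cat:
  "prod_cat (slice_two_cat K A) (slice_two_cat K B) = prod_cat (slice K A) (slice K B)"
  by (simp add: prod_cat_def)

text \<open>This and the two analogues below hold because the condition looks at objects and arrows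
  only, where the 2-categories concerned agree with slices and products of the underlying
  category.\<close>

lemma is_functor_two:
  "is_functor (prod_two_cat (slice_two_cat K A) (slice_two_cat K B)) (slice_two_cat K Q) (coprod_two_func K S) \<longleftrightarrow>
    is_functor (prod_cat (slice K A) (slice K B)) (slice K Q) (coprod_func K S)"
  by (simp add: is_functor_def prod_cat_slice_two_cat)

lemma fully_faithful_two:
  "fully_faithful (prod_two_cat (slice_two_cat K A) (slice_two_cat K B)) (slice_two_cat K Q) (coprod_two_func K S) \<longleftrightarrow>
    fully_faithful (prod_cat (slice K A) (slice K B)) (slice K Q) (coprod_func K S)"
  by (simp add: fully_faithful_def prod_cat_slice_two_cat)

lemma is_iso_slice_two_cat: "is_iso (slice_two_cat K A) = is_iso (slice K A)"
  by (simp add: is_iso_def fun_eq_iff)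

lemma ess_surjective_two:
  "ess_surjective (prod_two_cat (slice_two_cat K A) (slice_two_cat K B)) (slice_two_cat K Q) (coprod_two_func K S) \<longleftrightarrow>
    ess_surjective (prod_cat (slice K A) (slice K B)) (slice K Q) (coprod_func K S)"
  by (simp add: ess_surjective_def prod_cat_slice_two_cat is_iso_slice_two_cat)

context coprod2_choice
begin

lemma two_functor_coprod_two_func:
  assumes "A \<in> Obj K" "B \<in> Obj K"
  shows "is_two_functor (prod_two_cat (slice_two_cat K A) (slice_two_cat K B)) (slice_two_cat K (cp_obj S A B))
    (coprod_two_func K S)"
proof -
  let ?P = "prod_two_cat (slice_two_cat K A) (slice_two_cat K B)" and ?Q = "slice_two_cat K (cp_obj S A B)"
    and ?F = "coprod_two_func K S"
  show ?thesis
    unfolding is_two_functor_def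
  proof (intro conjI ballI impI)
    show "is_functor ?P ?Q ?F"
      unfolding is_functor_two by (rule functor_coprod_func[OF assms])
  next
    fix \<theta> assume "\<theta> \<in> Cell ?P"
    then obtain f f' \<alpha> g g' \<beta> where \<theta>: "\<theta> = ((f, f', \<alpha>), (g, g', \<beta>))"
      "(f, f', \<alpha>) \<in> Cell (slice_two_cat K A)" "(g, g', \<beta>) \<in> Cell (slice_two_cat K B)"
      by (cases \<theta>) (simp add: split_paired_all)
    then have "\<alpha> \<in> Cell K" "\<beta> \<in> Cell K" by (simp_all add: slice_Cell_iff)
    then show "CMap ?F \<theta> \<in> cells ?Q (AMap ?F (Src ?P \<theta>)) (AMap ?F (Trg ?P \<theta>))"
      using sum_cell_triangle[OF \<theta>(2,3)] by (simp add: \<theta>(1) cells_def)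
  next
    fix f assume "f \<in> Arr ?P"
    then show "CMap ?F (Idc ?P f) = Idc ?Q (AMap ?F f)"
      by (cases f) (simp add: split_paired_all sum_cell_Idc slice_Arr_iff)
  next
    fix \<theta> \<theta>' assume *: "\<theta> \<in> Cell ?P" "\<theta>' \<in> Cell ?P" "Trg ?P \<theta> = Src ?P \<theta>'"
    then obtain f f' \<alpha> \<alpha>' g g' \<beta> \<beta>' where \<theta>: "\<theta> = ((f, f', \<alpha>), (g, g', \<beta>))" "\<theta>' = ((f, f', \<alpha>'), (g, g', \<beta>'))"
      by (cases \<theta>; cases \<theta>') (simp add: split_paired_all)
    then show "CMap ?F (Vc ?P \<theta>' \<theta>) = Vc ?Q (CMap ?F \<theta>') (CMap ?F \<theta>)"
      using * by (simp add: slice_Cell_iff sum_cell_Vc)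
  next
    fix \<theta> \<theta>' assume *: "\<theta> \<in> Cell ?P" "\<theta>' \<in> Cell ?P" "Cod ?P (Src ?P \<theta>) = Dom ?P (Src ?P \<theta>')"
    then obtain f f' f'' \<alpha> \<alpha>' g g' g'' \<beta> \<beta>' where \<theta>: "\<theta> = ((f, f', \<alpha>), (g, g', \<beta>))" "\<theta>' = ((f', f'', \<alpha>'), (g', g'', \<beta>'))"
      by (cases \<theta>; cases \<theta>') (simp add: split_paired_all)
    then show "CMap ?F (Hc ?P \<theta>' \<theta>) = Hc ?Q (CMap ?F \<theta>') (CMap ?F \<theta>)"
      using * by (simp add: slice_Cell_iff sum_cell_Hc)
  qed
qed

text \<open>The argument for arrows one dimension up: the restrictions of a 2-cell \<theta> to the
  two summands are lifted through the pullback squares by their 2-dimensional universal property.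
  The compatibility this asks for is the slice condition that \<theta> whiskers to an
  identity.\<close>

lemma cell_fully_faithful_coprod_two_func:
  assumes A [simp]: "A \<in> Obj K" and B [simp]: "B \<in> Obj K" and pb: "has_pullbacks2 K"
    and vk: "van_kampen A B (cp_obj S A B) (inl A B) (inr A B)"
  shows "cell_fully_faithful (prod_two_cat (slice_two_cat K A) (slice_two_cat K B))
    (slice_two_cat K (cp_obj S A B)) (coprod_two_func K S)"
proof -
  let ?P = "prod_two_cat (slice_two_cat K A) (slice_two_cat K B)" and ?Q = "slice_two_cat K (cp_obj S A B)"
    and ?F = "coprod_two_func K S"
  show ?thesis
    unfolding cell_fully_faithful_def
  proof (intro ballI impI)
    fix u v t assume u: "u \<in> Arr ?P" and v: "v \<in> Arr ?P" and t: "t \<in> cells ?Q (AMap ?F u) (AMap ?F v)"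
      and uv: "Dom ?P u = Dom ?P v" "Cod ?P u = Cod ?P v"
    obtain f f' h h' g g' k k' where eq: "u = ((f, f', h), (g, g', k))" "v = ((f, f', h'), (g, g', k'))"
      using u v uv by (cases u; cases v) (simp add: split_paired_all)
    have f: "f \<in> Arr K" "Cod K f = A" "f' \<in> Arr K" "Cod K f' = A" "h \<in> Arr K" "Dom K h = Dom K f" "Cod K h = Dom K f'"
      "f' \<cdot> h = f" "h' \<in> Arr K" "Dom K h' = Dom K f" "Cod K h' = Dom K f'" "f' \<cdot> h' = f"
      and g: "g \<in> Arr K" "Cod K g = B" "g' \<in> Arr K" "Cod K g' = B" "k \<in> Arr K" "Dom K k = Dom K g" "Cod K k = Dom K g'"
      "g' \<cdot> k = g" "k' \<in> Arr K" "Dom K k' = Dom K g" "Cod K k' = Dom K g'" "g' \<cdot> k' = g"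
      using u v eq by (simp_all add: slice_Arr_iff)
    obtain \<theta> where t_eq: "t = (sum_arr K S f g, sum_arr K S f' g', \<theta>)" and \<theta>: "\<theta> \<in> Cell K"
      "Src K \<theta> = sum_arr K S h k" "Trg K \<theta> = sum_arr K S h' k'"
      "Hc K (Idc K (sum_arr K S f' g')) \<theta> = Idc K (sum_arr K S f g)"
      using t eq by (cases t) (simp add: cells_def slice_Cell_iff)
    note [simp] = f g \<theta>(1)
    have \<theta>w: "Hc K (Idc K (sum_arr K S f' g')) (Hc K \<theta> \<gamma>) = Hc K (Idc K (sum_arr K S f g)) \<gamma>"
      if "\<gamma> \<in> Cell K" "Cod K (Src K \<gamma>) = cp_obj S (Dom K f) (Dom K g)" for \<gamma>
      unfolding \<theta>(4)[symmetric] using that \<theta>(2) by simp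
    note Q = S[of "Dom K f'" "Dom K g'"]
    have "is_pullback K (inl A B) (sum_arr K S f' g') (Dom K f') f' (inl (Dom K f') (Dom K g'))"
      "is_pullback K (inr A B) (sum_arr K S f' g') (Dom K g') g' (inr (Dom K f') (Dom K g'))"
      using van_kampenD[OF vk Q, of f' g' "sum_arr K S f' g'"] by simp_all
    note P = this[THEN pullback2_if_pullback[OF pb]]
    have "\<exists>!\<alpha>. \<alpha> \<in> Cell K \<and> Src K \<alpha> = h \<and> Trg K \<alpha> = h' \<and> Hc K (Idc K f') \<alpha> = Idc K f \<and>
        Hc K (Idc K (inl (Dom K f') (Dom K g'))) \<alpha> = Hc K \<theta> (Idc K (inl (Dom K f) (Dom K g)))"
      by (rule pullback2_ex1[OF P(1)]) (simp_all add: \<theta> \<theta>w)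
    then obtain \<alpha> where \<alpha>: "\<alpha> \<in> Cell K" "Src K \<alpha> = h" "Trg K \<alpha> = h'" "Hc K (Idc K f') \<alpha> = Idc K f"
        "Hc K (Idc K (inl (Dom K f') (Dom K g'))) \<alpha> = Hc K \<theta> (Idc K (inl (Dom K f) (Dom K g)))"
      and \<alpha>': "\<And>\<gamma>. \<gamma> \<in> Cell K \<Longrightarrow> Src K \<gamma> = h \<Longrightarrow> Trg K \<gamma> = h' \<Longrightarrow> Hc K (Idc K f') \<gamma> = Idc K f \<Longrightarrow>
        Hc K (Idc K (inl (Dom K f') (Dom K g'))) \<gamma> = Hc K \<theta> (Idc K (inl (Dom K f) (Dom K g))) \<Longrightarrow> \<gamma> = \<alpha>"
      by blast
    have "\<exists>!\<beta>. \<beta> \<in> Cell K \<and> Src K \<beta> = k \<and> Trg K \<beta> = k' \<and> Hc K (Idc K g') \<beta> = Idc K g \<and>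
        Hc K (Idc K (inr (Dom K f') (Dom K g'))) \<beta> = Hc K \<theta> (Idc K (inr (Dom K f) (Dom K g)))"
      by (rule pullback2_ex1[OF P(2)]) (simp_all add: \<theta> \<theta>w)
    then obtain \<beta> where \<beta>: "\<beta> \<in> Cell K" "Src K \<beta> = k" "Trg K \<beta> = k'" "Hc K (Idc K g') \<beta> = Idc K g"
        "Hc K (Idc K (inr (Dom K f') (Dom K g'))) \<beta> = Hc K \<theta> (Idc K (inr (Dom K f) (Dom K g)))"
      and \<beta>': "\<And>\<gamma>. \<gamma> \<in> Cell K \<Longrightarrow> Src K \<gamma> = k \<Longrightarrow> Trg K \<gamma> = k' \<Longrightarrow> Hc K (Idc K g') \<gamma> = Idc K g \<Longrightarrow>
        Hc K (Idc K (inr (Dom K f') (Dom K g'))) \<gamma> = Hc K \<theta> (Idc K (inr (Dom K f) (Dom K g))) \<Longrightarrow> \<gamma> = \<beta>"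
      by blast
    have sum: "sum_cell K S \<alpha> \<beta> = \<theta>"
      by (rule sum_cell_eqI) (simp_all add: \<alpha> \<beta> \<theta>)
    show "\<exists>!\<gamma>. \<gamma> \<in> cells ?P u v \<and> CMap ?F \<gamma> = t"
    proof (rule ex1I[of _ "((f, f', \<alpha>), (g, g', \<beta>))"])
      show "((f, f', \<alpha>), (g, g', \<beta>)) \<in> cells ?P u v \<and> CMap ?F ((f, f', \<alpha>), (g, g', \<beta>)) = t"
        using \<alpha>(1-4) \<beta>(1-4) sum by (simp add: cells_def slice_Cell_iff eq t_eq)
    next
      fix \<gamma> assume \<gamma>: "\<gamma> \<in> cells ?P u v \<and> CMap ?F \<gamma> = t"
      then obtain \<alpha>1 \<beta>1 where \<gamma>_eq: "\<gamma> = ((f, f', \<alpha>1), (g, g', \<beta>1))"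
        by (cases \<gamma>) (auto simp: cells_def eq)
      have c: "\<alpha>1 \<in> Cell K" "Src K \<alpha>1 = h" "Trg K \<alpha>1 = h'" "Hc K (Idc K f') \<alpha>1 = Idc K f"
        "\<beta>1 \<in> Cell K" "Src K \<beta>1 = k" "Trg K \<beta>1 = k'" "Hc K (Idc K g') \<beta>1 = Idc K g"
        and sum1: "sum_cell K S \<alpha>1 \<beta>1 = \<theta>"
        using \<gamma> by (simp_all add: \<gamma>_eq cells_def eq t_eq slice_Cell_iff)
      have "\<alpha>1 = \<alpha>" "\<beta>1 = \<beta>"
        using sum_cell_inl[of \<alpha>1 \<beta>1] sum_cell_inr[of \<alpha>1 \<beta>1] c by (auto intro!: \<alpha>' \<beta>' simp: sum1)
      then show "\<gamma> = ((f, f', \<alpha>), (g, g', \<beta>))" by (simp add: \<gamma>_eq)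
    qed
  qed
qed

end

lemma (in two_category) coprod2_choice_the_coprods2:
  assumes "has_finite_coproducts2 K"
  shows "coprod2_choice K (the_coprods2 K)"
proof
  fix A B assume "A \<in> Obj K" "B \<in> Obj K"
  then have "\<exists>p. case p of (Q, i, j) \<Rightarrow> is_coproduct2 K A B Q i j"
    using assms unfolding has_finite_coproducts2_def by fastforce
  then have "case the_coprods2 K A B of (Q, i, j) \<Rightarrow> is_coproduct2 K A B Q i j"
    unfolding the_coprods2_def by (rule someI_ex)
  then show "is_coproduct2 K A B (cp_obj (the_coprods2 K) A B) (cp_inl (the_coprods2 K) A B) (cp_inr (the_coprods2 K) A B)"
    by (simp add: split_beta)
qed

lemma has_pullbacks_if_has_pullbacks2: "has_pullbacks2 K \<Longrightarrow> has_pullbacks K"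
  unfolding has_pullbacks2_def has_pullbacks_def is_pullback2_def by blast

text \<open>The van Kampen condition concerns the underlying category; the 2-dimensional half of
  extensivity is supplied by the \<open>Cat\<close>-enriched pullbacks and coproducts.\<close>

lemma extensive2I:
  assumes K: "two_category K" "has_pullbacks2 K" "has_finite_coproducts2 K"
    and vk: "\<And>A B Q i j. is_coproduct2 K A B Q i j \<Longrightarrow> category.van_kampen K A B Q i j"
  shows "extensive2 K"
proof -
  interpret two_category K by fact
  interpret coprod2_choice K "the_coprods2 K" by (rule coprod2_choice_the_coprods2) fact
  have "is_two_equivalence (prod_two_cat (slice_two_cat K A) (slice_two_cat K B))
      (slice_two_cat K (cp_obj (the_coprods2 K) A B)) (coprod_two_func K (the_coprods2 K))"
    if AB: "A \<in> Obj K" "B \<in> Obj K" for A B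
  proof (rule is_two_equivalenceI)
    have vk': "van_kampen A B (cp_obj (the_coprods2 K) A B) (inl A B) (inr A B)"
      by (rule vk[OF S2[OF AB]])
    show "fully_faithful (prod_two_cat (slice_two_cat K A) (slice_two_cat K B))
        (slice_two_cat K (cp_obj (the_coprods2 K) A B)) (coprod_two_func K (the_coprods2 K))"
      unfolding fully_faithful_two by (rule fully_faithful_coprod_func[OF AB vk'])
    show "ess_surjective (prod_two_cat (slice_two_cat K A) (slice_two_cat K B))
        (slice_two_cat K (cp_obj (the_coprods2 K) A B)) (coprod_two_func K (the_coprods2 K))"
      unfolding ess_surjective_two
      by (rule ess_surjective_coprod_func[OF AB has_pullbacks_if_has_pullbacks2[OF K(2)] vk'])
    show "cell_fully_faithful (prod_two_cat (slice_two_cat K A) (slice_two_cat K B))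
        (slice_two_cat K (cp_obj (the_coprods2 K) A B)) (coprod_two_func K (the_coprods2 K))"
      by (rule cell_fully_faithful_coprod_two_func[OF AB K(2) vk'])
  qed (use AB in \<open>simp_all add: two_functor_coprod_two_func two_category_prod two_category_slice\<close>)
  with K show ?thesis by (simp add: extensive2_def)
qed

text \<open>\<open>is_equivalence\<close> takes plain \<open>func\<close> records, hence the
  truncation that forgets the action on 2-cells.\<close>

lemma is_equivalence_if_two_equivalence:
  fixes F :: "('o, 'm, 'c, 'p, 'n, 'd) two_func"
  assumes "is_two_equivalence K L F"
  shows "is_equivalence K L (func.truncate F)"
proof -
  obtain G :: "('p, 'n, 'd, 'o, 'm, 'c) two_func" and \<eta> \<epsilon> where "is_functor K L F" "is_functor L K G"
    "is_nat_iso K K (id_two_func :: ('o, 'm, 'c, 'o, 'm, 'c) two_func) (comp_two_func G F) \<eta>"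
    "is_nat_iso L L (comp_two_func F G) (id_two_func :: ('p, 'n, 'd, 'p, 'n, 'd) two_func) \<epsilon>"
    using assms
    unfolding is_two_equivalence_def is_two_functor_def is_two_nat_iso_def is_two_nat_def is_nat_iso_def by auto
  then have "is_functor K L (func.truncate F)" "is_functor L K (func.truncate G)"
    "is_nat_iso K K id_func (comp_func (func.truncate G) (func.truncate F)) \<eta>"
    "is_nat_iso L L (comp_func (func.truncate F) (func.truncate G)) id_func \<epsilon>"
    by (simp_all add: is_functor_def is_nat_iso_def is_nat_def id_two_func_def comp_two_func_def
        id_func_def comp_func_def func.truncate_def)
  then show ?thesis unfolding is_equivalence_def by blast
qed

lemma extensive2_van_kampen:
  assumes ext: "extensive2 K" and Q: "is_coproduct K A B Q i j"
  shows "category.van_kampen K A B Q i j"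
proof -
  interpret two_category K using ext by (simp add: extensive2_def)
  interpret coprod2_choice K "the_coprods2 K"
    by (rule coprod2_choice_the_coprods2) (use ext in \<open>simp add: extensive2_def\<close>)
  obtain Z0 where Z0: "is_initial K Z0"
    using ext unfolding extensive2_def has_finite_coproducts2_def is_initial2_def by blast
  note AB = coproductD(1,2)[OF Q]
  have "is_equivalence (prod_two_cat (slice_two_cat K A) (slice_two_cat K B))
      (slice_two_cat K (cp_obj (the_coprods2 K) A B)) (func.truncate (coprod_two_func K (the_coprods2 K)))"
    by (rule is_equivalence_if_two_equivalence) (use ext AB in \<open>simp add: extensive2_def\<close>)
  moreover have "func.truncate (coprod_two_func K (the_coprods2 K)) = coprod_func K (the_coprods2 K)"
    by (simp add: func.truncate_def coprod_two_func_def)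
  ultimately have "is_equivalence (prod_cat (slice K A) (slice K B))
      (slice K (cp_obj (the_coprods2 K) A B)) (coprod_func K (the_coprods2 K))"
    by (simp add: is_equivalence_def is_functor_def is_nat_iso_def is_nat_def prod_cat_slice_two_cat
        is_iso_slice_two_cat is_iso_def[of "prod_two_cat _ _"] is_iso_def[of "prod_cat _ _"])
  then have "van_kampen A B (cp_obj (the_coprods2 K) A B) (inl A B) (inr A B)"
    by (rule van_kampen_if_equivalence[OF AB Z0])
  then show ?thesis by (rule van_kampen_iso[OF _ S[OF AB] Q])
qed

section \<open>Internal categories through generalised elements\<close>

context category
begin

text \<open>The unit and associativity laws are left out: for pullbacks and coproducts of internal categories
  they are checked only after the structure maps, and with them \<open>icomp\<close>, are available.\<close>

definition is_igraph :: "('o, 'm) icat \<Rightarrow> bool" where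
  "is_igraph A \<longleftrightarrow>
     ic0 A \<in> Obj C \<and> ic1 A \<in> Obj C \<and> ic2 A \<in> Obj C \<and> ic3 A \<in> Obj C \<and>
     src A \<in> hom C (ic1 A) (ic0 A) \<and> tgt A \<in> hom C (ic1 A) (ic0 A) \<and>
     unt A \<in> hom C (ic0 A) (ic1 A) \<and> mul A \<in> hom C (ic2 A) (ic1 A) \<and>
     is_pullback C (tgt A) (src A) (ic2 A) (fst2 A) (snd2 A) \<and>
     is_pullback C (snd2 A) (fst2 A) (ic3 A) (fst3 A) (snd3 A) \<and>
     src A \<cdot> unt A = Idn C (ic0 A) \<and> tgt A \<cdot> unt A = Idn C (ic0 A) \<and>
     src A \<cdot> mul A = src A \<cdot> fst2 A \<and> tgt A \<cdot> mul A = tgt A \<cdot> snd2 A"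

definition composable :: "('o, 'm) icat \<Rightarrow> 'm \<Rightarrow> 'm \<Rightarrow> bool" where
  "composable A x y \<longleftrightarrow> x \<in> Arr C \<and> y \<in> Arr C \<and> Dom C y = Dom C x \<and> Cod C x = ic1 A \<and> Cod C y = ic1 A \<and>
     tgt A \<cdot> x = src A \<cdot> y"

lemma igraph_simps [simp]:
  assumes "is_igraph A"
  shows "ic0 A \<in> Obj C" "ic1 A \<in> Obj C" "ic2 A \<in> Obj C" "ic3 A \<in> Obj C"
    "src A \<in> Arr C" "Dom C (src A) = ic1 A" "Cod C (src A) = ic0 A"
    "tgt A \<in> Arr C" "Dom C (tgt A) = ic1 A" "Cod C (tgt A) = ic0 A"
    "unt A \<in> Arr C" "Dom C (unt A) = ic0 A" "Cod C (unt A) = ic1 A"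
    "mul A \<in> Arr C" "Dom C (mul A) = ic2 A" "Cod C (mul A) = ic1 A"
    "fst2 A \<in> Arr C" "Dom C (fst2 A) = ic2 A" "Cod C (fst2 A) = ic1 A"
    "snd2 A \<in> Arr C" "Dom C (snd2 A) = ic2 A" "Cod C (snd2 A) = ic1 A"
    "fst3 A \<in> Arr C" "Dom C (fst3 A) = ic3 A" "Cod C (fst3 A) = ic2 A"
    "snd3 A \<in> Arr C" "Dom C (snd3 A) = ic3 A" "Cod C (snd3 A) = ic2 A"
    "src A \<cdot> unt A = Idn C (ic0 A)" "tgt A \<cdot> unt A = Idn C (ic0 A)"
    "src A \<cdot> mul A = src A \<cdot> fst2 A" "tgt A \<cdot> mul A = tgt A \<cdot> snd2 A"
    "tgt A \<cdot> fst2 A = src A \<cdot> snd2 A" "snd2 A \<cdot> fst3 A = fst2 A \<cdot> snd3 A"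
  using assms by (simp_all add: is_igraph_def hom_def is_pullback_def)

lemma igraph_pullback2: "is_igraph A \<Longrightarrow> is_pullback C (tgt A) (src A) (ic2 A) (fst2 A) (snd2 A)"
  and igraph_pullback3: "is_igraph A \<Longrightarrow> is_pullback C (snd2 A) (fst2 A) (ic3 A) (fst3 A) (snd3 A)"
  unfolding is_igraph_def by blast+

lemma igraph_Cmp_simps [simp]:
  assumes [simp]: "is_igraph A" "x \<in> Arr C"
  shows "Cod C x = ic0 A \<Longrightarrow> src A \<cdot> unt A \<cdot> x = x" "Cod C x = ic0 A \<Longrightarrow> tgt A \<cdot> unt A \<cdot> x = x"
    "Cod C x = ic2 A \<Longrightarrow> src A \<cdot> mul A \<cdot> x = src A \<cdot> fst2 A \<cdot> x"
    "Cod C x = ic2 A \<Longrightarrow> tgt A \<cdot> mul A \<cdot> x = tgt A \<cdot> snd2 A \<cdot> x"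
    "Cod C x = ic2 A \<Longrightarrow> tgt A \<cdot> fst2 A \<cdot> x = src A \<cdot> snd2 A \<cdot> x"
    "Cod C x = ic3 A \<Longrightarrow> snd2 A \<cdot> fst3 A \<cdot> x = fst2 A \<cdot> snd3 A \<cdot> x"
  using Cmp_eq_Cmp[OF igraph_simps(29), of A x] Cmp_eq_Cmp[OF igraph_simps(30), of A x]
    square_Cmp[OF igraph_simps(31), of A x] square_Cmp[OF igraph_simps(32), of A x]
    square_Cmp[OF igraph_simps(33), of A x] square_Cmp[OF igraph_simps(34), of A x] by simp_all

lemma pair2_simps [simp]:
  assumes A [simp]: "is_igraph A" and "composable A x y"
  shows "pair2 C A x y \<in> Arr C" "Dom C (pair2 C A x y) = Dom C x" "Cod C (pair2 C A x y) = ic2 A"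
    "fst2 A \<cdot> pair2 C A x y = x" "snd2 A \<cdot> pair2 C A x y = y"
proof -
  have xy: "x \<in> Arr C" "y \<in> Arr C" "Dom C y = Dom C x" "Cod C x = ic1 A" "Cod C y = ic1 A" "tgt A \<cdot> x = src A \<cdot> y"
    using assms by (simp_all add: composable_def)
  obtain u where "u \<in> Arr C" "Dom C u = Dom C x" "Cod C u = ic2 A" "fst2 A \<cdot> u = x" "snd2 A \<cdot> u = y"
    by (rule pullback_lift[OF igraph_pullback2[OF A], of x y]) (use xy in simp_all)
  then have "\<exists>!u. u \<in> hom C (Dom C x) (ic2 A) \<and> fst2 A \<cdot> u = x \<and> snd2 A \<cdot> u = y"
    by (intro ex1I[of _ u]) (auto simp: hom_def intro: pullback_eqI[OF igraph_pullback2[OF A]])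
  from theI'[OF this]
  show "pair2 C A x y \<in> Arr C" "Dom C (pair2 C A x y) = Dom C x" "Cod C (pair2 C A x y) = ic2 A"
    "fst2 A \<cdot> pair2 C A x y = x" "snd2 A \<cdot> pair2 C A x y = y"
    by (simp_all add: pair2_def hom_def)
qed

lemma pair2_eq:
  assumes "is_igraph A" "u \<in> Arr C" "Cod C u = ic2 A"
  shows "pair2 C A (fst2 A \<cdot> u) (snd2 A \<cdot> u) = u"
proof -
  have "composable A (fst2 A \<cdot> u) (snd2 A \<cdot> u)" using assms by (simp add: composable_def)
  then show ?thesis
    by (intro pullback_eqI[OF igraph_pullback2[OF assms(1)], of _ u]) (use assms in simp_all)
qed

lemma pair2_Cmp:
  assumes A [simp]: "is_igraph A" and xy: "composable A x y" and u: "u \<in> Arr C" "Cod C u = Dom C x"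
  shows "pair2 C A x y \<cdot> u = pair2 C A (x \<cdot> u) (y \<cdot> u)"
proof -
  have "fst2 A \<cdot> pair2 C A x y \<cdot> u = x \<cdot> u" "snd2 A \<cdot> pair2 C A x y \<cdot> u = y \<cdot> u"
    using xy u by (simp_all add: Cmp_eq_Cmp[OF pair2_simps(4)[OF A xy]] Cmp_eq_Cmp[OF pair2_simps(5)[OF A xy]])
  then show ?thesis
    using pair2_eq[OF A, of "pair2 C A x y \<cdot> u"] xy u by simp
qed

text \<open>The projections form the generic composable pair: \<open>mul\<close> is their composite,
  and every other composite arises from it by substitution.\<close>

lemma mul_Cmp:
  "is_igraph A \<Longrightarrow> u \<in> Arr C \<Longrightarrow> Cod C u = ic2 A \<Longrightarrow> mul A \<cdot> u = icomp C A (fst2 A \<cdot> u) (snd2 A \<cdot> u)"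
  by (simp add: icomp_def pair2_eq)

lemma mul_eq: "is_igraph A \<Longrightarrow> mul A = icomp C A (fst2 A) (snd2 A)"
  using mul_Cmp[of A "Idn C (ic2 A)"] by simp

lemma icomp_simps [simp]:
  assumes A [simp]: "is_igraph A" and xy: "composable A x y"
  shows "icomp C A x y \<in> Arr C" "Dom C (icomp C A x y) = Dom C x" "Cod C (icomp C A x y) = ic1 A"
    "src A \<cdot> icomp C A x y = src A \<cdot> x" "tgt A \<cdot> icomp C A x y = tgt A \<cdot> y"
  using xy by (simp_all add: icomp_def)

lemma icomp_Cmp [simp]:
  "is_igraph A \<Longrightarrow> composable A x y \<Longrightarrow> u \<in> Arr C \<Longrightarrow> Cod C u = Dom C x \<Longrightarrow>
    icomp C A x y \<cdot> u = icomp C A (x \<cdot> u) (y \<cdot> u)"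
  by (simp add: icomp_def pair2_Cmp)

text \<open>The Yoneda principle: an equation between the generic elements, namely the identity of
  \<open>ic1 A\<close> and the projections of \<open>ic3 A\<close>, amounts to the same equation
  between all generalised elements. Internal categories can then be handled as if they had
  elements.\<close>

lemma is_icat_iff:
  "is_icat C A \<longleftrightarrow> is_igraph A \<and>
     (\<forall>x. x \<in> Arr C \<longrightarrow> Cod C x = ic1 A \<longrightarrow> icomp C A (unt A \<cdot> src A \<cdot> x) x = x) \<and>
     (\<forall>x. x \<in> Arr C \<longrightarrow> Cod C x = ic1 A \<longrightarrow> icomp C A x (unt A \<cdot> tgt A \<cdot> x) = x) \<and>
     (\<forall>x y z. composable A x y \<longrightarrow> composable A y z \<longrightarrow>
        icomp C A (icomp C A x y) z = icomp C A x (icomp C A y z))"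
  (is "_ \<longleftrightarrow> _ \<and> ?L \<and> ?R \<and> ?assoc")
proof -
  let ?l = "icomp C A (unt A \<cdot> src A) (Idn C (ic1 A)) = Idn C (ic1 A)"
    and ?r = "icomp C A (Idn C (ic1 A)) (unt A \<cdot> tgt A) = Idn C (ic1 A)"
    and ?a = "icomp C A (mul A \<cdot> fst3 A) (snd2 A \<cdot> snd3 A) = icomp C A (fst2 A \<cdot> fst3 A) (mul A \<cdot> snd3 A)"
  have "is_icat C A \<longleftrightarrow> is_igraph A \<and> ?l \<and> ?r \<and> ?a"
    unfolding is_icat_def is_igraph_def by (simp only: conj_assoc)
  moreover have "?l \<longleftrightarrow> ?L" if [simp]: "is_igraph A"
  proof
    assume l: ?l
    show ?L
    proof (intro allI impI)
      fix x assume x [simp]: "x \<in> Arr C" "Cod C x = ic1 A"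
      have "composable A (unt A \<cdot> src A) (Idn C (ic1 A))" by (simp add: composable_def)
      then show "icomp C A (unt A \<cdot> src A \<cdot> x) x = x"
        using arg_cong[OF l, of "\<lambda>u. u \<cdot> x"] by simp
    qed
  next
    assume ?L then show ?l by (elim allE[of _ "Idn C (ic1 A)"]) simp
  qed
  moreover have "?r \<longleftrightarrow> ?R" if [simp]: "is_igraph A"
  proof
    assume r: ?r
    show ?R
    proof (intro allI impI)
      fix x assume x [simp]: "x \<in> Arr C" "Cod C x = ic1 A"
      have "composable A (Idn C (ic1 A)) (unt A \<cdot> tgt A)" by (simp add: composable_def)
      then show "icomp C A x (unt A \<cdot> tgt A \<cdot> x) = x"
        using arg_cong[OF r, of "\<lambda>u. u \<cdot> x"] by simp
    qed
  next
    assume ?R then show ?r by (elim allE[of _ "Idn C (ic1 A)"]) simp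
  qed
  moreover have "?a \<longleftrightarrow> ?assoc" if A [simp]: "is_igraph A"
  proof
    assume a: ?a
    show ?assoc
    proof (intro allI impI)
      fix x y z assume c [simp]: "composable A x y" "composable A y z"
      then have xyz [simp]: "x \<in> Arr C" "Dom C y = Dom C x" "y \<in> Arr C" "z \<in> Arr C" "Dom C z = Dom C x"
        by (auto simp: composable_def)
      \<comment> \<open>The generalised triple \<open>(x, y, z)\<close>, along which the generic
        associativity law is pulled back.\<close>
      obtain u where u: "u \<in> Arr C" "Dom C u = Dom C x" "Cod C u = ic3 A" "fst3 A \<cdot> u = pair2 C A x y"
        "snd3 A \<cdot> u = pair2 C A y z"
        by (rule pullback_lift[OF igraph_pullback3[OF A], of "pair2 C A x y" "pair2 C A y z"]) simp_all
      have c3: "composable A (mul A \<cdot> fst3 A) (snd2 A \<cdot> snd3 A)" "composable A (fst2 A \<cdot> fst3 A) (mul A \<cdot> snd3 A)"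
        by (simp_all add: composable_def)
      have "icomp C A (mul A \<cdot> fst3 A) (snd2 A \<cdot> snd3 A) \<cdot> u = icomp C A (fst2 A \<cdot> fst3 A) (mul A \<cdot> snd3 A) \<cdot> u"
        by (simp only: a)
      then have "icomp C A (mul A \<cdot> fst3 A \<cdot> u) (snd2 A \<cdot> snd3 A \<cdot> u) = icomp C A (fst2 A \<cdot> fst3 A \<cdot> u) (mul A \<cdot> snd3 A \<cdot> u)"
        using u(1-3) c3 by simp
      then show "icomp C A (icomp C A x y) z = icomp C A x (icomp C A y z)"
        by (simp add: u(4,5) icomp_def[of C A x y, symmetric] icomp_def[of C A y z, symmetric])
    qed
  next
    assume assoc: ?assoc
    \<comment> \<open>The generic composable triple.\<close>
    have c: "composable A (fst2 A \<cdot> fst3 A) (snd2 A \<cdot> fst3 A)" "composable A (snd2 A \<cdot> fst3 A) (snd2 A \<cdot> snd3 A)"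
      by (simp_all add: composable_def)
    from assoc[rule_format, OF this] show ?a by (simp add: mul_Cmp)
  qed
  ultimately show ?thesis by metis
qed

lemma icat_igraph [simp]: "is_icat C A \<Longrightarrow> is_igraph A"
  unfolding is_icat_iff by blast

lemma icomp_unt_left [simp]:
  "is_icat C A \<Longrightarrow> x \<in> Arr C \<Longrightarrow> Cod C x = ic1 A \<Longrightarrow> src A \<cdot> x = a \<Longrightarrow> icomp C A (unt A \<cdot> a) x = x"
  and icomp_unt_right [simp]:
  "is_icat C A \<Longrightarrow> x \<in> Arr C \<Longrightarrow> Cod C x = ic1 A \<Longrightarrow> tgt A \<cdot> x = a \<Longrightarrow> icomp C A x (unt A \<cdot> a) = x"
  unfolding is_icat_iff by blast+

lemma icomp_assoc [simp]:
  "is_icat C A \<Longrightarrow> composable A x y \<Longrightarrow> composable A y z \<Longrightarrow>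
    icomp C A (icomp C A x y) z = icomp C A x (icomp C A y z)"
  unfolding is_icat_iff by blast

text \<open>The functor laws without the unit and associativity laws of the two ends. Projections
  from a pullback and injections into a coproduct satisfy this before the new object is known to be
  a category, and its laws are then deduced through them.\<close>

definition is_gfun :: "('o, 'm) ifun \<Rightarrow> bool" where
  "is_gfun F \<longleftrightarrow> is_igraph (ifdom F) \<and> is_igraph (ifcod F) \<and>
     if0 F \<in> hom C (ic0 (ifdom F)) (ic0 (ifcod F)) \<and> if1 F \<in> hom C (ic1 (ifdom F)) (ic1 (ifcod F)) \<and>
     src (ifcod F) \<cdot> if1 F = if0 F \<cdot> src (ifdom F) \<and> tgt (ifcod F) \<cdot> if1 F = if0 F \<cdot> tgt (ifdom F) \<and>
     if1 F \<cdot> unt (ifdom F) = unt (ifcod F) \<cdot> if0 F \<and>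
     if1 F \<cdot> mul (ifdom F) = icomp C (ifcod F) (if1 F \<cdot> fst2 (ifdom F)) (if1 F \<cdot> snd2 (ifdom F))"

lemma is_ifun_iff: "is_ifun C F \<longleftrightarrow> is_gfun F \<and> is_icat C (ifdom F) \<and> is_icat C (ifcod F)"
  using icat_igraph[of "ifdom F"] icat_igraph[of "ifcod F"]
  unfolding is_ifun_def is_gfun_def Let_def by blast

lemma ifun_gfun [simp]: "is_ifun C F \<Longrightarrow> is_gfun F"
  and ifun_icat [simp]: "is_ifun C F \<Longrightarrow> is_icat C (ifdom F)" "is_ifun C F \<Longrightarrow> is_icat C (ifcod F)"
  unfolding is_ifun_iff by blast+

lemma gfun_igraph [simp]:
  "is_gfun F \<Longrightarrow> is_igraph (ifdom F)" "is_gfun F \<Longrightarrow> is_igraph (ifcod F)"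
  unfolding is_gfun_def by blast+

text \<open>The endpoints are kept as variables, so that the rules apply once \<open>ifdom F\<close> and \<open>ifcod F\<close> have been
  rewritten.\<close>

lemma gfun_simps [simp]:
  assumes "is_gfun F"
  shows "if0 F \<in> Arr C" "Dom C (if0 F) = ic0 (ifdom F)" "Cod C (if0 F) = ic0 (ifcod F)"
    "if1 F \<in> Arr C" "Dom C (if1 F) = ic1 (ifdom F)" "Cod C (if1 F) = ic1 (ifcod F)"
    "ifcod F = B \<Longrightarrow> src B \<cdot> if1 F = if0 F \<cdot> src (ifdom F)"
    "ifcod F = B \<Longrightarrow> tgt B \<cdot> if1 F = if0 F \<cdot> tgt (ifdom F)"
    "ifdom F = A \<Longrightarrow> if1 F \<cdot> unt A = unt (ifcod F) \<cdot> if0 F"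
  using assms unfolding is_gfun_def hom_def by auto

lemma gfun_Cmp_simps [simp]:
  assumes F [simp]: "is_gfun F" and [simp]: "x \<in> Arr C"
  shows "ifcod F = B \<Longrightarrow> Cod C x = ic1 (ifdom F) \<Longrightarrow> src B \<cdot> if1 F \<cdot> x = if0 F \<cdot> src (ifdom F) \<cdot> x"
    "ifcod F = B \<Longrightarrow> Cod C x = ic1 (ifdom F) \<Longrightarrow> tgt B \<cdot> if1 F \<cdot> x = if0 F \<cdot> tgt (ifdom F) \<cdot> x"
    "ifdom F = A \<Longrightarrow> Cod C x = ic0 A \<Longrightarrow> if1 F \<cdot> unt A \<cdot> x = unt (ifcod F) \<cdot> if0 F \<cdot> x"
proof -
  show "src B \<cdot> if1 F \<cdot> x = if0 F \<cdot> src (ifdom F) \<cdot> x" if "ifcod F = B" "Cod C x = ic1 (ifdom F)"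
    unfolding that(1)[symmetric]
    by (rule square_Cmp[OF gfun_simps(7)[OF F refl]]) (use that(2) in simp_all)
  show "tgt B \<cdot> if1 F \<cdot> x = if0 F \<cdot> tgt (ifdom F) \<cdot> x" if "ifcod F = B" "Cod C x = ic1 (ifdom F)"
    unfolding that(1)[symmetric]
    by (rule square_Cmp[OF gfun_simps(8)[OF F refl]]) (use that(2) in simp_all)
  show "if1 F \<cdot> unt A \<cdot> x = unt (ifcod F) \<cdot> if0 F \<cdot> x" if "ifdom F = A" "Cod C x = ic0 A"
    unfolding that(1)[symmetric]
    by (rule square_Cmp[OF gfun_simps(9)[OF F refl]]) (use that(2)[folded that(1)] in simp_all)
qed

lemma gfun_composable:
  "is_gfun F \<Longrightarrow> ifdom F = A \<Longrightarrow> ifcod F = B \<Longrightarrow> composable A x y \<Longrightarrow> composable B (if1 F \<cdot> x) (if1 F \<cdot> y)"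
  by (simp add: composable_def)

text \<open>The defining equation concerns the generic composable pair; precomposition with
  \<open>pair2\<close> yields every other pair.\<close>

lemma gfun_icomp:
  assumes F [simp]: "is_gfun F" and A: "ifdom F = A" and B: "ifcod F = B" and xy: "composable A x y"
  shows "if1 F \<cdot> icomp C A x y = icomp C B (if1 F \<cdot> x) (if1 F \<cdot> y)"
proof -
  note [simp] = A B
  have [simp]: "is_igraph A" "is_igraph B" using gfun_igraph[OF F] by simp_all
  have eq: "if1 F \<cdot> mul A = icomp C B (if1 F \<cdot> fst2 A) (if1 F \<cdot> snd2 A)"
    using F unfolding is_gfun_def by simp
  have c: "composable A (fst2 A) (snd2 A)" by (simp add: composable_def)
  have "if1 F \<cdot> icomp C A x y = icomp C B (if1 F \<cdot> fst2 A) (if1 F \<cdot> snd2 A) \<cdot> pair2 C A x y"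
    using xy by (simp add: icomp_def[of C A] Cmp_eq_Cmp[OF eq])
  also have "\<dots> = icomp C B (if1 F \<cdot> x) (if1 F \<cdot> y)"
    using xy gfun_composable[OF F A B c] by simp
  finally show ?thesis .
qed

lemma is_gfunI:
  assumes "is_igraph (ifdom F)" "is_igraph (ifcod F)"
    "if0 F \<in> Arr C" "Dom C (if0 F) = ic0 (ifdom F)" "Cod C (if0 F) = ic0 (ifcod F)"
    "if1 F \<in> Arr C" "Dom C (if1 F) = ic1 (ifdom F)" "Cod C (if1 F) = ic1 (ifcod F)"
    "src (ifcod F) \<cdot> if1 F = if0 F \<cdot> src (ifdom F)" "tgt (ifcod F) \<cdot> if1 F = if0 F \<cdot> tgt (ifdom F)"
    "if1 F \<cdot> unt (ifdom F) = unt (ifcod F) \<cdot> if0 F"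
    "\<And>x y. composable (ifdom F) x y \<Longrightarrow>
      if1 F \<cdot> icomp C (ifdom F) x y = icomp C (ifcod F) (if1 F \<cdot> x) (if1 F \<cdot> y)"
  shows "is_gfun F"
proof -
  have "composable (ifdom F) (fst2 (ifdom F)) (snd2 (ifdom F))"
    using assms(1) by (simp add: composable_def)
  from assms(12)[OF this] have "if1 F \<cdot> mul (ifdom F) = icomp C (ifcod F) (if1 F \<cdot> fst2 (ifdom F)) (if1 F \<cdot> snd2 (ifdom F))"
    by (simp only: mul_eq[OF assms(1), symmetric])
  then show ?thesis
    unfolding is_gfun_def hom_def using assms(1-11) by blast
qed

section \<open>Internal natural transformations\<close>

lemma is_itrans_iff:
  "is_itrans C \<alpha> \<longleftrightarrow> is_ifun C (itsrc \<alpha>) \<and> is_ifun C (ittrg \<alpha>) \<and> ifdom (ittrg \<alpha>) = ifdom (itsrc \<alpha>) \<and>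
     ifcod (ittrg \<alpha>) = ifcod (itsrc \<alpha>) \<and> itc \<alpha> \<in> Arr C \<and> Dom C (itc \<alpha>) = ic0 (ifdom (itsrc \<alpha>)) \<and>
     Cod C (itc \<alpha>) = ic1 (ifcod (itsrc \<alpha>)) \<and> src (ifcod (itsrc \<alpha>)) \<cdot> itc \<alpha> = if0 (itsrc \<alpha>) \<and>
     tgt (ifcod (itsrc \<alpha>)) \<cdot> itc \<alpha> = if0 (ittrg \<alpha>) \<and>
     icomp C (ifcod (itsrc \<alpha>)) (if1 (itsrc \<alpha>)) (itc \<alpha> \<cdot> tgt (ifdom (itsrc \<alpha>)))
       = icomp C (ifcod (itsrc \<alpha>)) (itc \<alpha> \<cdot> src (ifdom (itsrc \<alpha>))) (if1 (ittrg \<alpha>))"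
  by (simp add: is_itrans_def Let_def hom_def conj_assoc)

lemma itrans_simps [simp]:
  assumes "is_itrans C \<alpha>"
  shows "is_ifun C (itsrc \<alpha>)" "is_ifun C (ittrg \<alpha>)" "ifdom (ittrg \<alpha>) = ifdom (itsrc \<alpha>)"
    "ifcod (ittrg \<alpha>) = ifcod (itsrc \<alpha>)" "itc \<alpha> \<in> Arr C" "Dom C (itc \<alpha>) = ic0 (ifdom (itsrc \<alpha>))"
    "Cod C (itc \<alpha>) = ic1 (ifcod (itsrc \<alpha>))"
    "ifcod (itsrc \<alpha>) = B \<Longrightarrow> src B \<cdot> itc \<alpha> = if0 (itsrc \<alpha>)"
    "ifcod (itsrc \<alpha>) = B \<Longrightarrow> tgt B \<cdot> itc \<alpha> = if0 (ittrg \<alpha>)"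
  using assms unfolding is_itrans_iff by auto

lemma itrans_Cmp_simps [simp]:
  assumes \<alpha> [simp]: "is_itrans C \<alpha>" and [simp]: "x \<in> Arr C"
  shows "ifcod (itsrc \<alpha>) = B \<Longrightarrow> Cod C x = ic0 (ifdom (itsrc \<alpha>)) \<Longrightarrow> src B \<cdot> itc \<alpha> \<cdot> x = if0 (itsrc \<alpha>) \<cdot> x"
    "ifcod (itsrc \<alpha>) = B \<Longrightarrow> Cod C x = ic0 (ifdom (itsrc \<alpha>)) \<Longrightarrow> tgt B \<cdot> itc \<alpha> \<cdot> x = if0 (ittrg \<alpha>) \<cdot> x"
  using Cmp_eq_Cmp[OF itrans_simps(8)[OF \<alpha> refl], of x] Cmp_eq_Cmp[OF itrans_simps(9)[OF \<alpha> refl], of x] by auto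

lemma itrans_nat:
  assumes \<alpha> [simp]: "is_itrans C \<alpha>" and A: "ifdom (itsrc \<alpha>) = A" and B: "ifcod (itsrc \<alpha>) = B"
    and x [simp]: "x \<in> Arr C" "Cod C x = ic1 A"
  shows "icomp C B (if1 (itsrc \<alpha>) \<cdot> x) (itc \<alpha> \<cdot> tgt A \<cdot> x) = icomp C B (itc \<alpha> \<cdot> src A \<cdot> x) (if1 (ittrg \<alpha>) \<cdot> x)"
proof -
  note [simp] = A B
  have [simp]: "is_icat C A" "is_icat C B"
    using itrans_simps(1)[OF \<alpha>] ifun_icat[of "itsrc \<alpha>"] by simp_all
  have "icomp C B (if1 (itsrc \<alpha>)) (itc \<alpha> \<cdot> tgt A) \<cdot> x = icomp C B (itc \<alpha> \<cdot> src A) (if1 (ittrg \<alpha>)) \<cdot> x"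
    using \<alpha> unfolding is_itrans_iff by simp
  moreover have "composable B (if1 (itsrc \<alpha>)) (itc \<alpha> \<cdot> tgt A)" "composable B (itc \<alpha> \<cdot> src A) (if1 (ittrg \<alpha>))"
    by (simp_all add: composable_def)
  ultimately show ?thesis by simp
qed

lemma is_itransI:
  assumes "is_ifun C (itsrc \<alpha>)" "is_ifun C (ittrg \<alpha>)" "ifdom (ittrg \<alpha>) = ifdom (itsrc \<alpha>)"
    "ifcod (ittrg \<alpha>) = ifcod (itsrc \<alpha>)" "itc \<alpha> \<in> Arr C" "Dom C (itc \<alpha>) = ic0 (ifdom (itsrc \<alpha>))"
    "Cod C (itc \<alpha>) = ic1 (ifcod (itsrc \<alpha>))" "src (ifcod (itsrc \<alpha>)) \<cdot> itc \<alpha> = if0 (itsrc \<alpha>)"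
    "tgt (ifcod (itsrc \<alpha>)) \<cdot> itc \<alpha> = if0 (ittrg \<alpha>)"
    "\<And>x. x \<in> Arr C \<Longrightarrow> Cod C x = ic1 (ifdom (itsrc \<alpha>)) \<Longrightarrow>
      icomp C (ifcod (itsrc \<alpha>)) (if1 (itsrc \<alpha>) \<cdot> x) (itc \<alpha> \<cdot> tgt (ifdom (itsrc \<alpha>)) \<cdot> x)
       = icomp C (ifcod (itsrc \<alpha>)) (itc \<alpha> \<cdot> src (ifdom (itsrc \<alpha>)) \<cdot> x) (if1 (ittrg \<alpha>) \<cdot> x)"
  shows "is_itrans C \<alpha>"
  using assms(1-9) assms(10)[of "Idn C (ic1 (ifdom (itsrc \<alpha>)))"] unfolding is_itrans_iff by simp

section \<open>The 2-category of internal categories\<close>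

lemma CatI_simps [simp]:
  "A \<in> Obj (CatI C) \<longleftrightarrow> is_icat C A" "F \<in> Arr (CatI C) \<longleftrightarrow> is_ifun C F"
  "Dom (CatI C) = ifdom" "Cod (CatI C) = ifcod" "Idn (CatI C) = id_ifun C" "Cmp (CatI C) = comp_ifun C"
  "\<alpha> \<in> Cell (CatI C) \<longleftrightarrow> is_itrans C \<alpha>" "Src (CatI C) = itsrc" "Trg (CatI C) = ittrg"
  "Idc (CatI C) = id_itrans C" "Vc (CatI C) = vcomp_itrans C" "Hc (CatI C) = hcomp_itrans C"
  by (simp_all add: CatI_def)

lemma id_ifun_simps [simp]:
  "ifdom (id_ifun C A) = A" "ifcod (id_ifun C A) = A" "if0 (id_ifun C A) = Idn C (ic0 A)"
  "if1 (id_ifun C A) = Idn C (ic1 A)"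
  by (simp_all add: id_ifun_def)

lemma comp_ifun_simps [simp]:
  "ifdom (comp_ifun C G F) = ifdom F" "ifcod (comp_ifun C G F) = ifcod G"
  "if0 (comp_ifun C G F) = if0 G \<cdot> if0 F" "if1 (comp_ifun C G F) = if1 G \<cdot> if1 F"
  by (simp_all add: comp_ifun_def)

lemma id_itrans_simps [simp]:
  "itsrc (id_itrans C F) = F" "ittrg (id_itrans C F) = F" "itc (id_itrans C F) = unt (ifcod F) \<cdot> if0 F"
  by (simp_all add: id_itrans_def)

lemma vcomp_itrans_simps [simp]:
  "itsrc (vcomp_itrans C \<beta> \<alpha>) = itsrc \<alpha>" "ittrg (vcomp_itrans C \<beta> \<alpha>) = ittrg \<beta>"
  "itc (vcomp_itrans C \<beta> \<alpha>) = icomp C (ifcod (itsrc \<alpha>)) (itc \<alpha>) (itc \<beta>)"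
  by (simp_all add: vcomp_itrans_def)

lemma hcomp_itrans_simps [simp]:
  "itsrc (hcomp_itrans C \<beta> \<alpha>) = comp_ifun C (itsrc \<beta>) (itsrc \<alpha>)"
  "ittrg (hcomp_itrans C \<beta> \<alpha>) = comp_ifun C (ittrg \<beta>) (ittrg \<alpha>)"
  "itc (hcomp_itrans C \<beta> \<alpha>) =
     icomp C (ifcod (itsrc \<beta>)) (if1 (itsrc \<beta>) \<cdot> itc \<alpha>) (itc \<beta> \<cdot> if0 (ittrg \<alpha>))"
  by (simp_all add: hcomp_itrans_def)

lemma ifun_eqI: "ifdom F = ifdom G \<Longrightarrow> ifcod F = ifcod G \<Longrightarrow> if0 F = if0 G \<Longrightarrow> if1 F = if1 G \<Longrightarrow> F = (G :: ('o, 'm) ifun)"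
  by (cases F; cases G) simp

lemma itrans_eqI: "itsrc \<alpha> = itsrc \<beta> \<Longrightarrow> ittrg \<alpha> = ittrg \<beta> \<Longrightarrow> itc \<alpha> = itc \<beta> \<Longrightarrow> \<alpha> = (\<beta> :: ('o, 'm) itrans)"
  by (cases \<alpha>; cases \<beta>) simp

lemma composable_iff:
  "composable A x y \<longleftrightarrow> x \<in> Arr C \<and> y \<in> Arr C \<and> Dom C y = Dom C x \<and> Cod C x = ic1 A \<and> Cod C y = ic1 A \<and>
     tgt A \<cdot> x = src A \<cdot> y"
  by (simp add: composable_def)

lemma is_ifun_id [simp]: "is_icat C A \<Longrightarrow> is_ifun C (id_ifun C A)"
  unfolding is_ifun_iff by (intro conjI is_gfunI) (simp_all add: composable_iff)

lemma is_gfun_comp: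
  assumes "is_gfun F" "is_gfun G" "ifcod F = ifdom G"
  shows "is_gfun (comp_ifun C G F)"
proof (rule is_gfunI)
  fix x y assume xy: "composable (ifdom (comp_ifun C G F)) x y"
  have "composable (ifcod F) (if1 F \<cdot> x) (if1 F \<cdot> y)"
    using assms xy by (intro gfun_composable) simp_all
  then show "if1 (comp_ifun C G F) \<cdot> icomp C (ifdom (comp_ifun C G F)) x y =
      icomp C (ifcod (comp_ifun C G F)) (if1 (comp_ifun C G F) \<cdot> x) (if1 (comp_ifun C G F) \<cdot> y)"
    using assms xy gfun_icomp[of F "ifdom F" "ifcod F" x y] gfun_icomp[of G "ifdom G" "ifcod G" "if1 F \<cdot> x" "if1 F \<cdot> y"]
    by (simp add: composable_iff)
qed (use assms in simp_all)

lemma is_ifun_comp [simp]: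
  "is_ifun C F \<Longrightarrow> is_ifun C G \<Longrightarrow> ifcod F = ifdom G \<Longrightarrow> is_ifun C (comp_ifun C G F)"
  unfolding is_ifun_iff by (simp add: is_gfun_comp)

lemma category_CatI: "category (CatI C)"
  by unfold_locales (auto simp: hom_def intro!: ifun_eqI)

lemma is_itrans_id [simp]: "is_ifun C F \<Longrightarrow> is_itrans C (id_itrans C F)"
  by (rule is_itransI) simp_all

lemma is_itrans_vcomp [simp]:
  assumes \<alpha> [simp]: "is_itrans C \<alpha>" and \<beta> [simp]: "is_itrans C \<beta>" and eq [simp]: "ittrg \<alpha> = itsrc \<beta>"
  shows "is_itrans C (vcomp_itrans C \<beta> \<alpha>)"
proof (rule is_itransI)
  \<comment> \<open>Fixed names for the two ends: the equation between \<open>ittrg \<alpha>\<close>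
    and \<open>itsrc \<beta>\<close> would otherwise let the same category appear under different
    terms.\<close>
  define A B where AB: "A = ifdom (itsrc \<alpha>)" "B = ifcod (itsrc \<alpha>)"
  have [simp]: "ifdom (itsrc \<beta>) = A" "ifcod (itsrc \<beta>) = B" "ifdom (itsrc \<alpha>) = A" "ifcod (itsrc \<alpha>) = B"
    using itrans_simps(3,4)[OF \<alpha>] by (simp_all add: AB)
  have [simp]: "is_icat C A" "is_icat C B"
    unfolding AB using \<alpha> itrans_simps(1) ifun_icat by blast+
  have c [simp]: "composable B (itc \<alpha>) (itc \<beta>)"
    by (simp add: composable_iff)
  show "itc (vcomp_itrans C \<beta> \<alpha>) \<in> Arr C" "Dom C (itc (vcomp_itrans C \<beta> \<alpha>)) = ic0 (ifdom (itsrc (vcomp_itrans C \<beta> \<alpha>)))"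
    "Cod C (itc (vcomp_itrans C \<beta> \<alpha>)) = ic1 (ifcod (itsrc (vcomp_itrans C \<beta> \<alpha>)))"
    "src (ifcod (itsrc (vcomp_itrans C \<beta> \<alpha>))) \<cdot> itc (vcomp_itrans C \<beta> \<alpha>) = if0 (itsrc (vcomp_itrans C \<beta> \<alpha>))"
    "tgt (ifcod (itsrc (vcomp_itrans C \<beta> \<alpha>))) \<cdot> itc (vcomp_itrans C \<beta> \<alpha>) = if0 (ittrg (vcomp_itrans C \<beta> \<alpha>))"
    by simp_all
  fix x assume "x \<in> Arr C" "Cod C x = ic1 (ifdom (itsrc (vcomp_itrans C \<beta> \<alpha>)))"
  then have [simp]: "x \<in> Arr C" "Cod C x = ic1 A" by simp_all
  \<comment> \<open>The naturality squares at \<open>x\<close> are pasted: first that of \<alpha>,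
    then that of \<beta>.\<close>
  have "icomp C B (if1 (itsrc \<alpha>) \<cdot> x) (icomp C B (itc \<alpha> \<cdot> tgt A \<cdot> x) (itc \<beta> \<cdot> tgt A \<cdot> x)) =
     icomp C B (icomp C B (if1 (itsrc \<alpha>) \<cdot> x) (itc \<alpha> \<cdot> tgt A \<cdot> x)) (itc \<beta> \<cdot> tgt A \<cdot> x)"
    by (simp add: composable_iff)
  also have "\<dots> = icomp C B (itc \<alpha> \<cdot> src A \<cdot> x) (icomp C B (if1 (itsrc \<beta>) \<cdot> x) (itc \<beta> \<cdot> tgt A \<cdot> x))"
    by (subst itrans_nat[OF \<alpha>]) (simp_all add: composable_iff)
  also have "\<dots> = icomp C B (itc \<alpha> \<cdot> src A \<cdot> x) (icomp C B (itc \<beta> \<cdot> src A \<cdot> x) (if1 (ittrg \<beta>) \<cdot> x))"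
    by (subst itrans_nat[OF \<beta>]) simp_all
  finally show "icomp C (ifcod (itsrc (vcomp_itrans C \<beta> \<alpha>))) (if1 (itsrc (vcomp_itrans C \<beta> \<alpha>)) \<cdot> x)
      (itc (vcomp_itrans C \<beta> \<alpha>) \<cdot> tgt (ifdom (itsrc (vcomp_itrans C \<beta> \<alpha>))) \<cdot> x) =
    icomp C (ifcod (itsrc (vcomp_itrans C \<beta> \<alpha>))) (itc (vcomp_itrans C \<beta> \<alpha>) \<cdot> src (ifdom (itsrc (vcomp_itrans C \<beta> \<alpha>))) \<cdot> x)
      (if1 (ittrg (vcomp_itrans C \<beta> \<alpha>)) \<cdot> x)"
    by (simp add: composable_iff)
qed (use itrans_simps(3,4)[OF \<alpha>] in simp_all)

text \<open>Variant of \<open>itrans_nat\<close> with the endpoints of \<open>x\<close> abstracted,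
  for use after the simplifier has rewritten them.\<close>

lemma itrans_nat_itc:
  assumes \<beta> [simp]: "is_itrans C \<beta>" and A: "ifdom (itsrc \<beta>) = A" and B: "ifcod (itsrc \<beta>) = B"
    and "x \<in> Arr C" "Cod C x = ic1 A" "src A \<cdot> x = a" "tgt A \<cdot> x = b"
  shows "icomp C B (if1 (itsrc \<beta>) \<cdot> x) (itc \<beta> \<cdot> b) = icomp C B (itc \<beta> \<cdot> a) (if1 (ittrg \<beta>) \<cdot> x)"
  using itrans_nat[OF assms(1-5)] assms(6,7) by simp

lemma is_itrans_hcomp [simp]:
  assumes \<alpha> [simp]: "is_itrans C \<alpha>" and \<beta> [simp]: "is_itrans C \<beta>" and eq: "ifcod (itsrc \<alpha>) = ifdom (itsrc \<beta>)"
  shows "is_itrans C (hcomp_itrans C \<beta> \<alpha>)"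
proof (rule is_itransI)
  define A B D where AB: "A = ifdom (itsrc \<alpha>)" "B = ifcod (itsrc \<alpha>)" "D = ifcod (itsrc \<beta>)"
  have [simp]: "ifdom (itsrc \<beta>) = B" "ifcod (itsrc \<beta>) = D" "ifdom (itsrc \<alpha>) = A" "ifcod (itsrc \<alpha>) = B"
    using eq by (simp_all add: AB)
  have [simp]: "is_icat C A" "is_icat C B" "is_icat C D"
    unfolding AB using \<alpha> \<beta> itrans_simps(1) ifun_icat by blast+
  have c [simp]: "composable D (if1 (itsrc \<beta>) \<cdot> itc \<alpha>) (itc \<beta> \<cdot> if0 (ittrg \<alpha>))"
    by (simp add: composable_iff)
  show "itc (hcomp_itrans C \<beta> \<alpha>) \<in> Arr C" "Dom C (itc (hcomp_itrans C \<beta> \<alpha>)) = ic0 (ifdom (itsrc (hcomp_itrans C \<beta> \<alpha>)))"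
    "Cod C (itc (hcomp_itrans C \<beta> \<alpha>)) = ic1 (ifcod (itsrc (hcomp_itrans C \<beta> \<alpha>)))"
    "src (ifcod (itsrc (hcomp_itrans C \<beta> \<alpha>))) \<cdot> itc (hcomp_itrans C \<beta> \<alpha>) = if0 (itsrc (hcomp_itrans C \<beta> \<alpha>))"
    "tgt (ifcod (itsrc (hcomp_itrans C \<beta> \<alpha>))) \<cdot> itc (hcomp_itrans C \<beta> \<alpha>) = if0 (ittrg (hcomp_itrans C \<beta> \<alpha>))"
    by simp_all
  fix x assume "x \<in> Arr C" "Cod C x = ic1 (ifdom (itsrc (hcomp_itrans C \<beta> \<alpha>)))"
  then have [simp]: "x \<in> Arr C" "Cod C x = ic1 A" by simp_all
  let ?F = "itsrc \<alpha>" and ?F' = "ittrg \<alpha>" and ?G = "itsrc \<beta>" and ?G' = "ittrg \<beta>"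
  \<comment> \<open>First naturality of \<alpha> at \<open>x\<close>, inside the functor
    \<open>?G\<close>; then naturality of \<beta> at the arrow
    \<open>if1 ?F' \<cdot> x\<close>.\<close>
  have "icomp C D (if1 ?G \<cdot> if1 ?F \<cdot> x) (icomp C D (if1 ?G \<cdot> itc \<alpha> \<cdot> tgt A \<cdot> x) (itc \<beta> \<cdot> if0 ?F' \<cdot> tgt A \<cdot> x)) =
    icomp C D (if1 ?G \<cdot> icomp C B (if1 ?F \<cdot> x) (itc \<alpha> \<cdot> tgt A \<cdot> x)) (itc \<beta> \<cdot> if0 ?F' \<cdot> tgt A \<cdot> x)"
    by (subst gfun_icomp[where B = D]) (simp_all add: composable_iff)
  also have "\<dots> = icomp C D (if1 ?G \<cdot> itc \<alpha> \<cdot> src A \<cdot> x) (icomp C D (if1 ?G \<cdot> if1 ?F' \<cdot> x) (itc \<beta> \<cdot> if0 ?F' \<cdot> tgt A \<cdot> x))"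
    by (subst itrans_nat[OF \<alpha>, of A B], simp_all, subst gfun_icomp[where A = B and B = D]) (simp_all add: composable_iff)
  also have "\<dots> = icomp C D (if1 ?G \<cdot> itc \<alpha> \<cdot> src A \<cdot> x) (icomp C D (itc \<beta> \<cdot> if0 ?F' \<cdot> src A \<cdot> x) (if1 ?G' \<cdot> if1 ?F' \<cdot> x))"
    using itrans_nat_itc[OF \<beta>, of B D "if1 ?F' \<cdot> x" "if0 ?F' \<cdot> src A \<cdot> x" "if0 ?F' \<cdot> tgt A \<cdot> x"] by simp
  finally show "icomp C (ifcod (itsrc (hcomp_itrans C \<beta> \<alpha>))) (if1 (itsrc (hcomp_itrans C \<beta> \<alpha>)) \<cdot> x)
      (itc (hcomp_itrans C \<beta> \<alpha>) \<cdot> tgt (ifdom (itsrc (hcomp_itrans C \<beta> \<alpha>))) \<cdot> x) =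
    icomp C (ifcod (itsrc (hcomp_itrans C \<beta> \<alpha>))) (itc (hcomp_itrans C \<beta> \<alpha>) \<cdot> src (ifdom (itsrc (hcomp_itrans C \<beta> \<alpha>))) \<cdot> x)
      (if1 (ittrg (hcomp_itrans C \<beta> \<alpha>)) \<cdot> x)"
    by (simp add: composable_iff)
qed (use eq in simp_all)

lemma two_category_CatI: "two_category (CatI C)"
proof -
  interpret K: category "CatI C" by (rule category_CatI)
  have vc: "vcomp_itrans C (vcomp_itrans C \<gamma> \<beta>) \<alpha> = vcomp_itrans C \<gamma> (vcomp_itrans C \<beta> \<alpha>)"
    if [simp]: "is_itrans C \<alpha>" "is_itrans C \<beta>" "is_itrans C \<gamma>" and eq: "itsrc \<beta> = ittrg \<alpha>" "itsrc \<gamma> = ittrg \<beta>"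
    for \<alpha> \<beta> \<gamma>
  proof (rule itrans_eqI)
    define B where "B = ifcod (itsrc \<alpha>)"
    have [simp]: "ifcod (itsrc \<beta>) = B" "ifcod (itsrc \<gamma>) = B" "ifcod (itsrc \<alpha>) = B"
      "ifdom (itsrc \<beta>) = ifdom (itsrc \<alpha>)" "ifdom (itsrc \<gamma>) = ifdom (itsrc \<alpha>)"
      using eq itrans_simps(3,4)[of \<alpha>] itrans_simps(3,4)[of \<beta>] by (simp_all add: B_def)
    have "is_icat C (ifcod (itsrc \<alpha>))" using that(1) itrans_simps(1) ifun_icat by blast
    then have [simp]: "is_icat C B" by simp
    have "composable B (itc \<alpha>) (itc \<beta>)" "composable B (itc \<beta>) (itc \<gamma>)"
      by (simp_all add: composable_iff) (simp_all add: eq)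
    then show "itc (vcomp_itrans C (vcomp_itrans C \<gamma> \<beta>) \<alpha>) = itc (vcomp_itrans C \<gamma> (vcomp_itrans C \<beta> \<alpha>))"
      by simp
  qed simp_all
  have unit: "vcomp_itrans C \<alpha> (id_itrans C (itsrc \<alpha>)) = \<alpha>" "vcomp_itrans C (id_itrans C (ittrg \<alpha>)) \<alpha> = \<alpha>"
    "hcomp_itrans C \<alpha> (id_itrans C (id_ifun C (ifdom (itsrc \<alpha>)))) = \<alpha>"
    "hcomp_itrans C (id_itrans C (id_ifun C (ifcod (itsrc \<alpha>)))) \<alpha> = \<alpha>"
    if [simp]: "is_itrans C \<alpha>" for \<alpha>
  proof -
    show "vcomp_itrans C \<alpha> (id_itrans C (itsrc \<alpha>)) = \<alpha>" "vcomp_itrans C (id_itrans C (ittrg \<alpha>)) \<alpha> = \<alpha>"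
      by (rule itrans_eqI; simp)+
    have [simp]: "comp_ifun C F (id_ifun C (ifdom F)) = F" "comp_ifun C (id_ifun C (ifcod F)) F = F"
      if "is_ifun C F" for F
      using that by (auto intro!: ifun_eqI)
    have [simp]: "comp_ifun C (ittrg \<alpha>) (id_ifun C (ifdom (itsrc \<alpha>))) = ittrg \<alpha>"
      "comp_ifun C (id_ifun C (ifcod (itsrc \<alpha>))) (ittrg \<alpha>) = ittrg \<alpha>"
      by (auto intro!: ifun_eqI)
    show "hcomp_itrans C \<alpha> (id_itrans C (id_ifun C (ifdom (itsrc \<alpha>)))) = \<alpha>"
      "hcomp_itrans C (id_itrans C (id_ifun C (ifcod (itsrc \<alpha>)))) \<alpha> = \<alpha>"
      by (rule itrans_eqI; simp)+
  qed
  have comp_assoc: "comp_ifun C (comp_ifun C H G) F = comp_ifun C H (comp_ifun C G F)"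
    if "is_ifun C F" "is_ifun C G" "is_ifun C H" "ifcod F = ifdom G" "ifcod G = ifdom H" for F G H
    using that by (auto intro!: ifun_eqI)
  have hc: "hcomp_itrans C (hcomp_itrans C \<gamma> \<beta>) \<alpha> = hcomp_itrans C \<gamma> (hcomp_itrans C \<beta> \<alpha>)"
    if [simp]: "is_itrans C \<alpha>" "is_itrans C \<beta>" "is_itrans C \<gamma>" and eq: "ifcod (itsrc \<alpha>) = ifdom (itsrc \<beta>)"
      "ifcod (itsrc \<beta>) = ifdom (itsrc \<gamma>)" for \<alpha> \<beta> \<gamma>
  proof (rule itrans_eqI)
    define B D E where "B = ifcod (itsrc \<alpha>)" "D = ifcod (itsrc \<beta>)" "E = ifcod (itsrc \<gamma>)"
    then have [simp]: "ifcod (itsrc \<alpha>) = B" "ifdom (itsrc \<beta>) = B" "ifcod (itsrc \<beta>) = D" "ifdom (itsrc \<gamma>) = D"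
      "ifcod (itsrc \<gamma>) = E"
      using eq by simp_all
    have "is_icat C (ifcod (itsrc \<alpha>))" "is_icat C (ifcod (itsrc \<beta>))" "is_icat C (ifcod (itsrc \<gamma>))"
      using that(1-3) itrans_simps(1) ifun_icat by blast+
    then have [simp]: "is_icat C B" "is_icat C D" "is_icat C E" by simp_all
    show "itc (hcomp_itrans C (hcomp_itrans C \<gamma> \<beta>) \<alpha>) = itc (hcomp_itrans C \<gamma> (hcomp_itrans C \<beta> \<alpha>))"
      by (simp add: gfun_icomp[where F = "itsrc \<gamma>" and A = D and B = E] composable_iff)
  qed (use that in \<open>simp_all add: comp_assoc\<close>)
  have idid: "hcomp_itrans C (id_itrans C G) (id_itrans C F) = id_itrans C (comp_ifun C G F)"
    if "is_ifun C F" "is_ifun C G" "ifcod F = ifdom G" for F G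
    using that by (intro itrans_eqI) simp_all
  have inter: "hcomp_itrans C (vcomp_itrans C \<beta>' \<beta>) (vcomp_itrans C \<alpha>' \<alpha>) =
      vcomp_itrans C (hcomp_itrans C \<beta>' \<alpha>') (hcomp_itrans C \<beta> \<alpha>)"
    if [simp]: "is_itrans C \<alpha>" "is_itrans C \<beta>" "is_itrans C \<alpha>'" "is_itrans C \<beta>'"
      and eq: "itsrc \<alpha>' = ittrg \<alpha>" "itsrc \<beta>' = ittrg \<beta>" "ifcod (itsrc \<alpha>) = ifdom (itsrc \<beta>)" for \<alpha> \<beta> \<alpha>' \<beta>'
  proof (rule itrans_eqI)
    define B D where "B = ifcod (itsrc \<alpha>)" "D = ifcod (itsrc \<beta>)"
    then have [simp]: "ifcod (itsrc \<alpha>) = B" "ifdom (itsrc \<beta>) = B" "ifcod (itsrc \<beta>) = D"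
      "ifcod (itsrc \<alpha>') = B" "ifdom (itsrc \<beta>') = B" "ifcod (itsrc \<beta>') = D"
      "ifdom (itsrc \<alpha>') = ifdom (itsrc \<alpha>)"
      using eq itrans_simps(3,4)[of \<alpha>] itrans_simps(3,4)[of \<beta>] by simp_all
    have [simp]: "ittrg \<alpha> = itsrc \<alpha>'" "ittrg \<beta> = itsrc \<beta>'" using eq by simp_all
    have "is_icat C (ifcod (itsrc \<alpha>))" "is_icat C (ifcod (itsrc \<beta>))"
      using that(1-2) itrans_simps(1) ifun_icat by blast+
    then have [simp]: "is_icat C B" "is_icat C D" by simp_all
    let ?G = "if1 (itsrc \<beta>)" and ?G' = "if1 (itsrc \<beta>')" and ?F' = "if0 (itsrc \<alpha>')" and ?F'' = "if0 (ittrg \<alpha>')"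
    let ?c = "\<lambda>x y. icomp C D x y"
    have "?c (?c (?G \<cdot> itc \<alpha>) (?G \<cdot> itc \<alpha>')) (?c (itc \<beta> \<cdot> ?F'') (itc \<beta>' \<cdot> ?F'')) =
       ?c (?G \<cdot> itc \<alpha>) (?c (?c (?G \<cdot> itc \<alpha>') (itc \<beta> \<cdot> ?F'')) (itc \<beta>' \<cdot> ?F''))"
      by (simp add: composable_iff)
    \<comment> \<open>The heart of interchange: naturality of \<beta> at the component of
      \<alpha>'.\<close>
    also have "?c (?G \<cdot> itc \<alpha>') (itc \<beta> \<cdot> ?F'') = ?c (itc \<beta> \<cdot> ?F') (?G' \<cdot> itc \<alpha>')"
      using itrans_nat_itc[of \<beta> B D "itc \<alpha>'" ?F' ?F''] by simp
    also have "?c (?G \<cdot> itc \<alpha>) (?c (?c (itc \<beta> \<cdot> ?F') (?G' \<cdot> itc \<alpha>')) (itc \<beta>' \<cdot> ?F'')) =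
       ?c (?c (?G \<cdot> itc \<alpha>) (itc \<beta> \<cdot> ?F')) (?c (?G' \<cdot> itc \<alpha>') (itc \<beta>' \<cdot> ?F''))"
      by (simp add: composable_iff)
    finally show "itc (hcomp_itrans C (vcomp_itrans C \<beta>' \<beta>) (vcomp_itrans C \<alpha>' \<alpha>)) =
      itc (vcomp_itrans C (hcomp_itrans C \<beta>' \<alpha>') (hcomp_itrans C \<beta> \<alpha>))"
      by (simp add: gfun_icomp[where F = "itsrc \<beta>" and A = B and B = D] composable_iff)
  qed (use that in simp_all)
  show ?thesis
    by unfold_locales
      (auto simp: cells_def hom_def vc unit hc idid inter)
qed

end

section \<open>Pullbacks of internal categories\<close>

context category
begin

text \<open>One factor of the horizontal composite is the component of an identity transformation,
  and the unit law removes it.\<close>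

lemma itc_lwhisk [simp]:
  assumes "is_ifun C G" "is_itrans C \<alpha>" "ifcod (itsrc \<alpha>) = ifdom G"
  shows "itc (hcomp_itrans C (id_itrans C G) \<alpha>) = if1 G \<cdot> itc \<alpha>"
  using assms by (simp add: composable_iff)

lemma itc_rwhisk [simp]:
  assumes "is_ifun C F" "is_itrans C \<theta>" "ifcod F = ifdom (itsrc \<theta>)"
  shows "itc (hcomp_itrans C \<theta> (id_itrans C F)) = itc \<theta> \<cdot> if0 F"
proof -
  have "is_icat C (ifcod (itsrc \<theta>))" using assms(2) itrans_simps(1) ifun_icat by blast
  then show ?thesis using assms by (simp add: composable_iff)
qed

lemma ifun_commute:
  assumes "comp_ifun C F p = comp_ifun C G q"
  shows "if0 F \<cdot> if0 p = if0 G \<cdot> if0 q" "if1 F \<cdot> if1 p = if1 G \<cdot> if1 q"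
  using arg_cong[OF assms, of if0] arg_cong[OF assms, of if1] by simp_all

text \<open>The laws hold after applying \<open>p\<close> and \<open>q\<close>, because they hold in
  \<open>A\<close> and \<open>B\<close>. At this stage \<open>P\<close> is only a graph, which is
  why \<open>p\<close> and \<open>q\<close> are taken with \<open>is_gfun\<close> rather than
  \<open>is_ifun\<close>.\<close>

lemma is_icat_if_jointly_monic:
  assumes p: "is_gfun p" "ifdom p = P" "ifcod p = A" and q: "is_gfun q" "ifdom q = P" "ifcod q = B"
    and A: "is_icat C A" and B: "is_icat C B"
    and monic: "\<And>x y. x \<in> Arr C \<Longrightarrow> y \<in> Arr C \<Longrightarrow> Dom C y = Dom C x \<Longrightarrow> Cod C x = ic1 P \<Longrightarrow> Cod C y = ic1 P \<Longrightarrow>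
      if1 p \<cdot> x = if1 p \<cdot> y \<Longrightarrow> if1 q \<cdot> x = if1 q \<cdot> y \<Longrightarrow> x = y"
  shows "is_icat C P"
proof -
  note [simp] = p q A B
  have [simp]: "is_igraph P" using gfun_igraph(1)[OF p(1)] by simp
  note gi [simp] = gfun_icomp[OF p] gfun_icomp[OF q]
  show ?thesis
    unfolding is_icat_iff
  proof (intro conjI allI impI)
    fix x assume [simp]: "x \<in> Arr C" "Cod C x = ic1 P"
    have [simp]: "composable P (unt P \<cdot> src P \<cdot> x) x" "composable P x (unt P \<cdot> tgt P \<cdot> x)"
      by (simp_all add: composable_iff)
    show "icomp C P (unt P \<cdot> src P \<cdot> x) x = x" "icomp C P x (unt P \<cdot> tgt P \<cdot> x) = x"
      by (rule monic; simp)+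
  next
    fix x y z assume c [simp]: "composable P x y" "composable P y z"
    have [simp]: "composable P (icomp C P x y) z" "composable P x (icomp C P y z)"
      using c by (simp_all add: composable_iff)
    have [simp]: "composable A (if1 p \<cdot> x) (if1 p \<cdot> y)" "composable A (if1 p \<cdot> y) (if1 p \<cdot> z)"
      "composable B (if1 q \<cdot> x) (if1 q \<cdot> y)" "composable B (if1 q \<cdot> y) (if1 q \<cdot> z)"
      by (simp_all add: gfun_composable[OF p] gfun_composable[OF q])
    show "icomp C P (icomp C P x y) z = icomp C P x (icomp C P y z)"
      by (rule monic) simp_all
  qed simp
qed

text \<open>Objects and arrows suffice as levels: an internal functor is given by its parts at these
  two, and a transformation by one arrow between them.\<close>

definition levelwise_pullback :: "('o, 'm) ifun \<Rightarrow> ('o, 'm) ifun \<Rightarrow> ('o, 'm) ifun \<Rightarrow> ('o, 'm) ifun \<Rightarrow> bool" where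
  "levelwise_pullback F G p q \<longleftrightarrow> is_ifun C F \<and> is_ifun C G \<and> is_ifun C p \<and> is_ifun C q \<and>
     ifcod G = ifcod F \<and> ifcod p = ifdom F \<and> ifcod q = ifdom G \<and> ifdom q = ifdom p \<and>
     is_pullback C (if0 F) (if0 G) (ic0 (ifdom p)) (if0 p) (if0 q) \<and>
     is_pullback C (if1 F) (if1 G) (ic1 (ifdom p)) (if1 p) (if1 q)"

lemma levelwise_pullback_exists:
  assumes pb: "has_pullbacks C" and F [simp]: "is_ifun C F" and G [simp]: "is_ifun C G" and FG [simp]: "ifcod G = ifcod F"
  shows "\<exists>p q. levelwise_pullback F G p q"
proof -
  define A B D where "A = ifdom F" "B = ifdom G" "D = ifcod F"
  then have [simp]: "ifdom F = A" "ifdom G = B" "ifcod F = D" by simp_all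
  have "is_icat C (ifdom F)" "is_icat C (ifdom G)" "is_icat C (ifcod F)"
    using F G by (simp_all del: \<open>ifdom F = A\<close> \<open>ifdom G = B\<close> \<open>ifcod F = D\<close>)
  then have [simp]: "is_icat C A" "is_icat C B" "is_icat C D" by simp_all
  obtain P0 p0 q0 where P0: "is_pullback C (if0 F) (if0 G) P0 p0 q0"
    using pb unfolding has_pullbacks_def by (elim ballE[of _ _ "if0 F"] ballE[of _ _ "if0 G"]) auto
  obtain P1 p1 q1 where P1: "is_pullback C (if1 F) (if1 G) P1 p1 q1"
    using pb unfolding has_pullbacks_def by (elim ballE[of _ _ "if1 F"] ballE[of _ _ "if1 G"]) auto
  note P0s [simp] = pullbackD(4-10)[OF P0] and P1s [simp] = pullbackD(4-10)[OF P1]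
  have sq0: "if0 F \<cdot> p0 \<cdot> x = if0 G \<cdot> q0 \<cdot> x" if "x \<in> Arr C" "Cod C x = P0" for x
    using that square_Cmp[OF pullbackD(11)[OF P0], of x] by simp
  have sq1: "if1 F \<cdot> p1 \<cdot> x = if1 G \<cdot> q1 \<cdot> x" if "x \<in> Arr C" "Cod C x = P1" for x
    using that square_Cmp[OF pullbackD(11)[OF P1], of x] by simp
  have sq0': "if0 F \<cdot> p0 = if0 G \<cdot> q0" and sq1': "if1 F \<cdot> p1 = if1 G \<cdot> q1"
    by (rule pullbackD(11)[OF P0], rule pullbackD(11)[OF P1])
  have str: "if0 F \<cdot> src A \<cdot> p1 = if0 G \<cdot> src B \<cdot> q1" "if0 F \<cdot> tgt A \<cdot> p1 = if0 G \<cdot> tgt B \<cdot> q1"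
    "if1 F \<cdot> unt A \<cdot> p0 = if1 G \<cdot> unt B \<cdot> q0"
  proof -
    have "src D \<cdot> if1 F \<cdot> p1 = src D \<cdot> if1 G \<cdot> q1" "tgt D \<cdot> if1 F \<cdot> p1 = tgt D \<cdot> if1 G \<cdot> q1"
      "unt D \<cdot> if0 F \<cdot> p0 = unt D \<cdot> if0 G \<cdot> q0" by (simp_all only: sq0' sq1')
    then show "if0 F \<cdot> src A \<cdot> p1 = if0 G \<cdot> src B \<cdot> q1" "if0 F \<cdot> tgt A \<cdot> p1 = if0 G \<cdot> tgt B \<cdot> q1"
      "if1 F \<cdot> unt A \<cdot> p0 = if1 G \<cdot> unt B \<cdot> q0" by simp_all
  qed
  obtain s where s [simp]: "s \<in> Arr C" "Dom C s = P1" "Cod C s = P0" "p0 \<cdot> s = src A \<cdot> p1" "q0 \<cdot> s = src B \<cdot> q1"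
    by (rule pullback_lift[OF P0, of "src A \<cdot> p1" "src B \<cdot> q1"]) (simp_all add: str)
  obtain t where t [simp]: "t \<in> Arr C" "Dom C t = P1" "Cod C t = P0" "p0 \<cdot> t = tgt A \<cdot> p1" "q0 \<cdot> t = tgt B \<cdot> q1"
    by (rule pullback_lift[OF P0, of "tgt A \<cdot> p1" "tgt B \<cdot> q1"]) (simp_all add: str)
  obtain u where u [simp]: "u \<in> Arr C" "Dom C u = P0" "Cod C u = P1" "p1 \<cdot> u = unt A \<cdot> p0" "q1 \<cdot> u = unt B \<cdot> q0"
    by (rule pullback_lift[OF P1, of "unt A \<cdot> p0" "unt B \<cdot> q0"]) (simp_all add: str del: gfun_Cmp_simps)
  note [simp] = Cmp_eq_Cmp[OF u(4)] Cmp_eq_Cmp[OF u(5)] square_Cmp[OF s(4)] square_Cmp[OF s(5)]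
    square_Cmp[OF t(4)] square_Cmp[OF t(5)]
  \<comment> \<open>Composable pairs and triples are any pullbacks of the new structure maps;
    composition is then defined componentwise, through \<open>p1\<close> and
    \<open>q1\<close>.\<close>
  obtain P2 f2 g2 where P2: "is_pullback C t s P2 f2 g2"
    using pb unfolding has_pullbacks_def by (elim ballE[of _ _ t] ballE[of _ _ s]) auto
  note P2s [simp] = pullbackD(4-11)[OF P2]
  obtain P3 f3 g3 where P3: "is_pullback C g2 f2 P3 f3 g3"
    using pb unfolding has_pullbacks_def by (elim ballE[of _ _ g2] ballE[of _ _ f2]) auto
  note P3s [simp] = pullbackD(4-11)[OF P3]
  have cA [simp]: "composable A (p1 \<cdot> f2) (p1 \<cdot> g2)" and cB [simp]: "composable B (q1 \<cdot> f2) (q1 \<cdot> g2)"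
  proof -
    have "p0 \<cdot> t \<cdot> f2 = p0 \<cdot> s \<cdot> g2" "q0 \<cdot> t \<cdot> f2 = q0 \<cdot> s \<cdot> g2" by (simp_all only: pullbackD(11)[OF P2])
    then have "tgt A \<cdot> p1 \<cdot> f2 = src A \<cdot> p1 \<cdot> g2" "tgt B \<cdot> q1 \<cdot> f2 = src B \<cdot> q1 \<cdot> g2"
      by (simp_all del: pullbackD(11)[OF P2])
    then show "composable A (p1 \<cdot> f2) (p1 \<cdot> g2)" "composable B (q1 \<cdot> f2) (q1 \<cdot> g2)"
      by (simp_all add: composable_iff)
  qed
  obtain m where m [simp]: "m \<in> Arr C" "Dom C m = P2" "Cod C m = P1"
    "p1 \<cdot> m = icomp C A (p1 \<cdot> f2) (p1 \<cdot> g2)" "q1 \<cdot> m = icomp C B (q1 \<cdot> f2) (q1 \<cdot> g2)"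
  proof (rule pullback_lift[OF P1, of "icomp C A (p1 \<cdot> f2) (p1 \<cdot> g2)" "icomp C B (q1 \<cdot> f2) (q1 \<cdot> g2)"])
    show "if1 F \<cdot> icomp C A (p1 \<cdot> f2) (p1 \<cdot> g2) = if1 G \<cdot> icomp C B (q1 \<cdot> f2) (q1 \<cdot> g2)"
      by (simp add: gfun_icomp[of F A D] gfun_icomp[of G B D] sq1)
  qed simp_all
  define P :: "('o, 'm) icat" where "P = \<lparr>ic0 = P0, ic1 = P1, ic2 = P2, ic3 = P3, src = s, tgt = t, unt = u,
    fst2 = f2, snd2 = g2, mul = m, fst3 = f3, snd3 = g3\<rparr>"
  have P_simps [simp]: "ic0 P = P0" "ic1 P = P1" "ic2 P = P2" "ic3 P = P3" "src P = s" "tgt P = t" "unt P = u"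
    "fst2 P = f2" "snd2 P = g2" "mul P = m" "fst3 P = f3" "snd3 P = g3"
    by (simp_all add: P_def)
  have eqs: "s \<cdot> u = Idn C P0" "t \<cdot> u = Idn C P0" "s \<cdot> m = s \<cdot> f2" "t \<cdot> m = t \<cdot> g2"
    by (rule pullback_eqI[OF P0]; simp)+
  have graph [simp]: "is_igraph P"
    unfolding is_igraph_def by (simp add: hom_def P2 P3 eqs)
  define p :: "('o, 'm) ifun" where "p = \<lparr>ifdom = P, ifcod = A, if0 = p0, if1 = p1\<rparr>"
  define q :: "('o, 'm) ifun" where "q = \<lparr>ifdom = P, ifcod = B, if0 = q0, if1 = q1\<rparr>"
  have pq [simp]: "ifdom p = P" "ifcod p = A" "if0 p = p0" "if1 p = p1"
    "ifdom q = P" "ifcod q = B" "if0 q = q0" "if1 q = q1"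
    by (simp_all add: p_def q_def)
  have "is_gfun p" "is_gfun q"
    unfolding is_gfun_def by (simp_all add: hom_def)
  moreover have "is_icat C P"
    by (rule is_icat_if_jointly_monic[OF \<open>is_gfun p\<close> _ _ \<open>is_gfun q\<close>, of P A B])
      (simp_all, rule pullback_eqI[OF P1], simp_all)
  ultimately have "is_ifun C p" "is_ifun C q" by (simp_all add: is_ifun_iff)
  then have "levelwise_pullback F G p q"
    using P0 P1 by (simp add: levelwise_pullback_def)
  then show ?thesis by blast
qed

lemma levelwise_pullback_commute:
  assumes "levelwise_pullback F G p q"
  shows "comp_ifun C F p = comp_ifun C G q"
proof (rule ifun_eqI)
  show "if0 (comp_ifun C F p) = if0 (comp_ifun C G q)" "if1 (comp_ifun C F p) = if1 (comp_ifun C G q)"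
    using assms unfolding levelwise_pullback_def comp_ifun_simps by (blast intro: pullbackD(11))+
qed (use assms in \<open>simp_all add: levelwise_pullback_def\<close>)

text \<open>The pullbacks at objects and arrows provide the components of a functor or
  transformation into the vertex, and every equation required of them can be tested after
  \<open>p\<close> and \<open>q\<close>.\<close>

lemma pullback2_if_levelwise:
  assumes lw: "levelwise_pullback F G p q"
  shows "is_pullback2 (CatI C) F G (ifdom p) p q"
proof -
  note sq = levelwise_pullback_commute[OF lw]
  interpret K: two_category "CatI C" by (rule two_category_CatI)
  define A B D P where "A = ifdom F" "B = ifdom G" "D = ifcod F" "P = ifdom p"
  then have [simp]: "ifdom F = A" "ifdom G = B" "ifcod F = D" "ifcod G = D" "ifcod p = A" "ifcod q = B"
    "ifdom p = P" "ifdom q = P"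
    using lw by (simp_all add: levelwise_pullback_def)
  have [simp]: "is_ifun C F" "is_ifun C G" "is_ifun C p" "is_ifun C q"
    and P0: "is_pullback C (if0 F) (if0 G) (ic0 P) (if0 p) (if0 q)"
    and P1: "is_pullback C (if1 F) (if1 G) (ic1 P) (if1 p) (if1 q)"
    using lw by (simp_all add: levelwise_pullback_def)
  have "is_icat C (ifdom F)" "is_icat C (ifdom G)" "is_icat C (ifcod F)" "is_icat C (ifdom p)"
    using lw unfolding levelwise_pullback_def by (blast intro: ifun_icat)+
  then have [simp]: "is_icat C A" "is_icat C B" "is_icat C D" "is_icat C P" by simp_all
  note sq0 = ifun_commute(1)[OF sq] and sq1 = ifun_commute(2)[OF sq]
  have "is_pullback (CatI C) F G P p q"
  proof (rule K.pullbackI)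
    fix h k assume "h \<in> Arr (CatI C)" "k \<in> Arr (CatI C)" "Dom (CatI C) k = Dom (CatI C) h"
      "Cod (CatI C) h = Dom (CatI C) F" "Cod (CatI C) k = Dom (CatI C) G" and hk: "F \<cdot>\<^bsub>CatI C\<^esub> h = G \<cdot>\<^bsub>CatI C\<^esub> k"
    define X where "X = ifdom h"
    have [simp]: "is_ifun C h" "is_ifun C k" "ifdom h = X" "ifdom k = X" "ifcod h = A" "ifcod k = B"
      using \<open>h \<in> _\<close> \<open>k \<in> _\<close> \<open>Dom (CatI C) k = _\<close> \<open>Cod (CatI C) h = _\<close> \<open>Cod (CatI C) k = _\<close> by (simp_all add: X_def)
    have "is_icat C (ifdom h)" using \<open>h \<in> _\<close> by (simp del: \<open>ifdom h = X\<close>)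
    then have [simp]: "is_icat C X" by simp
    have hk0: "if0 F \<cdot> if0 h = if0 G \<cdot> if0 k" and hk1: "if1 F \<cdot> if1 h = if1 G \<cdot> if1 k"
      using hk ifun_commute[of F h G k] by simp_all
    obtain u0 where u0 [simp]: "u0 \<in> Arr C" "Dom C u0 = ic0 X" "Cod C u0 = ic0 P" "if0 p \<cdot> u0 = if0 h" "if0 q \<cdot> u0 = if0 k"
      by (rule pullback_lift[OF P0, of "if0 h" "if0 k"]) (simp_all add: hk0)
    obtain u1 where u1 [simp]: "u1 \<in> Arr C" "Dom C u1 = ic1 X" "Cod C u1 = ic1 P" "if1 p \<cdot> u1 = if1 h" "if1 q \<cdot> u1 = if1 k"
      by (rule pullback_lift[OF P1, of "if1 h" "if1 k"]) (simp_all add: hk1)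
    note [simp] = Cmp_eq_Cmp[OF u0(4)] Cmp_eq_Cmp[OF u0(5)] Cmp_eq_Cmp[OF u1(4)] Cmp_eq_Cmp[OF u1(5)]
    define u :: "('o, 'm) ifun" where "u = \<lparr>ifdom = X, ifcod = P, if0 = u0, if1 = u1\<rparr>"
    have [simp]: "ifdom u = X" "ifcod u = P" "if0 u = u0" "if1 u = u1" by (simp_all add: u_def)
    have st: "src P \<cdot> u1 = u0 \<cdot> src X" "tgt P \<cdot> u1 = u0 \<cdot> tgt X"
    proof -
      have "if0 p \<cdot> src P \<cdot> u1 = src A \<cdot> if1 p \<cdot> u1" "if0 q \<cdot> src P \<cdot> u1 = src B \<cdot> if1 q \<cdot> u1"
        "if0 p \<cdot> tgt P \<cdot> u1 = tgt A \<cdot> if1 p \<cdot> u1" "if0 q \<cdot> tgt P \<cdot> u1 = tgt B \<cdot> if1 q \<cdot> u1"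
        by (simp_all del: u1(4,5))
      then show "src P \<cdot> u1 = u0 \<cdot> src X" "tgt P \<cdot> u1 = u0 \<cdot> tgt X"
        by (intro pullback_eqI[OF P0, of _ "u0 \<cdot> src X"] pullback_eqI[OF P0, of _ "u0 \<cdot> tgt X"]; simp)+
    qed
    have un: "u1 \<cdot> unt X = unt P \<cdot> u0"
      by (rule pullback_eqI[OF P1]) simp_all
    have "is_gfun u"
    proof (rule is_gfunI)
      fix x y assume "composable (ifdom u) x y"
      then have c [simp]: "composable X x y" by simp
      then have xy: "x \<in> Arr C" "y \<in> Arr C" "Dom C y = Dom C x" "Cod C x = ic1 X" "Cod C y = ic1 X" "tgt X \<cdot> x = src X \<cdot> y"
        by (simp_all add: composable_def)
      have c' [simp]: "composable P (u1 \<cdot> x) (u1 \<cdot> y)"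
        using xy by (simp add: composable_iff square_Cmp[OF st(1)] square_Cmp[OF st(2)])
      have "u1 \<cdot> icomp C X x y = icomp C P (u1 \<cdot> x) (u1 \<cdot> y)"
        by (rule pullback_eqI[OF P1])
          (use xy in \<open>simp_all add: gfun_icomp[of p P A] gfun_icomp[of q P B] gfun_icomp[of h X A] gfun_icomp[of k X B]\<close>)
      then show "if1 u \<cdot> icomp C (ifdom u) x y = icomp C (ifcod u) (if1 u \<cdot> x) (if1 u \<cdot> y)" by simp
    qed (simp_all add: st un)
    then have "is_ifun C u" by (simp add: is_ifun_iff)
    moreover have "comp_ifun C p u = h" "comp_ifun C q u = k" by (simp_all add: ifun_eqI)
    ultimately show "\<exists>u. u \<in> Arr (CatI C) \<and> Dom (CatI C) u = Dom (CatI C) h \<and> Cod (CatI C) u = P \<and>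
        p \<cdot>\<^bsub>CatI C\<^esub> u = h \<and> q \<cdot>\<^bsub>CatI C\<^esub> u = k"
      by (intro exI[of _ u]) simp
  next
    fix u v assume uv: "u \<in> Arr (CatI C)" "v \<in> Arr (CatI C)" "Dom (CatI C) v = Dom (CatI C) u" "Cod (CatI C) u = P"
      "Cod (CatI C) v = P" "p \<cdot>\<^bsub>CatI C\<^esub> u = p \<cdot>\<^bsub>CatI C\<^esub> v" "q \<cdot>\<^bsub>CatI C\<^esub> u = q \<cdot>\<^bsub>CatI C\<^esub> v"
    then have "if0 p \<cdot> if0 u = if0 p \<cdot> if0 v" "if1 p \<cdot> if1 u = if1 p \<cdot> if1 v"
      "if0 q \<cdot> if0 u = if0 q \<cdot> if0 v" "if1 q \<cdot> if1 u = if1 q \<cdot> if1 v"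
      using ifun_commute[of p u p v] ifun_commute[of q u q v] by simp_all
    with uv show "u = v"
      using pullback_eqI[OF P0, of "if0 u" "if0 v"] pullback_eqI[OF P1, of "if1 u" "if1 v"]
      by (intro ifun_eqI) simp_all
  qed (use sq in simp_all)
  moreover have "\<exists>!\<theta>. \<theta> \<in> cells (CatI C) u v \<and> lwhisk (CatI C) p \<theta> = \<alpha> \<and> lwhisk (CatI C) q \<theta> = \<beta>"
    if u: "u \<in> hom (CatI C) X P" and v: "v \<in> hom (CatI C) X P" and
      \<alpha>: "\<alpha> \<in> cells (CatI C) (p \<cdot>\<^bsub>CatI C\<^esub> u) (p \<cdot>\<^bsub>CatI C\<^esub> v)" and
      \<beta>: "\<beta> \<in> cells (CatI C) (q \<cdot>\<^bsub>CatI C\<^esub> u) (q \<cdot>\<^bsub>CatI C\<^esub> v)" and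
      eq: "lwhisk (CatI C) F \<alpha> = lwhisk (CatI C) G \<beta>" for X u v \<alpha> \<beta>
  proof -
    have u_simps [simp]: "is_ifun C u" "ifdom u = X" "ifcod u = P" "is_ifun C v" "ifdom v = X" "ifcod v = P"
      using u v by (simp_all add: hom_def)
    have "is_icat C (ifdom u)" by (simp del: \<open>ifdom u = X\<close>)
    then have [simp]: "is_icat C X" by simp
    have \<alpha>_simps [simp]: "is_itrans C \<alpha>" "itsrc \<alpha> = comp_ifun C p u" "ittrg \<alpha> = comp_ifun C p v"
      and \<beta>_simps [simp]: "is_itrans C \<beta>" "itsrc \<beta> = comp_ifun C q u" "ittrg \<beta> = comp_ifun C q v"
      using \<alpha> \<beta> by (simp_all add: cells_def)
    have "if1 F \<cdot> itc \<alpha> = if1 G \<cdot> itc \<beta>"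
      using arg_cong[OF eq, of itc] by (simp add: lwhisk_def del: hcomp_itrans_simps)
    \<comment> \<open>The component of a transformation is an arrow into \<open>ic1 P\<close>, so
      the pullback at the level of arrows produces it.\<close>
    then obtain c where c [simp]: "c \<in> Arr C" "Dom C c = ic0 X" "Cod C c = ic1 P" "if1 p \<cdot> c = itc \<alpha>" "if1 q \<cdot> c = itc \<beta>"
      using pullback_lift[OF P1, of "itc \<alpha>" "itc \<beta>"] by auto
    note [simp] = Cmp_eq_Cmp[OF c(4)] Cmp_eq_Cmp[OF c(5)]
    have src_tgt [simp]: "src A \<cdot> itc \<alpha> = if0 p \<cdot> if0 u" "tgt A \<cdot> itc \<alpha> = if0 p \<cdot> if0 v"
      "src B \<cdot> itc \<beta> = if0 q \<cdot> if0 u" "tgt B \<cdot> itc \<beta> = if0 q \<cdot> if0 v"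
      using itrans_simps(8,9)[of \<alpha> A] itrans_simps(8,9)[of \<beta> B] by simp_all
    have st: "src P \<cdot> c = if0 u" "tgt P \<cdot> c = if0 v"
    proof -
      have "if0 p \<cdot> src P \<cdot> c = src A \<cdot> if1 p \<cdot> c" "if0 q \<cdot> src P \<cdot> c = src B \<cdot> if1 q \<cdot> c"
        "if0 p \<cdot> tgt P \<cdot> c = tgt A \<cdot> if1 p \<cdot> c" "if0 q \<cdot> tgt P \<cdot> c = tgt B \<cdot> if1 q \<cdot> c"
        by (simp_all del: c(4,5))
      then show "src P \<cdot> c = if0 u" "tgt P \<cdot> c = if0 v"
        by (intro pullback_eqI[OF P0, of _ "if0 u"] pullback_eqI[OF P0, of _ "if0 v"]; simp)+
    qed
    define \<theta> :: "('o, 'm) itrans" where "\<theta> = \<lparr>itsrc = u, ittrg = v, itc = c\<rparr>"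
    have \<theta>_simps [simp]: "itsrc \<theta> = u" "ittrg \<theta> = v" "itc \<theta> = c" by (simp_all add: \<theta>_def)
    have \<theta> [simp]: "is_itrans C \<theta>"
    proof (rule is_itransI)
      fix x assume "x \<in> Arr C" "Cod C x = ic1 (ifdom (itsrc \<theta>))"
      then have [simp]: "x \<in> Arr C" "Cod C x = ic1 X" by simp_all
      have cmp [simp]: "composable P (if1 u \<cdot> x) (c \<cdot> tgt X \<cdot> x)" "composable P (c \<cdot> src X \<cdot> x) (if1 v \<cdot> x)"
        by (simp_all add: composable_iff Cmp_eq_Cmp[OF st(1)] Cmp_eq_Cmp[OF st(2)])
      have "icomp C P (if1 u \<cdot> x) (c \<cdot> tgt X \<cdot> x) = icomp C P (c \<cdot> src X \<cdot> x) (if1 v \<cdot> x)"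
        by (rule pullback_eqI[OF P1])
          (use itrans_nat[of \<alpha> X A x] itrans_nat[of \<beta> X B x] in
            \<open>simp_all add: gfun_icomp[of p P A] gfun_icomp[of q P B]\<close>)
      then show "icomp C (ifcod (itsrc \<theta>)) (if1 (itsrc \<theta>) \<cdot> x) (itc \<theta> \<cdot> tgt (ifdom (itsrc \<theta>)) \<cdot> x)
        = icomp C (ifcod (itsrc \<theta>)) (itc \<theta> \<cdot> src (ifdom (itsrc \<theta>)) \<cdot> x) (if1 (ittrg \<theta>) \<cdot> x)" by simp
    qed (simp_all add: st)
    show ?thesis
    proof (rule ex1I[of _ \<theta>])
      show "\<theta> \<in> cells (CatI C) u v \<and> lwhisk (CatI C) p \<theta> = \<alpha> \<and> lwhisk (CatI C) q \<theta> = \<beta>"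
        by (auto simp: cells_def lwhisk_def intro!: itrans_eqI simp del: hcomp_itrans_simps(3))
    next
      fix \<gamma> assume \<gamma>: "\<gamma> \<in> cells (CatI C) u v \<and> lwhisk (CatI C) p \<gamma> = \<alpha> \<and> lwhisk (CatI C) q \<gamma> = \<beta>"
      then have [simp]: "is_itrans C \<gamma>" "itsrc \<gamma> = u" "ittrg \<gamma> = v" by (simp_all add: cells_def)
      have "itc (lwhisk (CatI C) p \<gamma>) = itc \<alpha>" "itc (lwhisk (CatI C) q \<gamma>) = itc \<beta>" using \<gamma> by simp_all
      then have "if1 p \<cdot> itc \<gamma> = if1 p \<cdot> c" "if1 q \<cdot> itc \<gamma> = if1 q \<cdot> c"
        by (simp_all add: lwhisk_def del: hcomp_itrans_simps)
      then have "itc \<gamma> = c"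
        by (intro pullback_eqI[OF P1, of "itc \<gamma>" c]) simp_all
      then show "\<gamma> = \<theta>" by (intro itrans_eqI) simp_all
    qed
  qed
  ultimately show ?thesis by (simp add: is_pullback2_def)
qed

lemma has_pullbacks2_CatI:
  assumes "has_pullbacks C"
  shows "has_pullbacks2 (CatI C)"
  unfolding has_pullbacks2_def
proof (intro ballI impI)
  fix F G assume "F \<in> Arr (CatI C)" "G \<in> Arr (CatI C)" "Cod (CatI C) F = Cod (CatI C) G"
  then obtain p q where lw: "levelwise_pullback F G p q"
    using levelwise_pullback_exists[OF assms, of F G] by auto
  from pullback2_if_levelwise[OF lw] show "\<exists>P p q. is_pullback2 (CatI C) F G P p q" by blast
qed

section \<open>Coproducts of internal categories\<close>

text \<open>In an extensive category a pullback of coproducts is the coproduct of the pullbacks: if the square of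
  the leg \<open>s\<close> is a pullback, then so is the square of the opposite projection \<open>f\<close>, along which \<open>Q2\<close> then
  decomposes.\<close>

lemma pullback_square_paste:
  assumes P: "is_pullback C i0 s A1 sA i1" and A2: "is_pullback C tA sA A2 fA gA" and Q2: "is_pullback C t s Q2 f g"
    and eq: "t \<cdot> i1 = i0 \<cdot> tA" "f \<cdot> i2 = i1 \<cdot> fA" "g \<cdot> i2 = i1 \<cdot> gA"
    and i2 [simp]: "i2 \<in> Arr C" "Dom C i2 = A2" "Cod C i2 = Q2"
    and dom [simp]: "Dom C s = Q1" "Dom C t = Q1" "Dom C tA = A1" "Dom C i0 = A0"
  shows "is_pullback C i1 f A2 fA i2"
proof -
  note [simp] = pullbackD(1-10)[OF P] pullbackD(1-10)[OF A2] pullbackD(1-10)[OF Q2]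
  have [simp]: "Cod C tA = A0" using pullbackD(3,9)[OF A2] pullbackD(9)[OF P] by simp
  note sqP = square_Cmp[OF pullbackD(11)[OF P]] and sqA = square_Cmp[OF pullbackD(11)[OF A2]]
    and sqQ = square_Cmp[OF pullbackD(11)[OF Q2]]
  have [simp]: "Cod C i0 = Cod C t" using pullbackD(3)[OF P] pullbackD(3)[OF Q2] by simp
  show ?thesis
  proof (rule pullbackI)
    fix h k assume "h \<in> Arr C" "k \<in> Arr C" "Dom C k = Dom C h" "Cod C h = Dom C i1" "Cod C k = Dom C f"
      and hk: "i1 \<cdot> h = f \<cdot> k"
    then have [simp]: "h \<in> Arr C" "k \<in> Arr C" "Dom C k = Dom C h" "Cod C h = A1" "Cod C k = Q2" by simp_all
    \<comment> \<open>The missing second component \<open>w\<close> in \<open>A1\<close> is obtained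
      from the square of \<open>s\<close>; together with \<open>h\<close> it gives an element of
      \<open>A2\<close>.\<close>
    have "i0 \<cdot> tA \<cdot> h = s \<cdot> g \<cdot> k"
      using square_Cmp[OF eq(1), of h] hk by (simp add: sqQ)
    then obtain w where w: "w \<in> Arr C" "Dom C w = Dom C h" "Cod C w = A1" "sA \<cdot> w = tA \<cdot> h" "i1 \<cdot> w = g \<cdot> k"
      using pullback_lift[OF P, of "tA \<cdot> h" "g \<cdot> k"] by auto
    obtain u where u: "u \<in> Arr C" "Dom C u = Dom C h" "Cod C u = A2" "fA \<cdot> u = h" "gA \<cdot> u = w"
      using pullback_lift[OF A2, of h w] w by auto
    have "i2 \<cdot> u = k"
      by (rule pullback_eqI[OF Q2])
        (use u w hk in \<open>simp_all add: square_Cmp[OF eq(2)] square_Cmp[OF eq(3)]\<close>)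
    with u show "\<exists>u. u \<in> Arr C \<and> Dom C u = Dom C h \<and> Cod C u = A2 \<and> fA \<cdot> u = h \<and> i2 \<cdot> u = k" by blast
  next
    fix u v assume uv: "u \<in> Arr C" "v \<in> Arr C" "Dom C v = Dom C u" "Cod C u = A2" "Cod C v = A2"
      "fA \<cdot> u = fA \<cdot> v" "i2 \<cdot> u = i2 \<cdot> v"
    have "g \<cdot> i2 \<cdot> u = g \<cdot> i2 \<cdot> v" "tA \<cdot> fA \<cdot> u = tA \<cdot> fA \<cdot> v" by (simp_all only: uv(6,7))
    then have "gA \<cdot> u = gA \<cdot> v"
      using uv(1-5) by (intro pullback_eqI[OF P, of "gA \<cdot> u" "gA \<cdot> v"]) (simp_all add: sqA square_Cmp[OF eq(3)])
    then show "u = v" using uv by (intro pullback_eqI[OF A2, of u v]) simp_all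
  qed (simp_all add: eq)
qed

lemma coproduct_of_pullbacks:
  assumes ext: "extensive C" and Q0: "is_coproduct C A0 B0 Q0 i0 j0" and Q1: "is_coproduct C A1 B1 Q1 i1 j1"
    and A2: "is_pullback C tA sA A2 fA gA" and B2: "is_pullback C tB sB B2 fB gB" and Q2: "is_pullback C t s Q2 f g"
    and eqA: "t \<cdot> i1 = i0 \<cdot> tA" "s \<cdot> i1 = i0 \<cdot> sA" "f \<cdot> i2 = i1 \<cdot> fA" "g \<cdot> i2 = i1 \<cdot> gA"
    and eqB: "t \<cdot> j1 = j0 \<cdot> tB" "s \<cdot> j1 = j0 \<cdot> sB" "f \<cdot> j2 = j1 \<cdot> fB" "g \<cdot> j2 = j1 \<cdot> gB"
    and i2 [simp]: "i2 \<in> Arr C" "Dom C i2 = A2" "Cod C i2 = Q2"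
    and j2 [simp]: "j2 \<in> Arr C" "Dom C j2 = B2" "Cod C j2 = Q2"
    and dom [simp]: "Dom C s = Q1" "Cod C s = Q0" "Dom C t = Q1" "Dom C tA = A1" "Dom C sA = A1" "Cod C sA = A0"
      "Dom C tB = B1" "Dom C sB = B1" "Cod C sB = B0"
  shows "is_coproduct C A2 B2 Q2 i2 j2"
proof -
  note [simp] = coproductD[OF Q0] coproductD[OF Q1] pullbackD(1-10)[OF A2] pullbackD(1-10)[OF B2] pullbackD(1-10)[OF Q2]
  \<comment> \<open>\<open>s\<close> maps one coproduct row to another, so the van Kampen property
    of \<open>Q0\<close> applies; the last step uses that of \<open>Q1\<close> in the opposite
    direction, along \<open>f\<close>.\<close>
  have S: "is_pullback C i0 s A1 sA i1" "is_pullback C j0 s B1 sB j1"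
    using van_kampenD[OF extensive_van_kampen[OF ext Q0] Q1, of sA sB s] eqA(2) eqB(2) by simp_all
  have "is_pullback C i1 f A2 fA i2"
    by (rule pullback_square_paste[OF S(1) A2 Q2 eqA(1,3,4), of Q1 A0]) simp_all
  moreover have "is_pullback C j1 f B2 fB j2"
    by (rule pullback_square_paste[OF S(2) B2 Q2 eqB(1,3,4), of Q1 B0]) simp_all
  ultimately show ?thesis
    using van_kampen_coproduct[OF extensive_van_kampen[OF ext Q1] Q1, of f A2 fA i2 B2 fB j2] by simp
qed

definition levelwise_coproduct :: "('o, 'm) ifun \<Rightarrow> ('o, 'm) ifun \<Rightarrow> bool" where
  "levelwise_coproduct i j \<longleftrightarrow> is_ifun C i \<and> is_ifun C j \<and> ifcod j = ifcod i \<and>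
     is_coproduct C (ic0 (ifdom i)) (ic0 (ifdom j)) (ic0 (ifcod i)) (if0 i) (if0 j) \<and>
     is_coproduct C (ic1 (ifdom i)) (ic1 (ifdom j)) (ic1 (ifcod i)) (if1 i) (if1 j)"

text \<open>The form suited to coproducts. Generalised elements of a coproduct, as in
  \<open>is_icat_iff\<close>, do not simply split into elements of the summands, whereas equations
  between arrows out of \<open>ic1\<close> and \<open>ic3\<close> are determined on the
  injections.\<close>

lemma is_icat_eqs:
  "is_icat C A \<longleftrightarrow> is_igraph A \<and> icomp C A (unt A \<cdot> src A) (Idn C (ic1 A)) = Idn C (ic1 A) \<and>
     icomp C A (Idn C (ic1 A)) (unt A \<cdot> tgt A) = Idn C (ic1 A) \<and>
     icomp C A (mul A \<cdot> fst3 A) (snd2 A \<cdot> snd3 A) = icomp C A (fst2 A \<cdot> fst3 A) (mul A \<cdot> snd3 A)"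
  unfolding is_icat_def is_igraph_def by (simp only: conj_assoc)

text \<open>\<open>src\<close>, \<open>tgt\<close> and \<open>unt\<close> are copaired at once.
  Composition starts at \<open>Q2\<close> and associativity compares arrows out of
  \<open>Q3\<close>, so both objects are first recognised as coproducts (\<open>C2\<close> and
  \<open>C3\<close>).\<close>

lemma levelwise_coproduct_exists:
  assumes ext: "extensive C" and A [simp]: "is_icat C A" and B [simp]: "is_icat C B"
  shows "\<exists>i j. levelwise_coproduct i j \<and> ifdom i = A \<and> ifdom j = B"
proof -
  have pb: "has_pullbacks C" and cp: "has_finite_coproducts C" using ext by (simp_all add: extensive_def)
  obtain Q0 i0 j0 where Q0: "is_coproduct C (ic0 A) (ic0 B) Q0 i0 j0"
    using cp unfolding has_finite_coproducts_def by (metis A B icat_igraph igraph_simps(1))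
  obtain Q1 i1 j1 where Q1: "is_coproduct C (ic1 A) (ic1 B) Q1 i1 j1"
    using cp unfolding has_finite_coproducts_def by (metis A B icat_igraph igraph_simps(2))
  note [simp] = coproductD[OF Q0] coproductD[OF Q1]
  obtain s where s [simp]: "s \<in> Arr C" "Dom C s = Q1" "Cod C s = Q0" "s \<cdot> i1 = i0 \<cdot> src A" "s \<cdot> j1 = j0 \<cdot> src B"
    by (rule copair[OF Q1, of "i0 \<cdot> src A" "j0 \<cdot> src B"]) simp_all
  obtain t where t [simp]: "t \<in> Arr C" "Dom C t = Q1" "Cod C t = Q0" "t \<cdot> i1 = i0 \<cdot> tgt A" "t \<cdot> j1 = j0 \<cdot> tgt B"
    by (rule copair[OF Q1, of "i0 \<cdot> tgt A" "j0 \<cdot> tgt B"]) simp_all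
  obtain u where u [simp]: "u \<in> Arr C" "Dom C u = Q0" "Cod C u = Q1" "u \<cdot> i0 = i1 \<cdot> unt A" "u \<cdot> j0 = j1 \<cdot> unt B"
    by (rule copair[OF Q0, of "i1 \<cdot> unt A" "j1 \<cdot> unt B"]) simp_all
  note [simp] = square_Cmp[OF s(4)] square_Cmp[OF s(5)] square_Cmp[OF t(4)] square_Cmp[OF t(5)]
    square_Cmp[OF u(4)] square_Cmp[OF u(5)]
  obtain Q2 f g where Q2: "is_pullback C t s Q2 f g"
    using pb unfolding has_pullbacks_def by (elim ballE[of _ _ t] ballE[of _ _ s]) auto
  note Q2s [simp] = pullbackD(4-11)[OF Q2]
  obtain Q3 f3 g3 where Q3: "is_pullback C g f Q3 f3 g3"
    using pb unfolding has_pullbacks_def by (elim ballE[of _ _ g] ballE[of _ _ f]) auto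
  note Q3s [simp] = pullbackD(4-11)[OF Q3]
  obtain i2 where i2 [simp]: "i2 \<in> Arr C" "Dom C i2 = ic2 A" "Cod C i2 = Q2" "f \<cdot> i2 = i1 \<cdot> fst2 A" "g \<cdot> i2 = i1 \<cdot> snd2 A"
    by (rule pullback_lift[OF Q2, of "i1 \<cdot> fst2 A" "i1 \<cdot> snd2 A"]) simp_all
  obtain j2 where j2 [simp]: "j2 \<in> Arr C" "Dom C j2 = ic2 B" "Cod C j2 = Q2" "f \<cdot> j2 = j1 \<cdot> fst2 B" "g \<cdot> j2 = j1 \<cdot> snd2 B"
    by (rule pullback_lift[OF Q2, of "j1 \<cdot> fst2 B" "j1 \<cdot> snd2 B"]) simp_all
  have C2: "is_coproduct C (ic2 A) (ic2 B) Q2 i2 j2"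
    by (rule coproduct_of_pullbacks[OF ext Q0 Q1 igraph_pullback2 igraph_pullback2 Q2]) simp_all
  note [simp] = square_Cmp[OF i2(4)] square_Cmp[OF i2(5)] square_Cmp[OF j2(4)] square_Cmp[OF j2(5)]
  obtain i3 where i3 [simp]: "i3 \<in> Arr C" "Dom C i3 = ic3 A" "Cod C i3 = Q3" "f3 \<cdot> i3 = i2 \<cdot> fst3 A" "g3 \<cdot> i3 = i2 \<cdot> snd3 A"
    by (rule pullback_lift[OF Q3, of "i2 \<cdot> fst3 A" "i2 \<cdot> snd3 A"]) simp_all
  obtain j3 where j3 [simp]: "j3 \<in> Arr C" "Dom C j3 = ic3 B" "Cod C j3 = Q3" "f3 \<cdot> j3 = j2 \<cdot> fst3 B" "g3 \<cdot> j3 = j2 \<cdot> snd3 B"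
    by (rule pullback_lift[OF Q3, of "j2 \<cdot> fst3 B" "j2 \<cdot> snd3 B"]) simp_all
  have C3: "is_coproduct C (ic3 A) (ic3 B) Q3 i3 j3"
    by (rule coproduct_of_pullbacks[OF ext Q1 C2 igraph_pullback3 igraph_pullback3 Q3]) simp_all
  obtain m where m [simp]: "m \<in> Arr C" "Dom C m = Q2" "Cod C m = Q1" "m \<cdot> i2 = i1 \<cdot> mul A" "m \<cdot> j2 = j1 \<cdot> mul B"
    by (rule copair[OF C2, of "i1 \<cdot> mul A" "j1 \<cdot> mul B"]) simp_all
  note [simp] = square_Cmp[OF m(4)] square_Cmp[OF m(5)]
  define Q :: "('o, 'm) icat" where "Q = \<lparr>ic0 = Q0, ic1 = Q1, ic2 = Q2, ic3 = Q3, src = s, tgt = t, unt = u,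
    fst2 = f, snd2 = g, mul = m, fst3 = f3, snd3 = g3\<rparr>"
  have Q_simps [simp]: "ic0 Q = Q0" "ic1 Q = Q1" "ic2 Q = Q2" "ic3 Q = Q3" "src Q = s" "tgt Q = t" "unt Q = u"
    "fst2 Q = f" "snd2 Q = g" "mul Q = m" "fst3 Q = f3" "snd3 Q = g3"
    by (simp_all add: Q_def)
  have eqs: "s \<cdot> u = Idn C Q0" "t \<cdot> u = Idn C Q0"
    by (rule coproduct_eqI[OF Q0]; simp)+
  have eqs2: "s \<cdot> m = s \<cdot> f" "t \<cdot> m = t \<cdot> g"
    by (rule coproduct_eqI[OF C2]; simp)+
  have graph [simp]: "is_igraph Q"
    unfolding is_igraph_def by (simp add: hom_def Q2 Q3 eqs eqs2)
  define i :: "('o, 'm) ifun" where "i = \<lparr>ifdom = A, ifcod = Q, if0 = i0, if1 = i1\<rparr>"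
  define j :: "('o, 'm) ifun" where "j = \<lparr>ifdom = B, ifcod = Q, if0 = j0, if1 = j1\<rparr>"
  have ij [simp]: "ifdom i = A" "ifcod i = Q" "if0 i = i0" "if1 i = i1"
    "ifdom j = B" "ifcod j = Q" "if0 j = j0" "if1 j = j1"
    by (simp_all add: i_def j_def)
  \<comment> \<open>On composable pairs the injections act as \<open>i2\<close> and
    \<open>j2\<close>, so they preserve composition by the choice of \<open>m\<close>.\<close>
  have pairs: "pair2 C Q (i1 \<cdot> fst2 A) (i1 \<cdot> snd2 A) = i2" "pair2 C Q (j1 \<cdot> fst2 B) (j1 \<cdot> snd2 B) = j2"
    using pair2_eq[OF graph, of i2] pair2_eq[OF graph, of j2] by simp_all
  have gi: "is_gfun i" "is_gfun j"
    unfolding is_gfun_def by (simp_all add: hom_def icomp_def pairs)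
  have "is_icat C Q"
    unfolding is_icat_eqs
  proof (intro conjI)
    have cu [simp]: "composable Q (unt Q \<cdot> src Q) (Idn C (ic1 Q))" "composable Q (Idn C (ic1 Q)) (unt Q \<cdot> tgt Q)"
      "composable A (unt A \<cdot> src A) (Idn C (ic1 A))" "composable A (Idn C (ic1 A)) (unt A \<cdot> tgt A)"
      "composable B (unt B \<cdot> src B) (Idn C (ic1 B))" "composable B (Idn C (ic1 B)) (unt B \<cdot> tgt B)"
      unfolding composable_iff using eqs by (simp_all add: Cmp_eq_Cmp[OF eqs(1)] Cmp_eq_Cmp[OF eqs(2)])
    note [simp] = cu(1,2)[simplified]
    show "icomp C Q (unt Q \<cdot> src Q) (Idn C (ic1 Q)) = Idn C (ic1 Q)"
      by (rule coproduct_eqI[OF Q1])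
        (use gfun_icomp[OF gi(1) ij(1,2) cu(3)] gfun_icomp[OF gi(2) ij(5,6) cu(5)] in simp_all)
    show "icomp C Q (Idn C (ic1 Q)) (unt Q \<cdot> tgt Q) = Idn C (ic1 Q)"
      by (rule coproduct_eqI[OF Q1])
        (use gfun_icomp[OF gi(1) ij(1,2) cu(4)] gfun_icomp[OF gi(2) ij(5,6) cu(6)] in simp_all)
    have c3: "composable D (mul D \<cdot> fst3 D) (snd2 D \<cdot> snd3 D)" "composable D (fst2 D \<cdot> fst3 D) (mul D \<cdot> snd3 D)"
      if "is_igraph D" for D
      using that by (simp_all add: composable_iff)
    have c3Q [simp]: "composable Q (m \<cdot> f3) (g \<cdot> g3)" "composable Q (f \<cdot> f3) (m \<cdot> g3)"
      using c3[OF graph] by simp_all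
    have "icomp C A (mul A \<cdot> fst3 A) (snd2 A \<cdot> snd3 A) = icomp C A (fst2 A \<cdot> fst3 A) (mul A \<cdot> snd3 A)"
      "icomp C B (mul B \<cdot> fst3 B) (snd2 B \<cdot> snd3 B) = icomp C B (fst2 B \<cdot> fst3 B) (mul B \<cdot> snd3 B)"
      using A B unfolding is_icat_eqs by blast+
    \<comment> \<open>The associativity law of each summand, transported along its injection; on
      \<open>Q3\<close> these are the two halves of the law for \<open>Q\<close>.\<close>
    from arg_cong[OF this(1), of "\<lambda>x. i1 \<cdot> x"] arg_cong[OF this(2), of "\<lambda>x. j1 \<cdot> x"]
    have "icomp C Q (i1 \<cdot> mul A \<cdot> fst3 A) (i1 \<cdot> snd2 A \<cdot> snd3 A) = icomp C Q (i1 \<cdot> fst2 A \<cdot> fst3 A) (i1 \<cdot> mul A \<cdot> snd3 A)"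
      "icomp C Q (j1 \<cdot> mul B \<cdot> fst3 B) (j1 \<cdot> snd2 B \<cdot> snd3 B) = icomp C Q (j1 \<cdot> fst2 B \<cdot> fst3 B) (j1 \<cdot> mul B \<cdot> snd3 B)"
      using gfun_icomp[OF gi(1) ij(1,2) c3(1)] gfun_icomp[OF gi(1) ij(1,2) c3(2)]
        gfun_icomp[OF gi(2) ij(5,6) c3(1)] gfun_icomp[OF gi(2) ij(5,6) c3(2)] by simp_all
    note eq = this
    show "icomp C Q (mul Q \<cdot> fst3 Q) (snd2 Q \<cdot> snd3 Q) = icomp C Q (fst2 Q \<cdot> fst3 Q) (mul Q \<cdot> snd3 Q)"
      by (rule coproduct_eqI[OF C3]) (use eq in simp_all)
  qed simp
  then have "levelwise_coproduct i j"
    using gi Q0 Q1 by (simp add: levelwise_coproduct_def is_ifun_iff)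
  then show ?thesis by (intro exI[of _ i] exI[of _ j]) simp
qed

lemma levelwise_coproductD:
  assumes "levelwise_coproduct i j"
  shows "is_ifun C i" "is_ifun C j" "ifcod j = ifcod i"
    "is_coproduct C (ic0 (ifdom i)) (ic0 (ifdom j)) (ic0 (ifcod i)) (if0 i) (if0 j)"
    "is_coproduct C (ic1 (ifdom i)) (ic1 (ifdom j)) (ic1 (ifcod i)) (if1 i) (if1 j)"
  using assms by (simp_all add: levelwise_coproduct_def)

definition if2 :: "('o, 'm) ifun \<Rightarrow> 'm" where
  "if2 F = pair2 C (ifcod F) (if1 F \<cdot> fst2 (ifdom F)) (if1 F \<cdot> snd2 (ifdom F))"

lemma if2_simps [simp]:
  assumes F [simp]: "is_gfun F"
  shows "if2 F \<in> Arr C" "Dom C (if2 F) = ic2 (ifdom F)" "Cod C (if2 F) = ic2 (ifcod F)"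
    "ifcod F = B \<Longrightarrow> fst2 B \<cdot> if2 F = if1 F \<cdot> fst2 (ifdom F)" "ifcod F = B \<Longrightarrow> snd2 B \<cdot> if2 F = if1 F \<cdot> snd2 (ifdom F)"
    "ifcod F = B \<Longrightarrow> mul B \<cdot> if2 F = if1 F \<cdot> mul (ifdom F)"
proof -
  have c: "composable (ifcod F) (if1 F \<cdot> fst2 (ifdom F)) (if1 F \<cdot> snd2 (ifdom F))"
    by (simp add: composable_iff)
  show 1: "if2 F \<in> Arr C" "Dom C (if2 F) = ic2 (ifdom F)" "Cod C (if2 F) = ic2 (ifcod F)"
    using c by (simp_all add: if2_def)
  show "ifcod F = B \<Longrightarrow> fst2 B \<cdot> if2 F = if1 F \<cdot> fst2 (ifdom F)" "ifcod F = B \<Longrightarrow> snd2 B \<cdot> if2 F = if1 F \<cdot> snd2 (ifdom F)"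
    using c by (auto simp: if2_def)
  have "composable (ifdom F) (fst2 (ifdom F)) (snd2 (ifdom F))" by (simp add: composable_iff)
  from gfun_icomp[OF F refl refl this]
  have "mul (ifcod F) \<cdot> if2 F = if1 F \<cdot> mul (ifdom F)"
    by (simp add: if2_def icomp_def[symmetric] mul_eq[symmetric])
  then show "ifcod F = B \<Longrightarrow> mul B \<cdot> if2 F = if1 F \<cdot> mul (ifdom F)" by auto
qed

lemma levelwise_coproduct_level2:
  assumes ext: "extensive C" and lw: "levelwise_coproduct i j"
  shows "is_coproduct C (ic2 (ifdom i)) (ic2 (ifdom j)) (ic2 (ifcod i)) (if2 i) (if2 j)"
proof -
  note lwD [simp] = levelwise_coproductD(1-3)[OF lw]
  have "is_gfun i" "is_gfun j" by (rule ifun_gfun, simp)+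
  have [simp]: "is_igraph (ifdom i)" "is_igraph (ifdom j)" "is_igraph (ifcod i)" using gfun_igraph \<open>is_gfun i\<close> \<open>is_gfun j\<close> by auto
  show ?thesis
    by (rule coproduct_of_pullbacks[OF ext levelwise_coproductD(4,5)[OF lw] igraph_pullback2 igraph_pullback2 igraph_pullback2])
      simp_all
qed

text \<open>The arrows between objects of triples are specified by their projections, so that the
  components of the nerve fit.\<close>

lemma levelwise_coproduct_level3:
  assumes ext: "extensive C" and lw: "levelwise_coproduct i j"
    and i3: "i3 \<in> Arr C" "Dom C i3 = ic3 (ifdom i)" "Cod C i3 = ic3 (ifcod i)"
      "fst3 (ifcod i) \<cdot> i3 = if2 i \<cdot> fst3 (ifdom i)" "snd3 (ifcod i) \<cdot> i3 = if2 i \<cdot> snd3 (ifdom i)"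
    and j3: "j3 \<in> Arr C" "Dom C j3 = ic3 (ifdom j)" "Cod C j3 = ic3 (ifcod i)"
      "fst3 (ifcod i) \<cdot> j3 = if2 j \<cdot> fst3 (ifdom j)" "snd3 (ifcod i) \<cdot> j3 = if2 j \<cdot> snd3 (ifdom j)"
  shows "is_coproduct C (ic3 (ifdom i)) (ic3 (ifdom j)) (ic3 (ifcod i)) i3 j3"
proof -
  note lwD [simp] = levelwise_coproductD(1-3)[OF lw]
  have "is_gfun i" "is_gfun j" by (rule ifun_gfun, simp)+
  have [simp]: "is_igraph (ifdom i)" "is_igraph (ifdom j)" "is_igraph (ifcod i)" using gfun_igraph \<open>is_gfun i\<close> \<open>is_gfun j\<close> by auto
  show ?thesis
    by (rule coproduct_of_pullbacks[OF ext levelwise_coproductD(5)[OF lw] levelwise_coproduct_level2[OF ext lw]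
          igraph_pullback3 igraph_pullback3 igraph_pullback3])
      (use i3 j3 in simp_all)
qed

text \<open>Copairing at objects and arrows gives the components of the induced functor. That it
  preserves composition is an equation between arrows out of \<open>ic2 Q\<close>; it splits along
  the summands because pairs form a coproduct, and this is where extensivity enters. The component
  of a transformation starts at \<open>ic0 Q\<close>, so copairing at objects yields it.\<close>

lemma coproduct2_if_levelwise:
  assumes ext: "extensive C" and lw: "levelwise_coproduct i j"
  shows "is_coproduct2 (CatI C) (ifdom i) (ifdom j) (ifcod i) i j"
proof -
  interpret K: two_category "CatI C" by (rule two_category_CatI)
  define A B Q where "A = ifdom i" "B = ifdom j" "Q = ifcod i"
  then have [simp]: "ifdom i = A" "ifdom j = B" "ifcod i = Q" "ifcod j = Q"
    using levelwise_coproductD(3)[OF lw] by simp_all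
  note ij [simp] = levelwise_coproductD(1,2)[OF lw]
  have "is_icat C (ifdom i)" "is_icat C (ifdom j)" "is_icat C (ifcod i)" using ij ifun_icat by blast+
  then have [simp]: "is_icat C A" "is_icat C B" "is_icat C Q" by simp_all
  have Q0: "is_coproduct C (ic0 A) (ic0 B) (ic0 Q) (if0 i) (if0 j)"
    and Q1: "is_coproduct C (ic1 A) (ic1 B) (ic1 Q) (if1 i) (if1 j)"
    and Q2: "is_coproduct C (ic2 A) (ic2 B) (ic2 Q) (if2 i) (if2 j)"
    using levelwise_coproductD(4,5)[OF lw] levelwise_coproduct_level2[OF ext lw] by simp_all
  have gi: "is_gfun i" "is_gfun j" by simp_all
  have "is_coproduct (CatI C) A B Q i j"
  proof (rule K.coproductI)
    fix h k assume "h \<in> Arr (CatI C)" "k \<in> Arr (CatI C)" "Dom (CatI C) h = A" "Dom (CatI C) k = B" "Cod (CatI C) k = Cod (CatI C) h"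
    define X where "X = ifcod h"
    have [simp]: "is_ifun C h" "is_ifun C k" "ifdom h = A" "ifdom k = B" "ifcod h = X" "ifcod k = X"
      using \<open>h \<in> _\<close> \<open>k \<in> _\<close> \<open>Dom (CatI C) h = A\<close> \<open>Dom (CatI C) k = B\<close> \<open>Cod (CatI C) k = _\<close> by (simp_all add: X_def)
    have "is_icat C (ifcod h)" using \<open>is_ifun C h\<close> ifun_icat by blast
    then have [simp]: "is_icat C X" by simp
    obtain u0 where u0 [simp]: "u0 \<in> Arr C" "Dom C u0 = ic0 Q" "Cod C u0 = ic0 X" "u0 \<cdot> if0 i = if0 h" "u0 \<cdot> if0 j = if0 k"
      by (rule copair[OF Q0, of "if0 h" "if0 k"]) simp_all
    obtain u1 where u1 [simp]: "u1 \<in> Arr C" "Dom C u1 = ic1 Q" "Cod C u1 = ic1 X" "u1 \<cdot> if1 i = if1 h" "u1 \<cdot> if1 j = if1 k"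
      by (rule copair[OF Q1, of "if1 h" "if1 k"]) simp_all
    note [simp] = Cmp_eq_Cmp[OF u0(4)] Cmp_eq_Cmp[OF u0(5)] Cmp_eq_Cmp[OF u1(4)] Cmp_eq_Cmp[OF u1(5)]
    have st: "src X \<cdot> u1 = u0 \<cdot> src Q" "tgt X \<cdot> u1 = u0 \<cdot> tgt Q"
      by (rule coproduct_eqI[OF Q1]; simp)+
    \<comment> \<open>The simp rules move \<open>unt\<close> to the left of a functor, which hides
      the composite \<open>u1 \<cdot> if1 i\<close>; these equations restore it.\<close>
    have "u1 \<cdot> unt Q \<cdot> if0 i = (u1 \<cdot> if1 i) \<cdot> unt A" "u1 \<cdot> unt Q \<cdot> if0 j = (u1 \<cdot> if1 j) \<cdot> unt B"
      by (subst Cmp_assoc_eq; simp)+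
    then have un: "u1 \<cdot> unt Q = unt X \<cdot> u0"
      by (intro coproduct_eqI[OF Q0, of "u1 \<cdot> unt Q"]) simp_all
    have cX [simp]: "composable X (u1 \<cdot> fst2 Q) (u1 \<cdot> snd2 Q)"
      by (simp add: composable_iff square_Cmp[OF st(1)] square_Cmp[OF st(2)])
    have ch: "composable A (fst2 A) (snd2 A)" and ck: "composable B (fst2 B) (snd2 B)" by (simp_all add: composable_iff)
    have mulh: "if1 h \<cdot> mul A = icomp C X (if1 h \<cdot> fst2 A) (if1 h \<cdot> snd2 A)"
      "if1 k \<cdot> mul B = icomp C X (if1 k \<cdot> fst2 B) (if1 k \<cdot> snd2 B)"
      using gfun_icomp[of h A X, OF _ _ _ ch] gfun_icomp[of k B X, OF _ _ _ ck]
      by (simp_all add: mul_eq[symmetric])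
    have mu: "u1 \<cdot> mul Q = icomp C X (u1 \<cdot> fst2 Q) (u1 \<cdot> snd2 Q)"
      by (rule coproduct_eqI[OF Q2]) (simp_all add: mulh)
    define u :: "('o, 'm) ifun" where "u = \<lparr>ifdom = Q, ifcod = X, if0 = u0, if1 = u1\<rparr>"
    have [simp]: "ifdom u = Q" "ifcod u = X" "if0 u = u0" "if1 u = u1" by (simp_all add: u_def)
    have "is_gfun u" unfolding is_gfun_def by (simp add: hom_def st un mu)
    then have "is_ifun C u" by (simp add: is_ifun_iff)
    moreover have "comp_ifun C u i = h" "comp_ifun C u j = k" by (simp_all add: ifun_eqI)
    ultimately show "\<exists>u. u \<in> Arr (CatI C) \<and> Dom (CatI C) u = Q \<and> Cod (CatI C) u = Cod (CatI C) h \<and>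
        u \<cdot>\<^bsub>CatI C\<^esub> i = h \<and> u \<cdot>\<^bsub>CatI C\<^esub> j = k"
      by (intro exI[of _ u]) simp
  next
    fix u v assume uv: "u \<in> Arr (CatI C)" "v \<in> Arr (CatI C)" "Dom (CatI C) u = Q" "Dom (CatI C) v = Q"
      "Cod (CatI C) v = Cod (CatI C) u" "u \<cdot>\<^bsub>CatI C\<^esub> i = v \<cdot>\<^bsub>CatI C\<^esub> i" "u \<cdot>\<^bsub>CatI C\<^esub> j = v \<cdot>\<^bsub>CatI C\<^esub> j"
    then have "if0 u \<cdot> if0 i = if0 v \<cdot> if0 i" "if1 u \<cdot> if1 i = if1 v \<cdot> if1 i"
      "if0 u \<cdot> if0 j = if0 v \<cdot> if0 j" "if1 u \<cdot> if1 j = if1 v \<cdot> if1 j"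
      using ifun_commute[of u i v i] ifun_commute[of u j v j] by simp_all
    with uv show "u = v"
      using coproduct_eqI[OF Q0, of "if0 u" "if0 v"] coproduct_eqI[OF Q1, of "if1 u" "if1 v"]
      by (intro ifun_eqI) simp_all
  qed simp_all
  moreover have "\<exists>!\<theta>. \<theta> \<in> cells (CatI C) u v \<and> rwhisk (CatI C) \<theta> i = \<alpha> \<and> rwhisk (CatI C) \<theta> j = \<beta>"
    if u: "u \<in> hom (CatI C) Q X" and v: "v \<in> hom (CatI C) Q X" and
      \<alpha>: "\<alpha> \<in> cells (CatI C) (u \<cdot>\<^bsub>CatI C\<^esub> i) (v \<cdot>\<^bsub>CatI C\<^esub> i)" and
      \<beta>: "\<beta> \<in> cells (CatI C) (u \<cdot>\<^bsub>CatI C\<^esub> j) (v \<cdot>\<^bsub>CatI C\<^esub> j)" for X u v \<alpha> \<beta>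
  proof -
    have u_simps [simp]: "is_ifun C u" "ifdom u = Q" "ifcod u = X" "is_ifun C v" "ifdom v = Q" "ifcod v = X"
      using u v by (simp_all add: hom_def)
    have "is_icat C (ifcod u)" using \<open>is_ifun C u\<close> ifun_icat by blast
    then have [simp]: "is_icat C X" by simp
    have \<alpha>_simps [simp]: "is_itrans C \<alpha>" "itsrc \<alpha> = comp_ifun C u i" "ittrg \<alpha> = comp_ifun C v i"
      and \<beta>_simps [simp]: "is_itrans C \<beta>" "itsrc \<beta> = comp_ifun C u j" "ittrg \<beta> = comp_ifun C v j"
      using \<alpha> \<beta> by (simp_all add: cells_def)
    obtain c where c [simp]: "c \<in> Arr C" "Dom C c = ic0 Q" "Cod C c = ic1 X" "c \<cdot> if0 i = itc \<alpha>" "c \<cdot> if0 j = itc \<beta>"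
      using copair[OF Q0, of "itc \<alpha>" "itc \<beta>"] by auto
    note [simp] = Cmp_eq_Cmp[OF c(4)] Cmp_eq_Cmp[OF c(5)]
    have src_tgt [simp]: "src X \<cdot> itc \<alpha> = if0 u \<cdot> if0 i" "tgt X \<cdot> itc \<alpha> = if0 v \<cdot> if0 i"
      "src X \<cdot> itc \<beta> = if0 u \<cdot> if0 j" "tgt X \<cdot> itc \<beta> = if0 v \<cdot> if0 j"
      using itrans_simps(8,9)[of \<alpha> X] itrans_simps(8,9)[of \<beta> X] by simp_all
    have st: "src X \<cdot> c = if0 u" "tgt X \<cdot> c = if0 v"
      by (rule coproduct_eqI[OF Q0]; simp)+
    define \<theta> :: "('o, 'm) itrans" where "\<theta> = \<lparr>itsrc = u, ittrg = v, itc = c\<rparr>"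
    have \<theta>_simps [simp]: "itsrc \<theta> = u" "ittrg \<theta> = v" "itc \<theta> = c" by (simp_all add: \<theta>_def)
    have cmp [simp]: "composable X (if1 u) (c \<cdot> tgt Q)" "composable X (c \<cdot> src Q) (if1 v)"
      by (simp_all add: composable_iff Cmp_eq_Cmp[OF st(1)] Cmp_eq_Cmp[OF st(2)])
    have "icomp C X (if1 u) (c \<cdot> tgt Q) = icomp C X (c \<cdot> src Q) (if1 v)"
      by (rule coproduct_eqI[OF Q1])
        (use itrans_nat[of \<alpha> A X "Idn C (ic1 A)"] itrans_nat[of \<beta> B X "Idn C (ic1 B)"] in simp_all)
    then have \<theta> [simp]: "is_itrans C \<theta>"
      unfolding is_itrans_iff by (simp add: st)
    show ?thesis
    proof (rule ex1I[of _ \<theta>])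
      show "\<theta> \<in> cells (CatI C) u v \<and> rwhisk (CatI C) \<theta> i = \<alpha> \<and> rwhisk (CatI C) \<theta> j = \<beta>"
        by (auto simp: cells_def rwhisk_def intro!: itrans_eqI simp del: hcomp_itrans_simps(3))
    next
      fix \<gamma> assume \<gamma>: "\<gamma> \<in> cells (CatI C) u v \<and> rwhisk (CatI C) \<gamma> i = \<alpha> \<and> rwhisk (CatI C) \<gamma> j = \<beta>"
      then have [simp]: "is_itrans C \<gamma>" "itsrc \<gamma> = u" "ittrg \<gamma> = v" by (simp_all add: cells_def)
      have "itc (rwhisk (CatI C) \<gamma> i) = itc \<alpha>" "itc (rwhisk (CatI C) \<gamma> j) = itc \<beta>" using \<gamma> by simp_all
      then have "itc \<gamma> \<cdot> if0 i = c \<cdot> if0 i" "itc \<gamma> \<cdot> if0 j = c \<cdot> if0 j"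
        by (simp_all add: rwhisk_def del: hcomp_itrans_simps)
      then have "itc \<gamma> = c"
        by (intro coproduct_eqI[OF Q0, of "itc \<gamma>" c]) simp_all
      then show "\<gamma> = \<theta>" by (intro itrans_eqI) simp_all
    qed
  qed
  ultimately show ?thesis by (simp add: is_coproduct2_def)
qed

lemma comp_ifun_iso_levels:
  assumes "is_iso (CatI C) t"
  shows "is_iso C (if0 t)" "is_iso C (if1 t)"
proof -
  obtain t' where t: "is_ifun C t" and t': "is_ifun C t'" "ifdom t' = ifcod t" "ifcod t' = ifdom t"
    "comp_ifun C t' t = id_ifun C (ifdom t)" "comp_ifun C t t' = id_ifun C (ifcod t)"
    using assms unfolding is_iso_def hom_def by auto
  have "if0 t' \<cdot> if0 t = Idn C (ic0 (ifdom t))" "if0 t \<cdot> if0 t' = Idn C (ic0 (ifcod t))"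
    "if1 t' \<cdot> if1 t = Idn C (ic1 (ifdom t))" "if1 t \<cdot> if1 t' = Idn C (ic1 (ifcod t))"
    using arg_cong[OF t'(4), of if0] arg_cong[OF t'(5), of if0] arg_cong[OF t'(4), of if1] arg_cong[OF t'(5), of if1]
    by simp_all
  with t t' show "is_iso C (if0 t)" "is_iso C (if1 t)"
    by (auto intro!: is_isoI[of "if0 t" "if0 t'"] is_isoI[of "if1 t" "if1 t'"])
qed

text \<open>Any coproduct is isomorphic to the levelwise one, and an isomorphism of internal
  categories is invertible on objects and on arrows.\<close>

lemma levelwise_if_coproduct:
  assumes ext: "extensive C" and Q: "is_coproduct (CatI C) A B Q i j"
  shows "levelwise_coproduct i j"
proof -
  interpret K: two_category "CatI C" by (rule two_category_CatI)
  note Qs [simp] = K.coproductD[OF Q, simplified]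
  obtain i' j' where lw: "levelwise_coproduct i' j'" and [simp]: "ifdom i' = A" "ifdom j' = B"
    using levelwise_coproduct_exists[OF ext, of A B] by auto
  have Q': "is_coproduct (CatI C) A B (ifcod i') i' j'"
    using coproduct2_if_levelwise[OF ext lw] by (simp add: is_coproduct2_def)
  obtain t where t: "is_iso (CatI C) t" "is_ifun C t" "ifdom t = ifcod i'" "ifcod t = Q"
    "comp_ifun C t i' = i" "comp_ifun C t j' = j"
    using K.coproduct_comparison[OF Q' Q] by auto
  have "if0 t \<cdot> if0 i' = if0 i" "if0 t \<cdot> if0 j' = if0 j" "if1 t \<cdot> if1 i' = if1 i" "if1 t \<cdot> if1 j' = if1 j"
    unfolding t(5,6)[symmetric] by simp_all
  moreover have "is_coproduct C (ic0 A) (ic0 B) (Cod C (if0 t)) (if0 t \<cdot> if0 i') (if0 t \<cdot> if0 j')"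
    by (rule coproduct_iso[OF _ comp_ifun_iso_levels(1)[OF t(1)]])
      (use levelwise_coproductD(4)[OF lw] t(2,3) in simp_all)
  moreover have "is_coproduct C (ic1 A) (ic1 B) (Cod C (if1 t)) (if1 t \<cdot> if1 i') (if1 t \<cdot> if1 j')"
    by (rule coproduct_iso[OF _ comp_ifun_iso_levels(2)[OF t(1)]])
      (use levelwise_coproductD(5)[OF lw] t(2,3) in simp_all)
  ultimately show ?thesis
    using t(2,4) by (simp add: levelwise_coproduct_def)
qed

lemma van_kampen_CatI:
  assumes ext: "extensive C" and Q: "is_coproduct (CatI C) A B Q i j"
  shows "category.van_kampen (CatI C) A B Q i j"
proof -
  interpret K: two_category "CatI C" by (rule two_category_CatI)
  note Qs [simp] = K.coproductD[OF Q, simplified]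
  have pb: "has_pullbacks C" using ext by (simp add: extensive_def)
  have lw: "levelwise_coproduct i j" by (rule levelwise_if_coproduct[OF ext Q])
  have Q0: "is_coproduct C (ic0 A) (ic0 B) (ic0 Q) (if0 i) (if0 j)"
    and Q1: "is_coproduct C (ic1 A) (ic1 B) (ic1 Q) (if1 i) (if1 j)"
    using levelwise_coproductD(4,5)[OF lw] by simp_all
  note vk0 = extensive_van_kampen[OF ext Q0] and vk1 = extensive_van_kampen[OF ext Q1]
  show ?thesis
  proof (rule K.van_kampenI[OF Q])
    fix x y assume "x \<in> Arr (CatI C)" "y \<in> Arr (CatI C)" "Cod (CatI C) x = A" "Cod (CatI C) y = B"
    then have xy [simp]: "is_ifun C x" "is_ifun C y" "ifcod x = A" "ifcod y = B" by simp_all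
    obtain m n where lwZ: "levelwise_coproduct m n" and [simp]: "ifdom m = ifdom x" "ifdom n = ifdom y"
      using levelwise_coproduct_exists[OF ext, of "ifdom x" "ifdom y"] by auto
    define Z where "Z = ifcod m"
    have [simp]: "ifcod m = Z" "ifcod n = Z" "is_ifun C m" "is_ifun C n"
      using levelwise_coproductD(1-3)[OF lwZ] by (simp_all add: Z_def)
    have Z: "is_coproduct (CatI C) (ifdom x) (ifdom y) Z m n"
      using coproduct2_if_levelwise[OF ext lwZ] by (simp add: is_coproduct2_def)
    obtain z where z: "is_ifun C z" "ifdom z = Z" "ifcod z = Q" "comp_ifun C z m = comp_ifun C i x"
      "comp_ifun C z n = comp_ifun C j y"
      using K.copair[OF Z, of "comp_ifun C i x" "comp_ifun C j y"] by auto
    note [simp] = z(1-3)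
    note sq = ifun_commute[OF z(4)] ifun_commute[OF z(5)]
    have p0: "is_pullback C (if0 i) (if0 z) (ic0 (ifdom x)) (if0 x) (if0 m)"
      "is_pullback C (if0 j) (if0 z) (ic0 (ifdom y)) (if0 y) (if0 n)"
      using van_kampenD[OF vk0, of "ic0 (ifdom x)" "ic0 (ifdom y)" "ic0 Z" "if0 m" "if0 n" "if0 x" "if0 y" "if0 z"]
        levelwise_coproductD(4)[OF lwZ] sq by simp_all
    have p1: "is_pullback C (if1 i) (if1 z) (ic1 (ifdom x)) (if1 x) (if1 m)"
      "is_pullback C (if1 j) (if1 z) (ic1 (ifdom y)) (if1 y) (if1 n)"
      using van_kampenD[OF vk1, of "ic1 (ifdom x)" "ic1 (ifdom y)" "ic1 Z" "if1 m" "if1 n" "if1 x" "if1 y" "if1 z"]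
        levelwise_coproductD(5)[OF lwZ] sq by simp_all
    have "levelwise_pullback i z x m" "levelwise_pullback j z y n"
      using p0 p1 by (simp_all add: levelwise_pullback_def)
    from this[THEN pullback2_if_levelwise]
    have "is_pullback (CatI C) i z (ifdom x) x m" "is_pullback (CatI C) j z (ifdom y) y n"
      by (simp_all add: is_pullback2_def)
    with Z z show "\<exists>Z z m n. is_coproduct (CatI C) (Dom (CatI C) x) (Dom (CatI C) y) Z m n \<and> z \<in> Arr (CatI C) \<and>
        Dom (CatI C) z = Z \<and> z \<cdot>\<^bsub>CatI C\<^esub> m = i \<cdot>\<^bsub>CatI C\<^esub> x \<and> z \<cdot>\<^bsub>CatI C\<^esub> n = j \<cdot>\<^bsub>CatI C\<^esub> y \<and>
        is_pullback (CatI C) i z (Dom (CatI C) x) x m \<and> is_pullback (CatI C) j z (Dom (CatI C) y) y n"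
      by (intro exI[of _ Z] exI[of _ z] exI[of _ m] exI[of _ n]) simp
  next
    fix z assume "z \<in> Arr (CatI C)" "Cod (CatI C) z = Q"
    then have [simp]: "is_ifun C z" "ifcod z = Q" by simp_all
    obtain x m where xm: "levelwise_pullback i z x m"
      using levelwise_pullback_exists[OF pb, of i z] by auto
    obtain y n where yn: "levelwise_pullback j z y n"
      using levelwise_pullback_exists[OF pb, of j z] by auto
    have [simp]: "is_ifun C x" "is_ifun C m" "ifcod x = A" "ifcod m = ifdom z" "ifdom m = ifdom x"
      "is_ifun C y" "is_ifun C n" "ifcod y = B" "ifcod n = ifdom z" "ifdom n = ifdom y"
      using xm yn by (simp_all add: levelwise_pullback_def)
    have "is_coproduct C (ic0 (ifdom x)) (ic0 (ifdom y)) (Dom C (if0 z)) (if0 m) (if0 n)"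
      by (rule van_kampen_coproduct[OF vk0 Q0, where x = "if0 x" and y = "if0 y"]) (use xm yn in \<open>simp_all add: levelwise_pullback_def\<close>)
    moreover have "is_coproduct C (ic1 (ifdom x)) (ic1 (ifdom y)) (Dom C (if1 z)) (if1 m) (if1 n)"
      by (rule van_kampen_coproduct[OF vk1 Q1, where x = "if1 x" and y = "if1 y"]) (use xm yn in \<open>simp_all add: levelwise_pullback_def\<close>)
    ultimately have "levelwise_coproduct m n"
      by (simp add: levelwise_coproduct_def)
    from coproduct2_if_levelwise[OF ext this]
    have "is_coproduct (CatI C) (ifdom x) (ifdom y) (ifdom z) m n" by (simp add: is_coproduct2_def)
    moreover have "comp_ifun C z m = comp_ifun C i x" "comp_ifun C z n = comp_ifun C j y"
      using levelwise_pullback_commute[OF xm] levelwise_pullback_commute[OF yn] by simp_all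
    ultimately show "\<exists>x y m n. x \<in> Arr (CatI C) \<and> y \<in> Arr (CatI C) \<and> Cod (CatI C) x = A \<and> Cod (CatI C) y = B \<and>
        is_coproduct (CatI C) (Dom (CatI C) x) (Dom (CatI C) y) (Dom (CatI C) z) m n \<and>
        z \<cdot>\<^bsub>CatI C\<^esub> m = i \<cdot>\<^bsub>CatI C\<^esub> x \<and> z \<cdot>\<^bsub>CatI C\<^esub> n = j \<cdot>\<^bsub>CatI C\<^esub> y"
      by (intro exI[of _ x] exI[of _ y] exI[of _ m] exI[of _ n]) simp
  qed
qed

section \<open>Discrete and codiscrete internal categories\<close>

definition disc :: "'o \<Rightarrow> ('o, 'm) icat" where
  "disc X = \<lparr>ic0 = X, ic1 = X, ic2 = X, ic3 = X, src = Idn C X, tgt = Idn C X, unt = Idn C X,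
     fst2 = Idn C X, snd2 = Idn C X, mul = Idn C X, fst3 = Idn C X, snd3 = Idn C X\<rparr>"

lemma disc_simps [simp]:
  "ic0 (disc X) = X" "ic1 (disc X) = X" "ic2 (disc X) = X" "ic3 (disc X) = X"
  "src (disc X) = Idn C X" "tgt (disc X) = Idn C X" "unt (disc X) = Idn C X"
  "fst2 (disc X) = Idn C X" "snd2 (disc X) = Idn C X" "mul (disc X) = Idn C X"
  "fst3 (disc X) = Idn C X" "snd3 (disc X) = Idn C X"
  by (simp_all add: disc_def)

lemma is_icat_disc [simp]:
  assumes [simp]: "X \<in> Obj C"
  shows "is_icat C (disc X)"
proof -
  have P: "is_pullback C (Idn C X) (Idn C X) X (Idn C X) (Idn C X)"
    by (rule pullbackI) auto
  have graph [simp]: "is_igraph (disc X)" unfolding is_igraph_def by (simp add: P hom_def)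
  have [simp]: "icomp C (disc X) x x = x" if "x \<in> Arr C" "Cod C x = X" for x
    using mul_Cmp[OF graph, of x] that by simp
  \<comment> \<open>Source and target are identities here, so composable arrows coincide.\<close>
  have eq: "y = x" if "composable (disc X) x y" for x y
    using that unfolding composable_def disc_simps by (elim conjE) simp
  show ?thesis unfolding is_icat_iff
  proof (intro conjI allI impI)
    fix x y z assume c: "composable (disc X) x y" "composable (disc X) y z"
    then show "icomp C (disc X) (icomp C (disc X) x y) z = icomp C (disc X) x (icomp C (disc X) y z)"
      using eq[OF c(1)] eq[OF c(2)] by (simp add: composable_iff)
  qed simp_all
qed

lemma icomp_disc: "X \<in> Obj C \<Longrightarrow> x \<in> Arr C \<Longrightarrow> Cod C x = X \<Longrightarrow> icomp C (disc X) x x = x"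
  using icomp_unt_left[of "disc X" x x] by simp

text \<open>The transpose of \<open>f\<close> under the adjunction between discrete categories and
  objects of objects.\<close>

definition from_disc :: "('o, 'm) icat \<Rightarrow> 'm \<Rightarrow> ('o, 'm) ifun" where
  "from_disc A f = \<lparr>ifdom = disc (Dom C f), ifcod = A, if0 = f, if1 = unt A \<cdot> f\<rparr>"

lemma from_disc_simps [simp]:
  "ifdom (from_disc A f) = disc (Dom C f)" "ifcod (from_disc A f) = A" "if0 (from_disc A f) = f"
  "if1 (from_disc A f) = unt A \<cdot> f"
  by (simp_all add: from_disc_def)

lemma is_ifun_from_disc [simp]:
  assumes [simp]: "is_icat C A" "f \<in> Arr C" "Cod C f = ic0 A"
  shows "is_ifun C (from_disc A f)"
proof -
  have "is_gfun (from_disc A f)"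
    by (rule is_gfunI) (auto simp: composable_iff icomp_disc)
  then show ?thesis by (simp add: is_ifun_iff)
qed

lemma ifun_from_disc:
  assumes "is_ifun C F" "ifdom F = disc X" "X \<in> Obj C"
  shows "if1 F = unt (ifcod F) \<cdot> if0 F"
  using gfun_simps(9)[of F "disc X"] assms by simp

text \<open>Functors preserve units, and a discrete category has no other arrows.\<close>

lemma from_disc_eqI:
  assumes "is_ifun C F" "is_ifun C G" "ifdom F = disc X" "ifdom G = disc X" "X \<in> Obj C" "ifcod F = ifcod G" "if0 F = if0 G"
  shows "F = G"
  using assms ifun_from_disc[of F X] ifun_from_disc[of G X] by (intro ifun_eqI) simp_all

lemma product_lift:
  assumes "is_product C A B P p q" "h \<in> Arr C" "k \<in> Arr C" "Dom C k = Dom C h" "Cod C h = A" "Cod C k = B"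
  obtains u where "u \<in> Arr C" "Dom C u = Dom C h" "Cod C u = P" "p \<cdot> u = h" "q \<cdot> u = k"
proof -
  have "h \<in> hom C (Dom C h) A" "k \<in> hom C (Dom C h) B" "Dom C h \<in> Obj C" using assms by (simp_all add: hom_def)
  then have "\<exists>!u. u \<in> hom C (Dom C h) P \<and> p \<cdot> u = h \<and> q \<cdot> u = k"
    using assms(1) unfolding is_product_def by blast
  then show ?thesis using that unfolding hom_def by blast
qed

lemma product_eqI:
  assumes P: "is_product C A B P p q" and "u \<in> Arr C" "v \<in> Arr C" "Dom C v = Dom C u" "Cod C u = P" "Cod C v = P"
    "p \<cdot> u = p \<cdot> v" "q \<cdot> u = q \<cdot> v"
  shows "u = v"
proof -
  have "p \<in> Arr C" "q \<in> Arr C" "Dom C p = P" "Cod C p = A" "Dom C q = P" "Cod C q = B"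
    using P by (auto simp: is_product_def hom_def)
  then have "p \<cdot> u \<in> hom C (Dom C u) A" "q \<cdot> u \<in> hom C (Dom C u) B" "Dom C u \<in> Obj C"
    using assms(2-6) by (simp_all add: hom_def)
  then have "\<exists>!w. w \<in> hom C (Dom C u) P \<and> p \<cdot> w = p \<cdot> u \<and> q \<cdot> w = q \<cdot> u"
    using P unfolding is_product_def by blast
  moreover have "u \<in> hom C (Dom C u) P" "v \<in> hom C (Dom C u) P" using assms(2-6) by (simp_all add: hom_def)
  ultimately show ?thesis using assms(7,8) by metis
qed

text \<open>The codiscrete category on \<open>X\<close> is right adjoint to the object of objects, which therefore preserves
  coproducts.\<close>

lemma codisc_exists:
  assumes pb: "has_pullbacks C" and fp: "has_finite_products C" and "X \<in> Obj C"
  shows "\<exists>A. is_icat C A \<and> ic0 A = X \<and> is_product C X X (ic1 A) (src A) (tgt A)"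
proof -
  obtain P p q where P: "is_product C X X P p q"
    using fp \<open>X \<in> Obj C\<close> unfolding has_finite_products_def by blast
  have X [simp]: "X \<in> Obj C" "P \<in> Obj C" "p \<in> Arr C" "q \<in> Arr C" "Dom C p = P" "Cod C p = X" "Dom C q = P" "Cod C q = X"
    using P by (auto simp: is_product_def hom_def)
  note monic = product_eqI[OF P]
  obtain u where u [simp]: "u \<in> Arr C" "Dom C u = X" "Cod C u = P" "p \<cdot> u = Idn C X" "q \<cdot> u = Idn C X"
    by (rule product_lift[OF P, of "Idn C X" "Idn C X"]) simp_all
  obtain P2 f g where P2: "is_pullback C q p P2 f g"
    using pb unfolding has_pullbacks_def by (elim ballE[of _ _ q] ballE[of _ _ p]) auto
  note P2s [simp] = pullbackD(4-11)[OF P2]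
  obtain P3 f3 g3 where P3: "is_pullback C g f P3 f3 g3"
    using pb unfolding has_pullbacks_def by (elim ballE[of _ _ g] ballE[of _ _ f]) auto
  note P3s [simp] = pullbackD(4-11)[OF P3]
  \<comment> \<open>An arrow of the codiscrete category is its pair of endpoints, so a composite is
    the outer pair.\<close>
  obtain m where m [simp]: "m \<in> Arr C" "Dom C m = P2" "Cod C m = P" "p \<cdot> m = p \<cdot> f" "q \<cdot> m = q \<cdot> g"
    by (rule product_lift[OF P, of "p \<cdot> f" "q \<cdot> g"]) simp_all
  define A :: "('o, 'm) icat" where "A = \<lparr>ic0 = X, ic1 = P, ic2 = P2, ic3 = P3, src = p, tgt = q, unt = u,
    fst2 = f, snd2 = g, mul = m, fst3 = f3, snd3 = g3\<rparr>"
  have A_simps [simp]: "ic0 A = X" "ic1 A = P" "ic2 A = P2" "ic3 A = P3" "src A = p" "tgt A = q" "unt A = u"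
    "fst2 A = f" "snd2 A = g" "mul A = m" "fst3 A = f3" "snd3 A = g3"
    by (simp_all add: A_def)
  have graph [simp]: "is_igraph A"
    unfolding is_igraph_def by (simp add: hom_def P2 P3)
  have st [simp]: "p \<cdot> icomp C A x y = p \<cdot> x" "q \<cdot> icomp C A x y = q \<cdot> y" if "composable A x y" for x y
    using icomp_simps(4,5)[OF graph that] by simp_all
  note [simp] = Cmp_eq_Cmp[OF u(4)] Cmp_eq_Cmp[OF u(5)]
  have "is_icat C A"
    unfolding is_icat_iff
  proof (intro conjI allI impI)
    fix x assume [simp]: "x \<in> Arr C" "Cod C x = ic1 A"
    have [simp]: "composable A (unt A \<cdot> src A \<cdot> x) x" "composable A x (unt A \<cdot> tgt A \<cdot> x)"
      by (simp_all add: composable_iff)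
    note [simp] = this[simplified]
    show "icomp C A (unt A \<cdot> src A \<cdot> x) x = x" "icomp C A x (unt A \<cdot> tgt A \<cdot> x) = x"
      by (rule monic; simp)+
  next
    fix x y z assume c [simp]: "composable A x y" "composable A y z"
    have [simp]: "composable A (icomp C A x y) z" "composable A x (icomp C A y z)"
      using c by (simp_all add: composable_iff)
    show "icomp C A (icomp C A x y) z = icomp C A x (icomp C A y z)"
      by (rule monic) simp_all
  qed simp
  then show ?thesis using P by (intro exI[of _ A]) simp
qed

text \<open>The transpose under the other adjunction: an arrow of \<open>K\<close> is determined by
  its endpoints, which forces the arrow part and makes the functor laws hold.\<close>

lemma to_codisc:
  assumes K: "is_icat C K" "is_product C (ic0 K) (ic0 K) (ic1 K) (src K) (tgt K)"
    and A [simp]: "is_icat C A" and f [simp]: "f \<in> Arr C" "Dom C f = ic0 A" "Cod C f = ic0 K"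
  obtains F where "is_ifun C F" "ifdom F = A" "ifcod F = K" "if0 F = f"
proof -
  note [simp] = K(1)
  obtain f1 where f1 [simp]: "f1 \<in> Arr C" "Dom C f1 = ic1 A" "Cod C f1 = ic1 K" "src K \<cdot> f1 = f \<cdot> src A" "tgt K \<cdot> f1 = f \<cdot> tgt A"
    by (rule product_lift[OF K(2), of "f \<cdot> src A" "f \<cdot> tgt A"]) simp_all
  note [simp] = square_Cmp[OF f1(4)] square_Cmp[OF f1(5)]
  define F :: "('o, 'm) ifun" where "F = \<lparr>ifdom = A, ifcod = K, if0 = f, if1 = f1\<rparr>"
  have [simp]: "ifdom F = A" "ifcod F = K" "if0 F = f" "if1 F = f1" by (simp_all add: F_def)
  have "is_gfun F"
  proof (rule is_gfunI)
    show "if1 F \<cdot> unt (ifdom F) = unt (ifcod F) \<cdot> if0 F"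
      by (rule product_eqI[OF K(2)]) simp_all
    fix x y assume "composable (ifdom F) x y"
    then have c [simp]: "composable A x y" by simp
    then have [simp]: "x \<in> Arr C" "y \<in> Arr C" "Dom C y = Dom C x" "Cod C x = ic1 A" "Cod C y = ic1 A" "tgt A \<cdot> x = src A \<cdot> y"
      by (simp_all only: composable_def)
    have c [simp]: "composable K (f1 \<cdot> x) (f1 \<cdot> y)" by (simp add: composable_iff)
    show "if1 F \<cdot> icomp C (ifdom F) x y = icomp C (ifcod F) (if1 F \<cdot> x) (if1 F \<cdot> y)"
      by (rule product_eqI[OF K(2)]) simp_all
  qed simp_all
  then show ?thesis using that[of F] by (simp add: is_ifun_iff)
qed

lemma to_codisc_eqI:
  assumes K: "is_product C (ic0 K) (ic0 K) (ic1 K) (src K) (tgt K)"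
    and "is_ifun C F" "is_ifun C G" "ifdom G = ifdom F" "ifcod F = K" "ifcod G = K" "if0 F = if0 G"
  shows "F = G"
proof -
  have "if1 F = if1 G"
    by (rule product_eqI[OF K]) (use assms(2-) in simp_all)
  then show ?thesis using assms(2-) by (intro ifun_eqI) simp_all
qed

section \<open>Universal properties passed down to objects of objects\<close>

lemma coproduct_objects:
  assumes pb: "has_pullbacks C" and fp: "has_finite_products C" and Q: "is_coproduct (CatI C) A B Q i j"
  shows "is_coproduct C (ic0 A) (ic0 B) (ic0 Q) (if0 i) (if0 j)"
proof -
  interpret K: two_category "CatI C" by (rule two_category_CatI)
  note Qs [simp] = K.coproductD[OF Q, simplified]
  show ?thesis
  proof (rule coproductI)
    fix h k assume hk [simp]: "h \<in> Arr C" "k \<in> Arr C" "Dom C h = ic0 A" "Dom C k = ic0 B" "Cod C k = Cod C h"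
    \<comment> \<open>The target of the test arrows is turned into a codiscrete category, into which
      \<open>h\<close> and \<open>k\<close> extend to functors.\<close>
    obtain K where K: "is_icat C K" "ic0 K = Cod C h" "is_product C (ic0 K) (ic0 K) (ic1 K) (src K) (tgt K)"
      using codisc_exists[OF pb fp, of "Cod C h"] by auto
    obtain H where H: "is_ifun C H" "ifdom H = A" "ifcod H = K" "if0 H = h"
      by (rule to_codisc[OF K(1,3), of A h]) (use K in simp_all)
    obtain L where L: "is_ifun C L" "ifdom L = B" "ifcod L = K" "if0 L = k"
      by (rule to_codisc[OF K(1,3), of B k]) (use K in simp_all)
    obtain u where u: "is_ifun C u" "ifdom u = Q" "ifcod u = K" "comp_ifun C u i = H" "comp_ifun C u j = L"
      using K.copair[OF Q, of H L] H L by auto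
    have "if0 u \<cdot> if0 i = h" "if0 u \<cdot> if0 j = k"
      using arg_cong[OF u(4), of if0] arg_cong[OF u(5), of if0] H L by simp_all
    with u K show "\<exists>u. u \<in> Arr C \<and> Dom C u = ic0 Q \<and> Cod C u = Cod C h \<and> u \<cdot> if0 i = h \<and> u \<cdot> if0 j = k"
      by (intro exI[of _ "if0 u"]) simp
  next
    fix u v assume uv [simp]: "u \<in> Arr C" "v \<in> Arr C" "Dom C u = ic0 Q" "Dom C v = ic0 Q" "Cod C v = Cod C u"
      and eq: "u \<cdot> if0 i = v \<cdot> if0 i" "u \<cdot> if0 j = v \<cdot> if0 j"
    obtain K where K: "is_icat C K" "ic0 K = Cod C u" "is_product C (ic0 K) (ic0 K) (ic1 K) (src K) (tgt K)"
      using codisc_exists[OF pb fp, of "Cod C u"] by auto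
    obtain U where U: "is_ifun C U" "ifdom U = Q" "ifcod U = K" "if0 U = u"
      by (rule to_codisc[OF K(1,3), of Q u]) (use K in simp_all)
    obtain V where V: "is_ifun C V" "ifdom V = Q" "ifcod V = K" "if0 V = v"
      by (rule to_codisc[OF K(1,3), of Q v]) (use K in simp_all)
    have "comp_ifun C U i = comp_ifun C V i"
      by (rule to_codisc_eqI[OF K(3)]) (use U V eq in simp_all)
    moreover have "comp_ifun C U j = comp_ifun C V j"
      by (rule to_codisc_eqI[OF K(3)]) (use U V eq in simp_all)
    ultimately have "U = V"
      using K.coproduct_eqI[OF Q, of U V] U V by simp
    then show "u = v" using U V by simp
  qed simp_all
qed

lemma initial_objects:
  assumes pb: "has_pullbacks C" and fp: "has_finite_products C" and Z: "is_initial (CatI C) Z"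
  shows "is_initial C (ic0 Z)"
proof -
  interpret K: two_category "CatI C" by (rule two_category_CatI)
  have Z_icat [simp]: "is_icat C Z" using Z by (simp add: is_initial_def)
  have "\<exists>!u. u \<in> hom C (ic0 Z) X" if X: "X \<in> Obj C" for X
  proof -
    obtain K where K: "is_icat C K" "ic0 K = X" "is_product C (ic0 K) (ic0 K) (ic1 K) (src K) (tgt K)"
      using codisc_exists[OF pb fp X] by auto
    obtain U where U: "is_ifun C U" "ifdom U = Z" "ifcod U = K"
      using K.initialE[OF Z, of K] K by auto
    have "v = if0 U" if v: "v \<in> hom C (ic0 Z) X" for v
    proof -
      obtain V where V: "is_ifun C V" "ifdom V = Z" "ifcod V = K" "if0 V = v"
        by (rule to_codisc[OF K(1,3), of Z v]) (use v K in \<open>simp_all add: hom_def\<close>)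
      have "V = U" by (rule K.initial_eqI[OF Z]) (use U V in simp_all)
      then show ?thesis using V by simp
    qed
    then show ?thesis
      by (intro ex1I[of _ "if0 U"]) (use U K in \<open>simp_all add: hom_def\<close>)
  qed
  then show ?thesis by (simp add: is_initial_def)
qed

text \<open>Test arrows are replaced by functors out of the discrete category on their
  domain.\<close>

lemma pullback_objects:
  assumes P: "is_pullback (CatI C) F G P p q"
  shows "is_pullback C (if0 F) (if0 G) (ic0 P) (if0 p) (if0 q)"
proof -
  interpret K: two_category "CatI C" by (rule two_category_CatI)
  note [simp] = K.pullbackD(1-10)[OF P, simplified]
  have sq: "comp_ifun C F p = comp_ifun C G q" using K.pullbackD(11)[OF P] by simp
  note sq0 = ifun_commute(1)[OF sq]
  show ?thesis
  proof (rule pullbackI)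
    fix h k assume hk [simp]: "h \<in> Arr C" "k \<in> Arr C" "Dom C k = Dom C h" "Cod C h = Dom C (if0 F)" "Cod C k = Dom C (if0 G)"
      and eq: "if0 F \<cdot> h = if0 G \<cdot> k"
    have "comp_ifun C F (from_disc (ifdom F) h) = comp_ifun C G (from_disc (ifdom G) k)"
      by (rule from_disc_eqI[of _ _ "Dom C h"]) (use eq in simp_all)
    then obtain u where u: "is_ifun C u" "ifdom u = disc (Dom C h)" "ifcod u = P"
      "comp_ifun C p u = from_disc (ifdom F) h" "comp_ifun C q u = from_disc (ifdom G) k"
      using K.pullback_lift[OF P, of "from_disc (ifdom F) h" "from_disc (ifdom G) k"] by auto
    have "if0 p \<cdot> if0 u = h" "if0 q \<cdot> if0 u = k"
      using arg_cong[OF u(4), of if0] arg_cong[OF u(5), of if0] by simp_all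
    with u show "\<exists>u. u \<in> Arr C \<and> Dom C u = Dom C h \<and> Cod C u = ic0 P \<and> if0 p \<cdot> u = h \<and> if0 q \<cdot> u = k"
      by (intro exI[of _ "if0 u"]) simp
  next
    fix u v assume uv [simp]: "u \<in> Arr C" "v \<in> Arr C" "Dom C v = Dom C u" "Cod C u = ic0 P" "Cod C v = ic0 P"
      and eq: "if0 p \<cdot> u = if0 p \<cdot> v" "if0 q \<cdot> u = if0 q \<cdot> v"
    have "is_icat C P" using K.pullbackD(4)[OF P] by simp
    note [simp] = this
    have "comp_ifun C p (from_disc P u) = comp_ifun C p (from_disc P v)"
      by (rule from_disc_eqI[of _ _ "Dom C u"]) (use eq in simp_all)
    moreover have "comp_ifun C q (from_disc P u) = comp_ifun C q (from_disc P v)"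
      by (rule from_disc_eqI[of _ _ "Dom C u"]) (use eq in simp_all)
    ultimately have "from_disc P u = from_disc P v"
      by (intro K.pullback_eqI[OF P, of "from_disc P u" "from_disc P v"]) simp_all
    then show "u = v" by (metis from_disc_simps(3))
  qed (simp_all add: sq0)
qed

text \<open>Levels 0 and 1 supply the components of the unique functor, level 2 its compatibility
  with composition. Components of transformations start at \<open>ic0 Z\<close>, so they are unique
  as well.\<close>

lemma initial2_if_levelwise:
  assumes Z [simp]: "is_icat C Z" and Z0: "is_initial C (ic0 Z)" and Z1: "is_initial C (ic1 Z)" and Z2: "is_initial C (ic2 Z)"
  shows "is_initial2 (CatI C) Z"
proof -
  have ex: "\<exists>u. u \<in> hom (CatI C) Z X" if X [simp]: "is_icat C X" for X
  proof -
    obtain u0 where u0 [simp]: "u0 \<in> Arr C" "Dom C u0 = ic0 Z" "Cod C u0 = ic0 X" using initialE[OF Z0, of "ic0 X"] by auto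
    obtain u1 where u1 [simp]: "u1 \<in> Arr C" "Dom C u1 = ic1 Z" "Cod C u1 = ic1 X" using initialE[OF Z1, of "ic1 X"] by auto
    have st: "src X \<cdot> u1 = u0 \<cdot> src Z" "tgt X \<cdot> u1 = u0 \<cdot> tgt Z"
      by (rule initial_eqI[OF Z1]; simp)+
    have un: "u1 \<cdot> unt Z = unt X \<cdot> u0"
      by (rule initial_eqI[OF Z0]) simp_all
    have "composable X (u1 \<cdot> fst2 Z) (u1 \<cdot> snd2 Z)"
      by (simp add: composable_iff square_Cmp[OF st(1)] square_Cmp[OF st(2)])
    then have mu: "u1 \<cdot> mul Z = icomp C X (u1 \<cdot> fst2 Z) (u1 \<cdot> snd2 Z)"
      by (intro initial_eqI[OF Z2]) simp_all
    define u :: "('o, 'm) ifun" where "u = \<lparr>ifdom = Z, ifcod = X, if0 = u0, if1 = u1\<rparr>"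
    have [simp]: "ifdom u = Z" "ifcod u = X" "if0 u = u0" "if1 u = u1" by (simp_all add: u_def)
    have "is_gfun u" unfolding is_gfun_def by (simp add: hom_def st un mu)
    then have "is_ifun C u" by (simp add: is_ifun_iff)
    then show ?thesis by (intro exI[of _ u]) (simp add: hom_def)
  qed
  have uniq: "u = v" if "u \<in> hom (CatI C) Z X" "v \<in> hom (CatI C) Z X" for u v X
  proof -
    have uv: "is_ifun C u" "is_ifun C v" "ifdom u = Z" "ifdom v = Z" "ifcod u = X" "ifcod v = X"
      using that by (simp_all add: hom_def)
    show ?thesis
      by (rule ifun_eqI) (use uv initial_eqI[OF Z0, of "if0 u" "if0 v"] initial_eqI[OF Z1, of "if1 u" "if1 v"] in simp_all)
  qed
  have cell: "\<exists>!\<theta>. \<theta> \<in> cells (CatI C) u v" if "u \<in> hom (CatI C) Z X" "v \<in> hom (CatI C) Z X" for u v X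
  proof -
    have u [simp]: "is_ifun C u" "ifdom u = Z" "ifcod u = X" and v: "v = u"
      using that uniq[OF that] by (simp_all add: hom_def)
    show ?thesis
    proof (rule ex1I[of _ "id_itrans C u"])
      show "id_itrans C u \<in> cells (CatI C) u v" by (simp add: cells_def v)
      fix \<theta> assume "\<theta> \<in> cells (CatI C) u v"
      then have "is_itrans C \<theta>" "itsrc \<theta> = u" "ittrg \<theta> = u" by (simp_all add: cells_def v)
      then show "\<theta> = id_itrans C u"
        using initial_eqI[OF Z0, of "itc \<theta>" "unt X \<cdot> if0 u"] icat_igraph[OF ifun_icat(2)[OF u(1)]] by (intro itrans_eqI) simp_all
    qed
  qed
  have "\<exists>!u. u \<in> hom (CatI C) Z X" if "is_icat C X" for X
    using ex[OF that] uniq by blast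
  then show ?thesis
    using cell by (simp add: is_initial2_def is_initial_def)
qed

section \<open>The two implications between extensivity of the base and of its internal
  categories\<close>

lemma extensive2_CatI_if_extensive:
  assumes ext: "extensive C"
  shows "extensive2 (CatI C)"
proof (rule extensive2I[OF two_category_CatI])
  show "has_pullbacks2 (CatI C)" using ext by (intro has_pullbacks2_CatI) (simp add: extensive_def)
  obtain Z where Z: "is_initial C Z" using ext unfolding extensive_def has_finite_coproducts_def by blast
  then have "is_initial2 (CatI C) (disc Z)"
    by (intro initial2_if_levelwise) (simp_all add: is_initial_def[of C Z])
  moreover have "\<exists>Q i j. is_coproduct2 (CatI C) A B Q i j" if "is_icat C A" "is_icat C B" for A B
    using levelwise_coproduct_exists[OF ext that] coproduct2_if_levelwise[OF ext] by metis
  ultimately show "has_finite_coproducts2 (CatI C)"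
    unfolding has_finite_coproducts2_def by auto
  show "category.van_kampen (CatI C) A B Q i j" if "is_coproduct2 (CatI C) A B Q i j" for A B Q i j
    using that by (intro van_kampen_CatI[OF ext]) (simp add: is_coproduct2_def)
qed

lemma extensive_if_extensive2_CatI:
  assumes pb: "has_pullbacks C" and fp: "has_finite_products C" and ext: "extensive2 (CatI C)"
  shows "extensive C"
proof -
  interpret K: two_category "CatI C" by (rule two_category_CatI)
  have pbK: "has_pullbacks (CatI C)" using ext by (simp add: extensive2_def has_pullbacks_if_has_pullbacks2)
  have cpK: "\<exists>Q i j. is_coproduct (CatI C) A B Q i j" if "is_icat C A" "is_icat C B" for A B
  proof -
    have "A \<in> Obj (CatI C)" "B \<in> Obj (CatI C)" using that by simp_all
    then show ?thesis
      using ext unfolding extensive2_def has_finite_coproducts2_def is_coproduct2_def by blast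
  qed
  obtain Z where "is_initial (CatI C) Z"
    using ext unfolding extensive2_def has_finite_coproducts2_def is_initial2_def by blast
  from initial_objects[OF pb fp this] have init: "\<exists>Z. is_initial C Z" by blast
  have main: "\<exists>Q i j. is_coproduct C A B Q i j \<and> van_kampen A B Q i j" if A [simp]: "A \<in> Obj C" and B [simp]: "B \<in> Obj C" for A B
  proof -
    \<comment> \<open>\<open>Q\<close> may be any coproduct of the two discrete categories; only its
      object of objects enters the result.\<close>
    obtain Q i j where Q: "is_coproduct (CatI C) (disc A) (disc B) Q i j"
      using cpK[of "disc A" "disc B"] by auto
    note [simp] = K.coproductD[OF Q, simplified]
    note vk = extensive2_van_kampen[OF ext Q]
    have Q0: "is_coproduct C A B (ic0 Q) (if0 i) (if0 j)"
      using coproduct_objects[OF pb fp Q] by simp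
    have "van_kampen A B (ic0 Q) (if0 i) (if0 j)"
    proof (rule van_kampenI[OF Q0])
      fix x y assume [simp]: "x \<in> Arr C" "y \<in> Arr C" "Cod C x = A" "Cod C y = B"
      define x' y' where "x' = from_disc (disc A) x" "y' = from_disc (disc B) y"
      then have [simp]: "is_ifun C x'" "is_ifun C y'" "ifdom x' = disc (Dom C x)" "ifcod x' = disc A" "if0 x' = x"
        "ifdom y' = disc (Dom C y)" "ifcod y' = disc B" "if0 y' = y" by simp_all
      \<comment> \<open>The candidate for the sum of \<open>x\<close> and \<open>y\<close> is again
        read off from a coproduct of discrete categories, at the level of objects.\<close>
      obtain R m n where R: "is_coproduct (CatI C) (disc (Dom C x)) (disc (Dom C y)) R m n"
        using cpK[of "disc (Dom C x)" "disc (Dom C y)"] by auto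
      note [simp] = K.coproductD[OF R, simplified]
      obtain z where z: "is_ifun C z" "ifdom z = R" "ifcod z = Q" "comp_ifun C z m = comp_ifun C i x'"
        "comp_ifun C z n = comp_ifun C j y'"
        using K.copair[OF R, of "comp_ifun C i x'" "comp_ifun C j y'"] by auto
      have "is_pullback (CatI C) i z (disc (Dom C x)) x' m" "is_pullback (CatI C) j z (disc (Dom C y)) y' n"
        using K.van_kampenD[OF vk R, of x' y' z] z by simp_all
      from this[THEN pullback_objects]
      have "is_pullback C (if0 i) (if0 z) (Dom C x) x (if0 m)" "is_pullback C (if0 j) (if0 z) (Dom C y) y (if0 n)" by simp_all
      moreover have "is_coproduct C (Dom C x) (Dom C y) (ic0 R) (if0 m) (if0 n)"
        using coproduct_objects[OF pb fp R] by simp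
      ultimately show "\<exists>Z z m n. is_coproduct C (Dom C x) (Dom C y) Z m n \<and> z \<in> Arr C \<and> Dom C z = Z \<and>
          z \<cdot> m = if0 i \<cdot> x \<and> z \<cdot> n = if0 j \<cdot> y \<and> is_pullback C (if0 i) z (Dom C x) x m \<and>
          is_pullback C (if0 j) z (Dom C y) y n"
        using z(1-3) ifun_commute(1)[OF z(4)] ifun_commute(1)[OF z(5)]
        by (intro exI[of _ "ic0 R"] exI[of _ "if0 z"] exI[of _ "if0 m"] exI[of _ "if0 n"]) simp
    next
      fix z assume [simp]: "z \<in> Arr C" "Cod C z = ic0 Q"
      define z' where "z' = from_disc Q z"
      then have [simp]: "is_ifun C z'" "ifdom z' = disc (Dom C z)" "ifcod z' = Q" "if0 z' = z" by simp_all
      obtain X x m where X: "is_pullback (CatI C) i z' X x m"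
        using pbK unfolding has_pullbacks_def by (elim ballE[of _ _ i] ballE[of _ _ z']) auto
      obtain Y y n where Y: "is_pullback (CatI C) j z' Y y n"
        using pbK unfolding has_pullbacks_def by (elim ballE[of _ _ j] ballE[of _ _ z']) auto
      note [simp] = K.pullbackD(1-10)[OF X, simplified] K.pullbackD(1-10)[OF Y, simplified]
      have sq: "if0 i \<cdot> if0 x = z \<cdot> if0 m" "if0 j \<cdot> if0 y = z \<cdot> if0 n"
        using pullbackD(11)[OF pullback_objects[OF X]] pullbackD(11)[OF pullback_objects[OF Y]] by simp_all
      have "is_coproduct (CatI C) X Y (disc (Dom C z)) m n"
        using K.van_kampen_coproduct[OF vk Q X Y] by simp
      from coproduct_objects[OF pb fp this]
      have "is_coproduct C (ic0 X) (ic0 Y) (Dom C z) (if0 m) (if0 n)" by simp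
      with sq show "\<exists>x y m n. x \<in> Arr C \<and> y \<in> Arr C \<and> Cod C x = A \<and> Cod C y = B \<and>
          is_coproduct C (Dom C x) (Dom C y) (Dom C z) m n \<and> z \<cdot> m = if0 i \<cdot> x \<and> z \<cdot> n = if0 j \<cdot> y"
        by (intro exI[of _ "if0 x"] exI[of _ "if0 y"] exI[of _ "if0 m"] exI[of _ "if0 n"]) simp
    qed
    with Q0 show ?thesis by blast
  qed
  show ?thesis
  proof (rule extensiveI)
    show "category C" by unfold_locales
    show "has_pullbacks C" by (rule pb)
    show "has_finite_coproducts C" using init main unfolding has_finite_coproducts_def by blast
  qed (rule main)
qed

end

section \<open>Functor categories\<close>

lemma fun_cat_simps:
  "F \<in> Obj (fun_cat S E) \<longleftrightarrow> is_functor S E F \<and> OMap F \<in> extensional (Obj S) \<and> AMap F \<in> extensional (Arr S)"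
  "(F, G, \<tau>) \<in> Arr (fun_cat S E) \<longleftrightarrow> F \<in> Obj (fun_cat S E) \<and> G \<in> Obj (fun_cat S E) \<and> is_nat S E F G \<tau> \<and> \<tau> \<in> extensional (Obj S)"
  "Dom (fun_cat S E) (F, G, \<tau>) = F" "Cod (fun_cat S E) (F, G, \<tau>) = G"
  "Idn (fun_cat S E) F = (F, F, \<lambda>a \<in> Obj S. Idn E (OMap F a))"
  "Cmp (fun_cat S E) (G', H, \<sigma>) (F, G, \<tau>) = (F, H, \<lambda>a \<in> Obj S. \<sigma> a \<cdot>\<^bsub>E\<^esub> \<tau> a)"
  by (simp_all add: fun_cat_def Let_def)

text \<open>The arguments are pointwise in the target, so the index \<open>S\<close> is asked only
  for \<open>Dom\<close> and \<open>Cod\<close> to land in \<open>Obj S\<close>; this keeps the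
  instance \<open>opp simplex3\<close> immediate.\<close>

locale functor_category = E: category E for E :: "('p, 'n, 'y) cat_scheme" (structure) +
  fixes S :: "('o, 'm, 'z) cat_scheme"
  assumes S_Dom [simp]: "f \<in> Arr S \<Longrightarrow> Dom S f \<in> Obj S"
    and S_Cod [simp]: "f \<in> Arr S \<Longrightarrow> Cod S f \<in> Obj S"
begin

abbreviation "FC \<equiv> fun_cat S E"

lemma nat_simps:
  assumes "(F, G, \<tau>) \<in> Arr FC"
  shows "a \<in> Obj S \<Longrightarrow> \<tau> a \<in> Arr E" "a \<in> Obj S \<Longrightarrow> Dom E (\<tau> a) = OMap F a" "a \<in> Obj S \<Longrightarrow> Cod E (\<tau> a) = OMap G a"
    "f \<in> Arr S \<Longrightarrow> AMap G f \<cdot> \<tau> (Dom S f) = \<tau> (Cod S f) \<cdot> AMap F f"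
    "F \<in> Obj FC" "G \<in> Obj FC" "is_functor S E F" "is_functor S E G" "\<tau> \<in> extensional (Obj S)"
  using assms by (auto simp: fun_cat_simps is_nat_def hom_def)

lemma natI:
  assumes "F \<in> Obj FC" "G \<in> Obj FC" "\<And>a. a \<in> Obj S \<Longrightarrow> \<tau> a \<in> Arr E" "\<And>a. a \<in> Obj S \<Longrightarrow> Dom E (\<tau> a) = OMap F a"
    "\<And>a. a \<in> Obj S \<Longrightarrow> Cod E (\<tau> a) = OMap G a" "\<tau> \<in> extensional (Obj S)"
    "\<And>f. f \<in> Arr S \<Longrightarrow> AMap G f \<cdot> \<tau> (Dom S f) = \<tau> (Cod S f) \<cdot> AMap F f"
  shows "(F, G, \<tau>) \<in> Arr FC"
  using assms by (auto simp: fun_cat_simps(2) is_nat_def hom_def)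

lemma Cmp_nat:
  assumes \<tau>: "(F, G, \<tau>) \<in> Arr FC" and \<sigma>: "(G, H, \<sigma>) \<in> Arr FC"
  shows "(F, H, \<lambda>a \<in> Obj S. \<sigma> a \<cdot> \<tau> a) \<in> Arr FC"
proof (rule natI)
  note [simp] = nat_simps[OF \<tau>] nat_simps[OF \<sigma>] is_functorD[OF nat_simps(7)[OF \<tau>]] is_functorD[OF nat_simps(8)[OF \<tau>]]
    is_functorD[OF nat_simps(8)[OF \<sigma>]]
  fix f assume f: "f \<in> Arr S"
  have "AMap H f \<cdot> \<sigma> (Dom S f) \<cdot> \<tau> (Dom S f) = \<sigma> (Cod S f) \<cdot> AMap G f \<cdot> \<tau> (Dom S f)"
    using f by (intro E.square_Cmp) simp_all
  then show "AMap H f \<cdot> (\<lambda>a \<in> Obj S. \<sigma> a \<cdot> \<tau> a) (Dom S f) = (\<lambda>a \<in> Obj S. \<sigma> a \<cdot> \<tau> a) (Cod S f) \<cdot> AMap F f"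
    using f by simp
qed (use nat_simps[OF \<tau>] nat_simps[OF \<sigma>] in simp_all)

lemma category_FC: "category FC"
proof
  fix f assume "f \<in> Arr FC"
  then show "Dom FC f \<in> Obj FC" "Cod FC f \<in> Obj FC"
    by (cases f; simp add: fun_cat_simps)+
next
  fix F assume F: "F \<in> Obj FC"
  then have "is_functor S E F" by (simp add: fun_cat_simps)
  note [simp] = is_functorD[OF this]
  have "(F, F, \<lambda>a \<in> Obj S. Idn E (OMap F a)) \<in> Arr FC"
    by (rule natI) (use F in simp_all)
  then show "Idn FC F \<in> hom FC F F" by (simp add: hom_def fun_cat_simps(3-))
next
  fix f g F G H assume fg: "f \<in> hom FC F G" "g \<in> hom FC G H"
  obtain \<tau> \<sigma> where "f = (F, G, \<tau>)" "g = (G, H, \<sigma>)"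
    using fg by (cases f; cases g) (simp add: hom_def fun_cat_simps(3-))
  then show "g \<cdot>\<^bsub>FC\<^esub> f \<in> hom FC F H"
    using fg Cmp_nat[of F G \<tau> H \<sigma>] by (simp add: hom_def fun_cat_simps(3-))
next
  fix f F G assume f: "f \<in> hom FC F G"
  obtain \<tau> where eq: "f = (F, G, \<tau>)" using f by (cases f) (simp add: hom_def fun_cat_simps(3-))
  then have f': "(F, G, \<tau>) \<in> Arr FC" using f by (simp add: hom_def)
  have "(\<lambda>a \<in> Obj S. \<tau> a \<cdot> (\<lambda>a \<in> Obj S. Idn E (OMap F a)) a) = \<tau>" "(\<lambda>a \<in> Obj S. (\<lambda>a \<in> Obj S. Idn E (OMap G a)) a \<cdot> \<tau> a) = \<tau>"
    by (rule extensionalityI[of _ "Obj S"]; use nat_simps[OF f'] in simp)+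
  then show "f \<cdot>\<^bsub>FC\<^esub> Idn FC F = f" "Idn FC G \<cdot>\<^bsub>FC\<^esub> f = f"
    by (simp_all add: eq fun_cat_simps(3-))
next
  fix f g h F G H K assume fgh: "f \<in> hom FC F G" "g \<in> hom FC G H" "h \<in> hom FC H K"
  obtain \<tau> \<sigma> \<rho> where eq: "f = (F, G, \<tau>)" "g = (G, H, \<sigma>)" "h = (H, K, \<rho>)"
    using fgh by (cases f; cases g; cases h) (simp add: hom_def fun_cat_simps(3-))
  then have t: "(F, G, \<tau>) \<in> Arr FC" "(G, H, \<sigma>) \<in> Arr FC" "(H, K, \<rho>) \<in> Arr FC" using fgh by (simp_all add: hom_def)
  show "(h \<cdot>\<^bsub>FC\<^esub> g) \<cdot>\<^bsub>FC\<^esub> f = h \<cdot>\<^bsub>FC\<^esub> g \<cdot>\<^bsub>FC\<^esub> f"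
    using nat_simps(1-3)[OF t(1)] nat_simps(1-3)[OF t(2)] nat_simps(1-3)[OF t(3)]
    by (simp add: eq fun_cat_simps(3-) restrict_def fun_eq_iff)
qed

text \<open>The induced arrows are chosen objectwise; naturality is an equation between arrows out
  of a coproduct and holds on both injections.\<close>

lemma pointwise_coproduct:
  assumes i: "(F, H, i) \<in> Arr FC" and j: "(G, H, j) \<in> Arr FC"
    and cp: "\<And>a. a \<in> Obj S \<Longrightarrow> is_coproduct E (OMap F a) (OMap G a) (OMap H a) (i a) (j a)"
  shows "is_coproduct FC F G H (F, H, i) (G, H, j)"
proof -
  interpret FC: category FC by (rule category_FC)
  note [simp] = nat_simps(1-3,5,6)[OF i] nat_simps(1-3,5,6)[OF j] is_functorD[OF nat_simps(7)[OF i]] is_functorD[OF nat_simps(8)[OF i]]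
    is_functorD[OF nat_simps(7)[OF j]]
  show ?thesis
  proof (rule FC.coproductI)
    fix h' k' assume h': "h' \<in> Arr FC" "k' \<in> Arr FC" "Dom FC h' = F" "Dom FC k' = G" "Cod FC k' = Cod FC h'"
    then obtain K h k where eq: "h' = (F, K, h)" "k' = (G, K, k)"
      by (cases h'; cases k') (simp add: fun_cat_simps(3-))
    have h: "(F, K, h) \<in> Arr FC" and k: "(G, K, k) \<in> Arr FC" using h' eq by simp_all
    note [simp] = nat_simps(1-3,5,6)[OF h] nat_simps(1-3,5,6)[OF k] is_functorD[OF nat_simps(8)[OF h]]
    have "\<forall>a \<in> Obj S. \<exists>u. u \<in> Arr E \<and> Dom E u = OMap H a \<and> Cod E u = OMap K a \<and> u \<cdot> i a = h a \<and> u \<cdot> j a = k a"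
    proof
      fix a assume a: "a \<in> Obj S"
      obtain u where "u \<in> Arr E" "Dom E u = OMap H a" "Cod E u = OMap K a" "u \<cdot> i a = h a" "u \<cdot> j a = k a"
        by (rule E.copair[OF cp[OF a], of "h a" "k a"]) (use a in simp_all)
      then show "\<exists>u. u \<in> Arr E \<and> Dom E u = OMap H a \<and> Cod E u = OMap K a \<and> u \<cdot> i a = h a \<and> u \<cdot> j a = k a" by blast
    qed
    then obtain u where "\<forall>a \<in> Obj S. u a \<in> Arr E \<and> Dom E (u a) = OMap H a \<and> Cod E (u a) = OMap K a \<and> u a \<cdot> i a = h a \<and> u a \<cdot> j a = k a"
      by metis
    then have u [simp]: "\<And>a. a \<in> Obj S \<Longrightarrow> u a \<in> Arr E" "\<And>a. a \<in> Obj S \<Longrightarrow> Dom E (u a) = OMap H a"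
      "\<And>a. a \<in> Obj S \<Longrightarrow> Cod E (u a) = OMap K a" "\<And>a. a \<in> Obj S \<Longrightarrow> u a \<cdot> i a = h a" "\<And>a. a \<in> Obj S \<Longrightarrow> u a \<cdot> j a = k a"
      by blast+
    have "(H, K, restrict u (Obj S)) \<in> Arr FC"
    proof (rule natI)
      fix f assume f [simp]: "f \<in> Arr S"
      have "AMap K f \<cdot> u (Dom S f) = u (Cod S f) \<cdot> AMap H f"
      proof (rule E.coproduct_eqI[OF cp[of "Dom S f"]])
        have "(u (Cod S f) \<cdot> AMap H f) \<cdot> i (Dom S f) = u (Cod S f) \<cdot> i (Cod S f) \<cdot> AMap F f"
          by (simp add: nat_simps(4)[OF i])
        also have "\<dots> = h (Cod S f) \<cdot> AMap F f"
          by (rule E.Cmp_eq_Cmp) simp_all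
        finally show "(AMap K f \<cdot> u (Dom S f)) \<cdot> i (Dom S f) = (u (Cod S f) \<cdot> AMap H f) \<cdot> i (Dom S f)"
          by (simp add: nat_simps(4)[OF h])
        have "(u (Cod S f) \<cdot> AMap H f) \<cdot> j (Dom S f) = u (Cod S f) \<cdot> j (Cod S f) \<cdot> AMap G f"
          by (simp add: nat_simps(4)[OF j])
        also have "\<dots> = k (Cod S f) \<cdot> AMap G f"
          by (rule E.Cmp_eq_Cmp) simp_all
        finally show "(AMap K f \<cdot> u (Dom S f)) \<cdot> j (Dom S f) = (u (Cod S f) \<cdot> AMap H f) \<cdot> j (Dom S f)"
          by (simp add: nat_simps(4)[OF k])
      qed simp_all
      then show "AMap K f \<cdot> restrict u (Obj S) (Dom S f) = restrict u (Obj S) (Cod S f) \<cdot> AMap H f" by simp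
    qed simp_all
    moreover have "(\<lambda>a \<in> Obj S. restrict u (Obj S) a \<cdot> i a) = h" "(\<lambda>a \<in> Obj S. restrict u (Obj S) a \<cdot> j a) = k"
      by (rule extensionalityI[of _ "Obj S"]; use nat_simps(9)[OF h] nat_simps(9)[OF k] in simp)+
    ultimately show "\<exists>u. u \<in> Arr FC \<and> Dom FC u = H \<and> Cod FC u = Cod FC h' \<and> u \<cdot>\<^bsub>FC\<^esub> (F, H, i) = h' \<and> u \<cdot>\<^bsub>FC\<^esub> (G, H, j) = k'"
      by (intro exI[of _ "(H, K, restrict u (Obj S))"]) (simp add: eq fun_cat_simps(3-))
  next
    fix u' v' assume uv': "u' \<in> Arr FC" "v' \<in> Arr FC" "Dom FC u' = H" "Dom FC v' = H" "Cod FC v' = Cod FC u'"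
      "u' \<cdot>\<^bsub>FC\<^esub> (F, H, i) = v' \<cdot>\<^bsub>FC\<^esub> (F, H, i)" "u' \<cdot>\<^bsub>FC\<^esub> (G, H, j) = v' \<cdot>\<^bsub>FC\<^esub> (G, H, j)"
    then obtain K u v where eq: "u' = (H, K, u)" "v' = (H, K, v)"
      by (cases u'; cases v') (simp add: fun_cat_simps(3-))
    have u: "(H, K, u) \<in> Arr FC" and v: "(H, K, v) \<in> Arr FC" using uv' eq by simp_all
    have e: "(\<lambda>a \<in> Obj S. u a \<cdot> i a) = (\<lambda>a \<in> Obj S. v a \<cdot> i a)" "(\<lambda>a \<in> Obj S. u a \<cdot> j a) = (\<lambda>a \<in> Obj S. v a \<cdot> j a)"
      using uv' by (simp_all add: eq fun_cat_simps(3-))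
    have "u = v"
    proof (rule extensionalityI[OF nat_simps(9)[OF u] nat_simps(9)[OF v]])
      fix a assume a: "a \<in> Obj S"
      show "u a = v a"
        by (rule E.coproduct_eqI[OF cp[OF a]])
          (use a fun_cong[OF e(1), of a] fun_cong[OF e(2), of a] nat_simps(1-3)[OF u] nat_simps(1-3)[OF v] in simp_all)
    qed
    then show "u' = v'" by (simp add: eq)
  qed (use i j in \<open>simp_all add: fun_cat_simps(3-)\<close>)
qed

lemma pointwise_initial:
  assumes F: "F \<in> Obj FC" and init: "\<And>a. a \<in> Obj S \<Longrightarrow> is_initial E (OMap F a)"
  shows "is_initial FC F"
proof -
  have "\<exists>!t. t \<in> hom FC F K" if K: "K \<in> Obj FC" for K
  proof -
    have FK: "is_functor S E F" "is_functor S E K" using F K by (simp_all add: fun_cat_simps)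
    note [simp] = is_functorD[OF FK(1)] is_functorD[OF FK(2)]
    have "\<forall>a \<in> Obj S. \<exists>u. u \<in> Arr E \<and> Dom E u = OMap F a \<and> Cod E u = OMap K a"
      using E.initialE[OF init] by (metis is_functorD(1)[OF FK(2)])
    then obtain u where "\<forall>a \<in> Obj S. u a \<in> Arr E \<and> Dom E (u a) = OMap F a \<and> Cod E (u a) = OMap K a" by metis
    then have u [simp]: "\<And>a. a \<in> Obj S \<Longrightarrow> u a \<in> Arr E" "\<And>a. a \<in> Obj S \<Longrightarrow> Dom E (u a) = OMap F a"
      "\<And>a. a \<in> Obj S \<Longrightarrow> Cod E (u a) = OMap K a"
      by blast+
    have t: "(F, K, restrict u (Obj S)) \<in> Arr FC"
    proof (rule natI)
      fix f assume f: "f \<in> Arr S"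
      show "AMap K f \<cdot> restrict u (Obj S) (Dom S f) = restrict u (Obj S) (Cod S f) \<cdot> AMap F f"
        by (rule E.initial_eqI[OF init[of "Dom S f"]]) (use f in simp_all)
    qed (use F K in simp_all)
    have "s = (F, K, restrict u (Obj S))" if s: "s \<in> hom FC F K" for s
    proof -
      obtain v where eq: "s = (F, K, v)" using s by (cases s) (simp add: hom_def fun_cat_simps(3-))
      have v: "(F, K, v) \<in> Arr FC" using s eq by (simp add: hom_def)
      have "v = restrict u (Obj S)"
      proof (rule extensionalityI[OF nat_simps(9)[OF v] restrict_extensional])
        fix a assume a: "a \<in> Obj S"
        show "v a = restrict u (Obj S) a"
          by (rule E.initial_eqI[OF init[OF a]]) (use a nat_simps(1-3)[OF v] in simp_all)
      qed
      then show ?thesis by (simp add: eq)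
    qed
    then show ?thesis
      using t by (intro ex1I[of _ "(F, K, restrict u (Obj S))"]) (simp_all add: hom_def fun_cat_simps(3-))
  qed
  then show ?thesis using F by (simp add: is_initial_def)
qed

lemma pointwise_iso:
  assumes iso: "is_iso FC (F, G, \<tau>)" and a: "a \<in> Obj S"
  shows "is_iso E (\<tau> a)"
proof -
  obtain s where s: "(F, G, \<tau>) \<in> Arr FC" "s \<in> Arr FC" "Dom FC s = G" "Cod FC s = F"
    "s \<cdot>\<^bsub>FC\<^esub> (F, G, \<tau>) = Idn FC F" "(F, G, \<tau>) \<cdot>\<^bsub>FC\<^esub> s = Idn FC G"
    using iso unfolding is_iso_def hom_def by (auto simp: fun_cat_simps(3-))
  obtain \<sigma> where eq: "s = (G, F, \<sigma>)" using s by (cases s) (simp add: fun_cat_simps(3-))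
  have \<sigma>: "(G, F, \<sigma>) \<in> Arr FC" using s eq by simp
  have "(\<lambda>a \<in> Obj S. \<sigma> a \<cdot> \<tau> a) = (\<lambda>a \<in> Obj S. Idn E (OMap F a))" "(\<lambda>a \<in> Obj S. \<tau> a \<cdot> \<sigma> a) = (\<lambda>a \<in> Obj S. Idn E (OMap G a))"
    using s(5,6) by (simp_all add: eq fun_cat_simps(3-))
  from fun_cong[OF this(1), of a] fun_cong[OF this(2), of a] show ?thesis
    using a nat_simps(1-3)[OF s(1)] nat_simps(1-3)[OF \<sigma>] by (intro E.is_isoI[of "\<tau> a" "\<sigma> a"]) simp_all
qed

end

lemma (in category) initial_iso:
  assumes Z: "is_initial C Z" and t: "is_iso C t" "Dom C t = Z"
  shows "is_initial C (Cod C t)"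
proof -
  obtain t' where t': "t \<in> Arr C" "t' \<in> Arr C" "Dom C t' = Cod C t" "Cod C t' = Z" "t' \<cdot> t = Idn C Z" "t \<cdot> t' = Idn C (Cod C t)"
    using is_iso_Arr[OF t(1)] iso_inverse[OF t refl] by metis
  have "\<exists>!u. u \<in> hom C (Cod C t) X" if X: "X \<in> Obj C" for X
  proof -
    obtain u where u: "u \<in> Arr C" "Dom C u = Z" "Cod C u = X" using initialE[OF Z X] .
    have "v = u \<cdot> t'" if v: "v \<in> hom C (Cod C t) X" for v
    proof -
      have "v \<cdot> t = u"
        by (rule initial_eqI[OF Z]) (use u v t t' in \<open>simp_all add: hom_def\<close>)
      then have "u \<cdot> t' = (v \<cdot> t) \<cdot> t'" by simp
      then show ?thesis using v t' t by (simp add: hom_def)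
    qed
    then show ?thesis
      using u t' by (intro ex1I[of _ "u \<cdot> t'"]) (simp_all add: hom_def)
  qed
  then show ?thesis using t'(1) by (simp add: is_initial_def)
qed

lemma (in category) initial_comparison:
  assumes Z: "is_initial C Z" and Z': "is_initial C Z'" and t: "t \<in> Arr C" "Dom C t = Z" "Cod C t = Z'"
  shows "is_iso C t"
proof -
  have Z_Obj: "Z \<in> Obj C" "Z' \<in> Obj C" using Z Z' by (simp_all add: is_initial_def)
  obtain s where s: "s \<in> Arr C" "Dom C s = Z'" "Cod C s = Z" using initialE[OF Z' Z_Obj(1)] .
  have "s \<cdot> t = Idn C Z" by (rule initial_eqI[OF Z]) (use s t Z_Obj in simp_all)
  moreover have "t \<cdot> s = Idn C Z'" by (rule initial_eqI[OF Z']) (use s t Z_Obj in simp_all)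
  ultimately show ?thesis using s t by (intro is_isoI[of t s]) simp_all
qed

section \<open>The nerve\<close>

context category
begin

text \<open>A composable chain of \<open>n\<close> generalised arrows at stage \<open>X\<close>.
  Vertices are recorded separately, since for \<open>n = 0\<close> there are no edges to carry
  them.\<close>

definition chain :: "('o, 'm) icat \<Rightarrow> 'o \<Rightarrow> nat \<Rightarrow> (nat \<Rightarrow> 'm) \<Rightarrow> (nat \<Rightarrow> 'm) \<Rightarrow> bool" where
  "chain A X n v e \<longleftrightarrow> (\<forall>i \<le> n. v i \<in> Arr C \<and> Dom C (v i) = X \<and> Cod C (v i) = ic0 A) \<and>
     (\<forall>i < n. e i \<in> Arr C \<and> Dom C (e i) = X \<and> Cod C (e i) = ic1 A \<and> src A \<cdot> e i = v i \<and> tgt A \<cdot> e i = v (Suc i))"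

lemma chainD:
  assumes "chain A X n v e"
  shows "i \<le> n \<Longrightarrow> v i \<in> Arr C" "i \<le> n \<Longrightarrow> Dom C (v i) = X" "i \<le> n \<Longrightarrow> Cod C (v i) = ic0 A"
    "i < n \<Longrightarrow> e i \<in> Arr C" "i < n \<Longrightarrow> Dom C (e i) = X" "i < n \<Longrightarrow> Cod C (e i) = ic1 A"
    "i < n \<Longrightarrow> src A \<cdot> e i = v i" "i < n \<Longrightarrow> tgt A \<cdot> e i = v (Suc i)"
  using assms by (simp_all add: chain_def)

lemma le3_cases: "(n :: nat) \<le> 3 \<Longrightarrow> (n = 0 \<Longrightarrow> P) \<Longrightarrow> (n = 1 \<Longrightarrow> P) \<Longrightarrow> (n = 2 \<Longrightarrow> P) \<Longrightarrow> (n = 3 \<Longrightarrow> P) \<Longrightarrow> P"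
  by linarith

lemma all_le_Suc: "(\<forall>i \<le> Suc n. Q i) \<longleftrightarrow> (\<forall>i \<le> n. Q i) \<and> Q (Suc n)"
  by (auto simp: le_Suc_eq)

lemma all_small:
  "(\<forall>i \<le> Suc 0. Q i) \<longleftrightarrow> Q 0 \<and> Q (Suc 0)"
  "(\<forall>i \<le> 2 :: nat. Q i) \<longleftrightarrow> Q 0 \<and> Q (Suc 0) \<and> Q 2"
  "(\<forall>i \<le> 3 :: nat. Q i) \<longleftrightarrow> Q 0 \<and> Q (Suc 0) \<and> Q 2 \<and> Q 3"
  "(\<forall>i < 2 :: nat. Q i) \<longleftrightarrow> Q 0 \<and> Q (Suc 0)"
  "(\<forall>i < 3 :: nat. Q i) \<longleftrightarrow> Q 0 \<and> Q (Suc 0) \<and> Q 2"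
  by (simp_all only: numeral_2_eq_2 numeral_3_eq_3 all_le_Suc All_less_Suc) (simp, simp, simp, fastforce+)

lemma level_simps [simp]:
  "level A 0 = ic0 A" "level A 1 = ic1 A" "level A (Suc 0) = ic1 A" "level A 2 = ic2 A" "level A 3 = ic3 A"
  by (simp_all add: level_def)

lemma chain_vertex_edge:
  assumes "is_igraph A" "n \<le> 3"
  shows "chain A (level A n) n (vertex C A n) (edge C A n)"
  using assms(2) by (rule le3_cases) (use assms(1) in \<open>simp_all add: chain_def all_small vertex_def edge_def\<close>)

lemma level_Obj [simp]: "is_igraph A \<Longrightarrow> n \<le> 3 \<Longrightarrow> level A n \<in> Obj C"
  by (erule le3_cases) simp_all

text \<open>\<open>ic2\<close> and \<open>ic3\<close> are iterated pullbacks of \<open>ic1\<close>,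
  so edges separate arrows into them; the case \<open>n = 0\<close> rests on the vertex
  instead.\<close>

lemma level_eqI:
  assumes A [simp]: "is_igraph A" and n: "n \<le> 3" and uv: "u \<in> Arr C" "v \<in> Arr C" "Cod C u = level A n" "Cod C v = level A n"
    "Dom C v = Dom C u" and vert: "\<And>i. i \<le> n \<Longrightarrow> vertex C A n i \<cdot> u = vertex C A n i \<cdot> v"
    and edge: "\<And>i. i < n \<Longrightarrow> edge C A n i \<cdot> u = edge C A n i \<cdot> v"
  shows "u = v"
  using n
proof (rule le3_cases)
  assume n0: "n = 0"
  show ?thesis using vert[of 0] uv(1-4) unfolding n0 by (simp add: vertex_def)
next
  assume n1: "n = 1"
  show ?thesis using edge[of 0] uv(1-4) unfolding n1 by (simp add: edge_def)
next
  assume [simp]: "n = 2"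
  show ?thesis
    by (rule pullback_eqI[OF igraph_pullback2[OF A]]) (use edge[of 0] edge[of 1] uv in \<open>simp_all add: edge_def\<close>)
next
  assume [simp]: "n = 3"
  note e = edge[of 0] edge[of 1] edge[of 2]
  have "snd2 A \<cdot> fst3 A \<cdot> u = snd2 A \<cdot> fst3 A \<cdot> v" "fst2 A \<cdot> fst3 A \<cdot> u = fst2 A \<cdot> fst3 A \<cdot> v"
    "snd2 A \<cdot> snd3 A \<cdot> u = snd2 A \<cdot> snd3 A \<cdot> v"
    using e uv by (simp_all add: edge_def)
  note e' = this
  show ?thesis
  proof (rule pullback_eqI[OF igraph_pullback3[OF A]])
    show "fst3 A \<cdot> u = fst3 A \<cdot> v"
      by (rule pullback_eqI[OF igraph_pullback2[OF A]]) (use e' uv in simp_all)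
    show "snd3 A \<cdot> u = snd3 A \<cdot> v"
      by (rule pullback_eqI[OF igraph_pullback2[OF A]]) (use e' uv in simp_all)
  qed (use uv in simp_all)
qed

text \<open>Together with \<open>level_eqI\<close> this is the Segal condition:
  \<open>level A n\<close> represents chains of length \<open>n\<close>.\<close>

lemma mediating_exists:
  assumes A [simp]: "is_igraph A" and n: "n \<le> 3" and c: "chain A X n v e"
  shows "\<exists>u. u \<in> Arr C \<and> Dom C u = X \<and> Cod C u = level A n \<and> (\<forall>i \<le> n. vertex C A n i \<cdot> u = v i) \<and> (\<forall>i < n. edge C A n i \<cdot> u = e i)"
  using n
proof (rule le3_cases)
  note D = chainD[OF c]
  {
    assume "n = 0" then show ?thesis using D(1-3)[of 0] by (intro exI[of _ "v 0"]) (simp add: vertex_def)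
  next
    assume "n = 1" then show ?thesis
      using D(1-3)[of 0] D(1-3)[of 1] D(4-)[of 0]
      by (intro exI[of _ "e 0"]) (simp add: vertex_def edge_def all_small)
  next
    assume [simp]: "n = 2"
    have [simp]: "composable A (e 0) (e (Suc 0))"
      using D(4-)[of 0] D(4-)[of 1] by (simp add: composable_iff)
    show ?thesis
      using D(1-3)[of 0] D(1-3)[of 1] D(4-)[of 0] D(4-)[of 1]
      by (intro exI[of _ "pair2 C A (e 0) (e 1)"]) (simp add: vertex_def edge_def all_small numeral_2_eq_2[symmetric])
  next
    assume [simp]: "n = 3"
    have c01 [simp]: "composable A (e 0) (e (Suc 0))" and c12 [simp]: "composable A (e (Suc 0)) (e 2)"
      using D(4-)[of 0] D(4-)[of 1] D(4-)[of 2] by (simp_all add: composable_iff numeral_2_eq_2)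
    obtain u where u: "u \<in> Arr C" "Dom C u = X" "Cod C u = ic3 A" "fst3 A \<cdot> u = pair2 C A (e 0) (e 1)" "snd3 A \<cdot> u = pair2 C A (e 1) (e 2)"
      using pullback_lift[OF igraph_pullback3[OF A], of "pair2 C A (e 0) (e 1)" "pair2 C A (e 1) (e 2)"]
        D(4-6)[of 0] D(4-6)[of 1] by auto
    have e: "fst2 A \<cdot> fst3 A \<cdot> u = e 0" "fst2 A \<cdot> snd3 A \<cdot> u = e 1" "snd2 A \<cdot> snd3 A \<cdot> u = e 2"
      using u by simp_all
    show ?thesis
      using u(1-3) e D(7,8)[of 0] D(7,8)[of 1] D(7,8)[of 2]
      by (intro exI[of _ u]) (simp add: vertex_def edge_def all_small numeral_2_eq_2[symmetric] numeral_3_eq_3[symmetric])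
  }
qed

text \<open>The description that occurs in both \<open>nerve_obj\<close> and
  \<open>nerve_arr\<close>, isolated so that its properties are proved once.\<close>

definition mediating :: "('o, 'm) icat \<Rightarrow> 'o \<Rightarrow> nat \<Rightarrow> (nat \<Rightarrow> 'm) \<Rightarrow> (nat \<Rightarrow> 'm) \<Rightarrow> 'm" where
  "mediating A X n v e = (THE u. u \<in> hom C X (level A n) \<and> (\<forall>i \<le> n. vertex C A n i \<cdot> u = v i) \<and>
     (\<forall>i < n. edge C A n i \<cdot> u = e i))"

lemma mediating:
  assumes A: "is_igraph A" and n: "n \<le> 3" and c: "chain A X n v e"
  shows "mediating A X n v e \<in> Arr C" "Dom C (mediating A X n v e) = X" "Cod C (mediating A X n v e) = level A n"
    "i \<le> n \<Longrightarrow> vertex C A n i \<cdot> mediating A X n v e = v i" "i < n \<Longrightarrow> edge C A n i \<cdot> mediating A X n v e = e i"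
proof -
  obtain u where u: "u \<in> Arr C" "Dom C u = X" "Cod C u = level A n" "\<forall>i \<le> n. vertex C A n i \<cdot> u = v i" "\<forall>i < n. edge C A n i \<cdot> u = e i"
    using mediating_exists[OF assms] by blast
  have "\<exists>!u. u \<in> hom C X (level A n) \<and> (\<forall>i \<le> n. vertex C A n i \<cdot> u = v i) \<and> (\<forall>i < n. edge C A n i \<cdot> u = e i)"
  proof (rule ex1I[of _ u])
    fix w assume "w \<in> hom C X (level A n) \<and> (\<forall>i \<le> n. vertex C A n i \<cdot> w = v i) \<and> (\<forall>i < n. edge C A n i \<cdot> w = e i)"
    then have w: "w \<in> Arr C" "Dom C w = X" "Cod C w = level A n" "\<forall>i \<le> n. vertex C A n i \<cdot> w = v i" "\<forall>i < n. edge C A n i \<cdot> w = e i"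
      by (simp_all add: hom_def)
    show "w = u"
      by (rule level_eqI[OF A n]) (use u w in simp_all)
  qed (use u in \<open>simp add: hom_def\<close>)
  from theI'[OF this]
  show "mediating A X n v e \<in> Arr C" "Dom C (mediating A X n v e) = X" "Cod C (mediating A X n v e) = level A n"
    "i \<le> n \<Longrightarrow> vertex C A n i \<cdot> mediating A X n v e = v i" "i < n \<Longrightarrow> edge C A n i \<cdot> mediating A X n v e = e i"
    unfolding mediating_def[symmetric] by (simp_all add: hom_def)
qed

text \<open>\<open>path\<close> for an arbitrary chain: restrictions along monotone maps and images
  under functors are chains as well, and their paths have to be compared.\<close>

primrec gpath :: "('o, 'm) icat \<Rightarrow> (nat \<Rightarrow> 'm) \<Rightarrow> (nat \<Rightarrow> 'm) \<Rightarrow> nat \<Rightarrow> nat \<Rightarrow> 'm" where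
  "gpath A v e i 0 = unt A \<cdot> v i"
| "gpath A v e i (Suc k) = icomp C A (gpath A v e i k) (e (i + k))"

lemma path_gpath: "path C A n i k = gpath A (vertex C A n) (edge C A n) i k"
  by (induction k) simp_all

lemma gpath:
  assumes A [simp]: "is_icat C A" and c: "chain A X n v e" and "i + k \<le> n"
  shows "gpath A v e i k \<in> Arr C \<and> Dom C (gpath A v e i k) = X \<and> Cod C (gpath A v e i k) = ic1 A \<and>
    src A \<cdot> gpath A v e i k = v i \<and> tgt A \<cdot> gpath A v e i k = v (i + k)"
  using \<open>i + k \<le> n\<close>
proof (induction k)
  case 0
  then show ?case using chainD(1-3)[OF c, of i] by simp
next
  case (Suc k)
  then have IH: "gpath A v e i k \<in> Arr C" "Dom C (gpath A v e i k) = X" "Cod C (gpath A v e i k) = ic1 A"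
    "src A \<cdot> gpath A v e i k = v i" "tgt A \<cdot> gpath A v e i k = v (i + k)" by simp_all
  have e: "e (i + k) \<in> Arr C" "Dom C (e (i + k)) = X" "Cod C (e (i + k)) = ic1 A" "src A \<cdot> e (i + k) = v (i + k)"
    "tgt A \<cdot> e (i + k) = v (Suc (i + k))"
    using chainD[OF c, of "i + k"] Suc.prems by simp_all
  have "composable A (gpath A v e i k) (e (i + k))"
    unfolding composable_def using IH e by simp
  with IH e show ?case by simp
qed

lemma gpath_composable:
  assumes A: "is_icat C A" and c: "chain A X n v e" and "i + (k + l) \<le> n"
  shows "composable A (gpath A v e i k) (gpath A v e (i + k) l)"
  unfolding composable_def
  using gpath[OF A c, of i k] gpath[OF A c, of "i + k" l] assms(3) by (simp add: add.assoc)

lemma gpath_edge_composable: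
  assumes A: "is_icat C A" and c: "chain A X n v e" and "i + k < n"
  shows "composable A (gpath A v e i k) (e (i + k))"
  unfolding composable_def
  using gpath[OF A c, of i k] chainD[OF c, of "i + k"] assms(3) by simp

text \<open>Units and associativity in unbiased form: paths concatenate.\<close>

lemma gpath_add:
  assumes A [simp]: "is_icat C A" and c: "chain A X n v e" and "i + (k + l) \<le> n"
  shows "gpath A v e i (k + l) = icomp C A (gpath A v e i k) (gpath A v e (i + k) l)"
  using assms(3)
proof (induction l)
  case 0
  then show ?case using gpath[OF A c, of i k] by simp
next
  case (Suc l)
  have "composable A (gpath A v e i k) (gpath A v e (i + k) l)" "composable A (gpath A v e (i + k) l) (e (i + k + l))"
    using gpath_composable[OF A c, of i k l] gpath_edge_composable[OF A c, of "i + k" l] Suc.prems by simp_all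
  then show ?case using Suc by (simp add: add.assoc)
qed

lemma gpath_1:
  assumes A [simp]: "is_icat C A" and c: "chain A X n v e" and "i < n"
  shows "gpath A v e i (Suc 0) = e i"
  using chainD[OF c, of i] assms(3) by simp

lemma gpath_Cmp:
  assumes A [simp]: "is_icat C A" and c: "chain A X n v e" and u: "u \<in> Arr C" "Cod C u = X" and "i + k \<le> n"
  shows "gpath A v e i k \<cdot> u = gpath A (\<lambda>i. v i \<cdot> u) (\<lambda>i. e i \<cdot> u) i k"
  using assms(5)
proof (induction k)
  case 0
  then show ?case using chainD(1-3)[OF c, of i] u by simp
next
  case (Suc k)
  then show ?case
    using gpath_edge_composable[OF A c, of i k] gpath[OF A c, of i k] u by simp
qed

lemma gpath_cong:
  assumes "v i = v' i" "\<And>j. i \<le> j \<Longrightarrow> j < i + k \<Longrightarrow> e j = e' j"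
  shows "gpath A v e i k = gpath A v' e' i k"
  using assms(2) by (induction k) (simp_all add: assms(1))

lemma chain_ifun:
  assumes F [simp]: "is_gfun F" and A: "ifdom F = A" and c: "chain A X n v e"
  shows "chain (ifcod F) X n (\<lambda>i. if0 F \<cdot> v i) (\<lambda>i. if1 F \<cdot> e i)"
  unfolding chain_def using chainD[OF c] A by simp

lemma gpath_ifun:
  assumes F [simp]: "is_ifun C F" and A [simp]: "ifdom F = A" and c: "chain A X n v e" and "i + k \<le> n"
  shows "if1 F \<cdot> gpath A v e i k = gpath (ifcod F) (\<lambda>i. if0 F \<cdot> v i) (\<lambda>i. if1 F \<cdot> e i) i k"
  using assms(4)
proof (induction k)
  case 0
  then show ?case using chainD(1-3)[OF c, of i] by simp
next
  case (Suc k)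
  have "is_icat C A" using ifun_icat(1)[OF F] by simp
  from gpath_edge_composable[OF this c, of i k] Suc show ?case
    using gfun_icomp[of F A "ifcod F"] by simp
qed

text \<open>The combinatorial content of functoriality: a path of the restricted chain is a path of
  the original one between the images of its endpoints, since the step lengths
  \<open>f (Suc i) - f i\<close> telescope.\<close>

lemma chain_restrict:
  assumes A: "is_icat C A" and c: "chain A X n v e" and f: "f \<in> {..m} \<rightarrow> {..n}" "mono_on {..m} f"
  shows "chain A X m (\<lambda>i. v (f i)) (\<lambda>i. gpath A v e (f i) (f (Suc i) - f i))"
    and "i + k \<le> m \<Longrightarrow> gpath A (\<lambda>i. v (f i)) (\<lambda>i. gpath A v e (f i) (f (Suc i) - f i)) i k = gpath A v e (f i) (f (i + k) - f i)"
proof -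
  have le: "f i \<le> n" if "i \<le> m" for i using f(1) that by auto
  have mono: "f i \<le> f j" if "i \<le> j" "j \<le> m" for i j using f(2) that by (auto simp: mono_on_def)
  show "chain A X m (\<lambda>i. v (f i)) (\<lambda>i. gpath A v e (f i) (f (Suc i) - f i))"
    unfolding chain_def
  proof (intro conjI allI impI)
    fix i assume "i < m"
    then have "f i + (f (Suc i) - f i) \<le> n" "f i + (f (Suc i) - f i) = f (Suc i)"
      using le[of "Suc i"] mono[of i "Suc i"] by simp_all
    then show "gpath A v e (f i) (f (Suc i) - f i) \<in> Arr C" "Dom C (gpath A v e (f i) (f (Suc i) - f i)) = X"
      "Cod C (gpath A v e (f i) (f (Suc i) - f i)) = ic1 A" "src A \<cdot> gpath A v e (f i) (f (Suc i) - f i) = v (f i)"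
      "tgt A \<cdot> gpath A v e (f i) (f (Suc i) - f i) = v (f (Suc i))"
      using gpath[OF A c, of "f i" "f (Suc i) - f i"] by simp_all
  qed (use le chainD[OF c] in simp_all)
  show "gpath A (\<lambda>i. v (f i)) (\<lambda>i. gpath A v e (f i) (f (Suc i) - f i)) i k = gpath A v e (f i) (f (i + k) - f i)"
    if "i + k \<le> m"
    using that
  proof (induction k)
    case (Suc k)
    \<comment> \<open>Subtraction of naturals is truncated; monotonicity makes these differences
      genuine.\<close>
    have eq: "f (Suc (i + k)) - f i = (f (i + k) - f i) + (f (Suc (i + k)) - f (i + k))" "f i + (f (i + k) - f i) = f (i + k)"
      using mono[of i "i + k"] mono[of "i + k" "Suc (i + k)"] Suc.prems by simp_all
    have "f i + ((f (i + k) - f i) + (f (Suc (i + k)) - f (i + k))) \<le> n"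
      using le[of "Suc (i + k)"] mono[of i "i + k"] mono[of "i + k" "Suc (i + k)"] Suc.prems by simp
    from gpath_add[OF A c this] show ?case
      using Suc by (simp only: gpath.simps add_Suc_right eq)
  qed simp
qed

section \<open>The nerve as a functor into presheaves on \<open>simplex3\<close>\<close>

lemma opp_simps [simp]:
  "Obj (opp D) = Obj D" "Arr (opp D) = Arr D" "Dom (opp D) = Cod D" "Cod (opp D) = Dom D" "Idn (opp D) = Idn D"
  "Cmp (opp D) g f = Cmp D f g"
  by (simp_all add: opp_def)

lemma simplex3_simps:
  "n \<in> Obj simplex3 \<longleftrightarrow> n \<le> 3"
  "(m, n, f) \<in> Arr simplex3 \<longleftrightarrow> m \<le> 3 \<and> n \<le> 3 \<and> f \<in> {..m} \<rightarrow>\<^sub>E {..n} \<and> mono_on {..m} f"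
  "Dom simplex3 (m, n, f) = m" "Cod simplex3 (m, n, f) = n" "Idn simplex3 n = (n, n, \<lambda>i \<in> {..n}. i)"
  "Cmp simplex3 (n', k, g) (m, n, f) = (m, k, \<lambda>i \<in> {..m}. g (f i))"
  by (simp_all add: simplex3_def)

lemma simplex3_map:
  assumes "(m, n, f) \<in> Arr simplex3"
  shows "m \<le> 3" "n \<le> 3" "f \<in> {..m} \<rightarrow> {..n}" "mono_on {..m} f" "i \<le> m \<Longrightarrow> f i \<le> n" "i < m \<Longrightarrow> f i + (f (Suc i) - f i) \<le> n"
proof -
  show 1: "m \<le> 3" "n \<le> 3" "f \<in> {..m} \<rightarrow> {..n}" "mono_on {..m} f"
    using assms by (auto simp: simplex3_simps)
  show le: "f i \<le> n" if "i \<le> m" for i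
    using 1(3) that by auto
  show "f i + (f (Suc i) - f i) \<le> n" if "i < m"
  proof -
    have "f i \<le> f (Suc i)" using 1(4) that by (auto simp: mono_on_def)
    then show ?thesis using le[of "Suc i"] that by simp
  qed
qed

lemma functor_category_simplex3: "functor_category C (opp simplex3)"
  by unfold_locales (auto simp: simplex3_simps split_paired_all)

lemma nerve_obj_simps:
  "n \<le> 3 \<Longrightarrow> OMap (nerve_obj C A) n = level A n"
  "(m, n, f) \<in> Arr simplex3 \<Longrightarrow> AMap (nerve_obj C A) (m, n, f) =
     mediating A (level A n) m (\<lambda>i. vertex C A n (f i)) (\<lambda>i. gpath A (vertex C A n) (edge C A n) (f i) (f (Suc i) - f i))"
  by (simp_all add: nerve_obj_def simplex3_simps(1) mediating_def path_gpath)

lemma nerve_chain: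
  assumes A: "is_icat C A" and f: "(m, n, f) \<in> Arr simplex3"
  shows "chain A (level A n) m (\<lambda>i. vertex C A n (f i)) (\<lambda>i. gpath A (vertex C A n) (edge C A n) (f i) (f (Suc i) - f i))"
  using chain_restrict(1)[OF A chain_vertex_edge[OF icat_igraph[OF A]]] simplex3_map[OF f] by blast

lemma nerve_AMap:
  assumes A: "is_icat C A" and f: "(m, n, f) \<in> Arr simplex3"
  defines "u \<equiv> AMap (nerve_obj C A) (m, n, f)"
  shows "u \<in> Arr C" "Dom C u = level A n" "Cod C u = level A m" "i \<le> m \<Longrightarrow> vertex C A m i \<cdot> u = vertex C A n (f i)"
    "i < m \<Longrightarrow> edge C A m i \<cdot> u = gpath A (vertex C A n) (edge C A n) (f i) (f (Suc i) - f i)"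
  using mediating[OF icat_igraph[OF A] simplex3_map(1)[OF f] nerve_chain[OF A f]]
  unfolding u_def nerve_obj_simps(2)[OF f] by blast+

text \<open>Restriction along a composite of monotone maps turns an edge into a path at the
  intermediate level; hence the defining equation is extended from edges to paths.\<close>

lemma nerve_AMap_path:
  assumes A: "is_icat C A" and f: "(m, n, f) \<in> Arr simplex3" and ik: "i + k \<le> m"
  shows "gpath A (vertex C A m) (edge C A m) i k \<cdot> AMap (nerve_obj C A) (m, n, f) =
    gpath A (vertex C A n) (edge C A n) (f i) (f (i + k) - f i)"
proof -
  let ?u = "AMap (nerve_obj C A) (m, n, f)"
  note u = nerve_AMap[OF A f] and m = simplex3_map(1,2)[OF f]
  have "gpath A (vertex C A m) (edge C A m) i k \<cdot> ?u = gpath A (\<lambda>i. vertex C A m i \<cdot> ?u) (\<lambda>i. edge C A m i \<cdot> ?u) i k"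
    by (rule gpath_Cmp[OF A chain_vertex_edge[OF icat_igraph[OF A] m(1)] u(1,3) ik])
  also have "\<dots> = gpath A (\<lambda>i. vertex C A n (f i)) (\<lambda>i. gpath A (vertex C A n) (edge C A n) (f i) (f (Suc i) - f i)) i k"
    by (rule gpath_cong) (use u(4,5) ik in simp_all)
  also have "\<dots> = gpath A (vertex C A n) (edge C A n) (f i) (f (i + k) - f i)"
    by (rule chain_restrict(2)[OF A chain_vertex_edge[OF icat_igraph[OF A] m(2)] simplex3_map(3,4)[OF f] ik])
  finally show ?thesis .
qed

text \<open>Both functor laws are tested on vertices and edges by \<open>level_eqI\<close>. An edge
  of the identity is a path of length one, and composites reduce to
  \<open>nerve_AMap_path\<close>.\<close>

lemma nerve_obj_Obj:
  assumes A: "is_icat C A"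
  shows "nerve_obj C A \<in> Obj (fun_cat (opp simplex3) C)"
proof -
  note G = icat_igraph[OF A]
  have "is_functor (opp simplex3) C (nerve_obj C A)"
    unfolding is_functor_def
  proof (intro conjI ballI impI)
    fix n assume "n \<in> Obj (opp simplex3)"
    then have n: "n \<le> 3" by (simp add: simplex3_simps)
    then show "OMap (nerve_obj C A) n \<in> Obj C" using G by (simp add: nerve_obj_simps)
    have id: "(n, n, \<lambda>i \<in> {..n}. i) \<in> Arr simplex3" using n by (auto simp: simplex3_simps mono_on_def)
    note c = chain_vertex_edge[OF G n]
    have "AMap (nerve_obj C A) (n, n, \<lambda>i \<in> {..n}. i) = Idn C (level A n)"
    proof (rule level_eqI[OF G n])
      fix i assume "i \<le> n"
      then show "vertex C A n i \<cdot> AMap (nerve_obj C A) (n, n, \<lambda>i \<in> {..n}. i) = vertex C A n i \<cdot> Idn C (level A n)"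
        using nerve_AMap(4)[OF A id, of i] chainD(1-3)[OF c, of i] by simp
    next
      fix i assume "i < n"
      then show "edge C A n i \<cdot> AMap (nerve_obj C A) (n, n, \<lambda>i \<in> {..n}. i) = edge C A n i \<cdot> Idn C (level A n)"
        using nerve_AMap(5)[OF A id, of i] chainD(4-6)[OF c, of i] gpath_1[OF A c, of i] by simp
    qed (use nerve_AMap(1-3)[OF A id] n G in simp_all)
    then show "AMap (nerve_obj C A) (Idn (opp simplex3) n) = Idn C (OMap (nerve_obj C A) n)"
      using n by (simp add: simplex3_simps nerve_obj_simps)
  next
    fix a assume a: "a \<in> Arr (opp simplex3)"
    obtain m n f where "a = (m, n, f)" by (cases a)
    then show "AMap (nerve_obj C A) a \<in> hom C (OMap (nerve_obj C A) (Dom (opp simplex3) a)) (OMap (nerve_obj C A) (Cod (opp simplex3) a))"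
      using a nerve_AMap(1-3)[OF A, of m n f] simplex3_map(1,2)[of m n f] by (simp add: hom_def simplex3_simps(3,4) nerve_obj_simps(1))
  next
    fix a b assume ab: "a \<in> Arr (opp simplex3)" "b \<in> Arr (opp simplex3)" "Cod (opp simplex3) a = Dom (opp simplex3) b"
    obtain m n f where a: "a = (m, n, f)" by (cases a)
    obtain l g where b: "b = (l, m, g)" using ab a by (cases b) (simp add: simplex3_simps(3,4))
    have f: "(m, n, f) \<in> Arr simplex3" and g: "(l, m, g) \<in> Arr simplex3" using ab a b by simp_all
    have fg: "(l, n, \<lambda>i \<in> {..l}. f (g i)) \<in> Arr simplex3"
    proof -
      have "mono_on {..l} (\<lambda>i \<in> {..l}. f (g i))"
      proof (rule mono_onI)
        fix r s assume rs: "r \<in> {..l}" "s \<in> {..l}" "r \<le> s"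
        then have "g r \<le> g s" "g s \<le> m"
          using simplex3_map(4,5)[OF g] by (auto simp: mono_on_def)
        then show "(\<lambda>i \<in> {..l}. f (g i)) r \<le> (\<lambda>i \<in> {..l}. f (g i)) s"
          using simplex3_map(4)[OF f] rs by (auto simp: mono_on_def)
      qed
      then show ?thesis
        using simplex3_map(1,2,5)[OF f] simplex3_map(1,5)[OF g] by (auto simp: simplex3_simps)
    qed
    note ml = simplex3_map(1)[OF f] simplex3_map(1)[OF g] and gm = simplex3_map(5,6)[OF g]
    note F = nerve_AMap[OF A f] and N = nerve_AMap[OF A g] and FG = nerve_AMap[OF A fg]
    note cm = chain_vertex_edge[OF G ml(1)] and cl = chain_vertex_edge[OF G ml(2)]
    have "AMap (nerve_obj C A) (l, n, \<lambda>i \<in> {..l}. f (g i)) = AMap (nerve_obj C A) (l, m, g) \<cdot> AMap (nerve_obj C A) (m, n, f)"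
    proof (rule level_eqI[OF G ml(2)])
      fix i assume i: "i \<le> l"
      have "vertex C A l i \<cdot> AMap (nerve_obj C A) (l, m, g) \<cdot> AMap (nerve_obj C A) (m, n, f) = vertex C A m (g i) \<cdot> AMap (nerve_obj C A) (m, n, f)"
        by (rule Cmp_eq_Cmp[OF N(4)[OF i]]) (use chainD(1-3)[OF cl i] N(1-3) F(1-3) in simp_all)
      then show "vertex C A l i \<cdot> AMap (nerve_obj C A) (l, n, \<lambda>i \<in> {..l}. f (g i)) =
          vertex C A l i \<cdot> AMap (nerve_obj C A) (l, m, g) \<cdot> AMap (nerve_obj C A) (m, n, f)"
        using FG(4)[OF i] F(4)[OF gm(1)[OF i]] i by simp
    next
      fix i assume i: "i < l"
      have "edge C A l i \<cdot> AMap (nerve_obj C A) (l, m, g) \<cdot> AMap (nerve_obj C A) (m, n, f) =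
          gpath A (vertex C A m) (edge C A m) (g i) (g (Suc i) - g i) \<cdot> AMap (nerve_obj C A) (m, n, f)"
        by (rule Cmp_eq_Cmp[OF N(5)[OF i]]) (use chainD(4-6)[OF cl i] N(1-3) F(1-3) in simp_all)
      moreover have "g i + (g (Suc i) - g i) = g (Suc i)"
        using simplex3_map(4)[OF g] i by (auto simp: mono_on_def)
      ultimately show "edge C A l i \<cdot> AMap (nerve_obj C A) (l, n, \<lambda>i \<in> {..l}. f (g i)) =
          edge C A l i \<cdot> AMap (nerve_obj C A) (l, m, g) \<cdot> AMap (nerve_obj C A) (m, n, f)"
        using FG(5)[OF i] nerve_AMap_path[OF A f gm(2)[OF i]] i by simp
    qed (use F(1-3) N(1-3) FG(1-3) in simp_all)
    then show "AMap (nerve_obj C A) (b \<cdot>\<^bsub>opp simplex3\<^esub> a) = AMap (nerve_obj C A) b \<cdot> AMap (nerve_obj C A) a"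
      by (simp add: a b simplex3_simps(6))
  qed
  then show ?thesis by (simp add: fun_cat_simps nerve_obj_def)
qed

definition nerve_component :: "('o, 'm) ifun \<Rightarrow> nat \<Rightarrow> 'm" where
  "nerve_component F n = mediating (ifcod F) (level (ifdom F) n) n
     (\<lambda>i. if0 F \<cdot> vertex C (ifdom F) n i) (\<lambda>i. if1 F \<cdot> edge C (ifdom F) n i)"

lemma nerve_arr_eq:
  "nerve_arr C F = (nerve_obj C (ifdom F), nerve_obj C (ifcod F), \<lambda>n \<in> Obj simplex3. nerve_component F n)"
  by (simp add: nerve_arr_def nerve_component_def mediating_def Let_def)

lemma nerve_component:
  assumes F: "is_ifun C F" and A: "ifdom F = A" and B: "ifcod F = B" and n: "n \<le> 3"
  shows "nerve_component F n \<in> Arr C" "Dom C (nerve_component F n) = level A n" "Cod C (nerve_component F n) = level B n"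
    "i \<le> n \<Longrightarrow> vertex C B n i \<cdot> nerve_component F n = if0 F \<cdot> vertex C A n i"
    "i < n \<Longrightarrow> edge C B n i \<cdot> nerve_component F n = if1 F \<cdot> edge C A n i"
proof -
  have G: "is_igraph A" "is_igraph B" using F A B gfun_igraph[OF ifun_gfun[OF F]] by simp_all
  note c = chain_ifun[OF ifun_gfun[OF F] A chain_vertex_edge[OF G(1) n]]
  show "nerve_component F n \<in> Arr C" "Dom C (nerve_component F n) = level A n" "Cod C (nerve_component F n) = level B n"
    "i \<le> n \<Longrightarrow> vertex C B n i \<cdot> nerve_component F n = if0 F \<cdot> vertex C A n i"
    "i < n \<Longrightarrow> edge C B n i \<cdot> nerve_component F n = if1 F \<cdot> edge C A n i"
    using mediating[OF G(2) n c[unfolded B]] unfolding nerve_component_def A B by blast+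
qed

lemma nerve_component_eqI:
  assumes F: "is_ifun C F" and A: "ifdom F = A" and B: "ifcod F = B" and n: "n \<le> 3"
    and u: "u \<in> Arr C" "Dom C u = level A n" "Cod C u = level B n" "\<And>i. i \<le> n \<Longrightarrow> vertex C B n i \<cdot> u = if0 F \<cdot> vertex C A n i"
      "\<And>i. i < n \<Longrightarrow> edge C B n i \<cdot> u = if1 F \<cdot> edge C A n i"
  shows "nerve_component F n = u"
proof -
  have G: "is_igraph B" using F B gfun_igraph[OF ifun_gfun[OF F]] by simp
  show ?thesis
    by (rule level_eqI[OF G n]) (use nerve_component[OF F A B n] u in simp_all)
qed

text \<open>Naturality is tested on vertices and edges; on edges it says that \<open>F\<close>
  preserves composites of paths (\<open>gpath_ifun\<close>).\<close>

lemma nerve_arr_Arr: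
  assumes F: "is_ifun C F"
  shows "nerve_arr C F \<in> Arr (fun_cat (opp simplex3) C)"
proof -
  interpret N: functor_category C "opp simplex3" by (rule functor_category_simplex3)
  define A B where "A = ifdom F" "B = ifcod F"
  then have AB: "ifdom F = A" "ifcod F = B" by simp_all
  have icat: "is_icat C A" "is_icat C B" using ifun_icat[OF F] AB by simp_all
  note G = icat_igraph[OF icat(1)] icat_igraph[OF icat(2)]
  note comp = nerve_component[OF F AB]
  show ?thesis
    unfolding nerve_arr_eq AB
  proof (rule N.natI)
    fix a assume a: "a \<in> Arr (opp simplex3)"
    obtain m n f where eq: "a = (m, n, f)" by (cases a)
    then have f: "(m, n, f) \<in> Arr simplex3" using a by simp
    note mn = simplex3_map(1,2)[OF f] and fi = simplex3_map(5,6)[OF f]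
    note NA = nerve_AMap[OF icat(1) f] and NB = nerve_AMap[OF icat(2) f]
    note cAm = chain_vertex_edge[OF G(1) mn(1)] and cAn = chain_vertex_edge[OF G(1) mn(2)]
      and cBm = chain_vertex_edge[OF G(2) mn(1)] and cBn = chain_vertex_edge[OF G(2) mn(2)]
    note [simp] = ifun_gfun[OF F] AB
    have "AMap (nerve_obj C B) (m, n, f) \<cdot> nerve_component F n = nerve_component F m \<cdot> AMap (nerve_obj C A) (m, n, f)"
    proof (rule level_eqI[OF G(2) mn(1)])
      fix i assume i: "i \<le> m"
      have "vertex C B m i \<cdot> AMap (nerve_obj C B) (m, n, f) \<cdot> nerve_component F n = vertex C B n (f i) \<cdot> nerve_component F n"
        by (rule Cmp_eq_Cmp[OF NB(4)[OF i]]) (use chainD(1-3)[OF cBm i] NB(1-3) comp(1-3)[OF mn(2)] in simp_all)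
      also have "\<dots> = if0 F \<cdot> vertex C A n (f i)" by (rule comp(4)[OF mn(2) fi(1)[OF i]])
      also have "\<dots> = if0 F \<cdot> vertex C A m i \<cdot> AMap (nerve_obj C A) (m, n, f)" by (simp only: NA(4)[OF i])
      also have "\<dots> = vertex C B m i \<cdot> nerve_component F m \<cdot> AMap (nerve_obj C A) (m, n, f)"
        by (rule square_Cmp[OF comp(4)[OF mn(1) i], symmetric])
          (use chainD(1-3)[OF cAm i] chainD(1-3)[OF cBm i] NA(1-3) comp(1-3)[OF mn(1)] in simp_all)
      finally show "vertex C B m i \<cdot> AMap (nerve_obj C B) (m, n, f) \<cdot> nerve_component F n =
          vertex C B m i \<cdot> nerve_component F m \<cdot> AMap (nerve_obj C A) (m, n, f)" .
    next
      fix i assume i: "i < m"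
      let ?k = "f (Suc i) - f i"
      have "edge C B m i \<cdot> AMap (nerve_obj C B) (m, n, f) \<cdot> nerve_component F n =
          gpath B (vertex C B n) (edge C B n) (f i) ?k \<cdot> nerve_component F n"
        by (rule Cmp_eq_Cmp[OF NB(5)[OF i]]) (use chainD(4-6)[OF cBm i] NB(1-3) comp(1-3)[OF mn(2)] in simp_all)
      also have "\<dots> = gpath B (\<lambda>i. vertex C B n i \<cdot> nerve_component F n) (\<lambda>i. edge C B n i \<cdot> nerve_component F n) (f i) ?k"
        by (rule gpath_Cmp[OF icat(2) cBn comp(1,3)[OF mn(2)] fi(2)[OF i]])
      also have "\<dots> = gpath B (\<lambda>i. if0 F \<cdot> vertex C A n i) (\<lambda>i. if1 F \<cdot> edge C A n i) (f i) ?k"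
        by (rule gpath_cong) (use comp(4,5)[OF mn(2)] fi[of i] i in simp_all)
      also have "\<dots> = if1 F \<cdot> gpath A (vertex C A n) (edge C A n) (f i) ?k"
        using gpath_ifun[OF F AB(1) cAn fi(2)[OF i]] by simp
      also have "\<dots> = if1 F \<cdot> edge C A m i \<cdot> AMap (nerve_obj C A) (m, n, f)" by (simp only: NA(5)[OF i])
      also have "\<dots> = edge C B m i \<cdot> nerve_component F m \<cdot> AMap (nerve_obj C A) (m, n, f)"
        by (rule square_Cmp[OF comp(5)[OF mn(1) i], symmetric])
          (use chainD(4-6)[OF cAm i] chainD(4-6)[OF cBm i] NA(1-3) comp(1-3)[OF mn(1)] in simp_all)
      finally show "edge C B m i \<cdot> AMap (nerve_obj C B) (m, n, f) \<cdot> nerve_component F n =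
          edge C B m i \<cdot> nerve_component F m \<cdot> AMap (nerve_obj C A) (m, n, f)" .
    qed (use NA(1-3) NB(1-3) comp(1-3)[OF mn(1)] comp(1-3)[OF mn(2)] in simp_all)
    then show "AMap (nerve_obj C B) a \<cdot> (\<lambda>n \<in> Obj simplex3. nerve_component F n) (Dom (opp simplex3) a) =
        (\<lambda>n \<in> Obj simplex3. nerve_component F n) (Cod (opp simplex3) a) \<cdot> AMap (nerve_obj C A) a"
      using mn by (simp add: eq simplex3_simps(1,3,4))
  qed (use nerve_obj_Obj icat comp(1-3) in \<open>simp_all add: simplex3_simps(1) nerve_obj_simps(1)\<close>)
qed

lemma nerve_arr_Cmp:
  assumes F: "is_ifun C F" and G: "is_ifun C G" and FG: "ifcod F = ifdom G"
  shows "nerve_arr C (comp_ifun C G F) = nerve_arr C G \<cdot>\<^bsub>fun_cat (opp simplex3) C\<^esub> nerve_arr C F"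
proof -
  have "nerve_component (comp_ifun C G F) n = nerve_component G n \<cdot> nerve_component F n" if n: "n \<le> 3" for n
  proof -
    note cF = nerve_component[OF F refl FG n] and cG = nerve_component[OF G refl refl n]
    have g: "is_igraph (ifdom F)" "is_igraph (ifdom G)" "is_igraph (ifcod G)"
      using gfun_igraph[OF ifun_gfun[OF F]] gfun_igraph[OF ifun_gfun[OF G]] by simp_all
    note cA = chain_vertex_edge[OF g(1) n] and cB = chain_vertex_edge[OF g(2) n] and cD = chain_vertex_edge[OF g(3) n]
    note [simp] = ifun_gfun[OF F] ifun_gfun[OF G] FG
    show ?thesis
    proof (rule nerve_component_eqI[OF is_ifun_comp[OF F G FG] refl refl n])
      fix i assume i: "i \<le> n"
      have "vertex C (ifcod G) n i \<cdot> nerve_component G n \<cdot> nerve_component F n = if0 G \<cdot> vertex C (ifdom G) n i \<cdot> nerve_component F n"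
        by (rule square_Cmp[OF cG(4)[OF i]]) (use chainD(1-3)[OF cB i] chainD(1-3)[OF cD i] cF(1-3) cG(1-3) in simp_all)
      also have "\<dots> = (if0 G \<cdot> if0 F) \<cdot> vertex C (ifdom F) n i"
        using cF(4)[OF i] chainD(1-3)[OF cA i] by simp
      finally show "vertex C (ifcod (comp_ifun C G F)) n i \<cdot> nerve_component G n \<cdot> nerve_component F n =
          if0 (comp_ifun C G F) \<cdot> vertex C (ifdom (comp_ifun C G F)) n i" by simp
    next
      fix i assume i: "i < n"
      have "edge C (ifcod G) n i \<cdot> nerve_component G n \<cdot> nerve_component F n = if1 G \<cdot> edge C (ifdom G) n i \<cdot> nerve_component F n"
        by (rule square_Cmp[OF cG(5)[OF i]]) (use chainD(4-6)[OF cB i] chainD(4-6)[OF cD i] cF(1-3) cG(1-3) in simp_all)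
      also have "\<dots> = (if1 G \<cdot> if1 F) \<cdot> edge C (ifdom F) n i"
        using cF(5)[OF i] chainD(4-6)[OF cA i] by simp
      finally show "edge C (ifcod (comp_ifun C G F)) n i \<cdot> nerve_component G n \<cdot> nerve_component F n =
          if1 (comp_ifun C G F) \<cdot> edge C (ifdom (comp_ifun C G F)) n i" by simp
    qed (use cF(1-3) cG(1-3) in simp_all)
  qed
  then show ?thesis
    using FG by (simp add: nerve_arr_eq fun_cat_simps(6)) (rule ext, simp add: restrict_def simplex3_simps(1))
qed

text \<open>Translates the nerve into the components used for coproducts. At level 3 the projections
  are what \<open>levelwise_coproduct_level3\<close> asks for.\<close>

lemma nerve_component_levels:
  assumes F: "is_ifun C F"
  shows "nerve_component F 0 = if0 F" "nerve_component F (Suc 0) = if1 F" "nerve_component F 2 = if2 F"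
    "fst3 (ifcod F) \<cdot> nerve_component F 3 = if2 F \<cdot> fst3 (ifdom F)" "snd3 (ifcod F) \<cdot> nerve_component F 3 = if2 F \<cdot> snd3 (ifdom F)"
proof -
  define A B where "A = ifdom F" "B = ifcod F"
  then have AB [simp]: "ifdom F = A" "ifcod F = B" by simp_all
  note [simp] = ifun_gfun[OF F]
  have G [simp]: "is_igraph A" "is_igraph B" using gfun_igraph[OF ifun_gfun[OF F]] by simp_all
  note comp = nerve_component[OF F AB]
  show "nerve_component F 0 = if0 F"
    using comp(1-3)[of 0] comp(4)[of 0 0] by (simp add: vertex_def)
  show "nerve_component F (Suc 0) = if1 F"
    using comp(1-3)[of "Suc 0"] comp(5)[of "Suc 0" 0] by (simp add: edge_def)
  note c2 = comp(1-3)[of 2] comp(5)[of 2 0] comp(5)[of 2 1]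
  show "nerve_component F 2 = if2 F"
    by (rule pullback_eqI[OF igraph_pullback2[OF G(2)]]) (use c2 in \<open>simp_all add: edge_def\<close>)
  note c3 = comp(1-3)[of 3] comp(5)[of 3 0] comp(5)[of 3 1] comp(5)[of 3 2]
  have e: "fst2 B \<cdot> fst3 B \<cdot> nerve_component F 3 = if1 F \<cdot> fst2 A \<cdot> fst3 A"
    "fst2 B \<cdot> snd3 B \<cdot> nerve_component F 3 = if1 F \<cdot> fst2 A \<cdot> snd3 A"
    "snd2 B \<cdot> snd3 B \<cdot> nerve_component F 3 = if1 F \<cdot> snd2 A \<cdot> snd3 A"
    using c3 by (simp_all add: edge_def)
  note s = square_Cmp[OF if2_simps(4)[of F B]] square_Cmp[OF if2_simps(5)[of F B]]
  show "fst3 (ifcod F) \<cdot> nerve_component F 3 = if2 F \<cdot> fst3 (ifdom F)"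
    by (rule pullback_eqI[OF igraph_pullback2[OF G(2)]]) (use c3(1-3) e in \<open>simp_all add: s\<close>)
  show "snd3 (ifcod F) \<cdot> nerve_component F 3 = if2 F \<cdot> snd3 (ifdom F)"
    by (rule pullback_eqI[OF igraph_pullback2[OF G(2)]]) (use c3(1-3) e in \<open>simp_all add: s\<close>)
qed

section \<open>Coproduct cocones and their nerves\<close>

lemma nerve_coproduct_if_levelwise:
  assumes ext: "extensive C" and lw: "levelwise_coproduct i j"
  shows "is_coproduct (fun_cat (opp simplex3) C) (nerve_obj C (ifdom i)) (nerve_obj C (ifdom j)) (nerve_obj C (ifcod i))
    (nerve_arr C i) (nerve_arr C j)"
proof -
  interpret N: functor_category C "opp simplex3" by (rule functor_category_simplex3)
  define A B Q where "A = ifdom i" "B = ifdom j" "Q = ifcod i"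
  then have [simp]: "ifdom i = A" "ifdom j = B" "ifcod i = Q" "ifcod j = Q"
    using levelwise_coproductD(3)[OF lw] by simp_all
  note ij = levelwise_coproductD(1,2)[OF lw]
  have "is_coproduct C (level A n) (level B n) (level Q n) (nerve_component i n) (nerve_component j n)" if n: "n \<le> 3" for n
    using n
  proof (rule le3_cases)
    assume "n = 0" then show ?thesis
      using levelwise_coproductD(4)[OF lw] by (simp add: nerve_component_levels[OF ij(1)] nerve_component_levels[OF ij(2)])
  next
    assume "n = 1" then show ?thesis
      using levelwise_coproductD(5)[OF lw] by (simp add: nerve_component_levels[OF ij(1)] nerve_component_levels[OF ij(2)])
  next
    assume "n = 2" then show ?thesis
      using levelwise_coproduct_level2[OF ext lw] by (simp add: nerve_component_levels[OF ij(1)] nerve_component_levels[OF ij(2)])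
  next
    assume "n = 3"
    moreover have "is_coproduct C (ic3 (ifdom i)) (ic3 (ifdom j)) (ic3 (ifcod i)) (nerve_component i 3) (nerve_component j 3)"
      by (rule levelwise_coproduct_level3[OF ext lw])
        (use nerve_component(1-3)[OF ij(1) refl refl, of 3] nerve_component(1-3)[OF ij(2) refl refl, of 3]
          nerve_component_levels(4,5)[OF ij(1)] nerve_component_levels(4,5)[OF ij(2)] in simp_all)
    ultimately show ?thesis by simp
  qed
  moreover have "nerve_arr C i \<in> Arr N.FC" "nerve_arr C j \<in> Arr N.FC"
    by (rule nerve_arr_Arr[OF ij(1)], rule nerve_arr_Arr[OF ij(2)])
  ultimately show ?thesis
    unfolding nerve_arr_eq levelwise_coproductD(3)[OF lw]
    by (intro N.pointwise_coproduct) (simp_all add: simplex3_simps(1) nerve_obj_simps(1))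
qed

text \<open>Invertibility is extracted on the levels by which coproducts
  (\<open>levelwise_coproduct\<close>) and initial objects (\<open>initial2_if_levelwise\<close>) of
  internal categories are recognised.\<close>

lemma levelwise_iso_if_nerve_iso:
  assumes t: "is_ifun C t" and iso: "is_iso (fun_cat (opp simplex3) C) (nerve_arr C t)"
  shows "is_iso C (if0 t)" "is_iso C (if1 t)" "is_iso C (if2 t)"
proof -
  interpret N: functor_category C "opp simplex3" by (rule functor_category_simplex3)
  have "is_iso C (nerve_component t n)" if "n \<le> 3" for n
    using N.pointwise_iso[OF iso[unfolded nerve_arr_eq], of n] that by (simp add: simplex3_simps(1))
  from this[of 0] this[of 1] this[of 2] show "is_iso C (if0 t)" "is_iso C (if1 t)" "is_iso C (if2 t)"
    by (simp_all add: nerve_component_levels[OF t])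
qed

lemma nerve_iso:
  assumes iso: "is_iso (CatI C) t"
  shows "is_iso (fun_cat (opp simplex3) C) (nerve_arr C t)"
proof -
  interpret N: functor_category C "opp simplex3" by (rule functor_category_simplex3)
  interpret FC: category "fun_cat (opp simplex3) C" by (rule N.category_FC)
  interpret K: category "CatI C" by (rule category_CatI)
  obtain s where st: "is_ifun C t" "is_ifun C s" "ifdom s = ifcod t" "ifcod s = ifdom t" "comp_ifun C s t = id_ifun C (ifdom t)"
    "comp_ifun C t s = id_ifun C (ifcod t)"
    using K.is_isoE[OF iso] by (simp only: CatI_simps) metis
  have id: "nerve_arr C (id_ifun C A) = Idn (fun_cat (opp simplex3) C) (nerve_obj C A)" if A: "is_icat C A" for A
  proof -
    have "nerve_component (id_ifun C A) n = Idn C (level A n)" if n: "n \<le> 3" for n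
    proof (rule nerve_component_eqI[OF is_ifun_id[OF A] _ _ n])
      note c = chain_vertex_edge[OF icat_igraph[OF A] n]
      show "vertex C A n i \<cdot> Idn C (level A n) = if0 (id_ifun C A) \<cdot> vertex C A n i" if "i \<le> n" for i
        using chainD(1-3)[OF c that] by simp
      show "edge C A n i \<cdot> Idn C (level A n) = if1 (id_ifun C A) \<cdot> edge C A n i" if "i < n" for i
        using chainD(4-6)[OF c that] by simp
    qed (use A n in simp_all)
    then show ?thesis
      by (simp add: nerve_arr_eq fun_cat_simps(5)) (rule ext, simp add: restrict_def simplex3_simps(1) nerve_obj_simps(1))
  qed
  show ?thesis
  proof (rule FC.is_isoI)
    show "nerve_arr C t \<in> Arr N.FC" "nerve_arr C s \<in> Arr N.FC"
      by (rule nerve_arr_Arr[OF st(1)], rule nerve_arr_Arr[OF st(2)])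
    show "nerve_arr C s \<cdot>\<^bsub>N.FC\<^esub> nerve_arr C t = Idn N.FC (Dom N.FC (nerve_arr C t))"
      using nerve_arr_Cmp[OF st(1,2)] st id[of "ifdom t"] by (simp add: nerve_arr_eq[of t] fun_cat_simps(3))
    show "nerve_arr C t \<cdot>\<^bsub>N.FC\<^esub> nerve_arr C s = Idn N.FC (Cod N.FC (nerve_arr C t))"
      using nerve_arr_Cmp[OF st(2,1)] st id[of "ifcod t"] by (simp add: nerve_arr_eq[of t] fun_cat_simps(4))
  qed (simp_all add: nerve_arr_eq fun_cat_simps(3,4) st)
qed

text \<open>Each cocone is compared with a known universal one whose nerve is universal too. If the
  nerve of the given cocone is universal, the comparison is invertible in the functor category,
  hence at each level, and universality is carried along it level by level.\<close>

lemma coproducts_computed_in_nerve: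
  assumes ext: "extensive C"
  shows "coproducts_computed_in (CatI C) (fun_cat (opp simplex3) C) (nerve C)"
proof -
  interpret N: functor_category C "opp simplex3" by (rule functor_category_simplex3)
  interpret FC: category "fun_cat (opp simplex3) C" by (rule N.category_FC)
  interpret K: two_category "CatI C" by (rule two_category_CatI)
  have initial: "is_initial2 (CatI C) Z \<longleftrightarrow> is_initial N.FC (nerve_obj C Z)" if Z: "is_icat C Z" for Z
  proof -
    obtain O' where O': "is_initial C O'" using ext unfolding extensive_def has_finite_coproducts_def by blast
    then have [simp]: "O' \<in> Obj C" by (simp add: is_initial_def)
    have D: "is_initial (CatI C) (disc O')"
      using initial2_if_levelwise[of "disc O'"] O' by (simp add: is_initial2_def)
    \<comment> \<open>All levels of a discrete category coincide, so its nerve is initial at every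
      index.\<close>
    have level_disc: "level (disc O') n = O'" for n by (simp add: level_def)
    have ND: "is_initial N.FC (nerve_obj C (disc O'))"
      by (rule N.pointwise_initial) (simp_all add: nerve_obj_Obj simplex3_simps(1) nerve_obj_simps(1) level_disc O')
    obtain t where t: "is_ifun C t" "ifdom t = disc O'" "ifcod t = Z"
      using K.initialE[OF D, of Z] Z by auto
    have NT: "nerve_arr C t \<in> Arr N.FC" "Dom N.FC (nerve_arr C t) = nerve_obj C (disc O')" "Cod N.FC (nerve_arr C t) = nerve_obj C Z"
      using nerve_arr_Arr[OF t(1)] t by (simp_all add: nerve_arr_eq fun_cat_simps(3,4))
    show ?thesis
    proof
      assume "is_initial2 (CatI C) Z"
      then have "is_iso (CatI C) t"
        using t by (intro K.initial_comparison[OF D, of Z]) (simp_all add: is_initial2_def)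
      from FC.initial_iso[OF ND nerve_iso[OF this] NT(2)] show "is_initial N.FC (nerve_obj C Z)"
        by (simp only: NT(3))
    next
      assume "is_initial N.FC (nerve_obj C Z)"
      then have "is_iso N.FC (nerve_arr C t)" by (rule FC.initial_comparison[OF ND _ NT])
      note iso = levelwise_iso_if_nerve_iso[OF t(1) this]
      note [simp] = ifun_gfun[OF t(1)] t(2,3)
      show "is_initial2 (CatI C) Z"
        using initial_iso[OF O' iso(1)] initial_iso[OF O' iso(2)] initial_iso[OF O' iso(3)]
        by (intro initial2_if_levelwise[OF Z]) simp_all
    qed
  qed
  have coproduct: "is_coproduct2 (CatI C) A B Q i j \<longleftrightarrow>
      is_coproduct N.FC (nerve_obj C A) (nerve_obj C B) (nerve_obj C Q) (nerve_arr C i) (nerve_arr C j)"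
    if i: "is_ifun C i" "ifdom i = A" "ifcod i = Q" and j: "is_ifun C j" "ifdom j = B" "ifcod j = Q" for A B Q i j
  proof
    assume "is_coproduct2 (CatI C) A B Q i j"
    then have "levelwise_coproduct i j" by (intro levelwise_if_coproduct[OF ext, of A B Q]) (simp add: is_coproduct2_def)
    from nerve_coproduct_if_levelwise[OF ext this] i j
    show "is_coproduct N.FC (nerve_obj C A) (nerve_obj C B) (nerve_obj C Q) (nerve_arr C i) (nerve_arr C j)" by simp
  next
    assume NQ: "is_coproduct N.FC (nerve_obj C A) (nerve_obj C B) (nerve_obj C Q) (nerve_arr C i) (nerve_arr C j)"
    have AB: "is_icat C A" "is_icat C B" using ifun_icat(1)[OF i(1)] ifun_icat(1)[OF j(1)] i j by simp_all
    obtain i' j' where lw: "levelwise_coproduct i' j'" and i'_dom: "ifdom i' = A" "ifdom j' = B"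
      using levelwise_coproduct_exists[OF ext AB] by blast
    define Q' where "Q' = ifcod i'"
    have i': "is_ifun C i'" "is_ifun C j'" "ifcod i' = Q'" "ifcod j' = Q'"
      using levelwise_coproductD(1-3)[OF lw] by (simp_all add: Q'_def)
    have Q': "is_coproduct (CatI C) A B Q' i' j'"
      using coproduct2_if_levelwise[OF ext lw] i'_dom i' by (simp add: is_coproduct2_def)
    obtain t where t: "is_ifun C t" "ifdom t = Q'" "ifcod t = Q" "comp_ifun C t i' = i" "comp_ifun C t j' = j"
      using K.copair[OF Q', of i j] i j by auto
    have NQ': "is_coproduct N.FC (nerve_obj C A) (nerve_obj C B) (nerve_obj C Q') (nerve_arr C i') (nerve_arr C j')"
      using nerve_coproduct_if_levelwise[OF ext lw] i'_dom i' by simp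
    obtain s where s: "is_iso N.FC s" "s \<in> Arr N.FC" "Dom N.FC s = nerve_obj C Q'" "Cod N.FC s = nerve_obj C Q"
      "s \<cdot>\<^bsub>N.FC\<^esub> nerve_arr C i' = nerve_arr C i" "s \<cdot>\<^bsub>N.FC\<^esub> nerve_arr C j' = nerve_arr C j"
      by (rule FC.coproduct_comparison[OF NQ' NQ])
    \<comment> \<open>By uniqueness the comparison in the functor category is the nerve of the
      comparison \<open>t\<close> in \<open>CatI C\<close>. This takes the place of an appeal to
      fullness of the nerve.\<close>
    have "s = nerve_arr C t"
    proof (rule FC.coproduct_eqI[OF NQ' s(2) nerve_arr_Arr[OF t(1)] s(3)])
      show "s \<cdot>\<^bsub>N.FC\<^esub> nerve_arr C i' = nerve_arr C t \<cdot>\<^bsub>N.FC\<^esub> nerve_arr C i'"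
        using nerve_arr_Cmp[OF i'(1) t(1)] i' t s by simp
      show "s \<cdot>\<^bsub>N.FC\<^esub> nerve_arr C j' = nerve_arr C t \<cdot>\<^bsub>N.FC\<^esub> nerve_arr C j'"
        using nerve_arr_Cmp[OF i'(2) t(1)] i' t s by simp
    qed (use s t in \<open>simp_all add: nerve_arr_eq fun_cat_simps(3,4)\<close>)
    then have iso: "is_iso C (if0 t)" "is_iso C (if1 t)"
      using levelwise_iso_if_nerve_iso[OF t(1)] s(1) by simp_all
    note [simp] = ifun_gfun[OF t(1)]
    have eqs: "if0 t \<cdot> if0 i' = if0 i" "if0 t \<cdot> if0 j' = if0 j" "if1 t \<cdot> if1 i' = if1 i" "if1 t \<cdot> if1 j' = if1 j"
      unfolding t(4,5)[symmetric] by simp_all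
    have "is_coproduct C (ic0 A) (ic0 B) (ic0 Q) (if0 i) (if0 j)"
      using coproduct_iso[OF levelwise_coproductD(4)[OF lw] iso(1)] t(2,3) i' i'_dom eqs by simp
    moreover have "is_coproduct C (ic1 A) (ic1 B) (ic1 Q) (if1 i) (if1 j)"
      using coproduct_iso[OF levelwise_coproductD(5)[OF lw] iso(2)] t(2,3) i' i'_dom eqs by simp
    ultimately have "levelwise_coproduct i j"
      using i j by (simp add: levelwise_coproduct_def)
    from coproduct2_if_levelwise[OF ext this] i j show "is_coproduct2 (CatI C) A B Q i j" by simp
  qed
  show ?thesis
    unfolding coproducts_computed_in_def nerve_def
    using initial coproduct by (simp add: hom_def)
qed

end

theorem lemma5p2:
  fixes E :: "('o, 'm) cat"
  assumes "category E"
    and "has_pullbacks E"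
    and "has_finite_products E"
  shows "(extensive E \<longleftrightarrow> extensive2 (CatI E)) \<and>
    (extensive E \<longrightarrow> coproducts_computed_in (CatI E) (fun_cat (opp simplex3) E) (nerve E))"
proof -
  interpret category E by fact
  have "extensive E \<longleftrightarrow> extensive2 (CatI E)"
    using extensive2_CatI_if_extensive extensive_if_extensive2_CatI[OF assms(2,3)] by blast
  then show ?thesis using coproducts_computed_in_nerve by blast
qed

end
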